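(* Let $C>32$ and let $\varepsilon,\alpha,\beta>0$ and $n$ be such that $1/n\ll\beta\ll\alpha\ll\varepsilon$, with $n$ even. Let $T$ be an $n$-vertex tournament with $\mathrm{ex}(T)\ge Cn$, and suppose $T$ has no perfect decomposition. Then there is a subdigraph $D$ of $T$ such that: (i) $D$ has no perfect decomposition; (ii) $|D|\ge(1-\beta)n$ and $|D|$ is even; (iii) $d_D(v)\ge(1-\varepsilon)|D|$ for all $v\in V(D)$; (iv) $1\le|\mathrm{ex}_D(v)|\le 3\alpha|D|$ for all $v\in V(D)$; (v) $\mathrm{ex}(D)\ge (C/4-5)n$.
   Context: Hierarchy convention: $a\ll b$ means there is a non-decreasing $f:(0,1]\to(0,1]$ such that the statement holds whenever $a\le f(b)$; chains are read from right to left (choose $\varepsilon$, then $\alpha$ small enough, then $\beta$, then $n$ large enough). $|D|$ is the number of vertices. Paths are directed; $d_D(v)=d^+_D(v)+d^-_D(v)$, $\mathrm{ex}_D(v)=d^+_D(v)-d^-_D(v)$, $\mathrm{ex}(D)=\sum_v\max\{\mathrm{ex}_D(v),0\}$. A perfect decomposition of $D$ is a set of exactly $\mathrm{ex}(D)$ paths of $D$ whose edge sets partition $E(D)$. *)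

theory Defs
  imports Complex_Main "Graph_Theory.Graph_Theory"
begin

definition tournament :: "('a, 'b) pre_digraph \<Rightarrow> bool" where
  "tournament T \<longleftrightarrow> digraph T \<and>
     (\<forall>u \<in> verts T. \<forall>v \<in> verts T. u \<noteq> v \<longrightarrow> (u \<rightarrow>\<^bsub>T\<^esub> v \<longleftrightarrow> \<not> v \<rightarrow>\<^bsub>T\<^esub> u))"

definition degree :: "('a, 'b) pre_digraph \<Rightarrow> 'a \<Rightarrow> nat" where
  "degree D v = out_degree D v + in_degree D v"

definition excess :: "('a, 'b) pre_digraph \<Rightarrow> 'a \<Rightarrow> int" where
  "excess D v = int (out_degree D v) - int (in_degree D v)"

definition total_excess :: "('a, 'b) pre_digraph \<Rightarrow> int" where
  "total_excess D = (\<Sum>v \<in> verts D. max (excess D v) 0)"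

text \<open>
  A path is given by its list of arcs. Paths without arcs are excluded because their arc sets would
  be empty blocks of the partition.
\<close>

definition perfect_decomposition :: "('a, 'b) pre_digraph \<Rightarrow> 'b list set \<Rightarrow> bool" where
  "perfect_decomposition D P \<longleftrightarrow>
     (\<forall>p \<in> P. p \<noteq> [] \<and> (\<exists>u v. pre_digraph.apath D u p v)) \<and>
     (\<forall>p \<in> P. \<forall>q \<in> P. p \<noteq> q \<longrightarrow> set p \<inter> set q = {}) \<and>
     (\<Union>p \<in> P. set p) = arcs D \<and>
     finite P \<and> int (card P) = total_excess D"

definition has_perfect_decomposition :: "('a, 'b) pre_digraph \<Rightarrow> bool" where
  "has_perfect_decomposition D \<longleftrightarrow> (\<exists>P. perfect_decomposition D P)"

text \<open>
  The functions \<open>f : (0,1] \<rightarrow> (0,1]\<close> by which a hierarchy \<open>a \<lless> b\<close> is witnessed, in the form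
  \<open>a \<le> f b\<close>.
\<close>

definition hierarchy_fun :: "(real \<Rightarrow> real) \<Rightarrow> bool" where
  "hierarchy_fun f \<longleftrightarrow> mono_on {0<..1} f \<and> f ` {0<..1} \<subseteq> {0<..1}"

end

theory Submission
  imports Defs "HOL-Library.Multiset"
begin

text \<open>
  Let \<open>W\<close> consist of the vertices with \<open>\<bar>ex(v)\<bar> > \<alpha>n\<close>. If \<open>W\<close> is not small, then \<open>ex(T)\<close> is quadratic
  in \<open>n\<close> and \<open>T\<close> has a perfect decomposition: reserve linearly many short paths through every
  vertex, each from a vertex of large positive to one of large negative excess, and decompose the
  rest into excess paths and a balanced digraph. A cycle of the latter is absorbed by cutting it
  into blocks and rerouting one reserved path through the head of each block. Long cycles are
  absorbed first; they exist while the balanced part is dense.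

  If \<open>W\<close> is small, the arcs meeting \<open>W\<close> are grouped into short strands whose ends lie outside \<open>W\<close>
  or are legitimate ends of paths. The strands are joined into few edge-disjoint paths through the
  nearly regular tournament on \<open>V - W\<close>. Removing all arcs used by these paths leaves a digraph \<open>D\<close>
  on \<open>V - W\<close>; tokens record which vertices of \<open>D\<close> are starts or ends of unfinished strands, and are
  distributed so that no vertex of \<open>D\<close> has excess \<open>0\<close>, at least about half of the excess
  survives, and every perfect decomposition of \<open>D\<close> extends to one of \<open>T\<close>. If \<open>V - W\<close> is odd, the
  same reduction applied to \<open>D\<close> and a single vertex of positive excess restores parity; this costs
  only a linear amount of excess.
\<close>

section \<open>Decompositions as multisets of paths\<close>

text \<open>That a decomposition has exactly as many paths as the excess is a local condition: no
  vertex is both a start and an end of paths. It holds once every path runs from positive to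
  negative excess of T, so paths need not be counted. The dichotomy has room because ex(T) <
  \<beta>^2 n^2 leaves at most 2 \<beta>^2 n / \<alpha> vertices in W, negligible against \<alpha>n,
  the excess available at each of them, and against \<beta>n, the number of vertices that may be
  lost. Evenness of n makes all degrees n - 1 odd, hence all excesses of T nonzero. The obstacle in
  the second case is that removing arcs may destroy the sign of a vertex, while every path of D must
  extend to one with legitimate ends. How often a perfect decomposition of D starts and ends at x
  depends on the excess alone, so tokens can be fixed before the decomposition is known.\<close>

definition path_arcs :: "'a list \<Rightarrow> ('a \<times> 'a) multiset" where
  "path_arcs p = mset (zip p (tl p))"

definition arc_excess :: "('a \<times> 'a) multiset \<Rightarrow> 'a \<Rightarrow> int" where
  "arc_excess A v = (\<Sum>e\<in>#A. of_bool (fst e = v) - of_bool (snd e = v))"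

lemma path_arcs_simps [simp]:
  "path_arcs [] = {#}" "path_arcs [x] = {#}"
  "path_arcs (x # y # p) = add_mset (x, y) (path_arcs (y # p))"
  by (simp_all add: path_arcs_def)

lemma path_arcs_append: "path_arcs (p @ v # q) = path_arcs (p @ [v]) + path_arcs (v # q)"
proof (induction p)
  case (Cons a p)
  then show ?case by (cases p) auto
qed simp

lemma path_arcs_append2:
  assumes "p \<noteq> []" "q \<noteq> []"
  shows "path_arcs (p @ q) = add_mset (last p, hd q) (path_arcs p + path_arcs q)"
proof -
  have "p @ q = butlast p @ last p # hd q # tl q"
    using assms by (metis append.assoc append_Cons append_Nil append_butlast_last_id list.collapse)
  then have "path_arcs (p @ q) = path_arcs (butlast p @ last p # hd q # tl q)"
    by simp
  also have "\<dots> = path_arcs (butlast p @ [last p]) + path_arcs (last p # hd q # tl q)"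
    by (rule path_arcs_append)
  finally have "path_arcs (p @ q) = path_arcs p + path_arcs (last p # q)" using assms by simp
  moreover have "path_arcs (last p # q) = add_mset (last p, hd q) (path_arcs q)"
    using assms(2) by (cases q) auto
  ultimately show ?thesis by simp
qed

lemma path_arcs_glue:
  assumes "p \<noteq> []" "q \<noteq> []" "last p = hd q"
  shows "path_arcs (butlast p @ q) = path_arcs p + path_arcs q"
  using path_arcs_append[of "butlast p" "hd q" "tl q"] assms
  by (metis append_butlast_last_id list.collapse)

lemma path_arcs_glue':
  assumes "p \<noteq> []" "q \<noteq> []" "last p = hd q"
  shows "path_arcs (p @ tl q) = path_arcs p + path_arcs q"
  using path_arcs_glue[OF assms] assms
  by (metis append_Cons append_assoc append_butlast_last_id append_Nil list.collapse)

lemma path_arcs_in: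
  "(x, y) \<in># path_arcs p \<Longrightarrow> x \<in> set p \<and> y \<in> set p"
proof (induction p)
  case (Cons a p)
  then show ?case by (cases p) auto
qed simp

lemma path_arcs_touch:
  "x \<in> set p \<Longrightarrow> 2 \<le> length p \<Longrightarrow> \<exists>e\<in>#path_arcs p. fst e = x \<or> snd e = x"
proof (induction p)
  case (Cons a p)
  then obtain b q where p: "p = b # q" by (cases p) auto
  show ?case
  proof (cases "x = a \<or> x = b")
    case True then show ?thesis using p by auto
  next
    case False
    then have "x \<in> set p" "2 \<le> length p" using Cons.prems p by (cases q; auto)+
    then show ?thesis using Cons.IH p by auto
  qed
qed simp

lemma size_path_arcs [simp]: "size (path_arcs p) = length p - 1"
  by (simp add: path_arcs_def)

lemma path_arcs_eq_empty: "path_arcs p = {#} \<longleftrightarrow> length p \<le> 1"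
  by (metis diff_is_0_eq size_eq_0_iff_empty size_path_arcs)

lemma arc_excess_empty [simp]: "arc_excess {#} v = 0"
  by (simp add: arc_excess_def)

lemma arc_excess_add [simp]: "arc_excess (A + B) v = arc_excess A v + arc_excess B v"
  by (simp add: arc_excess_def)

lemma arc_excess_add_mset [simp]:
  "arc_excess (add_mset e A) v = of_bool (fst e = v) - of_bool (snd e = v) + arc_excess A v"
  by (simp add: arc_excess_def)

lemma arc_excess_sum_mset: "arc_excess (\<Sum>p\<in>#P. f p) v = (\<Sum>p\<in>#P. arc_excess (f p) v)"
  by (induction P) auto

lemma arc_excess_path:
  "p \<noteq> [] \<Longrightarrow> arc_excess (path_arcs p) v = of_bool (hd p = v) - of_bool (last p = v)"
proof (induction p)
  case (Cons a p)
  then show ?case by (cases p) auto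
qed simp

lemma of_bool_sum_mset: "(\<Sum>p\<in>#P. (of_bool (Q p) :: int)) = int (size (filter_mset Q P))"
  by (induction P) auto

lemma sum_mset_diff_int: "(\<Sum>p\<in>#P. f p - (g p :: int)) = (\<Sum>p\<in>#P. f p) - (\<Sum>p\<in>#P. g p)"
  by (induction P) auto

lemma arc_excess_paths:
  assumes "\<And>p. p \<in># P \<Longrightarrow> p \<noteq> []"
  shows "arc_excess (\<Sum>p\<in>#P. path_arcs p) v =
    int (size {#p \<in># P. hd p = v#}) - int (size {#p \<in># P. last p = v#})"
proof -
  have "arc_excess (\<Sum>p\<in>#P. path_arcs p) v = (\<Sum>p\<in>#P. of_bool (hd p = v) - of_bool (last p = v))"
    unfolding arc_excess_sum_mset using assms
    by (intro arg_cong[of _ _ sum_mset] image_mset_cong arc_excess_path) auto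
  then show ?thesis by (simp add: sum_mset_diff_int of_bool_sum_mset)
qed

lemma arc_excess_mset_set:
  assumes "finite E"
  shows "arc_excess (mset_set E) v = int (card {y. (v, y) \<in> E}) - int (card {x. (x, v) \<in> E})"
proof -
  have 1: "card {e \<in> E. fst e = v} = card {y. (v, y) \<in> E}"
    by (rule bij_betw_same_card[of snd]) (auto simp: bij_betw_def inj_on_def image_iff)
  have 2: "card {e \<in> E. snd e = v} = card {x. (x, v) \<in> E}"
    by (rule bij_betw_same_card[of fst]) (auto simp: bij_betw_def inj_on_def image_iff)
  show ?thesis
    unfolding arc_excess_def sum_mset_diff_int of_bool_sum_mset using assms 1 2 by simp
qed

text \<open>The number of paths is replaced by the condition that no start is an end;
  \<open>size_perfect\<close> and \<open>hd_neq_last_if_size\<close> relate the two. For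
  \<open>A\<close> of the form \<open>mset_set E\<close>, the single multiset equation contains both
  disjointness and covering.\<close>

definition perfect :: "('a \<times> 'a) multiset \<Rightarrow> bool" where
  "perfect A \<longleftrightarrow> (\<exists>P. (\<forall>p\<in>#P. distinct p \<and> 2 \<le> length p) \<and>
     (\<forall>p\<in>#P. \<forall>q\<in>#P. hd p \<noteq> last q) \<and> (\<Sum>p\<in>#P. path_arcs p) = A)"

lemma size_partition_mset:
  assumes "finite V" "\<And>p. p \<in># P \<Longrightarrow> f p \<in> V"
  shows "size P = (\<Sum>v\<in>V. size {#p \<in># P. f p = v#})"
  using assms(2)
proof (induction P)
  case (add p P)
  have "(\<Sum>v\<in>V. size {#q \<in># add_mset p P. f q = v#}) =
     (\<Sum>v\<in>V. (if v = f p then 1 else 0) + size {#q \<in># P. f q = v#})"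
    by (rule sum.cong) auto
  also have "\<dots> = 1 + (\<Sum>v\<in>V. size {#q \<in># P. f q = v#})"
    using add.prems assms(1) by (simp add: sum.distrib)
  finally show ?case using add by simp
qed simp

text \<open>At every vertex the number of starts or the number of ends is 0, so the positive part of
  the excess is exactly the number of paths starting there.\<close>

lemma size_perfect:
  assumes "finite V" "\<And>p. p \<in># P \<Longrightarrow> p \<noteq> [] \<and> set p \<subseteq> V"
    and "\<forall>p\<in>#P. \<forall>q\<in>#P. hd p \<noteq> last q"
  shows "(\<Sum>v\<in>V. max (arc_excess (\<Sum>p\<in>#P. path_arcs p) v) 0) = int (size P)"
proof -
  have "max (arc_excess (\<Sum>p\<in>#P. path_arcs p) v) 0 = int (size {#p \<in># P. hd p = v#})" for v
  proof -
    have "size {#p \<in># P. hd p = v#} = 0 \<or> size {#p \<in># P. last p = v#} = 0"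
      using assms(3) by (auto simp: filter_mset_eq_conv size_eq_0_iff_empty) 
    then show ?thesis using arc_excess_paths[of P v] assms(2)
      by (metis diff_0 diff_zero max.absorb1 max.absorb2 of_nat_0 of_nat_0_le_iff neg_le_0_iff_le)
  qed
  then show ?thesis
    using size_partition_mset[of V P hd] assms(1,2) by (simp add: subset_iff)
qed

text \<open>The positive part of the excess is at most the number of starts, and strictly less at a
  start which is also an end. A single such vertex makes the sum fall short of
  \<open>size P\<close>.\<close>

lemma hd_neq_last_if_size:
  assumes "finite V" "\<And>p. p \<in># P \<Longrightarrow> p \<noteq> [] \<and> set p \<subseteq> V"
    and "(\<Sum>v\<in>V. max (arc_excess (\<Sum>p\<in>#P. path_arcs p) v) 0) = int (size P)"
    and "p \<in># P" "q \<in># P"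
  shows "hd p \<noteq> last q"
proof
  assume eq: "hd p = last q"
  let ?s = "\<lambda>v. int (size {#p \<in># P. hd p = v#})"
  let ?v = "hd p"
  have le: "max (arc_excess (\<Sum>p\<in>#P. path_arcs p) v) 0 \<le> ?s v" for v
    using arc_excess_paths[of P v] assms(2) by auto
  have pos: "p \<in># {#p \<in># P. hd p = ?v#}" "q \<in># {#p \<in># P. last p = ?v#}"
    using assms(4,5) eq by auto
  have "0 < size {#p \<in># P. hd p = ?v#}" "0 < size {#p \<in># P. last p = ?v#}"
    using pos by (metis nonempty_has_size empty_not_add_mset multi_member_split)+
  then have "max (arc_excess (\<Sum>p\<in>#P. path_arcs p) ?v) 0 < ?s ?v"
    using arc_excess_paths[of P ?v] assms(2) by auto
  moreover have "?v \<in> V" using assms(2,4) by (meson hd_in_set subset_iff)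
  ultimately have "(\<Sum>v\<in>V. max (arc_excess (\<Sum>p\<in>#P. path_arcs p) v) 0) < (\<Sum>v\<in>V. ?s v)"
    using le assms(1) by (intro sum_strict_mono_ex1) auto
  also have "\<dots> = int (size P)"
    using size_partition_mset[of V P hd] assms(1,2) by (simp add: subset_iff)
  finally show False using assms(3) by simp
qed

lemma sum_mset_mset_set_distinct:
  assumes "finite P" "\<And>p. p \<in> P \<Longrightarrow> distinct p"
    "\<And>p q. p \<in> P \<Longrightarrow> q \<in> P \<Longrightarrow> p \<noteq> q \<Longrightarrow> set p \<inter> set q = {}"
  shows "(\<Sum>p\<in>#mset_set P. mset p) = mset_set (\<Union>p\<in>P. set p)"
  using assms
proof (induction P)
  case (insert p P)
  have "set p \<inter> (\<Union>q\<in>P. set q) = {}" using insert by blast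
  then have "mset_set (set p \<union> (\<Union>q\<in>P. set q)) = mset_set (set p) + mset_set (\<Union>q\<in>P. set q)"
    using insert by (intro mset_set_Union) auto
  then show ?case using insert by (simp add: mset_set_set)
qed simp

section \<open>Passage between arc lists of a digraph and vertex lists\<close>

context wf_digraph
begin

lemma path_arcs_awalk_verts:
  "cas u p v \<Longrightarrow> path_arcs (awalk_verts u p) = image_mset (arc_to_ends G) (mset p)"
proof (induction p arbitrary: u)
  case (Cons e p)
  then show ?case by (cases p) (auto simp: arc_to_ends_def)
qed simp

lemma length_awalk_verts': "length (awalk_verts u p) = Suc (length p)"
  by (induction p arbitrary: u) auto

text \<open>Each arc list is replaced by the list of the vertices it visits. Without parallel arcs
  nothing is lost, because \<open>arc_to_ends\<close> is injective on the arcs.\<close>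

lemma perfect_if_has_perfect_decomposition:
  assumes "has_perfect_decomposition G" "finite (verts G)" "inj_on (arc_to_ends G) (arcs G)"
    and ex: "total_excess G = (\<Sum>v\<in>verts G. max (arc_excess (mset_set (arcs_ends G)) v) 0)"
  shows "perfect (mset_set (arcs_ends G))"
proof -
  obtain P where P_dec: "perfect_decomposition G P"
    using assms(1) unfolding has_perfect_decomposition_def by blast
  have P: "\<And>p. p \<in> P \<Longrightarrow> p \<noteq> []" "\<And>p. p \<in> P \<Longrightarrow> \<exists>u v. apath u p v"
    "\<And>p q. p \<in> P \<Longrightarrow> q \<in> P \<Longrightarrow> p \<noteq> q \<Longrightarrow> set p \<inter> set q = {}"
    "(\<Union>p\<in>P. set p) = arcs G" "finite P" "int (card P) = total_excess G"
    using P_dec unfolding perfect_decomposition_def by simp_all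
  have "\<forall>p\<in>P. \<exists>w. apath (fst w) p (snd w)" using P(2) by simp
  then obtain w where w: "\<forall>p\<in>P. apath (fst (w p)) p (snd (w p))" by (rule bchoice[THEN exE])
  define s t where "s p = fst (w p)" and "t p = snd (w p)" for p
  have ap: "\<And>p. p \<in> P \<Longrightarrow> apath (s p) p (t p)" using w unfolding s_def t_def by blast
  define f where "f p = awalk_verts (s p) p" for p
  define Q where "Q = image_mset f (mset_set P)"
  have dist: "distinct p" if "p \<in> P" for p
  proof -
    have "distinct (awalk_verts (s p) p)" "awalk (s p) p (t p)"
      using ap[OF that] by (auto simp: apath_def)
    then show ?thesis using distinct_verts_imp_distinct by blast
  qed
  have fp: "path_arcs (f p) = image_mset (arc_to_ends G) (mset p)" if "p \<in> P" for p
    unfolding f_def using ap[OF that]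
    by (intro path_arcs_awalk_verts[of _ _ "t p"]) (auto simp: apath_def awalk_def)
  have "(\<Sum>p\<in>#Q. path_arcs p) = (\<Sum>p\<in>#mset_set P. image_mset (arc_to_ends G) (mset p))"
    unfolding Q_def using fp P(5)
    by (auto simp: image_mset.compositionality comp_def intro!: arg_cong[of _ _ sum_mset] image_mset_cong)
  also have "\<dots> = image_mset (arc_to_ends G) (\<Sum>p\<in>#mset_set P. mset p)"
    using P(5) by (induction P) auto
  also have "\<dots> = image_mset (arc_to_ends G) (mset_set (arcs G))"
    using sum_mset_mset_set_distinct[of P] P dist by simp
  also have "\<dots> = mset_set (arcs_ends G)"
    unfolding arcs_ends_def using assms(3) by (simp add: image_mset_mset_set)
  finally have sum: "(\<Sum>p\<in>#Q. path_arcs p) = mset_set (arcs_ends G)" .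
  have fQ: "distinct p \<and> 2 \<le> length p \<and> set p \<subseteq> verts G" if pQ: "p \<in># Q" for p
  proof -
    obtain q where q: "q \<in> P" "p = awalk_verts (s q) q"
      using pQ P(5) unfolding Q_def f_def by auto
    have "awalk (s q) q (t q)" "distinct p" using ap[OF q(1)] q(2) by (auto simp: apath_def)
    moreover from this have "set p \<subseteq> verts G" unfolding q(2) by (meson awalkE')
    moreover have "2 \<le> length p" using P(1)[OF q(1)] unfolding q(2) length_awalk_verts' by (cases q) auto
    ultimately show ?thesis by simp
  qed
  have "hd p \<noteq> last q" if "p \<in># Q" "q \<in># Q" for p q
  proof (rule hd_neq_last_if_size[OF assms(2) _ _ that])
    show "(\<Sum>v\<in>verts G. max (arc_excess (\<Sum>p\<in>#Q. path_arcs p) v) 0) = int (size Q)"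
      using P(6) sum ex by (simp add: Q_def)
  qed (use fQ in force)
  then show ?thesis unfolding perfect_def using sum fQ by blast
qed

lemma has_perfect_decomposition_if_perfect:
  assumes "perfect (mset_set (arcs_ends G))" "finite (verts G)" "finite (arcs G)"
    "inj_on (arc_to_ends G) (arcs G)"
    and ex: "total_excess G = (\<Sum>v\<in>verts G. max (arc_excess (mset_set (arcs_ends G)) v) 0)"
  shows "has_perfect_decomposition G"
proof -
  obtain P where P: "\<And>p. p \<in># P \<Longrightarrow> distinct p" "\<And>p. p \<in># P \<Longrightarrow> 2 \<le> length p"
    "\<And>p q. p \<in># P \<Longrightarrow> q \<in># P \<Longrightarrow> hd p \<noteq> last q"
    "(\<Sum>p\<in>#P. path_arcs p) = mset_set (arcs_ends G)"
    using assms(1) unfolding perfect_def by metis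
  define g where "g = inv_into (arcs G) (arc_to_ends G)"
  have g: "g e \<in> arcs G" "arc_to_ends G (g e) = e" if "e \<in> arcs_ends G" for e
    using that unfolding g_def arcs_ends_def by (auto intro: inv_into_into f_inv_into_f)
  define f where "f p = map g (zip p (tl p))" for p
  have fin: "finite (arcs_ends G)" using assms(3) by (simp add: arcs_ends_def)
  have apath: "apath (hd p) (f p) (last p) \<and> awalk_verts (hd p) (f p) = p"
    if "p \<noteq> []" "distinct p" "set_mset (path_arcs p) \<subseteq> arcs_ends G" "set p \<subseteq> verts G" for p
    using that
  proof (induction p)
    case (Cons a p)
    show ?case
    proof (cases p)
      case Nil
      then show ?thesis using Cons by (simp add: f_def apath_Nil_iff)
    next
      case (Cons b q)
      note p = this
      have "(a, b) \<in> arcs_ends G" using Cons.prems(3) by (auto simp: p)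
      note gab = g[OF this]
      have "apath b (f p) (last p) \<and> awalk_verts b (f p) = p" using Cons.IH Cons.prems p by auto
      then show ?thesis using gab Cons.prems(2)
        by (auto simp: p f_def arc_to_ends_def apath_Cons_iff)
    qed
  qed simp
  have sub: "path_arcs p \<subseteq># mset_set (arcs_ends G)" if "p \<in># P" for p
    unfolding P(4)[symmetric] using that by (metis image_mset_add_mset insert_DiffM mset_subset_eq_add_left sum_mset.insert)
  then have sub': "set_mset (path_arcs p) \<subseteq> arcs_ends G" if "p \<in># P" for p
    using that fin by (metis finite_set_mset_mset_set set_mset_mono)
  have verts: "set p \<subseteq> verts G" if pP: "p \<in># P" for p
  proof
    fix x assume "x \<in> set p"
    then obtain e where "e \<in> arcs_ends G" "fst e = x \<or> snd e = x"
      using path_arcs_touch[OF \<open>x \<in> set p\<close> P(2)[OF pP]] sub'[OF pP] by blast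
    then show "x \<in> verts G" by (auto simp: arcs_ends_def arc_to_ends_def)
  qed
  have setf: "mset (f p) = image_mset g (path_arcs p)" for p
    by (simp add: f_def path_arcs_def)
  have sumg: "(\<Sum>p\<in>#P. mset (f p)) = mset_set (arcs G)"
  proof -
    have "(\<Sum>p\<in>#P. mset (f p)) = image_mset g (\<Sum>p\<in>#P. path_arcs p)"
      unfolding setf by (induction P) auto
    also have "\<dots> = mset_set (g ` arcs_ends G)"
      unfolding P(4) by (intro image_mset_mset_set inj_on_inverseI[of _ "arc_to_ends G"]) (use g in auto)
    also have "g ` arcs_ends G = arcs G"
      unfolding g_def arcs_ends_def using assms(4) by (simp add: image_image)
    finally show ?thesis .
  qed
  define Q where "Q = image_mset f P"
  have sumQ: "(\<Sum>q\<in>#Q. mset q) = mset_set (arcs G)"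
    using sumg by (simp add: Q_def image_mset.compositionality comp_def)
  have Qne: "q \<noteq> []" if "q \<in># Q" for q
  proof -
    obtain p where "p \<in># P" "q = f p" using \<open>q \<in># Q\<close> Q_def by auto
    moreover have "length (f p) = length p - 1" by (simp add: f_def)
    ultimately show ?thesis using P(2) by fastforce
  qed
  have disj: "set p \<inter> set q = {}" if "add_mset p (add_mset q Q') = Q" for p q Q'
  proof (rule ccontr)
    assume "set p \<inter> set q \<noteq> {}"
    then obtain e where "e \<in> set p" "e \<in> set q" by auto
    then have "2 \<le> count (mset p + mset q) e"
      by (metis add_mono count_greater_eq_one_iff count_union one_add_one set_mset_mset)
    also have "\<dots> \<le> count (\<Sum>q\<in>#Q. mset q) e" by (simp flip: that)
    also have "\<dots> \<le> 1" unfolding sumQ by (simp add: count_mset_set')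
    finally show False by simp
  qed
  \<comment> \<open>An arc list occurring twice would be disjoint from itself, hence empty. So the
    multiset is a set, as \<open>perfect_decomposition\<close> demands, and no path is lost in
    counting.\<close>
  have Qset: "Q = mset_set (set_mset Q)"
  proof (rule multiset_eqI)
    fix q
    have "count Q q \<le> 1"
    proof (rule ccontr)
      assume "\<not> ?thesis"
      then have "count {#q, q#} a \<le> count Q a" for a by (cases "a = q") auto
      then have "{#q, q#} \<subseteq># Q" by (simp add: subseteq_mset_def)
      then obtain Q' where "add_mset q (add_mset q Q') = Q" 
        by (metis add_mset_add_single mset_subset_eq_exists_conv union_mset_add_mset_left union_commute add_0)
      from disj[OF this] Qne[of q] this show False by auto
    qed
    then show "count Q q = count (mset_set (set_mset Q)) q"
      by (metis count_mset_set(1) count_mset_set(3) finite_set_mset le_antisym count_greater_eq_one_iff not_in_iff)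
  qed
  have "perfect_decomposition G (set_mset Q)"
    unfolding perfect_decomposition_def
  proof (intro conjI ballI impI)
    fix q assume "q \<in> set_mset Q"
    then obtain p where p: "p \<in># P" "q = f p" using Q_def by auto
    show "q \<noteq> []" using Qne \<open>q \<in> set_mset Q\<close> by simp
    have "p \<noteq> []" using P(2)[OF p(1)] by auto
    then show "\<exists>u v. apath u q v"
      using apath[of p] P(1)[OF p(1)] sub'[OF p(1)] verts[OF p(1)] p(2) by blast
  next
    fix p q assume "p \<in> set_mset Q" "q \<in> set_mset Q" "p \<noteq> q"
    then show "set p \<inter> set q = {}"
      by (metis disj insert_DiffM insert_noteq_member)
  next
    have "set_mset (\<Sum>q\<in>#Q. mset q) = arcs G" unfolding sumQ using assms(3) by simp
    then show "(\<Union>p\<in>set_mset Q. set p) = arcs G" by simp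
  next
    have "int (size P) = total_excess G"
      unfolding ex P(4)[symmetric]
    proof (rule size_perfect[symmetric])
      show "p \<noteq> [] \<and> set p \<subseteq> verts G" if "p \<in># P" for p
        using verts[OF that] P(2)[OF that] by auto
    qed (use assms P in auto)
    moreover have "card (set_mset Q) = size P"
      using Qset by (metis Q_def size_image_mset size_mset_set)
    ultimately show "int (card (set_mset Q)) = total_excess G" by simp
  qed simp
  then show ?thesis unfolding has_perfect_decomposition_def by blast
qed

end

section \<open>Excess paths and long cycles\<close>

lemma path_arcs_le_1: "distinct p \<Longrightarrow> count (path_arcs p) e \<le> 1"
proof (induction p)
  case (Cons a p)
  then show ?case
  proof (cases p)
    case (Cons b q)
    have "count (path_arcs p) (a, b) = 0"
      using path_arcs_in[of a b p] Cons.prems by (auto simp: count_eq_zero_iff)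
    then show ?thesis using Cons.IH Cons.prems Cons by auto
  qed simp
qed simp

lemma le_1_subseteq_mset:
  assumes "\<And>e. count A e \<le> 1" "set_mset A \<subseteq> set_mset B"
  shows "A \<subseteq># B"
  unfolding subseteq_mset_def
proof
  fix e show "count A e \<le> count B e"
  proof (cases "e \<in># A")
    case True
    then have "1 \<le> count B e" using assms(2) by (simp add: Suc_le_eq subset_iff)
    then show ?thesis using assms(1)[of e] by linarith
  qed (simp add: not_in_iff)
qed

lemma path_arcs_suffix: "set_mset (path_arcs q) \<subseteq> set_mset (path_arcs (p @ q))"
  by (cases q) (simp, metis path_arcs_append mset_subset_eq_add_right set_mset_mono)

section \<open>Splitting off paths from positive to negative excess\<close>

lemma rtrancl_distinct_path:
  assumes "(x, y) \<in> r\<^sup>*"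
  shows "\<exists>p. p \<noteq> [] \<and> hd p = x \<and> last p = y \<and> distinct p \<and> set_mset (path_arcs p) \<subseteq> r"
  using assms
proof (induction rule: converse_rtrancl_induct)
  case base
  show ?case by (rule exI[of _ "[y]"]) simp
next
  case (step x z)
  then obtain p where p: "p \<noteq> []" "hd p = z" "last p = y" "distinct p" "set_mset (path_arcs p) \<subseteq> r"
    by blast
  show ?case
  proof (cases "x \<in> set p")
    case True
    then obtain a b where ab: "p = a @ x # b" by (meson split_list)
    then show ?thesis using p path_arcs_suffix[of "x # b" a] by (intro exI[of _ "x # b"]) auto
  next
    case False
    then show ?thesis using p step by (intro exI[of _ "x # p"]) (cases p; auto)
  qed
qed

text \<open>No arc leaves \<open>S\<close>: arcs inside contribute 0 to the sum, and arcs entering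
  contribute -1.\<close>

lemma arc_excess_sum_closed:
  assumes "finite S" "\<And>e. e \<in># A \<Longrightarrow> fst e \<in> S \<Longrightarrow> snd e \<in> S"
  shows "(\<Sum>x\<in>S. arc_excess A x) \<le> 0"
  using assms(2)
proof (induction A)
  case (add e A)
  have "(\<Sum>x\<in>S. arc_excess (add_mset e A) x) =
    (of_bool (fst e \<in> S) - of_bool (snd e \<in> S)) + (\<Sum>x\<in>S. arc_excess A x)"
    using assms(1) by (simp add: sum.distrib sum_subtractf of_bool_def sum.delta)
  then show ?case using add by auto
qed simp

text \<open>The set of vertices reachable from \<open>v\<close> is left by no arc, so its total
  excess is at most 0. As it contains \<open>v\<close>, it also contains a vertex of negative
  excess.\<close>

lemma excess_path_exists:
  assumes "arc_excess A v > 0"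
  shows "\<exists>p. distinct p \<and> 2 \<le> length p \<and> hd p = v \<and> arc_excess A (last p) < 0 \<and> path_arcs p \<subseteq># A"
proof -
  define S where "S = {x. (v, x) \<in> (set_mset A)\<^sup>*}"
  have "S \<subseteq> insert v (snd ` set_mset A)"
  proof
    fix x assume "x \<in> S"
    then have "(v, x) \<in> (set_mset A)\<^sup>*" by (simp add: S_def)
    then show "x \<in> insert v (snd ` set_mset A)" by (cases rule: rtranclE) (auto intro: rev_image_eqI)
  qed
  then have "finite S" by (rule finite_subset) auto
  moreover have "snd e \<in> S" if "e \<in># A" "fst e \<in> S" for e
    using that unfolding S_def by (cases e) (auto intro: rtrancl_into_rtrancl)
  ultimately have le: "(\<Sum>x\<in>S. arc_excess A x) \<le> 0" by (rule arc_excess_sum_closed)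
  have "v \<in> S" by (simp add: S_def)
  have "\<exists>x\<in>S. arc_excess A x < 0"
  proof (rule ccontr)
    assume "\<not> ?thesis"
    then have "0 < (\<Sum>x\<in>S. arc_excess A x)"
      using \<open>finite S\<close> \<open>v \<in> S\<close> assms by (intro sum_pos2[of S v]) auto
    with le show False by simp
  qed
  then obtain x where "x \<in> S" "arc_excess A x < 0" by blast
  then obtain p where p: "p \<noteq> []" "hd p = v" "last p = x" "distinct p" "set_mset (path_arcs p) \<subseteq> set_mset A"
    using rtrancl_distinct_path[of v x "set_mset A"] unfolding S_def by auto
  have "2 \<le> length p"
  proof (rule ccontr)
    assume "\<not> ?thesis"
    then have "hd p = last p" using p(1) by (cases p rule: remdups_adj.cases) auto
    then show False using p assms \<open>arc_excess A x < 0\<close> by simp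
  qed
  then show ?thesis
    using p \<open>arc_excess A x < 0\<close> le_1_subseteq_mset[OF path_arcs_le_1] by blast
qed

lemma excess_sum_zero_negative:
  assumes "\<not> (\<exists>v. arc_excess A v > 0)"
  shows "arc_excess A v = 0"
proof (rule ccontr)
  assume "arc_excess A v \<noteq> 0"
  then have neg: "arc_excess A v < 0" using assms by (meson linorder_neqE)
  define S where "S = insert v (fst ` set_mset A \<union> snd ` set_mset A)"
  have S: "finite S" "v \<in> S" "\<And>e. e \<in># A \<Longrightarrow> fst e \<in> S \<and> snd e \<in> S" by (auto simp: S_def)
  have "(\<Sum>x\<in>S. arc_excess A x) = 0" using S(3)
  proof (induction A)
    case (add e A)
    have "(\<Sum>x\<in>S. arc_excess (add_mset e A) x) =
      (of_bool (fst e \<in> S) - of_bool (snd e \<in> S)) + (\<Sum>x\<in>S. arc_excess A x)"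
      using S(1) by (simp add: sum.distrib sum_subtractf of_bool_def sum.delta)
    then show ?case using add by auto
  qed simp
  moreover have "(\<Sum>x\<in>S. arc_excess A x) < (\<Sum>x\<in>S. 0)"
    using S neg assms by (intro sum_strict_mono_ex1) (auto simp: not_less)
  ultimately show False by simp
qed

text \<open>Induction on the number of arcs. Removing a path from a vertex of positive to one of
  negative excess moves both excesses by one towards 0, so no vertex acquires a sign it did not
  have; the ends found later therefore have the right sign in the original \<open>A\<close>
  too.\<close>

lemma excess_decomposition:
  "\<exists>P R. A = (\<Sum>p\<in>#P. path_arcs p) + R \<and> (\<forall>v. arc_excess R v = 0) \<and>
     (\<forall>p\<in>#P. distinct p \<and> 2 \<le> length p \<and> arc_excess A (hd p) > 0 \<and> arc_excess A (last p) < 0)"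
proof (induction "size A" arbitrary: A rule: less_induct)
  case less
  show ?case
  proof (cases "\<exists>v. arc_excess A v > 0")
    case False
    then show ?thesis
      by (intro exI[of _ "{#}"] exI[of _ A]) (use excess_sum_zero_negative in auto)
  next
    case True
    then obtain v where v: "arc_excess A v > 0" by blast
    obtain p where p: "distinct p" "2 \<le> length p" "hd p = v" "arc_excess A (last p) < 0" "path_arcs p \<subseteq># A"
      using excess_path_exists[OF v] by blast
    obtain A' where A': "A = path_arcs p + A'" using p(5) by (auto simp: subset_mset.le_iff_add)
    have "p \<noteq> []" using p(2) by auto
    have "size (path_arcs p) > 0" using p(2) by simp
    then have "size A' < size A" unfolding A' size_union by linarith
    from less[OF this] obtain P R where PR: "A' = (\<Sum>p\<in>#P. path_arcs p) + R" "\<forall>v. arc_excess R v = 0"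
      "\<forall>p\<in>#P. distinct p \<and> 2 \<le> length p \<and> arc_excess A' (hd p) > 0 \<and> arc_excess A' (last p) < 0"
      by blast
    have ex: "arc_excess A x = of_bool (v = x) - of_bool (last p = x) + arc_excess A' x" for x
      unfolding A' using arc_excess_path[OF \<open>p \<noteq> []\<close>] p(3) by simp
    have "v \<noteq> last p" using v p(4) by auto
    then have pos: "arc_excess A x > 0" if "arc_excess A' x > 0" for x
      using ex[of x] ex[of "last p"] p(4) that by (cases "last p = x") auto
    have neg: "arc_excess A x < 0" if "arc_excess A' x < 0" for x
      using ex[of x] v that \<open>v \<noteq> last p\<close> by (cases "v = x") auto
    show ?thesis
      by (rule exI[of _ "add_mset p P"], rule exI[of _ R])
        (use PR p v pos neg A' in \<open>auto simp: add_ac\<close>)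
  qed
qed

section \<open>Cycles in balanced digraphs\<close>

definition cycle_arcs :: "'a list \<Rightarrow> ('a \<times> 'a) multiset" where
  "cycle_arcs c = path_arcs (c @ [hd c])"

definition balanced :: "('a \<times> 'a) set \<Rightarrow> bool" where
  "balanced R \<longleftrightarrow> (\<forall>v. arc_excess (mset_set R) v = 0)"

lemma arc_excess_cycle: "c \<noteq> [] \<Longrightarrow> arc_excess (cycle_arcs c) v = 0"
  unfolding cycle_arcs_def by (subst arc_excess_path) auto

lemma cycle_arcs_eq: "c \<noteq> [] \<Longrightarrow> cycle_arcs c = add_mset (last c, hd c) (path_arcs c)"
  unfolding cycle_arcs_def by (subst path_arcs_append2) auto

lemma cycle_arcs_le_1:
  assumes "distinct c" "c \<noteq> []" shows "count (cycle_arcs c) e \<le> 1"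
proof -
  have "(last c, hd c) \<notin># path_arcs c"
  proof
    assume "(last c, hd c) \<in># path_arcs c"
    moreover have "(x, y) \<in># path_arcs c \<Longrightarrow> y \<in> set (tl c)" for x y
      unfolding path_arcs_def by (auto dest: set_zip_rightD)
    ultimately show False using assms by (cases c) auto
  qed
  then show ?thesis using path_arcs_le_1[OF assms(1), of e] assms(2)
    by (auto simp: cycle_arcs_eq count_eq_zero_iff)
qed

lemma balanced_remove_cycle:
  assumes "finite R" "balanced R" "distinct c" "c \<noteq> []" "set_mset (cycle_arcs c) \<subseteq> R"
  shows "mset_set R = cycle_arcs c + mset_set (R - set_mset (cycle_arcs c))"
    and "balanced (R - set_mset (cycle_arcs c))"
    and "card R = length c + card (R - set_mset (cycle_arcs c))"
proof -
  let ?C = "set_mset (cycle_arcs c)"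
  have C: "cycle_arcs c = mset_set ?C"
  proof (rule multiset_eqI)
    fix e show "count (cycle_arcs c) e = count (mset_set ?C) e"
      using cycle_arcs_le_1[OF assms(3,4), of e]
      by (cases "e \<in># cycle_arcs c") (auto simp: not_in_iff le_antisym Suc_le_eq)
  qed
  show 1: "mset_set R = cycle_arcs c + mset_set (R - ?C)"
    using assms(1,5) C by (metis Diff_disjoint Un_Diff_cancel finite_Diff finite_set_mset mset_set_Union sup.absorb_iff2)
  show "balanced (R - ?C)"
    using assms(2) arc_excess_cycle[OF assms(4)] 1 unfolding balanced_def by (metis add_0 arc_excess_add)
  have "size (mset_set R) = size (cycle_arcs c) + size (mset_set (R - ?C))" by (simp only: 1 size_union)
  moreover have "size (cycle_arcs c) = length c" by (simp add: cycle_arcs_def)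
  ultimately show "card R = length c + card (R - ?C)" by simp
qed

text \<open>A longest path in \<open>U\<close> contains all out-neighbours \<open>N\<close> of its
  last vertex \<open>z\<close> within \<open>U\<close>. Closing it from \<open>z\<close> to the
  first element of \<open>N\<close> gives a cycle through all of \<open>N\<close> and through
  \<open>z\<close>, which accounts for the length \<open>d + 1\<close>.\<close>

lemma min_outdegree_cycle:
  assumes "finite U" "U \<noteq> {}" "\<And>u. u \<in> U \<Longrightarrow> d \<le> card {y \<in> U. (u, y) \<in> R}" "1 \<le> d" "\<And>x. (x, x) \<notin> R"
  shows "\<exists>c. distinct c \<and> d + 1 \<le> length c \<and> set_mset (cycle_arcs c) \<subseteq> R"
proof -
  define good where "good p \<longleftrightarrow> distinct p \<and> p \<noteq> [] \<and> set p \<subseteq> U \<and> set_mset (path_arcs p) \<subseteq> R" for p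
  obtain u where "u \<in> U" using assms(2) by blast
  then have "good [u]" by (simp add: good_def)
  moreover have "\<forall>p. good p \<longrightarrow> length p < Suc (card U)"
    unfolding good_def using assms(1) by (metis card_mono distinct_card le_imp_less_Suc)
  ultimately have "\<exists>p. good p \<and> (\<forall>q. good q \<longrightarrow> length q \<le> length p)"
    by (rule ex_has_greatest_nat)
  then obtain p where p: "good p" "\<And>q. good q \<Longrightarrow> length q \<le> length p"
    by blast
  define z where "z = last p"
  define N where "N = {y \<in> U. (z, y) \<in> R}"
  have p': "distinct p" "p \<noteq> []" "set p \<subseteq> U" "set_mset (path_arcs p) \<subseteq> R" using p(1) by (auto simp: good_def)
  have "z \<in> U" using p' by (auto simp: z_def)
  have Nd: "d \<le> card N" using assms(3)[OF \<open>z \<in> U\<close>] by (simp add: N_def)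
  have Nsub: "N \<subseteq> set p"
  proof
    fix y assume y: "y \<in> N"
    show "y \<in> set p"
    proof (rule ccontr)
      assume "y \<notin> set p"
      then have "good (p @ [y])"
        using p' y unfolding good_def N_def z_def by (auto simp: path_arcs_append2)
      from p(2)[OF this] show False by simp
    qed
  qed
  have "N \<noteq> {}" using Nd assms(4) by auto
  then have "\<exists>y\<in>set p. y \<in> N" using Nsub by blast
  then obtain a y b where ab: "p = a @ y # b" "y \<in> N" "\<forall>x\<in>set a. x \<notin> N"
    by (rule split_list_first_propE)
  let ?c = "y # b"
  have "z \<in> set ?c" using ab by (auto simp: z_def)
  moreover have "z \<notin> N" using assms(5) by (auto simp: N_def)
  moreover have "N \<subseteq> set ?c" using Nsub ab by auto
  moreover have "finite N" using assms(1) by (simp add: N_def)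
  ultimately have sub: "insert z N \<subseteq> set ?c" and "card (insert z N) = Suc (card N)" by auto
  moreover from sub have "card (insert z N) \<le> card (set ?c)" by (rule card_mono[OF finite_set])
  moreover have "card (set ?c) = length ?c" using p'(1) ab by (intro distinct_card) auto
  ultimately have len: "d + 1 \<le> length ?c" using Nd by linarith
  have "set_mset (cycle_arcs ?c) \<subseteq> R"
    using p'(4) ab path_arcs_suffix[of "y # b" a] by (auto simp: cycle_arcs_eq N_def z_def)
  then show ?thesis using len p'(1) ab by (intro exI[of _ ?c]) auto
qed

lemma balanced_degrees:
  assumes "balanced R" "finite R" shows "card {y. (v, y) \<in> R} = card {x. (x, v) \<in> R}"
  using assms(1) arc_excess_mset_set[OF assms(2), of v] unfolding balanced_def by simp

text \<open>In a balanced digraph the head of an arc is also the tail of an arc, so within the set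
  of tails all out-degrees are at least 1.\<close>

lemma balanced_cycle_exists:
  assumes "finite R" "balanced R" "R \<noteq> {}" "\<And>x. (x, x) \<notin> R"
  shows "\<exists>c. distinct c \<and> 2 \<le> length c \<and> set_mset (cycle_arcs c) \<subseteq> R"
proof -
  define U where "U = fst ` R"
  have "1 \<le> card {y \<in> U. (u, y) \<in> R}" if "u \<in> U" for u
  proof -
    obtain y where y: "(u, y) \<in> R" using \<open>u \<in> U\<close> by (auto simp: U_def)
    have "finite ((\<lambda>x. (x, y)) -` R)" using assms(1) by (intro finite_vimageI) (auto simp: inj_on_def)
    then have "card {x. (x, y) \<in> R} > 0" using y by (auto simp: card_gt_0_iff vimage_def)
    then have "card {z. (y, z) \<in> R} > 0" using balanced_degrees[OF assms(2,1)] by simp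
    then obtain z where "(y, z) \<in> R" by (auto simp: card_gt_0_iff)
    then have "y \<in> U" unfolding U_def by (rule image_eqI[rotated]) simp
    moreover have "finite {y \<in> U. (u, y) \<in> R}" using assms(1) by (simp add: U_def)
    ultimately show ?thesis using y by (auto simp: Suc_le_eq card_gt_0_iff)
  qed
  from min_outdegree_cycle[of U 1 R, OF _ _ this] show ?thesis
    using assms by (auto simp: U_def numeral_2_eq_2)
qed

text \<open>A vertex of small out-degree gets the last position and the rest is ordered recursively.
  The arcs going backwards from it are among its at most \<open>d\<close> arcs into the current set,
  so every vertex pays for at most \<open>d\<close> of them.\<close>

lemma degenerate_ordering:
  assumes "finite U" "\<And>S. S \<subseteq> U \<Longrightarrow> S \<noteq> {} \<Longrightarrow> \<exists>v\<in>S. card {y \<in> S. (v, y) \<in> R} \<le> d"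
  shows "\<exists>pos :: 'a \<Rightarrow> nat. inj_on pos U \<and> pos ` U \<subseteq> {..<card U} \<and>
    card {(x, y) \<in> R \<inter> U \<times> U. pos y < pos x} \<le> d * card U"
  using assms
proof (induction "card U" arbitrary: U)
  case 0
  then show ?case by auto
next
  case (Suc k)
  then have "U \<noteq> {}" by auto
  then obtain v where v: "v \<in> U" "card {y \<in> U. (v, y) \<in> R} \<le> d" using Suc.prems(2)[of U] by auto
  let ?U = "U - {v}"
  have "k = card ?U" using Suc v by simp
  moreover have "\<And>S. S \<subseteq> ?U \<Longrightarrow> S \<noteq> {} \<Longrightarrow> \<exists>v\<in>S. card {y \<in> S. (v, y) \<in> R} \<le> d"
    using Suc.prems(2) by (meson Diff_subset subset_trans)
  ultimately obtain pos where pos: "inj_on pos ?U" "pos ` ?U \<subseteq> {..<card ?U}"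
    "card {(x, y) \<in> R \<inter> ?U \<times> ?U. pos y < pos x} \<le> d * card ?U"
    using Suc.hyps(1)[of ?U] Suc.prems(1) by blast
  define pos' where "pos' = pos(v := k)"
  have lt: "pos x < k" if "x \<in> ?U" for x using pos(2) that \<open>k = card ?U\<close> by auto
  have "inj_on pos' U"
    using pos(1) lt unfolding pos'_def inj_on_def
    by (metis Diff_iff fun_upd_apply less_irrefl singletonD)
  moreover have "pos' ` U \<subseteq> {..<card U}"
    using lt Suc.hyps(2)[symmetric] unfolding pos'_def by (auto simp: less_Suc_eq)
  moreover have "card {(x, y) \<in> R \<inter> U \<times> U. pos' y < pos' x} \<le> d * card U"
  proof -
    have "{(x, y) \<in> R \<inter> U \<times> U. pos' y < pos' x} \<subseteq>
      {(x, y) \<in> R \<inter> ?U \<times> ?U. pos y < pos x} \<union> Pair v ` {y \<in> U. (v, y) \<in> R}"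
    proof (clarify, goal_cases)
      case (1 x y)
      show ?case
      proof (cases "x = v")
        case False
        then have "x \<in> ?U" using 1 by simp
        moreover have "y \<noteq> v" using lt[OF \<open>x \<in> ?U\<close>] 1 False by (auto simp: pos'_def)
        ultimately show ?thesis using 1 by (auto simp: pos'_def)
      qed (use 1 in auto)
    qed
    then have "card {(x, y) \<in> R \<inter> U \<times> U. pos' y < pos' x} \<le>
      card ({(x, y) \<in> R \<inter> ?U \<times> ?U. pos y < pos x} \<union> Pair v ` {y \<in> U. (v, y) \<in> R})"
      using Suc.prems(1) by (intro card_mono) (auto intro: finite_subset[of _ "U \<times> U"])
    also have "\<dots> \<le> card {(x, y) \<in> R \<inter> ?U \<times> ?U. pos y < pos x} + card (Pair v ` {y \<in> U. (v, y) \<in> R})"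
      by (rule card_Un_le)
    also have "card (Pair v ` {y \<in> U. (v, y) \<in> R}) \<le> d"
      using v(2) card_image_le[of "{y \<in> U. (v, y) \<in> R}" "Pair v"] Suc.prems(1) by simp
    also note pos(3)
    also have "d * card ?U + d = d * card U" unfolding Suc.hyps(2)[symmetric] \<open>k = card ?U\<close>[symmetric] by simp
    finally show ?thesis by simp
  qed
  ultimately show ?case by blast
qed

text \<open>An ordering in which few arcs go backwards forces the forward arcs to be short, because the
  lengths of forward and backward arcs of a balanced digraph have the same total.\<close>

lemma balanced_long_cycle:
  assumes V: "finite V" "card V = n" and R: "R \<subseteq> V \<times> V" "balanced R" "\<And>x. (x, x) \<notin> R"
    and no: "\<And>c. distinct c \<Longrightarrow> set_mset (cycle_arcs c) \<subseteq> R \<Longrightarrow> length c < d + 2"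
  shows "L * card R \<le> L * (d * n) + L * (n * L) + d * n * n"
proof -
  have finR: "finite R" using V R(1) by (meson finite_SigmaI finite_subset)
  \<comment> \<open>If all out-degrees within \<open>S\<close> were at least \<open>d + 1\<close>,
    there would be a cycle of length at least \<open>d + 2\<close>.\<close>
  have "\<exists>v\<in>S. card {y \<in> S. (v, y) \<in> R} \<le> d" if S: "S \<subseteq> V" "S \<noteq> {}" for S
  proof (rule ccontr)
    assume "\<not> ?thesis"
    then have "\<And>u. u \<in> S \<Longrightarrow> d + 1 \<le> card {y \<in> S. (u, y) \<in> R}" by auto
    from min_outdegree_cycle[of S "d + 1" R, OF _ _ this] obtain c where
      "distinct c" "d + 2 \<le> length c" "set_mset (cycle_arcs c) \<subseteq> R"
      using S V R(3) finite_subset by fastforce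
    with no show False by force
  qed
  from degenerate_ordering[OF V(1) this] obtain pos :: "'a \<Rightarrow> nat" where
    pos: "inj_on pos V" "pos ` V \<subseteq> {..<card V}" "card {(x, y) \<in> R \<inter> V \<times> V. pos y < pos x} \<le> d * card V"
    by auto
  \<comment> \<open>Backward arcs are few by the ordering, and short forward arcs are few by
    counting positions. Only the arcs of \<open>Fl\<close>, longer than \<open>L\<close>, need the
    length argument.\<close>
  define B where "B = {e \<in> R. pos (snd e) < pos (fst e)}"
  define Fs where "Fs = {e \<in> R. pos (fst e) < pos (snd e) \<and> pos (snd e) \<le> pos (fst e) + L}"
  define Fl where "Fl = {e \<in> R. pos (fst e) + L < pos (snd e)}"
  have neq: "pos (fst e) \<noteq> pos (snd e)" if "e \<in> R" for e
    using that R pos(1) by (cases e) (auto dest!: inj_onD)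
  have Rsplit: "R = B \<union> (Fs \<union> Fl)"
  proof (intro equalityI subsetI)
    fix e assume "e \<in> R"
    with neq[OF this] show "e \<in> B \<union> (Fs \<union> Fl)"
      unfolding B_def Fs_def Fl_def mem_Collect_eq Un_iff by linarith
  qed (auto simp: B_def Fs_def Fl_def)
  have fins: "finite B" "finite Fs" "finite Fl" using finR by (auto simp: B_def Fs_def Fl_def)
  have "B = {(x, y) \<in> R \<inter> V \<times> V. pos y < pos x}" using R(1) by (auto simp: B_def)
  then have cB: "card B \<le> d * n" using pos(3) V by simp
  have cFs: "card Fs \<le> n * L"
  proof -
    have "card Fs \<le> card (SIGMA x:V. {i. pos x < i \<and> i \<le> pos x + L})"
    proof (rule card_inj_on_le[of "\<lambda>e. (fst e, pos (snd e))"])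
      show "inj_on (\<lambda>e. (fst e, pos (snd e))) Fs"
        using R(1) pos(1) by (auto simp: Fs_def inj_on_def)
      show "(\<lambda>e. (fst e, pos (snd e))) ` Fs \<subseteq> (SIGMA x:V. {i. pos x < i \<and> i \<le> pos x + L})"
        using R(1) by (auto simp: Fs_def)
    qed (use V in auto)
    also have "\<dots> = (\<Sum>x\<in>V. card {pos x<..pos x + L})" using V 
      by (subst card_SigmaI) (auto simp: greaterThanAtMost_def greaterThan_def atMost_def Int_def)
    also have "\<dots> = n * L" using V by simp
    finally show ?thesis .
  qed
  \<comment> \<open>Every vertex is head and tail of equally many arcs, so all positions cancel. An
    arc of \<open>B\<close> contributes at least \<open>- n\<close> and an arc of \<open>Fl\<close>
    at least \<open>L\<close>, which yields \<open>L * card Fl \<le> card B * n\<close>.\<close>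
  have "(\<Sum>e\<in>R. int (pos (snd e)) - int (pos (fst e))) = 0"
  proof -
    have s: "(\<Sum>e\<in>R. int (pos (g e))) = (\<Sum>v\<in>V. int (pos v) * int (card {e \<in> R. g e = v}))"
      if "g ` R \<subseteq> V" for g
    proof -
      have "(\<Sum>e\<in>R. int (pos (g e))) = (\<Sum>v\<in>V. \<Sum>e\<in>{e \<in> R. g e = v}. int (pos (g e)))"
        by (rule sum.group[OF finR V(1) that, symmetric])
      also have "\<dots> = (\<Sum>v\<in>V. int (pos v) * int (card {e \<in> R. g e = v}))"
        by (intro sum.cong) (auto simp: mult.commute)
      finally show ?thesis .
    qed
    have "card {e \<in> R. fst e = v} = card {e \<in> R. snd e = v}" for v
    proof -
      have 1: "card {e \<in> R. fst e = v} = card {y. (v, y) \<in> R}"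
        by (rule bij_betw_same_card[of snd]) (auto simp: bij_betw_def inj_on_def image_iff)
      have 2: "card {e \<in> R. snd e = v} = card {x. (x, v) \<in> R}"
        by (rule bij_betw_same_card[of fst]) (auto simp: bij_betw_def inj_on_def image_iff)
      show ?thesis using 1 2 balanced_degrees[OF R(2) finR] by simp
    qed
    moreover have "snd ` R \<subseteq> V" "fst ` R \<subseteq> V" using R(1) by auto
    ultimately show ?thesis unfolding sum_subtractf using s[of snd] s[of fst] by simp
  qed
  moreover have "(\<Sum>e\<in>R. int (pos (snd e)) - int (pos (fst e))) =
     (\<Sum>e\<in>B. int (pos (snd e)) - int (pos (fst e))) + ((\<Sum>e\<in>Fs. int (pos (snd e)) - int (pos (fst e))) +
     (\<Sum>e\<in>Fl. int (pos (snd e)) - int (pos (fst e))))"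
  proof -
    have "B \<inter> (Fs \<union> Fl) = {}" "Fs \<inter> Fl = {}" by (auto simp: B_def Fs_def Fl_def)
    then show ?thesis using fins by (subst Rsplit) (simp add: sum.union_disjoint)
  qed
  moreover have "(\<Sum>e\<in>B. int (pos (snd e)) - int (pos (fst e))) \<ge> (\<Sum>e\<in>B. - int n)"
  proof (rule sum_mono)
    fix e assume "e \<in> B"
    then have "fst e \<in> V" using R(1) by (auto simp: B_def)
    then have "pos (fst e) < n" using pos(2) V by auto
    then show "- int n \<le> int (pos (snd e)) - int (pos (fst e))" by linarith
  qed
  moreover have "(\<Sum>e\<in>Fs. int (pos (snd e)) - int (pos (fst e))) \<ge> 0"
    by (rule sum_nonneg) (auto simp: Fs_def)
  moreover have "(\<Sum>e\<in>Fl. int (pos (snd e)) - int (pos (fst e))) \<ge> (\<Sum>e\<in>Fl. int L)"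
    by (rule sum_mono) (auto simp: Fl_def)
  ultimately have "int L * int (card Fl) \<le> int (card B) * int n" by (simp add: mult.commute)
  then have "L * card Fl \<le> card B * n" by (metis of_nat_le_iff of_nat_mult)
  then have "L * card Fl \<le> d * n * n" using cB by (meson le_trans mult_le_mono1)
  moreover have "card R \<le> card B + (card Fs + card Fl)"
    unfolding Rsplit by (meson card_Un_le add_left_mono order_trans)
  then have "L * card R \<le> L * card B + (L * card Fs + L * card Fl)"
    by (metis distrib_left mult_le_mono2)
  moreover have "L * card B \<le> L * (d * n)" "L * card Fs \<le> L * (n * L)" using cB cFs by simp_all
  ultimately show ?thesis by linarith
qed

section \<open>Greedy systems of short paths\<close>

text \<open>Arcs in both directions are counted together, so that one bound limits the used arcs
  leaving and entering a vertex.\<close>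

definition arc_degree :: "('a \<times> 'a) set \<Rightarrow> 'a \<Rightarrow> nat" where
  "arc_degree U v = card {e \<in> U. fst e = v \<or> snd e = v}"

lemma arc_degree_path:
  assumes "distinct p"
  shows "arc_degree (set_mset (path_arcs p)) v \<le> (if v \<in> set p then 2 else 0)"
  using assms
proof (induction p)
  case (Cons a p)
  show ?case
  proof (cases p)
    case (Cons b q)
    have eq: "{e \<in> set_mset (path_arcs (a # p)). fst e = v \<or> snd e = v} =
      (if v = a \<or> v = b then {(a, b)} else {}) \<union> {e \<in> set_mset (path_arcs p). fst e = v \<or> snd e = v}"
      by (auto simp: Cons)
    show ?thesis
    proof (cases "v = a")
      case True
      then have "{e \<in> set_mset (path_arcs p). fst e = v \<or> snd e = v} = {}"
        using Cons.prems path_arcs_in[of _ _ p] by auto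
      then show ?thesis unfolding arc_degree_def eq by (simp only: True) simp
    next
      case False
      show ?thesis
      proof (cases "v = b")
        case True
        have "{e \<in> set_mset (path_arcs p). fst e = v \<or> snd e = v} \<subseteq> {(b, hd q)}"
          using Cons.prems True by (cases q) (auto simp: Cons dest: path_arcs_in)
        then have "card {e \<in> set_mset (path_arcs p). fst e = v \<or> snd e = v} \<le> card {(b, hd q)}"
          by (intro card_mono) auto
        then have "card ({(a, b)} \<union> {e \<in> set_mset (path_arcs p). fst e = v \<or> snd e = v}) \<le> 2"
          by (intro order_trans[OF card_Un_le]) simp
        then show ?thesis using True Cons unfolding arc_degree_def eq by simp
      next
        case False
        then show ?thesis using Cons.IH Cons.prems \<open>v \<noteq> a\<close> unfolding arc_degree_def eq by auto
      qed
    qed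
  qed (simp add: arc_degree_def)
qed (simp add: arc_degree_def)

lemma arc_degree_UN:
  assumes "finite I" "\<And>i. i \<in> I \<Longrightarrow> finite (U i)"
  shows "arc_degree (\<Union>i\<in>I. U i) v \<le> (\<Sum>i\<in>I. arc_degree (U i) v)"
proof -
  have "{e \<in> (\<Union>i\<in>I. U i). fst e = v \<or> snd e = v} = (\<Union>i\<in>I. {e \<in> U i. fst e = v \<or> snd e = v})" by auto
  then show ?thesis unfolding arc_degree_def using card_UN_le[OF assms(1)] by simp
qed

text \<open>Double counting of the pairs \<open>(i, v)\<close> with \<open>v \<in> S i\<close>. It
  bounds the number of overloaded vertices in \<open>greedy_paths\<close> and the number of vertices
  of large degree in \<open>dense_perfect_nat\<close>.\<close>

lemma card_heavy:
  assumes "finite I" "finite V" "\<And>i. i \<in> I \<Longrightarrow> finite (S i) \<and> card (S i) \<le> k"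
  shows "l * card {v \<in> V. l \<le> card {i \<in> I. v \<in> S i}} \<le> k * card I"
proof -
  let ?H = "{v \<in> V. l \<le> card {i \<in> I. v \<in> S i}}"
  have "l * card ?H = (\<Sum>v\<in>?H. l)" by simp
  also have "\<dots> \<le> (\<Sum>v\<in>?H. card {i \<in> I. v \<in> S i})" by (rule sum_mono) auto
  also have "\<dots> = (\<Sum>v\<in>?H. \<Sum>i\<in>I. of_bool (v \<in> S i))"
    using assms(1) by (simp add: Int_def)
  also have "\<dots> = (\<Sum>i\<in>I. \<Sum>v\<in>?H. of_bool (v \<in> S i))"
    by (rule sum.swap)
  also have "\<dots> \<le> (\<Sum>i\<in>I. k)"
  proof (rule sum_mono)
    fix i assume "i \<in> I"
    then have "finite (S i)" "card (S i) \<le> k" using assms(3) by auto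
    have "(\<Sum>v\<in>?H. of_bool (v \<in> S i)) = card (?H \<inter> {v. v \<in> S i})"
      using assms(2) by simp
    also have "\<dots> \<le> card (S i)" using \<open>finite (S i)\<close> by (intro card_mono) auto
    finally show "(\<Sum>v\<in>?H. of_bool (v \<in> S i)) \<le> k" using \<open>card (S i) \<le> k\<close> by simp
  qed
  finally show ?thesis by (simp add: mult.commute)
qed

text \<open>Demands are served one at a time. The path for a new demand avoids the vertices which are
  already overloaded, the free vertices used within its own group, and all used arcs; vertices
  in \<open>F i\<close> are prescribed by the demand and cannot be avoided.\<close>

lemma greedy_paths:
  fixes Q :: "'i \<Rightarrow> 'a list \<Rightarrow> bool" and F :: "'i \<Rightarrow> 'a set" and g :: "'i \<Rightarrow> 'g"
  assumes I: "finite I" and V: "finite V"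
    and step: "\<And>i Z U. i \<in> I \<Longrightarrow> card Z \<le> z \<Longrightarrow> Z \<subseteq> V \<Longrightarrow> finite U \<Longrightarrow>
      (\<And>v. v \<in> V \<Longrightarrow> arc_degree U v \<le> z) \<Longrightarrow>
      \<exists>p. Q i p \<and> set_mset (path_arcs p) \<inter> U = {} \<and> (set p - F i) \<inter> Z = {}"
    and Q: "\<And>i p. i \<in> I \<Longrightarrow> Q i p \<Longrightarrow> distinct p \<and> length p \<le> 5 \<and> set p \<subseteq> V"
    and h: "\<And>v. v \<in> V \<Longrightarrow> card {i \<in> I. v \<in> F i} \<le> h"
    and G: "\<And>i. i \<in> I \<Longrightarrow> card {j \<in> I. g j = g i} \<le> G"
    and num: "5 * card I \<le> l * zh" "0 < l" "zh + 5 * G \<le> z" "2 * (l + h) \<le> z"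
  shows "\<exists>f. (\<forall>i\<in>I. Q i (f i)) \<and>
    (\<forall>i\<in>I. \<forall>j\<in>I. i \<noteq> j \<longrightarrow> set_mset (path_arcs (f i)) \<inter> set_mset (path_arcs (f j)) = {}) \<and>
    (\<forall>i\<in>I. \<forall>j\<in>I. i \<noteq> j \<longrightarrow> g i = g j \<longrightarrow> (set (f i) - F i) \<inter> (set (f j) - F j) = {}) \<and>
    (\<forall>v\<in>V. card {i \<in> I. v \<in> set (f i) - F i} \<le> l)"
proof -
  have "\<exists>f. (\<forall>i\<in>J. Q i (f i)) \<and>
    (\<forall>i\<in>J. \<forall>j\<in>J. i \<noteq> j \<longrightarrow> set_mset (path_arcs (f i)) \<inter> set_mset (path_arcs (f j)) = {}) \<and>
    (\<forall>i\<in>J. \<forall>j\<in>J. i \<noteq> j \<longrightarrow> g i = g j \<longrightarrow> (set (f i) - F i) \<inter> (set (f j) - F j) = {}) \<and>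
    (\<forall>v\<in>V. card {i \<in> J. v \<in> set (f i) - F i} \<le> l)" if "finite J" "J \<subseteq> I" for J
    using that
  proof (induction J)
    case empty
    then show ?case by simp
  next
    case (insert i J)
    then obtain f where f: "\<forall>i\<in>J. Q i (f i)"
      "\<forall>i\<in>J. \<forall>j\<in>J. i \<noteq> j \<longrightarrow> set_mset (path_arcs (f i)) \<inter> set_mset (path_arcs (f j)) = {}"
      "\<forall>i\<in>J. \<forall>j\<in>J. i \<noteq> j \<longrightarrow> g i = g j \<longrightarrow> (set (f i) - F i) \<inter> (set (f j) - F j) = {}"
      "\<forall>v\<in>V. card {i \<in> J. v \<in> set (f i) - F i} \<le> l" by auto
    have iI: "i \<in> I" and JI: "J \<subseteq> I" using insert.prems by auto
    have len: "distinct (f j)" "card (set (f j)) \<le> 5" "set (f j) \<subseteq> V" if "j \<in> J" for j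
      using Q[of j "f j"] f(1) that JI card_length[of "f j"] by (auto intro: order_trans)
    have len5: "card (set (f j) - F j) \<le> 5" if "j \<in> J" for j
    proof -
      have "card (set (f j) - F j) \<le> card (set (f j))" by (intro card_mono) auto
      with len(2)[OF that] show ?thesis by linarith
    qed
    \<comment> \<open>\<open>Z1\<close> holds the vertices already used \<open>l\<close> times as
      free vertices; since every path has at most 5 vertices, \<open>5 * card I \<le> l * zh\<close>
      leaves at most \<open>zh\<close> of them. \<open>Z2\<close> holds the free vertices used
      within the same group.\<close>
    define Z1 where "Z1 = {v \<in> V. l \<le> card {j \<in> J. v \<in> set (f j) - F j}}"
    define Z2 where "Z2 = (\<Union>j\<in>{j \<in> J. g j = g i}. set (f j) - F j)"
    define U where "U = (\<Union>j\<in>J. set_mset (path_arcs (f j)))"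
    have "l * card Z1 \<le> 5 * card J"
      unfolding Z1_def using len5 insert.hyps(1) V by (intro card_heavy) auto
    also have "\<dots> \<le> 5 * card I" using JI I by (simp add: card_mono)
    finally have "card Z1 \<le> zh" using num(1,2) by (meson le_trans nat_mult_le_cancel_disj not_less_zero)
    moreover have "card Z2 \<le> 5 * G"
    proof -
      have "card Z2 \<le> (\<Sum>j\<in>{j \<in> J. g j = g i}. card (set (f j) - F j))"
        unfolding Z2_def using insert.hyps(1) by (intro card_UN_le) auto
      also have "\<dots> \<le> (\<Sum>j\<in>{j \<in> J. g j = g i}. 5)"
        by (rule sum_mono) (use len5 in auto)
      also have "\<dots> \<le> 5 * card {j \<in> I. g j = g i}"
        using I JI by (simp add: card_mono subset_iff)
      finally show ?thesis using G[OF iI] by linarith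
    qed
    ultimately have Z: "card (Z1 \<union> Z2) \<le> z" using card_Un_le[of Z1 Z2] num(3) by linarith
    have ZV: "Z1 \<union> Z2 \<subseteq> V" using len by (auto simp: Z1_def Z2_def)
    \<comment> \<open>A vertex is visited at most \<open>l\<close> times freely and at most
      \<open>h\<close> times by prescription, and each visit uses at most two arcs.\<close>
    have U: "arc_degree U v \<le> z" if v: "v \<in> V" for v
    proof -
      have "arc_degree U v \<le> (\<Sum>j\<in>J. arc_degree (set_mset (path_arcs (f j))) v)"
        unfolding U_def using insert.hyps(1) by (intro arc_degree_UN) auto
      also have "\<dots> \<le> (\<Sum>j\<in>J. 2 * (of_bool (v \<in> set (f j) - F j) + of_bool (v \<in> F j)))"
        using len(1) by (intro sum_mono order_trans[OF arc_degree_path]) auto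
      also have "\<dots> = 2 * (card {j \<in> J. v \<in> set (f j) - F j} + card {j \<in> J. v \<in> F j})"
        using insert.hyps(1) unfolding sum_distrib_left[symmetric] sum.distrib
        by (simp add: Int_def del: Diff_iff)
      also have "card {j \<in> J. v \<in> F j} \<le> card {j \<in> I. v \<in> F j}"
        using I JI by (intro card_mono) auto
      finally show ?thesis using f(4) v h[OF v] num(4) by fastforce
    qed
    have finU: "finite U" unfolding U_def using insert.hyps(1) by auto
    obtain p where p: "Q i p" "set_mset (path_arcs p) \<inter> U = {}" "(set p - F i) \<inter> (Z1 \<union> Z2) = {}"
      using step[OF iI Z ZV finU U] by blast
    define f' where "f' = f(i := p)"
    have eq: "f' j = f j" if "j \<in> J" for j using that insert.hyps(2) by (auto simp: f'_def)
    have eqi: "f' i = p" by (simp add: f'_def)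
    show ?case
    proof (intro exI[of _ f'] conjI ballI impI)
      fix j assume "j \<in> insert i J"
      then show "Q j (f' j)" using f(1) p(1) eq eqi by auto
    next
      fix j k assume "j \<in> insert i J" "k \<in> insert i J" "j \<noteq> k"
      moreover have "set_mset (path_arcs (f m)) \<inter> set_mset (path_arcs p) = {}" if "m \<in> J" for m
        using p(2) that unfolding U_def by blast
      ultimately show "set_mset (path_arcs (f' j)) \<inter> set_mset (path_arcs (f' k)) = {}"
        using f(2) eq eqi by (cases "j = i"; cases "k = i") (simp_all add: Int_commute)
    next
      fix j k assume jk: "j \<in> insert i J" "k \<in> insert i J" "j \<noteq> k" "g j = g k"
      have *: "(set (f m) - F m) \<inter> (set p - F i) = {}" if "m \<in> J" "g m = g i" for m
        using p(3) that unfolding Z2_def by blast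
      show "(set (f' j) - F j) \<inter> (set (f' k) - F k) = {}"
      proof (cases "j = i")
        case True
        then show ?thesis using jk *[of k] eq eqi by auto
      next
        case False
        then show ?thesis using jk *[of j] f(3) eq eqi by (cases "k = i") auto
      qed
    next
      fix v assume v: "v \<in> V"
      have eq': "{j \<in> insert i J. v \<in> set (f' j) - F j} =
        {j \<in> J. v \<in> set (f j) - F j} \<union> (if v \<in> set p - F i then {i} else {})"
        using eq eqi by auto
      show "card {j \<in> insert i J. v \<in> set (f' j) - F j} \<le> l"
      proof (cases "v \<in> set p - F i")
        case True
        then have "v \<notin> Z1" using p(3) by auto
        then have "card {j \<in> J. v \<in> set (f j) - F j} < l" using v by (auto simp: Z1_def)
        then show ?thesis unfolding eq' using True insert.hyps(1)
          by (auto intro!: order_trans[OF card_Un_le] simp del: Un_insert_right Diff_iff)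
      next
        case False
        then show ?thesis unfolding eq' using f(4) v by auto
      qed
    qed
  qed
  from this[OF I subset_refl] show ?thesis .
qed

section \<open>Absorbing cycles\<close>

text \<open>The vertex \<open>z\<close> plays the head of a block after the last one. With
  \<open>z\<close> the head of the first block, this cuts a cycle at the heads of its
  blocks.\<close>

lemma path_arcs_concat:
  assumes "\<And>B. B \<in> set Bs \<Longrightarrow> B \<noteq> []"
  shows "path_arcs (concat Bs @ [z]) =
    (\<Sum>i<length Bs. path_arcs (Bs ! i @ [if Suc i < length Bs then hd (Bs ! Suc i) else z]))"
  using assms
proof (induction Bs)
  case (Cons B Bs)
  let ?h = "\<lambda>Bs i. if Suc i < length Bs then hd (Bs ! Suc i) else z"
  have "path_arcs (concat (B # Bs) @ [z]) = path_arcs (B @ [?h (B # Bs) 0]) + path_arcs (concat Bs @ [z])"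
  proof (cases Bs)
    case (Cons C Cs)
    then obtain y ys where "C = y # ys" using Cons.prems by (cases C) auto
    then show ?thesis using Cons path_arcs_append[of B y "ys @ concat Cs @ [z]"] by simp
  qed simp
  also have "path_arcs (concat Bs @ [z]) = (\<Sum>i<length Bs. path_arcs (Bs ! i @ [?h Bs i]))"
    using Cons by simp
  also have "path_arcs (B @ [?h (B # Bs) 0]) + \<dots> =
    (\<Sum>i<length (B # Bs). path_arcs ((B # Bs) ! i @ [?h (B # Bs) i]))"
    by (simp add: sum.lessThan_Suc_shift del: sum.lessThan_Suc cong: if_cong)
  finally show ?case .
qed simp

lemma bij_betw_Suc_mod: "0 < k \<Longrightarrow> bij_betw (\<lambda>i. Suc i mod k) {..<k} {..<k}"
proof -
  assume k: "0 < k"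
  have "inj_on (\<lambda>i. Suc i mod k) {..<k}"
  proof (rule inj_onI)
    fix x y assume "x \<in> {..<k}" "y \<in> {..<k}" "Suc x mod k = Suc y mod k"
    then show "x = y" by (cases "Suc x = k"; cases "Suc y = k") auto
  qed
  moreover have "(\<lambda>i. Suc i mod k) ` {..<k} \<subseteq> {..<k}" using k by auto
  ultimately show ?thesis by (simp add: bij_betw_def endo_inj_surj)
qed

text \<open>A cycle is cut at the heads of its blocks; the \<open>i\<close>-th path runs along the \<open>i\<close>-th block and is
  continued by the \<open>(i+1)\<close>-st path, so that all starts and all ends are preserved.\<close>

lemma reroute_along_cycle:
  fixes Bs :: "'a list list" and I F :: "nat \<Rightarrow> 'a list"
  defines "k \<equiv> length Bs" and "p \<equiv> \<lambda>i. I i @ hd (Bs ! i) # F i"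
    and "N \<equiv> \<lambda>i. I i @ Bs ! i @ hd (Bs ! (Suc i mod length Bs)) # F (Suc i mod length Bs)"
  assumes k: "2 \<le> k" and dist: "distinct (concat Bs)" and ne: "\<And>B. B \<in> set Bs \<Longrightarrow> B \<noteq> []"
    and p: "\<And>i. i < k \<Longrightarrow> distinct (p i)"
    and disj: "\<And>i j. i < k \<Longrightarrow> j < k \<Longrightarrow> i \<noteq> j \<Longrightarrow> set (p i) \<inter> set (p j) = {}"
    and avoid: "\<And>i. i < k \<Longrightarrow> (set (p i) - {hd (Bs ! i)}) \<inter> set (Bs ! i) = {}"
    and avoid': "\<And>i. i < k \<Longrightarrow> (set (p (Suc i mod k)) - {hd (Bs ! (Suc i mod k))}) \<inter> set (Bs ! i) = {}"
  shows "(\<Sum>i<k. path_arcs (N i)) = (\<Sum>i<k. path_arcs (p i)) + cycle_arcs (concat Bs)"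
    and "\<And>i. i < k \<Longrightarrow> distinct (N i) \<and> 2 \<le> length (N i) \<and> hd (N i) = hd (p i) \<and>
      last (N i) = last (p (Suc i mod k))"
proof -
  let ?b = "\<lambda>i. hd (Bs ! i)" and ?s = "\<lambda>i. Suc i mod k"
  have ne': "Bs ! i \<noteq> []" if "i < k" for i using that ne k_def by auto
  \<comment> \<open>With a single block, \<open>N i\<close> would contain the head of that block
    twice; \<open>2 \<le> k\<close> makes the continuing path a different one.\<close>
  have s: "?s i < k" "?s i \<noteq> i" if "i < k" for i
    using that k by (auto simp: mod_Suc)
  have "[] \<notin> set Bs" using ne by blast
  then have dBs: "distinct Bs" using dist unfolding distinct_concat_iff by (simp add: removeAll_id)
  have blk: "set (Bs ! i) \<inter> set (Bs ! j) = {}" if "i < k" "j < k" "i \<noteq> j" for i j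
  proof -
    have "Bs ! i \<noteq> Bs ! j" using dBs that unfolding k_def by (simp add: nth_eq_iff_index_eq)
    then show ?thesis using dist that unfolding distinct_concat_iff k_def by simp
  qed
  \<comment> \<open>The three pieces are the initial segment of path \<open>i\<close>, block
    \<open>i\<close> with the arc to the next head, and the final segment of the next path. Summed
    over \<open>i\<close>, the outer pieces give the old paths and the middle ones the
    cycle.\<close>
  have arcs: "path_arcs (N i) = path_arcs (I i @ [?b i]) + path_arcs (Bs ! i @ [?b (?s i)]) + path_arcs (?b (?s i) # F (?s i))"
    if ik: "i < k" for i
  proof -
    obtain b r where "Bs ! i = b # r" using ne'[OF ik] by (cases "Bs ! i") auto
    then show ?thesis
      using path_arcs_append[of "I i" b "r @ ?b (?s i) # F (?s i)"]
        path_arcs_append[of "b # r" "?b (?s i)" "F (?s i)"]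
      by (simp add: N_def k_def)
  qed
  have pi: "path_arcs (p i) = path_arcs (I i @ [?b i]) + path_arcs (?b i # F i)" for i
    unfolding p_def by (rule path_arcs_append)
  have "(\<Sum>i<k. path_arcs (N i)) = (\<Sum>i<k. path_arcs (I i @ [?b i])) +
      (\<Sum>i<k. path_arcs (Bs ! i @ [?b (?s i)])) + (\<Sum>i<k. path_arcs (?b (?s i) # F (?s i)))"
    using arcs by (simp add: sum.distrib)
  also have "(\<Sum>i<k. path_arcs (?b (?s i) # F (?s i))) = (\<Sum>i<k. path_arcs (?b i # F i))"
    using sum.reindex_bij_betw[OF bij_betw_Suc_mod, of k "\<lambda>i. path_arcs (?b i # F i)"] k by simp
  also have "(\<Sum>i<k. path_arcs (Bs ! i @ [?b (?s i)])) = cycle_arcs (concat Bs)"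
  proof -
    have "hd (concat Bs) = ?b 0" using ne k unfolding k_def by (cases Bs) (auto simp: hd_append)
    moreover have "path_arcs (concat Bs @ [?b 0]) = (\<Sum>i<k. path_arcs (Bs ! i @ [?b (?s i)]))"
      by (subst path_arcs_concat[OF ne]) (auto simp: k_def mod_Suc intro!: sum.cong)
    ultimately show ?thesis by (simp add: cycle_arcs_def)
  qed
  finally show "(\<Sum>i<k. path_arcs (N i)) = (\<Sum>i<k. path_arcs (p i)) + cycle_arcs (concat Bs)"
    using pi by (simp add: sum.distrib add_ac)
  fix i assume i: "i < k"
  define j where "j = ?s i"
  have j: "j < k" "j \<noteq> i" using s[OF i] by (auto simp: j_def)
  have N: "N i = I i @ Bs ! i @ ?b j # F j" by (simp add: N_def k_def j_def)
  have bi: "?b i \<in> set (Bs ! i)" "?b j \<in> set (Bs ! j)" using ne' i j by auto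
  \<comment> \<open>\<open>N i\<close> repeats no vertex for three reasons: path \<open>i\<close>
    meets block \<open>i\<close> only in its head, different paths are disjoint, and the next path
    avoids block \<open>i\<close>.\<close>
  have 1: "set (I i) \<inter> set (Bs ! i) = {}" using avoid[OF i] p[OF i] by (auto simp: p_def)
  have 2: "set (I i) \<inter> set (?b j # F j) = {}"
    using disj[of i j] i j by (auto simp: p_def)
  have 3: "set (Bs ! i) \<inter> set (?b j # F j) = {}"
    using avoid'[OF i] blk[of i j] bi i j p[OF j(1)] unfolding j_def[symmetric] by (auto simp: p_def)
  have "distinct (Bs ! i)" using dist i by (auto simp: distinct_concat_iff k_def)
  then have "distinct (N i)" using 1 2 3 p[OF i] p[OF j(1)] unfolding N by (auto simp: p_def)
  moreover have "hd (N i) = hd (p i)" unfolding N p_def using ne'[OF i] by (cases "I i") auto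
  moreover have "last (N i) = last (p j)" unfolding N p_def by simp
  moreover have "2 \<le> length (N i)" unfolding N using ne'[OF i] by (cases "Bs ! i") auto
  ultimately show "distinct (N i) \<and> 2 \<le> length (N i) \<and> hd (N i) = hd (p i) \<and> last (N i) = last (p (?s i))"
    by (simp add: j_def)
qed

text \<open>\<open>\<rho> v\<close> is the reserve of paths through \<open>v\<close>, any two of which meet only in \<open>v\<close>.\<close>

definition absorber where
  "absorber V X Y A Q \<rho> R \<longleftrightarrow>
     A = (\<Sum>q\<in>#Q. path_arcs q) + (\<Sum>v\<in>V. \<Sum>q\<in>\<rho> v. path_arcs q) + mset_set R \<and>
     (\<forall>q\<in>#Q. distinct q \<and> 2 \<le> length q \<and> hd q \<in> X \<and> last q \<in> Y) \<and>
     (\<forall>v\<in>V. finite (\<rho> v) \<and> (\<forall>q\<in>\<rho> v. distinct q \<and> 2 \<le> length q \<and> length q \<le> 5 \<and> v \<in> set q \<and> hd q \<in> X \<and> last q \<in> Y) \<and>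
       (\<forall>q\<in>\<rho> v. \<forall>q'\<in>\<rho> v. q \<noteq> q' \<longrightarrow> set q \<inter> set q' \<subseteq> {v})) \<and>
     finite V \<and> R \<subseteq> V \<times> V \<and> balanced R \<and> (\<forall>x y. (x, y) \<in> R \<longrightarrow> (y, x) \<notin> R)"

lemma absorber_finish:
  assumes "absorber V X Y A Q \<rho> {}" "X \<inter> Y = {}"
  shows "perfect A"
proof -
  let ?P = "Q + (\<Sum>v\<in>V. mset_set (\<rho> v))"
  have a: "finite V" "A = (\<Sum>q\<in>#Q. path_arcs q) + (\<Sum>v\<in>V. \<Sum>q\<in>\<rho> v. path_arcs q)"
    "\<And>q. q \<in># Q \<Longrightarrow> distinct q \<and> 2 \<le> length q \<and> hd q \<in> X \<and> last q \<in> Y"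
    "\<And>q v. v \<in> V \<Longrightarrow> q \<in> \<rho> v \<Longrightarrow> distinct q \<and> 2 \<le> length q \<and> hd q \<in> X \<and> last q \<in> Y"
    "\<And>v. v \<in> V \<Longrightarrow> finite (\<rho> v)"
    using assms(1) unfolding absorber_def by auto
  have mem: "distinct q \<and> 2 \<le> length q \<and> hd q \<in> X \<and> last q \<in> Y" if q: "q \<in># ?P" for q
  proof -
    have "q \<in># Q \<or> (\<exists>v\<in>V. q \<in> \<rho> v)"
      using q a(1,5) by (auto simp: set_mset_sum)
    then show ?thesis using a(3,4) by blast
  qed
  have "(\<Sum>q\<in>#(\<Sum>v\<in>V. mset_set (\<rho> v)). path_arcs q) = (\<Sum>v\<in>V. \<Sum>q\<in>\<rho> v. path_arcs q)"
    using a(1) by (induction V) (auto simp: sum_unfold_sum_mset)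
  then have "(\<Sum>q\<in>#?P. path_arcs q) = A" using a(2) by simp
  moreover have "hd q \<noteq> last q'" if "q \<in># ?P" "q' \<in># ?P" for q q'
    using mem[OF that(1)] mem[OF that(2)] assms(2) by auto
  ultimately show ?thesis unfolding perfect_def using mem by (intro exI[of _ ?P] conjI ballI) simp_all
qed

text \<open>If all paths of the fan met \<open>Z\<close> outside \<open>v\<close>, the meeting
  points would be distinct, because the paths share at most \<open>v\<close>; but \<open>Z\<close>
  has too few points.\<close>

lemma fan_avoid:
  assumes "finite P" "finite Z" "card Z < card P"
    and "\<And>q q'. q \<in> P \<Longrightarrow> q' \<in> P \<Longrightarrow> q \<noteq> q' \<Longrightarrow> set q \<inter> set q' \<subseteq> {v}"
  shows "\<exists>q\<in>P. (set q - {v}) \<inter> Z = {}"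
proof (rule ccontr)
  assume "\<not> ?thesis"
  then have "\<forall>q\<in>P. \<exists>z. z \<in> (set q - {v}) \<inter> Z" by blast
  then obtain h where h: "\<forall>q\<in>P. h q \<in> (set q - {v}) \<inter> Z" by (rule bchoice[THEN exE])
  have "inj_on h P"
  proof (rule inj_onI, rule ccontr)
    fix q q' assume q: "q \<in> P" "q' \<in> P" "h q = h q'" "q \<noteq> q'"
    have "h q \<in> set q" "h q \<noteq> v" "h q' \<in> set q'" using h q by auto
    then show False using assms(4)[OF q(1,2,4)] q(3) by auto
  qed
  moreover have "h ` P \<subseteq> Z" using h by auto
  ultimately show False using assms(2,3) card_inj_on_le[of h P Z] by simp
qed

text \<open>Greedy choice. The term \<open>6 * k\<close> covers the at most 5 vertices of each path
  chosen before and the \<open>k\<close> centres \<open>b\<close>. Avoiding the other centres makes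
  the chosen paths entirely disjoint, and not only outside their own centres.\<close>

lemma choose_from_fans:
  fixes b :: "nat \<Rightarrow> 'a"
  assumes fin: "\<And>i. i < k \<Longrightarrow> finite (\<rho> (b i)) \<and> finite (Z i)"
    and card: "\<And>i. i < k \<Longrightarrow> card (Z i) + 6 * k < card (\<rho> (b i))"
    and fan: "\<And>i q q'. i < k \<Longrightarrow> q \<in> \<rho> (b i) \<Longrightarrow> q' \<in> \<rho> (b i) \<Longrightarrow> q \<noteq> q' \<Longrightarrow> set q \<inter> set q' \<subseteq> {b i}"
    and len: "\<And>i q. i < k \<Longrightarrow> q \<in> \<rho> (b i) \<Longrightarrow> length q \<le> 5"
    and inj: "inj_on b {..<k}"
  shows "\<exists>f. (\<forall>i<k. f i \<in> \<rho> (b i) \<and> (set (f i) - {b i}) \<inter> Z i = {}) \<and>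
    (\<forall>i<k. \<forall>j<k. i \<noteq> j \<longrightarrow> set (f i) \<inter> set (f j) = {})"
proof -
  have "\<exists>f. (\<forall>i<m. f i \<in> \<rho> (b i) \<and> (set (f i) - {b i}) \<inter> (Z i \<union> b ` {..<k}) = {}) \<and>
    (\<forall>i<m. \<forall>j<m. i \<noteq> j \<longrightarrow> set (f i) \<inter> set (f j) = {})" if "m \<le> k" for m
    using that
  proof (induction m)
    case (Suc m)
    then obtain f where f': "\<forall>i<m. f i \<in> \<rho> (b i) \<and> (set (f i) - {b i}) \<inter> (Z i \<union> b ` {..<k}) = {}"
      "\<forall>i<m. \<forall>j<m. i \<noteq> j \<longrightarrow> set (f i) \<inter> set (f j) = {}" by force
    have f: "f i \<in> \<rho> (b i) \<and> (set (f i) - {b i}) \<inter> (Z i \<union> b ` {..<k}) = {}" if "i < m" for i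
      using f'(1) that by blast
    have f2: "set (f i) \<inter> set (f j) = {}" if "i < m" "j < m" "i \<noteq> j" for i j
      using f'(2) that by blast
    have mk: "m < k" using Suc.prems by simp
    let ?Z = "Z m \<union> b ` {..<k} \<union> (\<Union>i<m. set (f i))"
    have "card (\<Union>i<m. set (f i)) \<le> (\<Sum>i<m. card (set (f i)))" by (intro card_UN_le) auto
    also have "\<dots> \<le> (\<Sum>i<m. 5)"
    proof (rule sum_mono)
      fix i assume "i \<in> {..<m}"
      then show "card (set (f i)) \<le> 5"
        using len[of i "f i"] f[of i] mk card_length[of "f i"] by simp
    qed
    finally have "card (\<Union>i<m. set (f i)) \<le> 5 * k" using mk by simp
    moreover have "card (b ` {..<k}) \<le> k" using card_image_le[of "{..<k}" b] by simp
    moreover have "card ?Z \<le> card (Z m) + card (b ` {..<k}) + card (\<Union>i<m. set (f i))"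
      by (meson add_le_mono1 card_Un_le order_trans)
    ultimately have "card ?Z < card (\<rho> (b m))" using card[OF mk] by linarith
    then obtain q where q: "q \<in> \<rho> (b m)" "(set q - {b m}) \<inter> ?Z = {}"
      using fan_avoid[of "\<rho> (b m)" ?Z "b m"] fin[OF mk] fan[OF mk] by auto
    have qd: "set (f i) \<inter> set q = {}" if "i < m" for i
    proof -
      have "b m \<noteq> b i" using inj that mk by (auto dest: inj_onD)
      then have "b m \<notin> set (f i)" using f[OF that] mk by auto
      then show ?thesis using q(2) that by auto
    qed
    show ?case
    proof (intro exI[of _ "f(m := q)"] conjI allI impI)
      fix i assume "i < Suc m"
      then show "(f(m := q)) i \<in> \<rho> (b i)" "(set ((f(m := q)) i) - {b i}) \<inter> (Z i \<union> b ` {..<k}) = {}"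
        using f[of i] q by (auto simp: less_Suc_eq)
    next
      fix i j assume "i < Suc m" "j < Suc m" "i \<noteq> j"
      then show "set ((f(m := q)) i) \<inter> set ((f(m := q)) j) = {}"
        using f2[of i j] qd[of i] qd[of j] by (cases "i = m"; cases "j = m") (simp_all add: less_Suc_eq Int_commute)
    qed
  qed simp
  from this[of k] show ?thesis by (auto simp: Int_Un_distrib)
qed

text \<open>One reserved path at each block head is spent and reappears, rerouted, in
  \<open>Q'\<close>. Rerouting preserves the starts and the ends, so the conditions on
  \<open>X\<close> and \<open>Y\<close> survive. In the bound on the reserve, \<open>2 * m\<close>
  is for two blocks to be avoided and \<open>6 * length Bs\<close> for the choice from the
  fans.\<close>

lemma absorb_step:
  assumes ab: "absorber V X Y A Q \<rho> R" and Bs: "2 \<le> length Bs" "distinct (concat Bs)"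
    "\<And>B. B \<in> set Bs \<Longrightarrow> B \<noteq> [] \<and> length B \<le> m \<and> 2 * m + 6 * length Bs < card (\<rho> (hd B))"
    and cyc: "set_mset (cycle_arcs (concat Bs)) \<subseteq> R"
  shows "\<exists>Q' \<rho>'. absorber V X Y A Q' \<rho>' (R - set_mset (cycle_arcs (concat Bs))) \<and>
    (\<forall>v. card (\<rho>' v) = card (\<rho> v) - of_bool (v \<in> hd ` set Bs))"
proof -
  let ?c = "concat Bs" and ?k = "length Bs"
  let ?b = "\<lambda>i. hd (Bs ! i)" and ?s = "\<lambda>i. Suc i mod ?k" 
  have a: "finite V" "A = (\<Sum>q\<in>#Q. path_arcs q) + (\<Sum>v\<in>V. \<Sum>q\<in>\<rho> v. path_arcs q) + mset_set R"
    "\<And>q. q \<in># Q \<Longrightarrow> distinct q \<and> 2 \<le> length q \<and> hd q \<in> X \<and> last q \<in> Y"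
    "\<And>q v. v \<in> V \<Longrightarrow> q \<in> \<rho> v \<Longrightarrow> distinct q \<and> 2 \<le> length q \<and> length q \<le> 5 \<and> v \<in> set q \<and> hd q \<in> X \<and> last q \<in> Y"
    "\<And>v q q'. v \<in> V \<Longrightarrow> q \<in> \<rho> v \<Longrightarrow> q' \<in> \<rho> v \<Longrightarrow> q \<noteq> q' \<Longrightarrow> set q \<inter> set q' \<subseteq> {v}"
    "\<And>v. v \<in> V \<Longrightarrow> finite (\<rho> v)" "R \<subseteq> V \<times> V" "balanced R" "\<And>x y. (x, y) \<in> R \<Longrightarrow> (y, x) \<notin> R"
    using ab unfolding absorber_def by auto
  have finR: "finite R" using a(1,7) by (meson finite_SigmaI finite_subset)
  have cne: "?c \<noteq> []" using Bs by (cases Bs) auto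
  have cV: "set ?c \<subseteq> V"
  proof
    fix x assume x: "x \<in> set ?c"
    have "2 \<le> length (?c @ [hd ?c])" using cne by (cases ?c) auto
    with path_arcs_touch[of x "?c @ [hd ?c]"] x obtain e where "e \<in># cycle_arcs ?c" "fst e = x \<or> snd e = x"
      by (auto simp: cycle_arcs_def)
    then show "x \<in> V" using cyc a(7) by auto
  qed
  have ne: "B \<noteq> []" if "B \<in> set Bs" for B using Bs(3)[OF that] by simp
  have bk: "Bs ! i \<noteq> []" "length (Bs ! i) \<le> m" "2 * m + 6 * ?k < card (\<rho> (?b i))" "?b i \<in> V" if "i < ?k" for i
  proof -
    show "Bs ! i \<noteq> []" "length (Bs ! i) \<le> m" "2 * m + 6 * ?k < card (\<rho> (?b i))" using Bs(3)[of "Bs ! i"] that by auto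
    then have "?b i \<in> set ?c" using that by (auto intro!: bexI[of _ "Bs ! i"])
    then show "?b i \<in> V" using cV by blast
  qed
  have injb: "inj_on ?b {..<?k}"
  proof (rule inj_onI)
    fix i j assume ij: "i \<in> {..<?k}" "j \<in> {..<?k}" "?b i = ?b j"
    have "[] \<notin> set Bs" using ne by blast
    then have d: "distinct Bs" using Bs(2) unfolding distinct_concat_iff by (simp add: removeAll_id)
    show "i = j"
    proof (rule ccontr)
      assume "i \<noteq> j"
      then have "Bs ! i \<noteq> Bs ! j" using d ij by (simp add: nth_eq_iff_index_eq)
      then have "set (Bs ! i) \<inter> set (Bs ! j) = {}" using Bs(2) ij unfolding distinct_concat_iff by auto
      then show False using bk[of i] bk[of j] ij by (auto simp: disjoint_iff dest: hd_in_set)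
    qed
  qed
  \<comment> \<open>\<open>pr\<close> is the cyclic predecessor. Path \<open>i\<close> must avoid
    its own block and also the preceding one, because its final segment is appended to that
    block.\<close>
  define pr where "pr i = (if i = 0 then ?k - 1 else i - 1)" for i
  have pr: "pr (?s i) = i" if "i < ?k" for i using that by (auto simp: pr_def mod_Suc)
  have prk: "pr i < ?k" if "i < ?k" for i using that by (auto simp: pr_def)
  define Z where "Z i = set (Bs ! i) \<union> set (Bs ! pr i)" for i
  have "card (Z i) \<le> 2 * m" if "i < ?k" for i
  proof -
    have "card (Z i) \<le> card (set (Bs ! i)) + card (set (Bs ! pr i))" unfolding Z_def by (rule card_Un_le)
    then show ?thesis using bk(2)[OF that] bk(2)[OF prk[OF that]] card_length[of "Bs ! i"] card_length[of "Bs ! pr i"]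
      by linarith
  qed
  then have Zc: "card (Z i) + 6 * ?k < card (\<rho> (?b i))" if "i < ?k" for i using bk(3)[OF that] that by force
  have "\<exists>f. (\<forall>i<?k. f i \<in> \<rho> (?b i) \<and> (set (f i) - {?b i}) \<inter> Z i = {}) \<and>
    (\<forall>i<?k. \<forall>j<?k. i \<noteq> j \<longrightarrow> set (f i) \<inter> set (f j) = {})"
  proof (rule choose_from_fans)
    fix i assume i: "i < ?k"
    show "finite (\<rho> (?b i)) \<and> finite (Z i)" using a(6) bk(4)[OF i] by (simp add: Z_def)
    show "card (Z i) + 6 * ?k < card (\<rho> (?b i))" by (rule Zc[OF i])
    show "length q \<le> 5" if "q \<in> \<rho> (?b i)" for q using a(4)[OF bk(4)[OF i] that] by simp
    show "set q \<inter> set q' \<subseteq> {?b i}" if "q \<in> \<rho> (?b i)" "q' \<in> \<rho> (?b i)" "q \<noteq> q'" for q q'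
      by (rule a(5)[OF bk(4)[OF i] that])
  qed (rule injb)
  then obtain f where f': "\<forall>i<?k. f i \<in> \<rho> (?b i) \<and> (set (f i) - {?b i}) \<inter> Z i = {}"
    "\<forall>i<?k. \<forall>j<?k. i \<noteq> j \<longrightarrow> set (f i) \<inter> set (f j) = {}" by (elim exE conjE)
  have f: "f i \<in> \<rho> (?b i) \<and> (set (f i) - {?b i}) \<inter> Z i = {}" if "i < ?k" for i
    using f'(1) that by simp
  have f2: "set (f i) \<inter> set (f j) = {}" if "i < ?k" "j < ?k" "i \<noteq> j" for i j
    using f'(2) that by simp
  have "\<exists>w. f i = fst w @ ?b i # snd w" if "i < ?k" for i
  proof -
    have "?b i \<in> set (f i)" using a(4)[OF bk(4)[OF that]] f[OF that] by blast
    then show ?thesis by (auto dest!: split_list)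
  qed
  then have "\<forall>i\<in>{..<?k}. \<exists>w. f i = fst w @ ?b i # snd w" by simp
  then obtain w where w: "\<forall>i\<in>{..<?k}. f i = fst (w i) @ ?b i # snd (w i)" by (rule bchoice[THEN exE])
  define I F where "I i = fst (w i)" and "F i = snd (w i)" for i
  have IF: "f i = I i @ ?b i # F i" if "i < ?k" for i using w that by (simp add: I_def F_def)
  define N where "N i = I i @ Bs ! i @ ?b (?s i) # F (?s i)" for i
  have sk: "?s i < ?k" if "i < ?k" for i using that Bs(1) by (intro mod_less_divisor) linarith
  have fi: "distinct (f i)" "hd (f i) \<in> X" "last (f i) \<in> Y" if "i < ?k" for i
    using f[OF that] a(4)[OF bk(4)[OF that]] by auto
  have av: "(set (f i) - {?b i}) \<inter> set (Bs ! i) = {}" if "i < ?k" for i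
    using f[OF that] by (auto simp: Z_def)
  have av': "(set (f (?s i)) - {?b (?s i)}) \<inter> set (Bs ! i) = {}" if "i < ?k" for i
    using f[OF sk[OF that]] pr[OF that] by (auto simp: Z_def)
  have g1: "distinct (I i @ ?b i # F i)" if "i < ?k" for i using fi(1)[OF that] unfolding IF[OF that] .
  have g2: "set (I i @ ?b i # F i) \<inter> set (I j @ ?b j # F j) = {}" if "i < ?k" "j < ?k" "i \<noteq> j" for i j
    using f2[OF that] unfolding IF[OF that(1)] IF[OF that(2)] .
  have g3: "(set (I i @ ?b i # F i) - {?b i}) \<inter> set (Bs ! i) = {}" if "i < ?k" for i
    using av[OF that] unfolding IF[OF that] .
  have g4: "(set (I (?s i) @ ?b (?s i) # F (?s i)) - {?b (?s i)}) \<inter> set (Bs ! i) = {}" if "i < ?k" for i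
    using av'[OF that] unfolding IF[OF sk[OF that]] .
  note re = reroute_along_cycle[of Bs I F, OF Bs(1,2) ne g1 g2 g3 g4]
  have sum: "(\<Sum>i<?k. path_arcs (N i)) = (\<Sum>i<?k. path_arcs (I i @ ?b i # F i)) + cycle_arcs ?c"
    unfolding N_def by (rule re(1)) simp_all
  have N: "distinct (N i) \<and> 2 \<le> length (N i) \<and> hd (N i) = hd (I i @ ?b i # F i) \<and>
     last (N i) = last (I (?s i) @ ?b (?s i) # F (?s i))" if "i < ?k" for i
    unfolding N_def by (rule re(2)) (use that in simp_all)
  have sum': "(\<Sum>i<?k. path_arcs (N i)) = (\<Sum>i<?k. path_arcs (f i)) + cycle_arcs ?c"
    using sum IF by simp
  have N': "distinct (N i) \<and> 2 \<le> length (N i) \<and> hd (N i) \<in> X \<and> last (N i) \<in> Y" if "i < ?k" for i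
    using N[OF that] fi[OF that] fi[OF sk[OF that]] IF[OF that] IF[OF sk[OF that]] by simp
  define \<rho>' where "\<rho>' v = \<rho> v - {f i |i. i < ?k \<and> ?b i = v}" for v
  define Q' where "Q' = Q + image_mset N (mset_set {..<?k})"
  have hds: "hd ` set Bs = ?b ` {..<?k}" unfolding set_conv_nth by auto
  have fset: "{f i |i. i < ?k \<and> ?b i = v} = (if v \<in> hd ` set Bs then {f (inv_into {..<?k} ?b v)} else {})" for v
  proof (cases "v \<in> hd ` set Bs")
    case True
    then obtain i where i: "i < ?k" "v = ?b i" unfolding hds by auto
    have inv: "inv_into {..<?k} ?b v = i" unfolding i(2) using i(1) injb by (intro inv_into_f_f) auto
    have uniq: "j = i" if "j < ?k" "?b j = v" for j
      using inj_onD[OF injb, of j i] i that by simp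
    have "{f j |j. j < ?k \<and> ?b j = v} = {f i}"
    proof (intro equalityI subsetI)
      fix x assume "x \<in> {f j |j. j < ?k \<and> ?b j = v}"
      then obtain j where "x = f j" "j < ?k" "?b j = v" by blast
      then show "x \<in> {f i}" using uniq[of j] by simp
    next
      fix x assume "x \<in> {f i}"
      then show "x \<in> {f j |j. j < ?k \<and> ?b j = v}" using i by blast
    qed
    then show ?thesis using True inv by simp
  next
    case False
    then have "{f j |j. j < ?k \<and> ?b j = v} = {}" unfolding hds by blast
    then show ?thesis using False by simp
  qed
  have inv: "inv_into {..<?k} ?b v < ?k" "?b (inv_into {..<?k} ?b v) = v" if "v \<in> hd ` set Bs" for v
    using that inv_into_into[of v ?b "{..<?k}"] f_inv_into_f[of v ?b "{..<?k}"] unfolding hds by auto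
  have rcard: "card (\<rho>' v) = card (\<rho> v) - of_bool (v \<in> hd ` set Bs)" for v
  proof (cases "v \<in> hd ` set Bs")
    case True
    then have "f (inv_into {..<?k} ?b v) \<in> \<rho> v" using f inv[OF True] by metis
    then show ?thesis using True unfolding \<rho>'_def fset by simp
  qed (simp add: \<rho>'_def fset)
  have rsum: "(\<Sum>q\<in>\<rho> v. path_arcs q) = (\<Sum>q\<in>\<rho>' v. path_arcs q) +
    (if v \<in> hd ` set Bs then path_arcs (f (inv_into {..<?k} ?b v)) else {#})" if "v \<in> V" for v
  proof (cases "v \<in> hd ` set Bs")
    case True
    then have "f (inv_into {..<?k} ?b v) \<in> \<rho> v" using f inv[OF True] by metis
    then show ?thesis using True a(6)[OF that] unfolding \<rho>'_def fset by (simp add: sum.remove)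
  qed (simp add: \<rho>'_def fset)
  have hdsV: "hd ` set Bs \<subseteq> V" using bk(4) unfolding hds by auto
  have "(\<Sum>v\<in>V. if v \<in> hd ` set Bs then path_arcs (f (inv_into {..<?k} ?b v)) else {#}) =
    (\<Sum>v\<in>hd ` set Bs. path_arcs (f (inv_into {..<?k} ?b v)))"
    using a(1) hdsV by (simp add: sum.If_cases Int_absorb1)
  also have "\<dots> = (\<Sum>i<?k. path_arcs (f i))"
    unfolding hds by (subst sum.reindex[OF injb]) (simp add: inv_into_f_f[OF injb])
  finally have rtot: "(\<Sum>v\<in>V. \<Sum>q\<in>\<rho> v. path_arcs q) = (\<Sum>v\<in>V. \<Sum>q\<in>\<rho>' v. path_arcs q) + (\<Sum>i<?k. path_arcs (f i))"
    using rsum by (simp add: sum.distrib)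
  note rc = balanced_remove_cycle[OF finR a(8) Bs(2) cne cyc]
  have "absorber V X Y A Q' \<rho>' (R - set_mset (cycle_arcs ?c))"
    unfolding absorber_def
  proof (intro conjI ballI allI impI)
    have "(\<Sum>q\<in>#Q'. path_arcs q) = (\<Sum>q\<in>#Q. path_arcs q) + (\<Sum>i<?k. path_arcs (N i))"
      by (simp add: Q'_def image_mset.compositionality comp_def sum_unfold_sum_mset)
    then show "A = (\<Sum>q\<in>#Q'. path_arcs q) + (\<Sum>v\<in>V. \<Sum>q\<in>\<rho>' v. path_arcs q) + mset_set (R - set_mset (cycle_arcs ?c))"
      unfolding a(2) rtot sum' rc(1) by (simp add: add_ac)
    show "distinct q" "2 \<le> length q" "hd q \<in> X" "last q \<in> Y" if "q \<in># Q'" for q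
      using that a(3) N' unfolding Q'_def by auto
    show "distinct q" "2 \<le> length q" "length q \<le> 5" "v \<in> set q" "hd q \<in> X" "last q \<in> Y" if "v \<in> V" "q \<in> \<rho>' v" for v q
      using that a(4)[of v q] by (auto simp: \<rho>'_def)
    show "set q \<inter> set q' \<subseteq> {v}" if "v \<in> V" "q \<in> \<rho>' v" "q' \<in> \<rho>' v" "q \<noteq> q'" for v q q'
      using that a(5)[of v q q'] by (auto simp: \<rho>'_def)
    show "finite (\<rho>' v)" if "v \<in> V" for v using a(6)[OF that] by (auto simp: \<rho>'_def)
    show "balanced (R - set_mset (cycle_arcs ?c))" by (rule rc(2))
  qed (use a in auto)
  then show ?thesis using rcard by blast
qed

section \<open>Absorption of long cycles and of short ones\<close>

lemma cycle_arcs_rotate: "cycle_arcs (p @ q) = cycle_arcs (q @ p)"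
proof (cases "p = [] \<or> q = []")
  case False
  then show ?thesis by (simp add: cycle_arcs_eq path_arcs_append2 add_ac)
qed auto

lemma cycle_arcs_touch:
  assumes "x \<in> set c" shows "\<exists>e\<in>#cycle_arcs c. fst e = x \<or> snd e = x"
proof -
  have "2 \<le> length (c @ [hd c])" using assms by (cases c) auto
  then show ?thesis using path_arcs_touch[of x "c @ [hd c]"] assms by (simp add: cycle_arcs_def)
qed

lemma cycle_arcs_verts:
  assumes "set_mset (cycle_arcs c) \<subseteq> V \<times> V" shows "set c \<subseteq> V"
proof
  fix x assume "x \<in> set c"
  from cycle_arcs_touch[OF this] obtain e where "e \<in># cycle_arcs c" "fst e = x \<or> snd e = x" by blast
  moreover from this have "e \<in> V \<times> V" using assms by blast
  ultimately show "x \<in> V" by auto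
qed

text \<open>Among the \<open>w\<close> vertices following the first \<open>w\<close> there is one
  outside \<open>bad\<close>, and the cut is made there. All blocks but the last thus have at least
  \<open>w\<close> vertices, which bounds their number.\<close>

lemma split_blocks:
  assumes "distinct c" "c \<noteq> []" "hd c \<notin> bad" "finite bad" "card bad < w"
  shows "\<exists>Bs. concat Bs = c \<and> (\<forall>B\<in>set Bs. B \<noteq> [] \<and> hd B \<notin> bad \<and> length B \<le> 2 * w) \<and>
    w * length Bs \<le> length c + w"
  using assms(1-3)
proof (induction "length c" arbitrary: c rule: less_induct)
  case less
  show ?case
  proof (cases "length c \<le> 2 * w")
    case True
    then show ?thesis using less.prems by (intro exI[of _ "[c]"]) auto
  next
    case False
    let ?S = "set (take w (drop w c))"
    have "card ?S = w" using False less.prems(1) by (subst distinct_card) auto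
    then have "\<not> ?S \<subseteq> bad" using assms(4,5) card_mono[of bad ?S] by auto
    then obtain x where "x \<in> ?S" "x \<notin> bad" by blast
    then obtain i where i: "i < w" "take w (drop w c) ! i \<notin> bad" using \<open>x \<notin> bad\<close> False
      by (auto simp: in_set_conv_nth)
    define t where "t = w + i"
    have t: "w \<le> t" "t < 2 * w" "c ! t \<notin> bad" using i False by (auto simp: t_def)
    have lt: "t < length c" using t False by simp
    have d: "length (drop t c) < length c" "distinct (drop t c)" "drop t c \<noteq> []" "hd (drop t c) \<notin> bad"
      using t lt less.prems(1) by (auto simp: hd_drop_conv_nth)
    from less.hyps[OF d] obtain Bs where Bs: "concat Bs = drop t c"
      "\<forall>B\<in>set Bs. B \<noteq> [] \<and> hd B \<notin> bad \<and> length B \<le> 2 * w" "w * length Bs \<le> length (drop t c) + w" by blast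
    have "concat (take t c # Bs) = c" using Bs(1) by simp
    moreover have "hd (take t c) = hd c" using t by simp
    then have "\<forall>B\<in>set (take t c # Bs). B \<noteq> [] \<and> hd B \<notin> bad \<and> length B \<le> 2 * w"
      using Bs(2) t less.prems lt by auto
    moreover have "w * length (take t c # Bs) \<le> length c + w"
      using Bs(3) t lt by simp
    ultimately show ?thesis by blast
  qed
qed

text \<open>Absorbing a cycle spends about one reserved path for every \<open>w\<close> of its
  vertices. All cycles together have at most \<open>n * n\<close> arcs, so at any time fewer than
  \<open>w\<close> vertices have lost more than half of their reserve, and a cycle longer than
  \<open>2 * w\<close> can be cut without using these as block heads.\<close>

lemma absorb_long_cycles:
  assumes "absorber V X Y A Q \<rho> R" "card V = n" "\<And>v. v \<in> V \<Longrightarrow> card (\<rho> v) = k0"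
    and num: "4 * n * n < w * (w * k0)" "8 * (w * w) + 24 * n < w * k0" "0 < w"
  shows "\<exists>Q' \<rho>' R'. absorber V X Y A Q' \<rho>' R' \<and> (\<forall>v\<in>V. k0 \<le> 2 * card (\<rho>' v) + 2) \<and>
    (\<forall>c. distinct c \<longrightarrow> set_mset (cycle_arcs c) \<subseteq> R' \<longrightarrow> length c \<le> 2 * w)"
proof -
  have V: "finite V" and RV: "R \<subseteq> V \<times> V" using assms(1) by (auto simp: absorber_def)
  have Rn: "card R' \<le> n * n" if "R' \<subseteq> V \<times> V" for R'
    using card_mono[of "V \<times> V" R'] that V assms(2) by (simp add: card_cartesian_product)
  \<comment> \<open>The last hypothesis is an account: every absorbed arc pays 2, every spent path
    costs \<open>w\<close>. A cycle longer than \<open>2 * w\<close> covers its cost because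
    \<open>w * length Bs \<le> length c + w \<le> 2 * length c\<close>.\<close>
  have "\<exists>Q' \<rho>' R''. absorber V X Y A Q' \<rho>' R'' \<and> (\<forall>v\<in>V. k0 \<le> 2 * card (\<rho>' v) + 2) \<and>
    (\<forall>c. distinct c \<longrightarrow> set_mset (cycle_arcs c) \<subseteq> R'' \<longrightarrow> length c \<le> 2 * w)"
    if "absorber V X Y A Q \<rho> R'" "\<And>v. v \<in> V \<Longrightarrow> card (\<rho> v) \<le> k0 \<and> k0 \<le> 2 * card (\<rho> v) + 2"
      "w * (\<Sum>v\<in>V. k0 - card (\<rho> v)) + 2 * card R' \<le> 2 * (n * n)" for Q \<rho> R'
    using that
  proof (induction "card R'" arbitrary: Q \<rho> R' rule: less_induct)
    case less
    show ?case
    proof (cases "\<exists>c. distinct c \<and> set_mset (cycle_arcs c) \<subseteq> R' \<and> 2 * w < length c")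
      case False
      then show ?thesis using less.prems by (meson not_le)
    next
      case True
      then obtain c0 where c0: "distinct c0" "set_mset (cycle_arcs c0) \<subseteq> R'" "2 * w < length c0" by blast
      have R'V: "R' \<subseteq> V \<times> V" "balanced R'" using less.prems(1) by (auto simp: absorber_def)
      have finR: "finite R'" using R'V V by (meson finite_SigmaI finite_subset)
      define bad where "bad = {v \<in> V. 2 * card (\<rho> v) < k0}"
      have "(\<Sum>v\<in>bad. k0) \<le> (\<Sum>v\<in>bad. 2 * (k0 - card (\<rho> v)))"
        by (rule sum_mono) (auto simp: bad_def)
      also have "\<dots> \<le> (\<Sum>v\<in>V. 2 * (k0 - card (\<rho> v)))"
        using V by (intro sum_mono2) (auto simp: bad_def)
      finally have "k0 * card bad \<le> 2 * (\<Sum>v\<in>V. k0 - card (\<rho> v))"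
        by (simp add: sum_distrib_left mult.commute)
      then have "w * (k0 * card bad) \<le> w * (2 * (\<Sum>v\<in>V. k0 - card (\<rho> v)))" by (rule mult_le_mono2)
      then have "w * k0 * card bad \<le> 2 * (w * (\<Sum>v\<in>V. k0 - card (\<rho> v)))" by (simp only: mult_ac)
      then have "w * k0 * card bad \<le> 4 * n * n" using less.prems(3) by linarith
      then have badw: "card bad < w"
        using num(1) by (smt (verit) mult.commute mult.left_commute mult_le_mono2 not_le le_trans not_less)
      have finbad: "finite bad" using V by (simp add: bad_def)
      have "card (set c0) = length c0" using c0 by (simp add: distinct_card)
      then have "\<not> set c0 \<subseteq> bad" using c0(3) badw finbad card_mono[of bad "set c0"] by auto
      then obtain x where x: "x \<in> set c0" "x \<notin> bad" by blast
      then obtain p q where pq: "c0 = p @ x # q" by (meson split_list)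
      \<comment> \<open>The cycle is rotated to begin outside \<open>bad\<close>, since its first
        vertex becomes a block head.\<close>
      define c where "c = x # q @ p"
      have c: "distinct c" "cycle_arcs c = cycle_arcs c0" "length c = length c0" "hd c = x" "c \<noteq> []"
        using c0(1) cycle_arcs_rotate[of "x # q" p] by (auto simp: c_def pq)
      obtain Bs where Bs: "concat Bs = c" "\<forall>B\<in>set Bs. B \<noteq> [] \<and> hd B \<notin> bad \<and> length B \<le> 2 * w"
        "w * length Bs \<le> length c + w"
        using split_blocks[OF c(1,5) _ finbad badw] x(2) c(4) by auto
      have len2: "2 \<le> length Bs"
      proof (rule ccontr)
        assume "\<not> ?thesis"
        then have "Bs = [] \<or> (\<exists>B. Bs = [B])" by (cases Bs rule: remdups_adj.cases) auto
        then show False using Bs(1,2) c0(3) c(3,5) by auto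
      qed
      have cV: "set c \<subseteq> V"
        by (rule cycle_arcs_verts) (use c0(2) c(2) R'V(1) in auto)
      then have "length c \<le> n" using c(1) card_mono[OF V cV] assms(2) by (simp add: distinct_card)
      then have "w * length Bs \<le> 2 * n" using Bs(3) c0(3) c(3) by linarith
      \<comment> \<open>Blocks of at most \<open>2 * w\<close> vertices require a reserve above
        \<open>4 * w + 6 * length Bs\<close>, and heads outside \<open>bad\<close> still have half
        of \<open>k0\<close>.\<close>
      then have "w * (8 * w + 12 * length Bs) < w * k0"
        using num(2) by (simp add: algebra_simps)
      then have kb: "8 * w + 12 * length Bs < k0" by simp
      have hdV: "hd B \<in> V" "hd B \<in> set c" if "B \<in> set Bs" for B
      proof -
        have "hd B \<in> set B" using Bs(2) that by simp
        then show "hd B \<in> set c" using Bs(1) that by auto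
        then show "hd B \<in> V" using cV by blast
      qed
      have "\<exists>Q' \<rho>'. absorber V X Y A Q' \<rho>' (R' - set_mset (cycle_arcs (concat Bs))) \<and>
        (\<forall>v. card (\<rho>' v) = card (\<rho> v) - of_bool (v \<in> hd ` set Bs))"
      proof (rule absorb_step[OF less.prems(1) len2, of "2 * w"])
        fix B assume B: "B \<in> set Bs"
        have "k0 \<le> 2 * card (\<rho> (hd B))" using Bs(2) B hdV(1)[OF B] by (auto simp: bad_def)
        then show "B \<noteq> [] \<and> length B \<le> 2 * w \<and> 2 * (2 * w) + 6 * length Bs < card (\<rho> (hd B))"
          using Bs(2) B kb by auto
      qed (use Bs(1) c c0 in auto)
      then obtain Q' \<rho>' where new: "absorber V X Y A Q' \<rho>' (R' - set_mset (cycle_arcs c))"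
        "\<And>v. card (\<rho>' v) = card (\<rho> v) - of_bool (v \<in> hd ` set Bs)" using Bs(1) by blast
      have cR: "card R' = length c + card (R' - set_mset (cycle_arcs c))"
        using balanced_remove_cycle(3)[OF finR R'V(2) c(1,5)] c0(2) c(2) by simp
      show ?thesis
      proof (rule less.hyps[OF _ new(1)])
        show "card (R' - set_mset (cycle_arcs c)) < card R'" using cR c(5) by simp
        \<comment> \<open>A path is spent only at a vertex that still has half of \<open>k0\<close>;
          the summand 2 allows for this last loss.\<close>
        show "card (\<rho>' v) \<le> k0 \<and> k0 \<le> 2 * card (\<rho>' v) + 2" if "v \<in> V" for v
        proof (cases "v \<in> hd ` set Bs")
          case True
          then have "v \<notin> bad" using Bs(2) by auto
          then have "k0 \<le> 2 * card (\<rho> v)" using that by (simp add: bad_def)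
          then show ?thesis using new(2)[of v] less.prems(2)[OF that] by auto
        next
          case False
          then show ?thesis using new(2)[of v] less.prems(2)[OF that] by simp
        qed
        have "(\<Sum>v\<in>V. k0 - card (\<rho>' v)) \<le> (\<Sum>v\<in>V. (k0 - card (\<rho> v)) + of_bool (v \<in> hd ` set Bs))"
          using new(2) by (intro sum_mono) auto
        also have "\<dots> = (\<Sum>v\<in>V. k0 - card (\<rho> v)) + card (V \<inter> hd ` set Bs)"
          using V by (simp add: sum.distrib Int_def)
        also have "card (V \<inter> hd ` set Bs) \<le> card (hd ` set Bs)" by (intro card_mono) auto
        also have "\<dots> \<le> length Bs" by (meson card_image_le card_length finite_set le_trans)
        finally have "w * (\<Sum>v\<in>V. k0 - card (\<rho>' v)) \<le> w * ((\<Sum>v\<in>V. k0 - card (\<rho> v)) + length Bs)"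
          by simp
        also have "\<dots> \<le> w * (\<Sum>v\<in>V. k0 - card (\<rho> v)) + 2 * length c"
          using Bs(3) c0(3) c(3) by (simp add: algebra_simps)
        finally show "w * (\<Sum>v\<in>V. k0 - card (\<rho>' v)) + 2 * card (R' - set_mset (cycle_arcs c)) \<le> 2 * (n * n)"
          using less.prems(3) cR by linarith
      qed
    qed
  qed
  from this[OF assms(1)] show ?thesis using assms(3) Rn[OF RV] by simp
qed

lemma arc_degree_mono: "finite U' \<Longrightarrow> U \<subseteq> U' \<Longrightarrow> arc_degree U v \<le> arc_degree U' v"
  unfolding arc_degree_def by (intro card_mono) auto

lemma arc_degree_remove:
  assumes "finite U" "e \<in> U" "e \<in> C" "fst e = v \<or> snd e = v"
  shows "arc_degree (U - C) v < arc_degree U v"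
  unfolding arc_degree_def using assms by (intro psubset_card_mono) auto

lemma two_breaks:
  assumes "distinct c" "u \<in> set c" "v \<in> set c" "u \<noteq> v"
  shows "\<exists>c' a b. c' = u # a @ v # b \<and> distinct c' \<and> cycle_arcs c' = cycle_arcs c \<and> length c' = length c"
proof -
  obtain p q where pq: "c = p @ u # q" using assms(2) by (meson split_list)
  have "v \<in> set (q @ p)" using assms pq by auto
  then obtain a b where ab: "q @ p = a @ v # b" by (meson split_list)
  have "cycle_arcs (u # q @ p) = cycle_arcs c" using cycle_arcs_rotate[of "u # q" p] pq by simp
  moreover have "distinct (u # q @ p)" "length (u # q @ p) = length c" using assms(1) pq by auto
  ultimately show ?thesis using ab by (intro exI[of _ "u # a @ v # b"] exI[of _ a] exI[of _ b]) auto
qed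

text \<open>Each cycle is charged to two of its arcs. Cycles having two vertices outside the set \<open>B\<close> of
  vertices of large degree are absorbed there; any other cycle contains an arc inside \<open>B\<close>.\<close>

lemma absorb_short_cycles:
  fixes \<rho> :: "'a \<Rightarrow> 'a list set"
  defines "cap \<equiv> \<lambda>B R v. if v \<in> B then arc_degree (R \<inter> B \<times> B) v else arc_degree R v"
  assumes "absorber V X Y A Q \<rho> R" "X \<inter> Y = {}"
    and "\<And>v. v \<in> V \<Longrightarrow> base + cap B R v \<le> card (\<rho> v)" "2 * m + 12 < base"
    and "\<And>c. distinct c \<Longrightarrow> set_mset (cycle_arcs c) \<subseteq> R \<Longrightarrow> length c \<le> m"
  shows "perfect A"
  using assms(2-)
proof (induction "card R" arbitrary: Q \<rho> R rule: less_induct)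
  case less
  have V: "finite V" and R: "R \<subseteq> V \<times> V" "balanced R" "\<And>x y. (x, y) \<in> R \<Longrightarrow> (y, x) \<notin> R"
    using less.prems(1) by (auto simp: absorber_def)
  have finR: "finite R" using R V by (meson finite_SigmaI finite_subset)
  show ?case
  proof (cases "R = {}")
    case True
    then show ?thesis using less.prems(1,2) absorber_finish by blast
  next
    case False
    have irr: "(x, x) \<notin> R" for x using R(3) by blast
    obtain c where c: "distinct c" "2 \<le> length c" "set_mset (cycle_arcs c) \<subseteq> R"
      using balanced_cycle_exists[OF finR R(2) False irr] by blast
    have c3: "3 \<le> length c"
    proof (rule ccontr)
      assume "\<not> ?thesis"
      then have "length c = 2" using c(2) by simp
      then obtain x y where "c = [x, y]" by (auto simp: length_Suc_conv numeral_2_eq_2)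
      then show False using c(3) R(3) by (auto simp: cycle_arcs_def)
    qed
    have cV: "set c \<subseteq> V"
      by (rule cycle_arcs_verts) (use c(3) R(1) in blast)
    have "\<exists>u v. u \<in> set c \<and> v \<in> set c \<and> u \<noteq> v \<and> ((u \<notin> B \<and> v \<notin> B) \<or> (u \<in> B \<and> v \<in> B \<and> (u, v) \<in># cycle_arcs c))"
    proof -
      have "\<exists>x r. cycle_arcs (x # r) = cycle_arcs c \<and> distinct (x # r) \<and> length (x # r) = length c \<and>
        set (x # r) = set c \<and> (x \<in> B \<longrightarrow> set c \<subseteq> B)"
      proof (cases "set c \<subseteq> B")
        case True
        then show ?thesis using c3 c(1) by (cases c) auto
      next
        case False
        then obtain x where "x \<in> set c" "x \<notin> B" by blast
        then obtain p q where pq: "c = p @ x # q" by (meson split_list)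
        then show ?thesis using \<open>x \<notin> B\<close> c(1) cycle_arcs_rotate[of "x # q" p]
          by (intro exI[of _ x] exI[of _ "q @ p"]) auto
      qed
      then obtain x r where xr: "cycle_arcs (x # r) = cycle_arcs c" "distinct (x # r)"
        "length (x # r) = length c" "set (x # r) = set c" "x \<in> B \<longrightarrow> set c \<subseteq> B" by blast
      obtain u v s where r: "r = u # v # s" using c3 xr(3) by (cases r rule: remdups_adj.cases) auto
      show ?thesis
      proof (cases "set r \<subseteq> B")
        case True
        have "(u, v) \<in># cycle_arcs (x # r)" unfolding r by (simp add: cycle_arcs_def)
        then show ?thesis using True xr(1,2,4) r by (intro exI[of _ u] exI[of _ v]) auto
      next
        case False
        then obtain y where "y \<in> set r" "y \<notin> B" by blast
        moreover from this have "x \<notin> B" using xr(4,5) by auto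
        ultimately show ?thesis using xr(2,4) by (intro exI[of _ x] exI[of _ y]) auto
      qed
    qed
    then obtain u v where uv: "u \<in> set c" "v \<in> set c" "u \<noteq> v"
      "(u \<notin> B \<and> v \<notin> B) \<or> (u \<in> B \<and> v \<in> B \<and> (u, v) \<in># cycle_arcs c)" by blast
    obtain c' a b where c': "c' = u # a @ v # b" "distinct c'" "cycle_arcs c' = cycle_arcs c" "length c' = length c"
      using two_breaks[OF c(1) uv(1-3)] by blast
    let ?Bs = "[u # a, v # b]" and ?R = "R - set_mset (cycle_arcs c)"
    have lm: "length c' \<le> m" using less.prems(5)[OF c(1,3)] c'(4) by simp
    have base: "base \<le> card (\<rho> x)" if "x \<in> V" for x using less.prems(3)[OF that] by linarith
    have "\<exists>Q' \<rho>'. absorber V X Y A Q' \<rho>' (R - set_mset (cycle_arcs (concat ?Bs))) \<and>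
      (\<forall>x. card (\<rho>' x) = card (\<rho> x) - of_bool (x \<in> hd ` set ?Bs))"
    proof (rule absorb_step[OF less.prems(1), of _ m])
      fix C assume C: "C \<in> set ?Bs"
      have "u \<in> V" "v \<in> V" using uv cV by auto
      then show "C \<noteq> [] \<and> length C \<le> m \<and> 2 * m + 6 * length ?Bs < card (\<rho> (hd C))"
        using C lm c'(1) base[of u] base[of v] less.prems(4) by auto
    qed (use c c' in auto)
    then obtain Q' \<rho>' where new: "absorber V X Y A Q' \<rho>' ?R"
      "\<And>x. card (\<rho>' x) = card (\<rho> x) - of_bool (x \<in> {u, v})" using c'(1,3) by auto
    have cne: "c \<noteq> []" using c3 by auto
    have cR: "card R = length c + card ?R" by (rule balanced_remove_cycle(3)[OF finR R(2) c(1) cne c(3)])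
    show ?thesis
    proof (rule less.hyps[OF _ new(1) less.prems(2) _ less.prems(4)])
      show "card ?R < card R" using cR cne by simp
      show "length c \<le> m" if "distinct c" "set_mset (cycle_arcs c) \<subseteq> ?R" for c
        using less.prems(5)[of c] that by blast
      show "base + cap B ?R x \<le> card (\<rho>' x)" if x: "x \<in> V" for x
      proof -
        \<comment> \<open>At each of the two cuts \<open>cap\<close> drops: outside \<open>B\<close>
          because any arc of the cycle at the cut is removed, inside \<open>B\<close> because
          \<open>(u, v)\<close> is. So the reserve always exceeds \<open>cap\<close> by
          \<open>base\<close>, and two blocks need no more than \<open>2 * m + 12\<close>.\<close>
        have le: "cap B ?R x + of_bool (x \<in> {u, v}) \<le> cap B R x"
        proof (cases "x \<in> {u, v}")
          case False
          then show ?thesis unfolding cap_def using finR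
            by (auto intro!: arc_degree_mono)
        next
          case xuv: True
          show ?thesis
          proof (cases "x \<in> B")
            case True
            then have "(u, v) \<in># cycle_arcs c" "u \<in> B" "v \<in> B" using uv(4) xuv by auto
            then have "arc_degree (R \<inter> B \<times> B - set_mset (cycle_arcs c)) x < arc_degree (R \<inter> B \<times> B) x"
              using xuv c(3) finR by (intro arc_degree_remove[of _ "(u, v)"]) auto
            moreover have "?R \<inter> B \<times> B = R \<inter> B \<times> B - set_mset (cycle_arcs c)" by auto
            ultimately show ?thesis using True xuv by (simp add: cap_def)
          next
            case False
            have "x \<in> set c" using xuv uv(1,2) by auto
            from cycle_arcs_touch[OF this] obtain e where "e \<in># cycle_arcs c" "fst e = x \<or> snd e = x"
              by blast
            then have "arc_degree ?R x < arc_degree R x"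
              using c(3) finR by (intro arc_degree_remove[of _ e]) auto
            then show ?thesis using False xuv by (simp add: cap_def)
          qed
        qed
        then show ?thesis using less.prems(3)[OF x] new(2)[of x] by linarith
      qed
    qed
  qed
qed

section \<open>Tournaments of quadratic excess\<close>

definition tourn :: "'a set \<Rightarrow> ('a \<times> 'a) set \<Rightarrow> bool" where
  "tourn V E \<longleftrightarrow> finite V \<and> E \<subseteq> V \<times> V \<and> (\<forall>x. (x, x) \<notin> E) \<and>
     (\<forall>x\<in>V. \<forall>y\<in>V. x \<noteq> y \<longrightarrow> ((x, y) \<in> E \<longleftrightarrow> (y, x) \<notin> E))"

definition outs :: "('a \<times> 'a) set \<Rightarrow> 'a \<Rightarrow> 'a set" where "outs E v = {y. (v, y) \<in> E}"
definition ins :: "('a \<times> 'a) set \<Rightarrow> 'a \<Rightarrow> 'a set" where "ins E v = {x. (x, v) \<in> E}"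

abbreviation excess_at :: "('a \<times> 'a) set \<Rightarrow> 'a \<Rightarrow> int" where
  "excess_at E v \<equiv> arc_excess (mset_set E) v"

lemma excess_at_eq: "finite E \<Longrightarrow> excess_at E v = int (card (outs E v)) - int (card (ins E v))"
  by (simp add: arc_excess_mset_set outs_def ins_def)

lemma finite_outs [simp]: "finite E \<Longrightarrow> finite (outs E v)"
  by (rule finite_subset[of _ "snd ` E"]) (force simp: outs_def)+

lemma finite_ins [simp]: "finite E \<Longrightarrow> finite (ins E v)"
  by (rule finite_subset[of _ "fst ` E"]) (force simp: ins_def)+

lemma card_outs_le: "finite U \<Longrightarrow> card (outs U v) \<le> arc_degree U v"
  unfolding arc_degree_def by (rule card_inj_on_le[of "Pair v"]) (auto simp: outs_def inj_on_def)

lemma card_ins_le: "finite U \<Longrightarrow> card (ins U v) \<le> arc_degree U v"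
  unfolding arc_degree_def by (rule card_inj_on_le[of "\<lambda>x. (x, v)"]) (auto simp: ins_def inj_on_def)

lemma tournD:
  assumes "tourn V E" shows "finite V" "E \<subseteq> V \<times> V" "(x, x) \<notin> E"
  using assms unfolding tourn_def by blast+

lemma tourn_asym:
  assumes "tourn V E" "(x, y) \<in> E" shows "(y, x) \<notin> E"
proof -
  have "x \<in> V" "y \<in> V" using assms(2) tournD(2)[OF assms(1)] by auto
  moreover have "x \<noteq> y" using assms(2) tournD(3)[OF assms(1)] by auto
  ultimately have "(x, y) \<in> E \<longleftrightarrow> (y, x) \<notin> E" using assms(1) unfolding tourn_def by blast
  then show ?thesis using assms(2) by simp
qed

lemma tourn_total: "tourn V E \<Longrightarrow> x \<in> V \<Longrightarrow> y \<in> V \<Longrightarrow> x \<noteq> y \<Longrightarrow> (x, y) \<in> E \<or> (y, x) \<in> E"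
  unfolding tourn_def by blast

lemma tourn_degrees:
  assumes "tourn V E" "v \<in> V"
  shows "card (outs E v) + card (ins E v) + 1 = card V"
proof -
  have f: "finite V" "finite E" using tournD(1,2)[OF assms(1)] by (meson finite_SigmaI finite_subset)+
  have "outs E v \<inter> ins E v = {}" using tourn_asym[OF assms(1)] by (auto simp: outs_def ins_def)
  then have "card (outs E v \<union> ins E v) = card (outs E v) + card (ins E v)"
    using f by (simp add: card_Un_disjoint)
  moreover have "outs E v \<union> ins E v = V - {v}"
  proof
    show "outs E v \<union> ins E v \<subseteq> V - {v}" using tournD(2,3)[OF assms(1)] by (auto simp: outs_def ins_def)
    show "V - {v} \<subseteq> outs E v \<union> ins E v"
      using tourn_total[OF assms] by (auto simp: outs_def ins_def)
  qed
  ultimately show ?thesis using card_Suc_Diff1[OF f(1) assms(2)] by simp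
qed

text \<open>The two neighbourhoods overlap in more vertices than \<open>Z\<close> and the arcs of
  \<open>U\<close> at \<open>a\<close> and \<open>b\<close> can spoil.\<close>

lemma two_step:
  assumes "finite V" "E \<subseteq> V \<times> V" "finite Z" "finite U"
    and "card V + card Z + arc_degree U a + arc_degree U b < card (outs E a) + card (ins E b)"
  shows "\<exists>x\<in>V. x \<notin> Z \<and> (a, x) \<in> E - U \<and> (x, b) \<in> E - U"
proof (rule ccontr)
  assume no: "\<not> ?thesis"
  have finE: "finite E" using assms(1,2) by (meson finite_SigmaI finite_subset)
  have sub: "outs E a \<union> ins E b \<subseteq> V" using assms(2) by (auto simp: outs_def ins_def)
  have "card (outs E a) + card (ins E b) = card (outs E a \<union> ins E b) + card (outs E a \<inter> ins E b)"
    using finE by (intro card_Un_Int) auto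
  also have "card (outs E a \<union> ins E b) \<le> card V" by (rule card_mono[OF assms(1) sub])
  also have "outs E a \<inter> ins E b \<subseteq> Z \<union> (outs U a \<union> ins U b)"
    using no sub by (auto simp: outs_def ins_def)
  then have "card (outs E a \<inter> ins E b) \<le> card (Z \<union> (outs U a \<union> ins U b))"
    using assms by (intro card_mono) auto
  also have "\<dots> \<le> card Z + (card (outs U a) + card (ins U b))"
    by (intro order_trans[OF card_Un_le] add_left_mono card_Un_le)
  finally show False using card_outs_le[OF assms(4), of a] card_ins_le[OF assms(4), of b] assms(5)
    by linarith
qed

text \<open>Vertices below \<open>t\<close> contribute at most \<open>t * card V\<close>, half of
  the sum. The other half needs \<open>t\<close> vertices, since each contributes at most
  \<open>card V\<close>.\<close>

lemma card_excess_large: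
  fixes x :: "'a \<Rightarrow> int"
  assumes "finite V" "\<And>v. v \<in> V \<Longrightarrow> x v \<le> int (card V)" "(\<Sum>v\<in>V. max (x v) 0) \<ge> int (2 * t * card V)" "V \<noteq> {}"
  shows "t \<le> card {v \<in> V. x v \<ge> int t}"
proof -
  let ?n = "card V" and ?H = "{v \<in> V. x v \<ge> int t}"
  have n: "0 < ?n" using assms(1,4) by auto
  have "(\<Sum>v\<in>V. max (x v) 0) \<le> (\<Sum>v\<in>V. int ?n * of_bool (v \<in> ?H) + int t)"
  proof (rule sum_mono)
    fix v assume "v \<in> V"
    then show "max (x v) 0 \<le> int ?n * of_bool (v \<in> ?H) + int t"
      using assms(2)[of v] by (cases "v \<in> ?H") auto
  qed
  also have "\<dots> = int ?n * int (card ?H) + int ?n * int t"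
    using assms(1) by (simp add: sum.distrib flip: sum_distrib_left) (simp add: Int_def conj_commute)
  finally have "int (2 * t * ?n) \<le> int ?n * int (card ?H) + int ?n * int t" using assms(3) by linarith
  then have "int (?n * t) \<le> int (?n * card ?H)" by (simp add: algebra_simps)
  then show ?thesis using n by (simp only: of_nat_le_iff) simp
qed

lemma sum_excess_at:
  assumes "finite V" "E \<subseteq> V \<times> V"
  shows "(\<Sum>v\<in>V. excess_at E v) = 0"
proof -
  have fE: "finite E" using assms by (meson finite_SigmaI finite_subset)
  have 1: "(\<Sum>v\<in>V. card (outs E v)) = card E"
  proof -
    have "E = (SIGMA v:V. outs E v)" using assms(2) by (auto simp: outs_def)
    then show ?thesis using assms(1) fE by (metis card_SigmaI finite_outs)
  qed
  have 2: "(\<Sum>v\<in>V. card (ins E v)) = card E"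
  proof -
    have "E\<inverse> = (SIGMA v:V. ins E v)" using assms(2) by (auto simp: ins_def)
    then show ?thesis using assms(1) fE by (metis card_SigmaI finite_ins card_inverse)
  qed
  have "(\<Sum>v\<in>V. excess_at E v) = int (\<Sum>v\<in>V. card (outs E v)) - int (\<Sum>v\<in>V. card (ins E v))"
    using fE by (simp add: excess_at_eq sum_subtractf)
  then show ?thesis using 1 2 by simp
qed

lemma sum_excess_neg:
  assumes "finite V" "E \<subseteq> V \<times> V"
  shows "(\<Sum>v\<in>V. max (- excess_at E v) 0) = (\<Sum>v\<in>V. max (excess_at E v) 0)"
proof -
  have "max (excess_at E v) 0 = excess_at E v + max (- excess_at E v) 0" for v by auto
  then have "(\<Sum>v\<in>V. max (excess_at E v) 0) = (\<Sum>v\<in>V. excess_at E v) + (\<Sum>v\<in>V. max (- excess_at E v) 0)"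
    by (simp add: sum.distrib)
  then show ?thesis using sum_excess_at[OF assms] by simp
qed

text \<open>The demands are the pairs \<open>(v, c)\<close> with \<open>c < k\<close>; each asks for a path through \<open>v\<close> from a vertex
  of large positive to a vertex of large negative excess.\<close>

lemma reserve_paths:
  assumes T: "tourn V E" and n: "card V = n" and Vne: "V \<noteq> {}"
    and ex: "(\<Sum>v\<in>V. max (excess_at E v) 0) \<ge> int (80 * s * n)"
    and s: "100 \<le> s" "100 * n * k \<le> s * s"
  shows "\<exists>f. (\<forall>v\<in>V. \<forall>c<k. distinct (f (v, c)) \<and> 2 \<le> length (f (v, c)) \<and> length (f (v, c)) \<le> 5 \<and>
        v \<in> set (f (v, c)) \<and> set_mset (path_arcs (f (v, c))) \<subseteq> E \<and>
        excess_at E (hd (f (v, c))) \<ge> int s \<and> excess_at E (last (f (v, c))) \<le> - int s) \<and>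
     (\<forall>i\<in>V \<times> {..<k}. \<forall>j\<in>V \<times> {..<k}. i \<noteq> j \<longrightarrow> set_mset (path_arcs (f i)) \<inter> set_mset (path_arcs (f j)) = {}) \<and>
     (\<forall>v\<in>V. \<forall>c<k. \<forall>d<k. c \<noteq> d \<longrightarrow> set (f (v, c)) \<inter> set (f (v, d)) \<subseteq> {v}) \<and>
     (\<forall>v\<in>V. card {i \<in> V \<times> {..<k}. v \<in> set (f i)} < s) \<and> s \<le> n"
proof -
  let ?x = "excess_at E"
  have V: "finite V" and EV: "E \<subseteq> V \<times> V" and irr: "\<And>x. (x, x) \<notin> E" using tournD[OF T] by auto
  have finE: "finite E" using V EV by (meson finite_SigmaI finite_subset)
  have deg: "card (outs E v) + card (ins E v) + 1 = n" if "v \<in> V" for v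
    using tourn_degrees[OF T that] n by simp
  have xeq: "?x v = int (card (outs E v)) - int (card (ins E v))" for v by (rule excess_at_eq[OF finE])
  have xle: "?x v \<le> int n" "- ?x v \<le> int n" if "v \<in> V" for v using deg[OF that] xeq[of v] by linarith+
  \<comment> \<open>Arms begin and end at vertices of excess at least \<open>40 * s\<close> in
    absolute value. There are at least \<open>40 * s\<close> of either sign, so avoiding about
    \<open>s\<close> vertices never exhausts them.\<close>
  define Hp where "Hp = {v \<in> V. ?x v \<ge> int (40 * s)}"
  define Hm where "Hm = {v \<in> V. - ?x v \<ge> int (40 * s)}"
  have Hp: "40 * s \<le> card Hp" unfolding Hp_def
    by (rule card_excess_large[OF V _ _ Vne]) (use xle ex n in auto)
  have Hm: "40 * s \<le> card Hm" unfolding Hm_def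
    by (rule card_excess_large[OF V _ _ Vne]) (use xle ex n sum_excess_neg[OF V EV] in auto)
  have "card Hp \<le> n" unfolding Hp_def using V n by (auto intro: card_mono)
  then have sn: "40 * s \<le> n" using Hp by linarith
  have k100: "100 * k \<le> s"
  proof -
    have "s * s \<le> n * s" using sn by simp
    with s(2) have "100 * n * k \<le> n * s" by (rule le_trans)
    then have "n * (100 * k) \<le> n * s" by (simp only: mult_ac)
    moreover have "0 < n" using Vne n V by auto
    ultimately show ?thesis by simp
  qed
  define Q where "Q i p \<longleftrightarrow> distinct p \<and> 2 \<le> length p \<and> length p \<le> 5 \<and> fst i \<in> set p \<and> set p \<subseteq> V \<and>
    set_mset (path_arcs p) \<subseteq> E \<and> ?x (hd p) \<ge> int s \<and> ?x (last p) \<le> - int s" for i :: "'a \<times> nat" and p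
  \<comment> \<open>A quarter and a half of \<open>s\<close> fit the greedy choice with
    \<open>z = s\<close> and \<open>h = G = k\<close>; the hypothesis
    \<open>100 * n * k \<le> s * s\<close> then gives \<open>5 * n * k \<le> l * zh\<close>.\<close>
  define l zh where "l = s div 4" and "zh = s div 2"
  have inarm: "\<exists>a x. a \<in> V \<and> x \<in> V \<and> ?x a \<ge> int s \<and> a \<notin> Z \<and> x \<notin> Z \<and> a \<noteq> x \<and> (a, x) \<in> E - U \<and> (x, v) \<in> E - U"
    if Z: "finite Z" "card Z \<le> s + 5" and U: "finite U" "\<And>v. v \<in> V \<Longrightarrow> arc_degree U v \<le> s"
      and v: "v \<in> V" "n \<le> 2 * card (ins E v) + 20 * s" for Z U v
  proof -
    have "\<not> Hp \<subseteq> Z" using card_mono[OF Z(1), of Hp] Hp Z(2) s(1) by auto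
    then obtain a where a: "a \<in> Hp" "a \<notin> Z" by blast
    have aV: "a \<in> V" and xa: "?x a \<ge> int (40 * s)" using a by (auto simp: Hp_def)
    have "card V + card Z + arc_degree U a + arc_degree U v < card (outs E a) + card (ins E v)"
      using xa xeq[of a] deg[OF aV] v(2) U(2)[OF aV] U(2)[OF v(1)] Z(2) s(1) n by linarith
    from two_step[OF V EV Z(1) U(1) this] obtain x where "x \<in> V" "x \<notin> Z" "(a, x) \<in> E - U" "(x, v) \<in> E - U" by blast
    then show ?thesis using a aV xa irr by (intro exI[of _ a] exI[of _ x]) auto
  qed
  have outarm: "\<exists>y b. y \<in> V \<and> b \<in> V \<and> ?x b \<le> - int s \<and> y \<notin> Z \<and> b \<notin> Z \<and> y \<noteq> b \<and> (v, y) \<in> E - U \<and> (y, b) \<in> E - U"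
    if Z: "finite Z" "card Z \<le> s + 5" and U: "finite U" "\<And>v. v \<in> V \<Longrightarrow> arc_degree U v \<le> s"
      and v: "v \<in> V" "n \<le> 2 * card (outs E v) + 20 * s" for Z U v
  proof -
    have "\<not> Hm \<subseteq> Z" using card_mono[OF Z(1), of Hm] Hm Z(2) s(1) by auto
    then obtain b where b: "b \<in> Hm" "b \<notin> Z" by blast
    have bV: "b \<in> V" and xb: "- ?x b \<ge> int (40 * s)" using b by (auto simp: Hm_def)
    have "card V + card Z + arc_degree U v + arc_degree U b < card (outs E v) + card (ins E b)"
      using xb xeq[of b] deg[OF bV] v(2) U(2)[OF bV] U(2)[OF v(1)] Z(2) s(1) n by linarith
    from two_step[OF V EV Z(1) U(1) this] obtain y where "y \<in> V" "y \<notin> Z" "(v, y) \<in> E - U" "(y, b) \<in> E - U" by blast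
    then show ?thesis using b bV xb irr by (intro exI[of _ y] exI[of _ b]) auto
  qed
  have step: "\<exists>p. Q i p \<and> set_mset (path_arcs p) \<inter> U = {} \<and> (set p - {fst i}) \<inter> Z = {}"
    if i: "i \<in> V \<times> {..<k}" and Z: "card Z \<le> s" "Z \<subseteq> V" and U: "finite U" "\<And>v. v \<in> V \<Longrightarrow> arc_degree U v \<le> s" for i Z U
  proof -
    define v where "v = fst i"
    have v: "v \<in> V" using i by (auto simp: v_def)
    have finZ: "finite Z" using Z(2) V finite_subset by blast
    have cZ: "card (insert v Z) \<le> s + 1" using Z(1) finZ by (simp add: card_insert_if)
    \<comment> \<open>If the in-degree of \<open>v\<close> is too small for an arm of two arcs into
      \<open>v\<close>, then \<open>v\<close> itself has large positive excess and serves as the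
      start; dually for the end. Both cannot happen at once.\<close>
    consider (full) "n \<le> 2 * card (ins E v) + 20 * s" "n \<le> 2 * card (outs E v) + 20 * s"
      | (start) "\<not> n \<le> 2 * card (ins E v) + 20 * s" "n \<le> 2 * card (outs E v) + 20 * s"
      | (fin) "n \<le> 2 * card (ins E v) + 20 * s" "\<not> n \<le> 2 * card (outs E v) + 20 * s"
      using deg[OF v] s(1) by linarith
    then show ?thesis
    proof cases
      case full
      obtain a x where ax: "a \<in> V" "x \<in> V" "?x a \<ge> int s" "a \<notin> insert v Z" "x \<notin> insert v Z" "a \<noteq> x"
        "(a, x) \<in> E - U" "(x, v) \<in> E - U"
        using inarm[of "insert v Z" U v] finZ cZ U v full by auto
      have "card (insert a (insert x (insert v Z))) \<le> s + 5" using Z(1) finZ by (simp add: card_insert_if)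
      then obtain y b where yb: "y \<in> V" "b \<in> V" "?x b \<le> - int s" "y \<notin> insert a (insert x (insert v Z))"
        "b \<notin> insert a (insert x (insert v Z))" "y \<noteq> b" "(v, y) \<in> E - U" "(y, b) \<in> E - U"
        using outarm[of "insert a (insert x (insert v Z))" U v] finZ U v full by auto
      show ?thesis using ax yb v by (intro exI[of _ "[a, x, v, y, b]"]) (auto simp: Q_def v_def)
    next
      case start
      have "?x v \<ge> int s" using start(1) deg[OF v] xeq[of v] s(1) by linarith
      moreover obtain y b where yb: "y \<in> V" "b \<in> V" "?x b \<le> - int s" "y \<notin> insert v Z"
        "b \<notin> insert v Z" "y \<noteq> b" "(v, y) \<in> E - U" "(y, b) \<in> E - U"
        using outarm[of "insert v Z" U v] finZ cZ U v start by auto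
      ultimately show ?thesis using v by (intro exI[of _ "[v, y, b]"]) (auto simp: Q_def v_def)
    next
      case fin
      have "?x v \<le> - int s" using fin(2) deg[OF v] xeq[of v] s(1) by linarith
      moreover obtain a x where ax: "a \<in> V" "x \<in> V" "?x a \<ge> int s" "a \<notin> insert v Z" "x \<notin> insert v Z" "a \<noteq> x"
        "(a, x) \<in> E - U" "(x, v) \<in> E - U"
        using inarm[of "insert v Z" U v] finZ cZ U v fin by auto
      ultimately show ?thesis using v by (intro exI[of _ "[a, x, v]"]) (auto simp: Q_def v_def)
    qed
  qed
  have row: "{i \<in> V \<times> {..<k}. fst i = v} = {v} \<times> {..<k}" if "v \<in> V" for v using that by auto
  have lz: "s \<le> 5 * l" "2 * s \<le> 5 * zh" "4 * l \<le> s" "2 * zh \<le> s" using s(1) unfolding l_def zh_def by linarith+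
  have "\<exists>f. (\<forall>i\<in>V \<times> {..<k}. Q i (f i)) \<and>
    (\<forall>i\<in>V \<times> {..<k}. \<forall>j\<in>V \<times> {..<k}. i \<noteq> j \<longrightarrow> set_mset (path_arcs (f i)) \<inter> set_mset (path_arcs (f j)) = {}) \<and>
    (\<forall>i\<in>V \<times> {..<k}. \<forall>j\<in>V \<times> {..<k}. i \<noteq> j \<longrightarrow> fst i = fst j \<longrightarrow> (set (f i) - {fst i}) \<inter> (set (f j) - {fst j}) = {}) \<and>
    (\<forall>v\<in>V. card {i \<in> V \<times> {..<k}. v \<in> set (f i) - {fst i}} \<le> l)"
  proof (rule greedy_paths[where z = s and zh = zh and h = k and G = k])
    show "\<exists>p. Q i p \<and> set_mset (path_arcs p) \<inter> U = {} \<and> (set p - {fst i}) \<inter> Z = {}"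
      if "i \<in> V \<times> {..<k}" "card Z \<le> s" "Z \<subseteq> V" "finite U" "\<And>v. v \<in> V \<Longrightarrow> arc_degree U v \<le> s" for i Z U
      using step that by blast
    show "card {i \<in> V \<times> {..<k}. v \<in> {fst i}} \<le> k" if "v \<in> V" for v
    proof -
      have "{i \<in> V \<times> {..<k}. v \<in> {fst i}} = {v} \<times> {..<k}" using that by auto
      then show ?thesis by simp
    qed
    show "card {j \<in> V \<times> {..<k}. fst j = fst i} \<le> k" if "i \<in> V \<times> {..<k}" for i
      using row[of "fst i"] that by auto
    show "5 * card (V \<times> {..<k}) \<le> l * zh"
    proof -
      have "s * (2 * s) \<le> (5 * l) * (5 * zh)" by (rule mult_le_mono[OF lz(1,2)])
      then show ?thesis using s(2) n by (simp add: card_cartesian_product)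
    qed
    show "zh + 5 * k \<le> s" using lz(4) k100 by linarith
    have "2 * (2 * (l + k)) \<le> 4 * l + 100 * k" by simp
    then show "2 * (l + k) \<le> s" using lz(3) k100 by linarith
    show "0 < l" using lz(1) s(1) by linarith
  qed (use V in \<open>auto simp: Q_def\<close>)
  then obtain f where f: "\<forall>i\<in>V \<times> {..<k}. Q i (f i)"
    "\<forall>i\<in>V \<times> {..<k}. \<forall>j\<in>V \<times> {..<k}. i \<noteq> j \<longrightarrow> set_mset (path_arcs (f i)) \<inter> set_mset (path_arcs (f j)) = {}"
    "\<forall>i\<in>V \<times> {..<k}. \<forall>j\<in>V \<times> {..<k}. i \<noteq> j \<longrightarrow> fst i = fst j \<longrightarrow> (set (f i) - {fst i}) \<inter> (set (f j) - {fst j}) = {}"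
    "\<forall>v\<in>V. card {i \<in> V \<times> {..<k}. v \<in> set (f i) - {fst i}} \<le> l" by (elim exE conjE)
  show ?thesis
  proof (intro exI[of _ f] conjI)
    show "\<forall>v\<in>V. \<forall>c<k. distinct (f (v, c)) \<and> 2 \<le> length (f (v, c)) \<and> length (f (v, c)) \<le> 5 \<and>
        v \<in> set (f (v, c)) \<and> set_mset (path_arcs (f (v, c))) \<subseteq> E \<and>
        excess_at E (hd (f (v, c))) \<ge> int s \<and> excess_at E (last (f (v, c))) \<le> - int s"
      using f(1) by (auto simp: Q_def)
    show "\<forall>v\<in>V. \<forall>c<k. \<forall>d<k. c \<noteq> d \<longrightarrow> set (f (v, c)) \<inter> set (f (v, d)) \<subseteq> {v}"
    proof (intro ballI allI impI)
      fix v c d assume "v \<in> V" "c < k" "d < k" "c \<noteq> d"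
      then have "(set (f (v, c)) - {v}) \<inter> (set (f (v, d)) - {v}) = {}" using f(3) by simp
      then show "set (f (v, c)) \<inter> set (f (v, d)) \<subseteq> {v}" by blast
    qed
    show "\<forall>v\<in>V. card {i \<in> V \<times> {..<k}. v \<in> set (f i)} < s"
    proof
      fix v assume v: "v \<in> V"
      have "card {i \<in> V \<times> {..<k}. v \<in> set (f i)} \<le>
        card ({i \<in> V \<times> {..<k}. v \<in> set (f i) - {fst i}} \<union> {i \<in> V \<times> {..<k}. fst i = v})"
        using V by (intro card_mono) auto
      also have "\<dots> \<le> l + k" using f(4) v row[OF v] by (intro order_trans[OF card_Un_le] add_mono) auto
      finally show "card {i \<in> V \<times> {..<k}. v \<in> set (f i)} < s" using lz k100 s(1) by linarith
    qed
  qed (use f(2) sn in auto)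
qed

lemma path_arcs_eq_mset_set: "distinct p \<Longrightarrow> path_arcs p = mset_set (set_mset (path_arcs p))"
proof (rule multiset_eqI)
  fix e assume "distinct p"
  then show "count (path_arcs p) e = count (mset_set (set_mset (path_arcs p))) e"
    using path_arcs_le_1[of p e] by (cases "e \<in># path_arcs p") (auto simp: not_in_iff le_antisym Suc_le_eq)
qed

lemma sum_path_arcs_disjoint:
  assumes "finite I" "\<And>i. i \<in> I \<Longrightarrow> distinct (f i)"
    "\<And>i j. i \<in> I \<Longrightarrow> j \<in> I \<Longrightarrow> i \<noteq> j \<Longrightarrow> set_mset (path_arcs (f i)) \<inter> set_mset (path_arcs (f j)) = {}"
  shows "(\<Sum>i\<in>I. path_arcs (f i)) = mset_set (\<Union>i\<in>I. set_mset (path_arcs (f i)))"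
  using assms
proof (induction I)
  case (insert i I)
  have "set_mset (path_arcs (f i)) \<inter> (\<Union>j\<in>I. set_mset (path_arcs (f j))) = {}" using insert by blast
  then have "mset_set (set_mset (path_arcs (f i)) \<union> (\<Union>j\<in>I. set_mset (path_arcs (f j)))) =
    mset_set (set_mset (path_arcs (f i))) + mset_set (\<Union>j\<in>I. set_mset (path_arcs (f j)))"
    using insert.hyps(1) by (intro mset_set_Union) auto
  then show ?case using insert path_arcs_eq_mset_set[of "f i"] by simp
qed simp

lemma mset_set_Diff_subset:
  "finite E \<Longrightarrow> U \<subseteq> E \<Longrightarrow> mset_set E = mset_set U + mset_set (E - U)"
  by (metis Diff_disjoint Un_Diff_cancel finite_Diff finite_subset mset_set_Union sup.absorb_iff2)

text \<open>Parameters: \<open>s\<close> is the excess demanded at the ends of reserved paths and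
  also bounds the number of reserved paths through a vertex; \<open>k\<close> is the reserve of each
  vertex; cycles longer than \<open>2 * w\<close> count as long; \<open>L\<close> separates short
  from long forward arcs in \<open>balanced_long_cycle\<close>.\<close>

lemma dense_perfect_nat:
  assumes T: "tourn V E" and n: "card V = n" and Vne: "V \<noteq> {}"
    and ex: "(\<Sum>v\<in>V. max (excess_at E v) 0) \<ge> int (80 * s * n)"
    and s: "100 \<le> s" "100 * n * k \<le> s * s"
    and w: "4 * n * n < w * (w * k)" "16 * w * w + 56 * n \<le> w * k" "0 < w"
    and L: "512 * n * L \<le> k * k" "1024 * n * n * w \<le> k * k * L" "0 < L"
  shows "perfect (mset_set E)"
proof -
  let ?x = "excess_at E" and ?I = "V \<times> {..<k}"
  have V: "finite V" and EV: "E \<subseteq> V \<times> V" and irr: "\<And>x. (x, x) \<notin> E" using tournD[OF T] by auto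
  have finE: "finite E" using V EV by (meson finite_SigmaI finite_subset)
  obtain f where f: "\<forall>v\<in>V. \<forall>c<k. distinct (f (v, c)) \<and> 2 \<le> length (f (v, c)) \<and> length (f (v, c)) \<le> 5 \<and>
        v \<in> set (f (v, c)) \<and> set_mset (path_arcs (f (v, c))) \<subseteq> E \<and>
        ?x (hd (f (v, c))) \<ge> int s \<and> ?x (last (f (v, c))) \<le> - int s"
     "\<forall>i\<in>?I. \<forall>j\<in>?I. i \<noteq> j \<longrightarrow> set_mset (path_arcs (f i)) \<inter> set_mset (path_arcs (f j)) = {}"
     "\<forall>v\<in>V. \<forall>c<k. \<forall>d<k. c \<noteq> d \<longrightarrow> set (f (v, c)) \<inter> set (f (v, d)) \<subseteq> {v}"
     "\<forall>v\<in>V. card {i \<in> ?I. v \<in> set (f i)} < s" "s \<le> n"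
    using reserve_paths[OF T n Vne ex s] by (elim exE conjE)
  have npos: "0 < n" using Vne V n by auto
  have fi: "distinct (f i)" "2 \<le> length (f i)" "set_mset (path_arcs (f i)) \<subseteq> E" if "i \<in> ?I" for i
    using f(1) that by auto
  have f_ends: "?x (hd (f i)) \<ge> int s" "?x (last (f i)) \<le> - int s" if "i \<in> ?I" for i
    using f(1) that by auto
  have inj: "inj_on f ?I"
  proof (rule inj_onI, rule ccontr)
    fix i j assume ij: "i \<in> ?I" "j \<in> ?I" "f i = f j" "i \<noteq> j"
    have "set_mset (path_arcs (f i)) \<inter> set_mset (path_arcs (f j)) = {}" using f(2) ij(1,2,4) by blast
    then have "path_arcs (f i) = {#}" using ij(3) by simp
    then show False using fi(2)[OF ij(1)] by (simp add: path_arcs_eq_empty)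
  qed
  define \<rho> where "\<rho> v = (\<lambda>c. f (v, c)) ` {..<k}" for v
  have rho_inj: "inj_on (\<lambda>c. f (v, c)) {..<k}" if "v \<in> V" for v
    using inj that by (auto simp: inj_on_def)
  define U where "U = (\<Union>i\<in>?I. set_mset (path_arcs (f i)))"
  have UE: "U \<subseteq> E" using fi(3) by (auto simp: U_def)
  have sumI: "(\<Sum>i\<in>?I. path_arcs (f i)) = mset_set U"
    unfolding U_def
  proof (rule sum_path_arcs_disjoint)
    show "set_mset (path_arcs (f i)) \<inter> set_mset (path_arcs (f j)) = {}" if "i \<in> ?I" "j \<in> ?I" "i \<noteq> j" for i j
      using f(2) that by blast
  qed (use V fi(1) in auto)
  have "(\<Sum>v\<in>V. \<Sum>q\<in>\<rho> v. path_arcs q) = (\<Sum>v\<in>V. \<Sum>c<k. path_arcs (f (v, c)))"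
    unfolding \<rho>_def using rho_inj by (intro sum.cong refl) (simp add: sum.reindex)
  then have rsum: "(\<Sum>v\<in>V. \<Sum>q\<in>\<rho> v. path_arcs q) = mset_set U"
    using sumI by (simp add: sum.cartesian_product)
  obtain P R where PR: "mset_set (E - U) = (\<Sum>p\<in>#P. path_arcs p) + R" "\<forall>v. arc_excess R v = 0"
     "\<forall>p\<in>#P. distinct p \<and> 2 \<le> length p \<and> excess_at (E - U) (hd p) > 0 \<and> excess_at (E - U) (last p) < 0"
    using excess_decomposition[of "mset_set (E - U)"] by blast
  have split: "mset_set E = mset_set U + mset_set (E - U)" by (rule mset_set_Diff_subset[OF finE UE])
  have "R \<subseteq># mset_set (E - U)" unfolding PR(1) by simp
  then have "count R e \<le> count (mset_set (E - U)) e" for e by (rule mset_subset_eq_count)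
  moreover have "count (mset_set (E - U)) e \<le> 1" for e by (simp add: count_mset_set')
  ultimately have Rle: "count R e \<le> 1" for e by (meson le_trans)
  have RE: "set_mset R \<subseteq> E - U"
    using set_mset_mono[OF \<open>R \<subseteq># mset_set (E - U)\<close>] finE by simp
  have Rset: "R = mset_set (set_mset R)"
  proof (rule multiset_eqI)
    fix e show "count R e = count (mset_set (set_mset R)) e"
      using Rle[of e] by (cases "e \<in># R") (auto simp: not_in_iff le_antisym Suc_le_eq)
  qed
  have exU: "arc_excess (mset_set U) v = int (card {i \<in> ?I. hd (f i) = v}) - int (card {i \<in> ?I. last (f i) = v})" for v
  proof -
    have "f i \<noteq> []" if "i \<in> ?I" for i using fi(2)[OF that] by auto
    then have "arc_excess (\<Sum>p\<in>#image_mset f (mset_set ?I). path_arcs p) v =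
      int (size {#p \<in># image_mset f (mset_set ?I). hd p = v#}) - int (size {#p \<in># image_mset f (mset_set ?I). last p = v#})"
      using V by (intro arc_excess_paths) auto
    moreover have "(\<Sum>p\<in>#image_mset f (mset_set ?I). path_arcs p) = mset_set U"
      using sumI by (simp add: image_mset.compositionality comp_def sum_unfold_sum_mset)
    ultimately show ?thesis using V by (simp add: filter_mset_image_mset)
  qed
  have ex': "excess_at (E - U) v = ?x v - int (card {i \<in> ?I. hd (f i) = v}) + int (card {i \<in> ?I. last (f i) = v})" for v
  proof -
    have "?x v = arc_excess (mset_set U) v + excess_at (E - U) v" by (simp only: split arc_excess_add)
    then show ?thesis using exU[of v] by linarith
  qed
  have small: "card {i \<in> ?I. hd (f i) = v} < s" "card {i \<in> ?I. last (f i) = v} < s" for v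
  proof -
    have *: "{i \<in> ?I. hd (f i) = v} \<subseteq> {i \<in> ?I. v \<in> set (f i)}" "{i \<in> ?I. last (f i) = v} \<subseteq> {i \<in> ?I. v \<in> set (f i)}"
    proof -
      have "f i \<noteq> []" if "i \<in> ?I" for i using fi(2)[OF that] by auto
      then have "hd (f i) \<in> set (f i) \<and> last (f i) \<in> set (f i)" if "i \<in> ?I" for i using that by simp
      then show "{i \<in> ?I. hd (f i) = v} \<subseteq> {i \<in> ?I. v \<in> set (f i)}"
        "{i \<in> ?I. last (f i) = v} \<subseteq> {i \<in> ?I. v \<in> set (f i)}" by blast+
    qed
    have "card {i \<in> ?I. v \<in> set (f i)} < s"
    proof (cases "v \<in> V")
      case False
      have "v \<notin> set (f i)" if "i \<in> ?I" for i
      proof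
        assume "v \<in> set (f i)"
        from path_arcs_touch[OF this fi(2)[OF that]] obtain e where "e \<in># path_arcs (f i)" "fst e = v \<or> snd e = v" by blast
        then show False using fi(3)[OF that] EV False by auto
      qed
      then have "{i \<in> ?I. v \<in> set (f i)} = {}" by blast
      then have "card {i \<in> ?I. v \<in> set (f i)} = 0" by (simp only: card.empty)
      then show ?thesis using s(1) by simp
    qed (use f(4) in blast)
    then show "card {i \<in> ?I. hd (f i) = v} < s" "card {i \<in> ?I. last (f i) = v} < s"
      using card_mono[OF _ *(1)] card_mono[OF _ *(2)] V by (simp_all add: order.strict_trans1)
  qed
  have no_hd: "{i \<in> ?I. hd (f i) = v} = {}" if "?x v < int s" for v
  proof -
    have "hd (f i) \<noteq> v" if "i \<in> ?I" for i using f_ends(1)[OF that] \<open>?x v < int s\<close> by auto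
    then show ?thesis by blast
  qed
  have no_last: "{i \<in> ?I. last (f i) = v} = {}" if "?x v > - int s" for v
  proof -
    have "last (f i) \<noteq> v" if "i \<in> ?I" for i using f_ends(2)[OF that] \<open>?x v > - int s\<close> by auto
    then show ?thesis by blast
  qed
  \<comment> \<open>Fewer than \<open>s\<close> reserved paths begin or end at a vertex, and only at
    vertices of excess at least \<open>s\<close> in absolute value. Removing them flips no sign, so
    the excess paths of the rest have ends of the right sign in \<open>E\<close>.\<close>
  have pos: "?x v > 0" if "excess_at (E - U) v > 0" for v
  proof (rule ccontr)
    assume "\<not> ?thesis"
    then have "{i \<in> ?I. hd (f i) = v} = {}" using s(1) by (intro no_hd) linarith
    then have "card {i \<in> ?I. hd (f i) = v} = 0" by (simp only: card.empty)
    moreover have "?x v \<le> - int s \<or> card {i \<in> ?I. last (f i) = v} = 0"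
      using no_last[of v] by (cases "?x v > - int s") (simp_all only: card.empty not_less simp_thms)
    ultimately show False using ex'[of v] that small(2)[of v] \<open>\<not> ?x v > 0\<close> by linarith
  qed
  have neg: "?x v < 0" if "excess_at (E - U) v < 0" for v
  proof (rule ccontr)
    assume "\<not> ?thesis"
    then have "{i \<in> ?I. last (f i) = v} = {}" using s(1) by (intro no_last) linarith
    then have "card {i \<in> ?I. last (f i) = v} = 0" by (simp only: card.empty)
    moreover have "?x v \<ge> int s \<or> card {i \<in> ?I. hd (f i) = v} = 0"
      using no_hd[of v] by (cases "?x v < int s") (simp_all only: card.empty not_less simp_thms)
    ultimately show False using ex'[of v] that small(1)[of v] \<open>\<not> ?x v < 0\<close> by linarith
  qed
  define X Y where "X = {v. ?x v > 0}" and "Y = {v. ?x v < 0}"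
  have XY: "X \<inter> Y = {}" by (auto simp: X_def Y_def)
  have "absorber V X Y (mset_set E) P \<rho> (set_mset R)"
    unfolding absorber_def
  proof (intro conjI ballI allI impI)
    show "mset_set E = (\<Sum>q\<in>#P. path_arcs q) + (\<Sum>v\<in>V. \<Sum>q\<in>\<rho> v. path_arcs q) + mset_set (set_mset R)"
      using split PR(1) rsum Rset by (simp add: add_ac)
    show "distinct q" "2 \<le> length q" "hd q \<in> X" "last q \<in> Y" if "q \<in># P" for q
      using PR(3) pos neg that by (auto simp: X_def Y_def)
    show "finite (\<rho> v)" for v by (simp add: \<rho>_def)
    show "distinct q" "2 \<le> length q" "length q \<le> 5" "v \<in> set q" if "v \<in> V" "q \<in> \<rho> v" for v q
      using f(1) that by (auto simp: \<rho>_def)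
    show "hd q \<in> X" "last q \<in> Y" if vq: "v \<in> V" "q \<in> \<rho> v" for v q
    proof -
      obtain c where "c < k" "q = f (v, c)" using vq(2) by (auto simp: \<rho>_def)
      then have "?x (hd q) \<ge> int s" "?x (last q) \<le> - int s" using f_ends[of "(v, c)"] vq(1) by auto
      then show "hd q \<in> X" "last q \<in> Y" using s(1) by (auto simp: X_def Y_def)
    qed
    show "set q \<inter> set q' \<subseteq> {v}" if v: "v \<in> V" and q: "q \<in> \<rho> v" "q' \<in> \<rho> v" "q \<noteq> q'" for v q q'
    proof -
      obtain c d where cd: "c < k" "q = f (v, c)" "d < k" "q' = f (v, d)" using q by (auto simp: \<rho>_def)
      then have "c \<noteq> d" using q(3) by auto
      then show ?thesis using f(3) v cd by blast
    qed
    show "set_mset R \<subseteq> V \<times> V" using RE EV by blast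
    show "balanced (set_mset R)" using PR(2) Rset unfolding balanced_def by simp
    show "(y, x) \<notin> set_mset R" if "(x, y) \<in> set_mset R" for x y
      using that RE tourn_asym[OF T, of x y] by blast
  qed (rule V)
  moreover have "card (\<rho> v) = k" if "v \<in> V" for v
    unfolding \<rho>_def using card_image[OF rho_inj[OF that]] by simp
  moreover have "8 * (w * w) + 24 * n < w * k" using w(2) npos by linarith
  ultimately obtain Q' \<rho>' R' where ab: "absorber V X Y (mset_set E) Q' \<rho>' R'"
    "\<forall>v\<in>V. k \<le> 2 * card (\<rho>' v) + 2"
    "\<forall>c. distinct c \<longrightarrow> set_mset (cycle_arcs c) \<subseteq> R' \<longrightarrow> length c \<le> 2 * w"
    using absorb_long_cycles[of V X Y "mset_set E" P \<rho> "set_mset R" n k w] n w by blast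
  have R': "R' \<subseteq> V \<times> V" "balanced R'" "\<And>x. (x, x) \<notin> R'" using ab(1) unfolding absorber_def by blast+
  have finR': "finite R'" using R'(1) V by (meson finite_SigmaI finite_subset)
  have kn: "k \<le> n"
  proof -
    from s(2) mult_le_mono1[OF f(5)] have "100 * n * k \<le> n * s" by (rule le_trans)
    then have "n * (100 * k) \<le> n * s" by (simp only: mult_ac)
    then have "100 * k \<le> s" using npos by simp
    then show ?thesis using f(5) by linarith
  qed
  have wk: "16 * w + 56 \<le> k"
  proof -
    have "w \<le> n"
    proof -
      have "w * w \<le> w * n" using w(2) kn mult_le_mono2[OF kn, of w] by linarith
      then show ?thesis using w(3) by simp
    qed
    then have "w * (16 * w + 56) \<le> w * k" using w(2) by (simp add: algebra_simps)
    then show ?thesis using w(3) by simp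
  qed
  have Ln: "L \<le> n"
  proof -
    from L(1) mult_le_mono[OF kn kn] have "512 * n * L \<le> n * n" by (rule le_trans)
    then have "n * (512 * L) \<le> n * n" by (simp only: mult_ac)
    then have "512 * L \<le> n" using npos by simp
    then show ?thesis by simp
  qed
  \<comment> \<open>The bound for digraphs without long cycles is applied with
    \<open>d = 2 * w\<close>; the hypotheses on \<open>L\<close> make each of its terms a small
    fraction of \<open>L * (k * k)\<close>.\<close>
  have cR': "128 * card R' \<le> k * k"
  proof -
    have "L * card R' \<le> L * (2 * w * n) + L * (n * L) + 2 * w * n * n"
      by (rule balanced_long_cycle[OF V n R']) (use ab(3) in force)+
    moreover have "L * (2 * w * n) \<le> n * (2 * w * n)" using Ln by (rule mult_le_mono1)
    moreover have "n * (2 * w * n) = 2 * (n * n * w)" "2 * w * n * n = 2 * (n * n * w)"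
      "L * (n * L) = n * L * L" by simp_all
    moreover have "512 * (n * L * L) \<le> L * (k * k)"
    proof -
      have "L * (512 * n * L) \<le> L * (k * k)" by (rule mult_le_mono2[OF L(1)])
      then show ?thesis by (simp only: mult_ac)
    qed
    moreover have "1024 * (n * n * w) \<le> L * (k * k)" using L(2) by (simp only: mult_ac)
    moreover have "L * (128 * card R') = 128 * (L * card R')" by simp
    ultimately have "L * (128 * card R') \<le> L * (k * k)" by linarith
    then show ?thesis using L(3) by simp
  qed
  \<comment> \<open>One eighth of \<open>k\<close>, rounded up. At most \<open>k / 8\<close>
    vertices have degree at least \<open>l\<close>, so \<open>cap\<close> is at most
    \<open>k / 4\<close> everywhere: by the degree outside \<open>B\<close>, and by
    \<open>2 * card B\<close> inside.\<close>
  define l where "l = (k + 7) div 8"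
  define B where "B = {v \<in> V. l \<le> arc_degree R' v}"
  have "l * card {v \<in> V. l \<le> card {e \<in> R'. v \<in> {fst e, snd e}}} \<le> 2 * card R'"
    by (rule card_heavy[OF finR' V]) (auto simp: card_insert_if)
  moreover have "{e \<in> R'. v \<in> {fst e, snd e}} = {e \<in> R'. fst e = v \<or> snd e = v}" for v by auto
  ultimately have "l * card B \<le> 2 * card R'" by (simp add: B_def arc_degree_def)
  moreover have "k \<le> 8 * l" "8 * l \<le> k + 7" unfolding l_def by linarith+
  then have "k * card B \<le> 8 * (l * card B)" by simp
  ultimately have "k * (8 * card B) \<le> k * k" using cR' by linarith
  then have cB: "8 * card B \<le> k" using wk by simp
  show ?thesis
  proof (rule absorb_short_cycles[OF ab(1) XY, where B = B and base = "4 * w + 13" and m = "2 * w"])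
    fix v assume v: "v \<in> V"
    have cap: "8 * (if v \<in> B then arc_degree (R' \<inter> B \<times> B) v else arc_degree R' v) \<le> 2 * k"
    proof (cases "v \<in> B")
      case True
      have "arc_degree (R' \<inter> B \<times> B) v \<le> card (Pair v ` B \<union> (\<lambda>x. (x, v)) ` B)"
        unfolding arc_degree_def using V by (intro card_mono) (auto simp: B_def)
      also have "\<dots> \<le> card B + card B"
        using V by (intro order_trans[OF card_Un_le] add_mono card_image_le) (auto simp: B_def)
      finally show ?thesis using True cB by simp
    next
      case False
      then have "arc_degree R' v < l" using v by (auto simp: B_def)
      then show ?thesis using False \<open>8 * l \<le> k + 7\<close> by simp
    qed
    \<comment> \<open>At least \<open>k / 2 - 1\<close> reserved paths are left, \<open>cap\<close>
      takes at most \<open>k / 4\<close> of them, and \<open>16 * w + 56 \<le> k\<close> covers the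
      base.\<close>
    show "4 * w + 13 + (if v \<in> B then arc_degree (R' \<inter> B \<times> B) v else arc_degree R' v) \<le> card (\<rho>' v)"
    proof -
      have "k \<le> 2 * card (\<rho>' v) + 2" using ab(2) v by blast
      with cap show ?thesis using wk by linarith
    qed
  qed (use ab(3) in auto)
qed

section \<open>Linking strands\<close>

lemma inj_avoiding:
  assumes "finite A" "finite B" "card A < card B"
  shows "\<exists>f. inj_on f A \<and> f ` A \<subseteq> B \<and> (\<forall>a\<in>A. f a \<noteq> forb a)"
  using assms(1,3)
proof (induction A)
  case (insert a A)
  then obtain f where f: "inj_on f A" "f ` A \<subseteq> B" "\<forall>a\<in>A. f a \<noteq> forb a" by auto
  have "card (insert (forb a) (f ` A)) \<le> Suc (card A)"
    using card_image_le[OF insert.hyps(1), of f] insert.hyps(1) by (simp add: card_insert_if)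
  then have "\<not> B \<subseteq> insert (forb a) (f ` A)"
    using insert card_mono[of "insert (forb a) (f ` A)" B] by auto
  then obtain b where b: "b \<in> B" "b \<noteq> forb a" "b \<notin> f ` A" by blast
  have eq: "(f(a := b)) ` A = f ` A" using insert.hyps(2) by auto
  have "inj_on (f(a := b)) (insert a A)"
    using f(1) b(3) insert.hyps(2) eq by (auto simp: inj_on_def)
  moreover have "(f(a := b)) ` insert a A \<subseteq> B" using f(2) b(1) eq by auto
  moreover have "\<forall>c\<in>insert a A. (f(a := b)) c \<noteq> forb c" using f(3) b(2) by auto
  ultimately show ?case by blast
qed simp

text \<open>Used to glue tokens to the paths of a decomposition of the core: both are matched along
  the vertex in which they meet.\<close>

lemma match_msets:
  assumes "image_mset f I = image_mset g P"
  shows "\<exists>M. image_mset fst M = I \<and> image_mset snd M = P \<and> (\<forall>q\<in>#M. f (fst q) = g (snd q))"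
  using assms
proof (induction I arbitrary: P)
  case (add a I)
  then have "f a \<in># image_mset g P" by (simp flip: add.prems)
  then obtain p where p: "p \<in># P" "f a = g p" by auto
  then obtain P' where P': "P = add_mset p P'" by (meson multi_member_split)
  then have "image_mset f I = image_mset g P'" using add.prems p(2) by simp
  from add.IH[OF this] obtain M where "image_mset fst M = I" "image_mset snd M = P'"
    "\<forall>q\<in>#M. f (fst q) = g (snd q)" by blast
  then show ?case using P' p(2) by (intro exI[of _ "add_mset (a, p) M"]) auto
qed simp

lemma pair_msets:
  assumes "\<And>x. size {#B \<in># BB. g B = x#} \<le> t" "m \<le> size AA" "m + t \<le> size BB"
  shows "\<exists>PL. length PL = m \<and> mset (map fst PL) \<subseteq># AA \<and> mset (map snd PL) \<subseteq># BB \<and>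
    (\<forall>q\<in>set PL. f (fst q) \<noteq> g (snd q))"
  using assms(2,3)
proof (induction m)
  case (Suc m)
  then obtain PL where PL: "length PL = m" "mset (map fst PL) \<subseteq># AA" "mset (map snd PL) \<subseteq># BB"
    "\<forall>q\<in>set PL. f (fst q) \<noteq> g (snd q)" by auto
  obtain A' B' where A': "AA = mset (map fst PL) + A'" and B': "BB = mset (map snd PL) + B'"
    using PL(2,3) by (auto simp: subset_mset.le_iff_add)
  have "size A' > 0" using Suc.prems(1) PL(1) unfolding A' by simp
  then have "A' \<noteq> {#}" by auto
  then obtain a where a: "a \<in># A'" by (meson multiset_nonemptyE)
  have "\<exists>b\<in>#B'. g b \<noteq> f a"
  proof (rule ccontr)
    assume "\<not> ?thesis"
    then have "{#B \<in># B'. g B = f a#} = B'" by (simp add: filter_mset_eq_conv)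
    then have "size B' \<le> size {#B \<in># BB. g B = f a#}" unfolding B' by simp
    then have "size B' \<le> t" using assms(1)[of "f a"] by linarith
    then show False using Suc.prems(2) PL(1) unfolding B' by simp
  qed
  then obtain b where b: "b \<in># B'" "g b \<noteq> f a" by blast
  have "mset (map fst ((a, b) # PL)) \<subseteq># AA" "mset (map snd ((a, b) # PL)) \<subseteq># BB"
  proof -
    obtain A'' B'' where "A' = add_mset a A''" "B' = add_mset b B''"
      using a b(1) by (meson multi_member_split)
    then show "mset (map fst ((a, b) # PL)) \<subseteq># AA" "mset (map snd ((a, b) # PL)) \<subseteq># BB"
      unfolding A' B' by simp_all
  qed
  then show ?case using PL(1,4) b(2) by (intro exI[of _ "(a, b) # PL"]) auto
qed simp

text \<open>The colours will be paths and the elements strands: \<open>conf\<close> keeps the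
  strands of one path disjoint, and \<open>bad\<close> keeps a strand away from paths whose tokens
  it meets.\<close>

lemma greedy_colouring:
  fixes bad :: "'s \<Rightarrow> nat set"
  assumes "finite S" "\<And>s s'. conf s s' \<Longrightarrow> conf s' s"
    and "\<And>s. s \<in> S \<Longrightarrow> card {s' \<in> S. conf s s'} + card (bad s \<inter> {..<m}) < m"
  shows "\<exists>col. \<forall>s\<in>S. col s < m \<and> col s \<notin> bad s \<and> (\<forall>s'\<in>S. s \<noteq> s' \<longrightarrow> conf s s' \<longrightarrow> col s \<noteq> col s')"
proof -
  have "\<exists>col. \<forall>s\<in>J. col s < m \<and> col s \<notin> bad s \<and> (\<forall>s'\<in>J. s \<noteq> s' \<longrightarrow> conf s s' \<longrightarrow> col s \<noteq> col s')"
    if "finite J" "J \<subseteq> S" for J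
    using that
  proof (induction J)
    case (insert s J)
    then obtain col where col: "\<forall>s\<in>J. col s < m \<and> col s \<notin> bad s \<and> (\<forall>s'\<in>J. s \<noteq> s' \<longrightarrow> conf s s' \<longrightarrow> col s \<noteq> col s')"
      by auto
    let ?F = "(bad s \<inter> {..<m}) \<union> col ` {s' \<in> J. conf s s'}"
    have "card ?F \<le> card (bad s \<inter> {..<m}) + card {s' \<in> J. conf s s'}"
      using insert.hyps(1) by (intro order_trans[OF card_Un_le] add_left_mono card_image_le) auto
    also have "card {s' \<in> J. conf s s'} \<le> card {s' \<in> S. conf s s'}"
      using insert.prems assms(1) by (intro card_mono) auto
    finally have "card ?F < card {..<m}" using assms(3)[of s] insert.prems by simp
    moreover have "finite ?F" using insert.hyps(1) by auto
    ultimately have "\<not> {..<m} \<subseteq> ?F" using card_mono[of ?F "{..<m}"] by linarith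
    then obtain c where c: "c < m" "c \<notin> bad s" "\<And>s'. s' \<in> J \<Longrightarrow> conf s s' \<Longrightarrow> c \<noteq> col s'" by auto
    have "\<forall>s'\<in>insert s J. (col(s := c)) s' < m \<and> (col(s := c)) s' \<notin> bad s' \<and>
      (\<forall>t\<in>insert s J. s' \<noteq> t \<longrightarrow> conf s' t \<longrightarrow> (col(s := c)) s' \<noteq> (col(s := c)) t)"
    proof (intro ballI conjI impI)
      fix s' t assume st: "s' \<in> insert s J" "t \<in> insert s J" "s' \<noteq> t" "conf s' t"
      show "(col(s := c)) s' \<noteq> (col(s := c)) t"
      proof (cases "s' = s")
        case True
        then show ?thesis using st c(3)[of t] insert.hyps(2) by auto
      next
        case False
        show ?thesis
        proof (cases "t = s")
          case True
          then show ?thesis using st False c(3)[of s'] assms(2)[OF st(4)] by auto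
        next
          case False
          then show ?thesis using st \<open>s' \<noteq> s\<close> col by auto
        qed
      qed
    qed (use col c insert.hyps(2) in auto)
    then show ?case by blast
  qed simp
  from this[OF assms(1) subset_refl] show ?thesis .
qed

lemma submset_of_size:
  assumes "k \<le> size M" shows "\<exists>L. L \<subseteq># M \<and> size L = k"
proof -
  obtain xs where xs: "M = mset xs" by (metis ex_mset)
  have "mset (take k xs) + mset (drop k xs) = M" unfolding xs by (metis append_take_drop_id mset_append)
  then have "mset (take k xs) \<subseteq># M" by (metis mset_subset_eq_add_left)
  moreover have "size (mset (take k xs)) = k" using assms unfolding xs by simp
  ultimately show ?thesis by blast
qed

text \<open>One representative for each element of \<open>S\<close>, completed arbitrarily to size
  \<open>k\<close>. This is how every core vertex keeps a token although only \<open>k\<close>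
  tokens are left over.\<close>

lemma submset_hitting:
  assumes "finite S" "\<And>x. x \<in> S \<Longrightarrow> \<exists>A\<in>#M. f A = x" "card S \<le> k" "k \<le> size M"
  shows "\<exists>L. L \<subseteq># M \<and> size L = k \<and> (\<forall>x\<in>S. \<exists>A\<in>#L. f A = x)"
proof -
  have "\<forall>x\<in>S. \<exists>A. A \<in># M \<and> f A = x" using assms(2) by blast
  then obtain h where h: "\<forall>x\<in>S. h x \<in># M \<and> f (h x) = x" by (rule bchoice[THEN exE])
  have inj: "inj_on h S" by (rule inj_on_inverseI[of _ f]) (use h in auto)
  have "mset_set (h ` S) \<subseteq># M"
    using h assms(1) by (intro le_1_subseteq_mset) (auto simp: count_mset_set')
  then obtain M' where M': "M = mset_set (h ` S) + M'" by (auto simp: subset_mset.le_iff_add)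
  have sz: "size (mset_set (h ` S)) = card S" using inj by (simp add: card_image)
  then have "k - card S \<le> size M'" using assms(4) unfolding M' by simp
  then obtain L where L: "L \<subseteq># M'" "size L = k - card S" using submset_of_size by blast
  have "mset_set (h ` S) + L \<subseteq># M" unfolding M' using L(1) by simp
  moreover have "size (mset_set (h ` S) + L) = k" using sz L(2) assms(3) by simp
  moreover have "\<forall>x\<in>S. \<exists>A\<in>#mset_set (h ` S) + L. f A = x" using h assms(1) by auto
  ultimately show ?thesis by blast
qed

text \<open>An element is added exactly when the chosen sum lags behind half of the total, so the
  overshoot is bounded by one term. The upper bound is there because the complement of
  \<open>G\<close> may be used instead of \<open>G\<close>.\<close>

lemma half_subset:
  fixes a :: "'a \<Rightarrow> nat"
  assumes "finite F" "\<And>x. x \<in> F \<Longrightarrow> a x \<le> t"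
  shows "\<exists>G\<subseteq>F. sum a F \<le> 2 * sum a G \<and> 2 * sum a G \<le> sum a F + 2 * t"
  using assms
proof (induction F)
  case (insert x F)
  then obtain G where G: "G \<subseteq> F" "sum a F \<le> 2 * sum a G" "2 * sum a G \<le> sum a F + 2 * t" by auto
  show ?case
  proof (cases "sum a F + a x \<le> 2 * sum a G")
    case True
    then show ?thesis using G insert.hyps by (intro exI[of _ G]) auto
  next
    case False
    have "finite G" "x \<notin> G" using G(1) insert.hyps finite_subset by auto
    then have "sum a (insert x G) = a x + sum a G" by simp
    then show ?thesis using G False insert.hyps insert.prems[of x] by (intro exI[of _ "insert x G"]) auto
  qed
qed simp

text \<open>The vertices carrying both kinds of tokens are split so that about half of either kind survives;
  alternatively all of them may be made negative.\<close>

lemma sign_partition: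
  fixes a b :: "'a \<Rightarrow> nat"
  assumes V: "finite V" and ab: "\<And>x. x \<in> V \<Longrightarrow> 1 \<le> a x + b x" "\<And>x. x \<in> V \<Longrightarrow> a x \<le> t"
    and N: "sum a V = N" "sum b V = N"
  shows "\<exists>S\<subseteq>V. (\<forall>x\<in>S. 1 \<le> a x) \<and> (\<forall>x\<in>V - S. 1 \<le> b x) \<and>
    N \<le> 2 * min (sum a S) (sum b (V - S)) + 2 * t \<and>
    N \<le> min (sum a S) (sum b (V - S)) + sum a {x \<in> V. 0 < b x}"
proof -
  \<comment> \<open>Vertices of \<open>P\<close> carry only tokens counted by \<open>a\<close> and
    must go to \<open>S\<close>; those of \<open>F\<close> carry both kinds and may go either
    way.\<close>
  define P where "P = {x \<in> V. b x = 0}"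
  define F where "F = {x \<in> V. 0 < a x \<and> 0 < b x}"
  define K where "K S = min (sum a S) (sum b (V - S))" for S
  define good where "good S \<longleftrightarrow> S \<subseteq> V \<and> (\<forall>x\<in>S. 1 \<le> a x) \<and> (\<forall>x\<in>V - S. 1 \<le> b x)" for S
  have good_PG: "good (P \<union> G)" if "G \<subseteq> F" for G
    using that ab(1) unfolding good_def P_def F_def by force
  have fin: "finite P" "finite F" using V by (auto simp: P_def F_def)
  have suma: "sum a V = sum a P + sum a F"
  proof -
    have "sum a V = sum a (P \<union> F)"
      using V ab(1) by (intro sum.mono_neutral_right) (auto simp: P_def F_def)
    also have "\<dots> = sum a P + sum a F" using fin by (intro sum.union_disjoint) (auto simp: P_def F_def)
    finally show ?thesis .
  qed
  have sumbP: "sum b (V - P) = N"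
  proof -
    have "sum b (V - P) = sum b V" by (rule sum.mono_neutral_left) (use V in \<open>auto simp: P_def\<close>)
    then show ?thesis using N by simp
  qed
  have K1: "N \<le> K P + sum a {x \<in> V. 0 < b x}"
  proof -
    have "sum a F \<le> sum a {x \<in> V. 0 < b x}" using V by (intro sum_mono2) (auto simp: F_def)
    then show ?thesis using suma sumbP N unfolding K_def by linarith
  qed
  have "\<exists>S. good S \<and> N \<le> 2 * K S + 2 * t"
  proof -
    \<comment> \<open>\<open>G\<close> and \<open>F - G\<close> each have about half of the
      \<open>a\<close>-tokens of \<open>F\<close>. The one added to \<open>P\<close> is chosen so
      that the other carries at least half of the \<open>b\<close>-tokens of
      \<open>F\<close>.\<close>
    obtain G where G: "G \<subseteq> F" "sum a F \<le> 2 * sum a G" "2 * sum a G \<le> sum a F + 2 * t"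
      using half_subset[of F a t] fin ab(2) by (auto simp: F_def)
    have sumG: "sum a F = sum a G + sum a (F - G)" "sum b F = sum b G + sum b (F - G)"
      using G(1) fin by (metis add.commute sum.subset_diff)+
    have sA: "sum a (P \<union> H) = sum a P + sum a H" if "H \<subseteq> F" for H
      using fin that by (intro sum.union_disjoint) (auto simp: P_def F_def intro: finite_subset)
    have sB: "N \<le> sum b (V - (P \<union> H)) + sum b H" if "H \<subseteq> F" for H
    proof -
      have "sum b (V - P) = sum b (V - (P \<union> H)) + sum b H"
      proof -
        have "V - P - H = V - (P \<union> H)" "H \<subseteq> V - P" using that by (auto simp: P_def F_def)
        then show ?thesis using V sum.subset_diff[of H "V - P" b] by simp
      qed
      then show ?thesis using sumbP by simp
    qed
    have "sum b F \<le> sum b V" using V by (intro sum_mono2) (auto simp: F_def)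
    then have bF: "sum b F \<le> N" using N(2) by simp
    show ?thesis
    proof (cases "sum b F \<le> 2 * sum b (F - G)")
      case True
      have "good (P \<union> G)" using good_PG G(1) by blast
      moreover have "N \<le> 2 * sum a (P \<union> G) + 2 * t" using sA[OF G(1)] suma N G(2) by linarith
      moreover have "N \<le> 2 * sum b (V - (P \<union> G)) + 2 * t" using sB[OF G(1)] sumG(2) True bF by linarith
      ultimately show ?thesis unfolding K_def by (intro exI[of _ "P \<union> G"]) auto
    next
      case False
      have "good (P \<union> (F - G))" using good_PG by blast
      moreover have "N \<le> 2 * sum a (P \<union> (F - G)) + 2 * t"
        using sA[of "F - G"] suma N sumG(1) G(3) by auto
      moreover have "N \<le> 2 * sum b (V - (P \<union> (F - G))) + 2 * t"
        using sB[of "F - G"] sumG(2) False bF by auto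
      ultimately show ?thesis unfolding K_def by (intro exI[of _ "P \<union> (F - G)"]) auto
    qed
  qed
  then obtain S where S: "good S" "N \<le> 2 * K S + 2 * t" by blast
  \<comment> \<open>Both bounds only improve as \<open>K\<close> grows, so whichever of
    \<open>S\<close> and \<open>P\<close> has the larger \<open>K\<close> satisfies them
    together.\<close>
  have "\<exists>S. good S \<and> N \<le> 2 * K S + 2 * t \<and> N \<le> K S + sum a {x \<in> V. 0 < b x}"
  proof (cases "K S \<le> K P")
    case True
    have "good P" using good_PG[of "{}"] by simp
    then show ?thesis using K1 S True by (intro exI[of _ P]) auto
  next
    case False
    then show ?thesis using K1 S by (intro exI[of _ S]) auto
  qed
  then show ?thesis unfolding good_def K_def by blast
qed

text \<open>Only the interior of a link is inserted, because its ends already are the last vertex of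
  one segment and the first vertex of the next.\<close>

fun weave :: "'a list list \<Rightarrow> (nat \<Rightarrow> 'a list) \<Rightarrow> 'a list" where
  "weave [] f = []"
| "weave [s] f = s"
| "weave (s # t # ss) f = s @ butlast (tl (f 0)) @ weave (t # ss) (\<lambda>j. f (Suc j))"

lemma weave_props:
  assumes "sk \<noteq> []" "\<And>s. s \<in> set sk \<Longrightarrow> s \<noteq> []"
    and "\<And>j. Suc j < length sk \<Longrightarrow> 2 \<le> length (f j) \<and> hd (f j) = last (sk ! j) \<and> last (f j) = hd (sk ! Suc j)"
  shows "weave sk f \<noteq> [] \<and> hd (weave sk f) = hd (concat sk) \<and> last (weave sk f) = last (concat sk) \<and>
    path_arcs (weave sk f) = (\<Sum>s\<leftarrow>sk. path_arcs s) + (\<Sum>j<length sk - 1. path_arcs (f j))"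
  using assms
proof (induction sk f rule: weave.induct)
  case (3 s t ss f)
  let ?r = "weave (t # ss) (\<lambda>j. f (Suc j))"
  have IH: "?r \<noteq> [] \<and> hd ?r = hd (concat (t # ss)) \<and> last ?r = last (concat (t # ss)) \<and>
    path_arcs ?r = (\<Sum>s\<leftarrow>t # ss. path_arcs s) + (\<Sum>j<length (t # ss) - 1. path_arcs (f (Suc j)))"
  proof (rule "3.IH")
    show "2 \<le> length (f (Suc j)) \<and> hd (f (Suc j)) = last ((t # ss) ! j) \<and> last (f (Suc j)) = hd ((t # ss) ! Suc j)"
      if "Suc j < length (t # ss)" for j using "3.prems"(3)[of "Suc j"] that by simp
  qed (use "3.prems" in auto)
  have s: "s \<noteq> []" "t \<noteq> []" using "3.prems" by auto
  have f0: "2 \<le> length (f 0)" "hd (f 0) = last s" "last (f 0) = hd t" using "3.prems"(3)[of 0] by auto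
  then have f0ne: "f 0 \<noteq> []" "tl (f 0) \<noteq> []" by (cases "f 0"; cases "tl (f 0)"; auto)+
  have hr: "hd ?r = hd t" using IH s(2) by simp
  have eq: "butlast (s @ tl (f 0)) @ ?r = weave (s # t # ss) f" using f0ne by (simp add: butlast_append)
  have l: "last (s @ tl (f 0)) = hd ?r" using f0ne f0 hr by (simp add: last_tl)
  have "path_arcs (weave (s # t # ss) f) = path_arcs (s @ tl (f 0)) + path_arcs ?r"
    unfolding eq[symmetric] using IH s l by (intro path_arcs_glue) auto
  also have "path_arcs (s @ tl (f 0)) = path_arcs s + path_arcs (f 0)"
    using s f0ne f0 by (intro path_arcs_glue') auto
  finally have "path_arcs (weave (s # t # ss) f) = (\<Sum>s\<leftarrow>s # t # ss. path_arcs s) +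
      (\<Sum>j<length (s # t # ss) - 1. path_arcs (f j))"
    using IH by (simp add: sum.lessThan_Suc_shift add_ac del: sum.lessThan_Suc)
  then show ?case using IH s by simp
qed auto

lemma weave_distinct:
  assumes "distinct (concat sk)"
    and "\<And>j. Suc j < length sk \<Longrightarrow> distinct (f j) \<and> set (butlast (tl (f j))) \<inter> set (concat sk) = {}"
    and "\<And>i j. Suc i < length sk \<Longrightarrow> Suc j < length sk \<Longrightarrow> i \<noteq> j \<Longrightarrow>
      set (butlast (tl (f i))) \<inter> set (butlast (tl (f j))) = {}"
  shows "distinct (weave sk f) \<and>
    set (weave sk f) \<subseteq> set (concat sk) \<union> (\<Union>j\<in>{j. Suc j < length sk}. set (butlast (tl (f j))))"
  using assms
proof (induction sk f rule: weave.induct)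
  case (3 s t ss f)
  let ?r = "weave (t # ss) (\<lambda>j. f (Suc j))"
  have IH: "distinct ?r \<and> set ?r \<subseteq> set (concat (t # ss)) \<union>
    (\<Union>j\<in>{j. Suc j < length (t # ss)}. set (butlast (tl (f (Suc j)))))"
  proof (rule "3.IH")
    show "distinct (f (Suc j)) \<and> set (butlast (tl (f (Suc j)))) \<inter> set (concat (t # ss)) = {}"
      if "Suc j < length (t # ss)" for j using "3.prems"(2)[of "Suc j"] that by auto
    show "set (butlast (tl (f (Suc i)))) \<inter> set (butlast (tl (f (Suc j)))) = {}"
      if "Suc i < length (t # ss)" "Suc j < length (t # ss)" "i \<noteq> j" for i j
      using "3.prems"(3)[of "Suc i" "Suc j"] that by simp
  qed (use "3.prems"(1) in auto)
  have f0: "distinct (f 0)" "set (butlast (tl (f 0))) \<inter> set (concat (s # t # ss)) = {}"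
    using "3.prems"(2)[of 0] by auto
  have "set s \<inter> set (butlast (tl (f (Suc j)))) = {}" if "Suc j < length (t # ss)" for j
    using "3.prems"(2)[of "Suc j"] that by auto
  then have "set s \<inter> (\<Union>j\<in>{j. Suc j < length (t # ss)}. set (butlast (tl (f (Suc j))))) = {}" by blast
  moreover have "set s \<inter> set (concat (t # ss)) = {}" using "3.prems"(1) by simp
  ultimately have 1: "set s \<inter> set ?r = {}" using conjunct2[OF IH] by blast
  have "set (butlast (tl (f 0))) \<inter> set (butlast (tl (f (Suc j)))) = {}" if "Suc j < length (t # ss)" for j
    using "3.prems"(3)[of 0 "Suc j"] that by simp
  then have "set (butlast (tl (f 0))) \<inter> (\<Union>j\<in>{j. Suc j < length (t # ss)}. set (butlast (tl (f (Suc j))))) = {}" by blast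
  moreover have "set (butlast (tl (f 0))) \<inter> set (concat (t # ss)) = {}" using f0(2) by auto
  ultimately have 2: "set (butlast (tl (f 0))) \<inter> set ?r = {}" using conjunct2[OF IH] by blast
  have "distinct (weave (s # t # ss) f)"
    using 1 2 f0 IH "3.prems"(1) by (auto simp: distinct_butlast distinct_tl)
  moreover have "set (weave (s # t # ss) f) \<subseteq> set (concat (s # t # ss)) \<union>
      (\<Union>j\<in>{j. Suc j < length (s # t # ss)}. set (butlast (tl (f j))))"
  proof
    fix x assume "x \<in> set (weave (s # t # ss) f)"
    then consider "x \<in> set s" | "x \<in> set (butlast (tl (f 0)))" | "x \<in> set ?r" by auto
    then show "x \<in> set (concat (s # t # ss)) \<union> (\<Union>j\<in>{j. Suc j < length (s # t # ss)}. set (butlast (tl (f j))))"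
    proof cases
      case 3
      then consider "x \<in> set (concat (t # ss))" | j where "Suc j < length (t # ss)" "x \<in> set (butlast (tl (f (Suc j))))"
        using IH by blast
      then show ?thesis
      proof cases
        case (2 j)
        then have "Suc j \<in> {j. Suc j < length (s # t # ss)}" by simp
        then show ?thesis using 2(2) by blast
      qed auto
    qed auto
  qed
  ultimately show ?case by blast
qed auto

text \<open>If the surviving out-neighbours \<open>S\<close> of \<open>x\<close> sent no arc to the surviving in-neighbours of \<open>y\<close>,
  then most arcs leaving \<open>S\<close> would stay in \<open>S\<close>, but \<open>S\<close> spans at most half of all pairs.\<close>

lemma link_exists:
  assumes V: "finite V" "card V \<le> n" and E: "E \<subseteq> V \<times> V" "\<And>x y. (x, y) \<in> E \<Longrightarrow> (y, x) \<notin> E"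
    and deg: "\<And>v. v \<in> V \<Longrightarrow> 12 * n \<le> 25 * card (outs E v)" "\<And>v. v \<in> V \<Longrightarrow> 12 * n \<le> 25 * card (ins E v)"
    and xy: "x \<in> V" "y \<in> V" "x \<noteq> y"
    and Z: "finite Z" "card Z \<le> z" and U: "finite U" "\<And>v. v \<in> V \<Longrightarrow> arc_degree U v \<le> z"
    and z: "100 * z \<le> n" "400 \<le> n"
  shows "\<exists>p. distinct p \<and> 2 \<le> length p \<and> length p \<le> 5 \<and> hd p = x \<and> last p = y \<and> set p \<subseteq> V \<and>
    set_mset (path_arcs p) \<subseteq> E \<and> set_mset (path_arcs p) \<inter> U = {} \<and> (set p - {x, y}) \<inter> Z = {}"
proof -
  have finE: "finite E" using V E by (meson finite_SigmaI finite_subset)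
  \<comment> \<open>\<open>S\<close> and \<open>R\<close> are what survives of the out-neighbourhood
    of \<open>x\<close> and of the in-neighbourhood of \<open>y\<close>: at least 45 of the original
    48 percent of \<open>n\<close>. A common vertex or an arc from \<open>S\<close> to
    \<open>R\<close> yields the link.\<close>
  define S where "S = outs E x - (outs U x \<union> (Z \<union> {x, y}))"
  define R where "R = ins E y - (ins U y \<union> (Z \<union> {x, y}))"
  have SV: "S \<subseteq> V" "R \<subseteq> V" using E(1) by (auto simp: S_def R_def outs_def ins_def)
  have c2: "card {x, y} \<le> 2" by (simp add: card_insert_if)
  have cS: "45 * n \<le> 100 * card S"
  proof -
    have "card (outs U x \<union> (Z \<union> {x, y})) \<le> card (outs U x) + (card Z + card {x, y})"
      by (intro order_trans[OF card_Un_le] add_left_mono card_Un_le)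
    then have "card (outs U x \<union> (Z \<union> {x, y})) \<le> 2 * z + 2"
      using card_outs_le[OF U(1), of x] U(2)[OF xy(1)] Z(2) c2 by linarith
    moreover have "card (outs E x) - card (outs U x \<union> (Z \<union> {x, y})) \<le> card S"
      unfolding S_def using U(1) Z(1) by (intro diff_card_le_card_Diff) auto
    ultimately show ?thesis using deg(1)[OF xy(1)] z by linarith
  qed
  have cR: "45 * n \<le> 100 * card R"
  proof -
    have "card (ins U y \<union> (Z \<union> {x, y})) \<le> card (ins U y) + (card Z + card {x, y})"
      by (intro order_trans[OF card_Un_le] add_left_mono card_Un_le)
    then have "card (ins U y \<union> (Z \<union> {x, y})) \<le> 2 * z + 2"
      using card_ins_le[OF U(1), of y] U(2)[OF xy(2)] Z(2) c2 by linarith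
    moreover have "card (ins E y) - card (ins U y \<union> (Z \<union> {x, y})) \<le> card R"
      unfolding R_def using U(1) Z(1) by (intro diff_card_le_card_Diff) auto
    ultimately show ?thesis using deg(2)[OF xy(2)] z by linarith
  qed
  show ?thesis
  proof (cases "S \<inter> R = {}")
    case False
    then obtain v where v: "v \<in> S" "v \<in> R" by blast
    then have "v \<in> V" using SV by blast
    then show ?thesis using v xy
      by (intro exI[of _ "[x, v, y]"]) (auto simp: S_def R_def outs_def ins_def)
  next
    case SR: True
    have "\<exists>u\<in>S. \<exists>v\<in>R. (u, v) \<in> E - U"
    proof (rule ccontr)
      assume no: "\<not> ?thesis"
      have finS: "finite S" "finite R" using SV V finite_subset by auto
      have cVR: "card (V - R) = card V - card R" using SV finS by (intro card_Diff_subset)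
      have SVR: "S \<subseteq> V - R" using SV SR by blast
      have cVRS: "card (V - R - S) = card (V - R) - card S" using SVR finS by (intro card_Diff_subset)
      have "36 * n \<le> 100 * card (outs E u \<inter> S)" if u: "u \<in> S" for u
      proof -
        have uV: "u \<in> V" using u SV by blast
        have "outs E u \<subseteq> (outs E u \<inter> S) \<union> ((V - R - S) \<union> outs U u)"
          using no u E(1) by (auto simp: outs_def)
        then have "card (outs E u) \<le> card ((outs E u \<inter> S) \<union> ((V - R - S) \<union> outs U u))"
          using finS V U(1) by (intro card_mono) auto
        also have "\<dots> \<le> card (outs E u \<inter> S) + (card (V - R - S) + card (outs U u))"
          by (intro order_trans[OF card_Un_le] add_left_mono card_Un_le)
        finally show ?thesis
          using cVR cVRS cS cR V(2) card_outs_le[OF U(1), of u] U(2)[OF uV] deg(1)[OF uV] z by linarith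
      qed
      then have "(\<Sum>u\<in>S. 36 * n) \<le> (\<Sum>u\<in>S. 100 * card (outs E u \<inter> S))" by (rule sum_mono)
      then have "card S * (36 * n) \<le> 100 * (\<Sum>u\<in>S. card (outs E u \<inter> S))"
        by (simp add: sum_distrib_left)
      also have "(\<Sum>u\<in>S. card (outs E u \<inter> S)) = card (SIGMA u:S. outs E u \<inter> S)"
        using finS by (subst card_SigmaI) auto
      also have "(SIGMA u:S. outs E u \<inter> S) = E \<inter> S \<times> S" by (auto simp: outs_def)
      finally have 1: "card S * (36 * n) \<le> 100 * card (E \<inter> S \<times> S)" .
      have "card (E \<inter> S \<times> S) + card ((E \<inter> S \<times> S)\<inverse>) = card (E \<inter> S \<times> S \<union> (E \<inter> S \<times> S)\<inverse>)"
        using finS E(2) by (intro card_Un_disjoint[symmetric]) auto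
      also have "\<dots> \<le> card (S \<times> S)" using finS by (intro card_mono) auto
      finally have 2: "2 * card (E \<inter> S \<times> S) \<le> card S * card S" by (simp add: card_cartesian_product)
      have "card S * (72 * n) = 2 * (card S * (36 * n))" "card S * (100 * card S) = 100 * (card S * card S)"
        by simp_all
      then have "card S * (72 * n) \<le> card S * (100 * card S)" using 1 2 by linarith
      moreover have "0 < card S" using cS z(2) by linarith
      \<comment> \<open>At most half of the ordered pairs in \<open>S\<close> are arcs, so
        out-degrees of 36 percent inside \<open>S\<close> force 72 percent of vertices; but
        \<open>S\<close> is disjoint from \<open>R\<close> and has at most 55 percent.\<close>
      ultimately have "72 * n \<le> 100 * card S" by simp
      moreover have "card S \<le> card (V - R)" using SVR V by (intro card_mono) auto
      ultimately show False using cVR cR V(2) z(2) by linarith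
    qed
    then obtain u v where uv: "u \<in> S" "v \<in> R" "(u, v) \<in> E - U" by blast
    then have "u \<in> V" "v \<in> V" "u \<noteq> v" using SV SR by blast+
    then show ?thesis using uv xy
      by (intro exI[of _ "[x, u, v, y]"]) (auto simp: S_def R_def outs_def ins_def)
  qed
qed

text \<open>A skeleton is a list of segments to be joined in order, and demand \<open>(i, j)\<close>
  asks for a link from segment \<open>j\<close> of skeleton \<open>i\<close> to the next one. The
  links of one skeleton form a group of \<open>greedy_paths\<close>, which keeps their interiors
  disjoint; the prescribed vertices of a demand are the two ends of its link.\<close>

lemma link_skeletons:
  fixes SK :: "nat \<Rightarrow> 'a list list"
  assumes V: "finite V" "card V \<le> n" and E: "E \<subseteq> V \<times> V" "\<And>x y. (x, y) \<in> E \<Longrightarrow> (y, x) \<notin> E"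
    and deg: "\<And>v. v \<in> V \<Longrightarrow> 12 * n \<le> 25 * card (outs E v)" "\<And>v. v \<in> V \<Longrightarrow> 12 * n \<le> 25 * card (ins E v)"
    and sk: "\<And>i. i < r \<Longrightarrow> SK i \<noteq> []" "\<And>i s. i < r \<Longrightarrow> s \<in> set (SK i) \<Longrightarrow> s \<noteq> []"
      "\<And>i. i < r \<Longrightarrow> distinct (concat (SK i))"
      "\<And>i j. i < r \<Longrightarrow> Suc j < length (SK i) \<Longrightarrow> last (SK i ! j) \<in> V \<and> hd (SK i ! Suc j) \<in> V"
    and h: "\<And>x. x \<in> V \<Longrightarrow> card {i. i < r \<and> x \<in> set (concat (SK i))} \<le> h"
    and G: "\<And>i. i < r \<Longrightarrow> length (SK i) \<le> G" "\<And>i. i < r \<Longrightarrow> length (concat (SK i)) \<le> z0"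
    and num: "5 * (\<Sum>i<r. length (SK i)) \<le> l * zh" "0 < l" "zh + 5 * G \<le> z" "2 * (l + 2 * h) \<le> z"
      "100 * (z + z0) \<le> n" "400 \<le> n"
  shows "\<exists>P U. U \<subseteq> E \<and> (\<forall>i<r. distinct (P i) \<and> P i \<noteq> [] \<and> hd (P i) = hd (concat (SK i)) \<and> last (P i) = last (concat (SK i))) \<and>
    (\<Sum>i<r. path_arcs (P i)) = (\<Sum>i<r. \<Sum>s\<leftarrow>SK i. path_arcs s) + mset_set U \<and>
    (\<forall>x\<in>V. arc_degree U x \<le> 2 * (l + 2 * h))"
proof -
  define I where "I = (SIGMA i:{..<r}. {..<length (SK i) - 1})"
  define F where "F = (\<lambda>(i, j). {last (SK i ! j), hd (SK i ! Suc j)})"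
  define Q where "Q ij p \<longleftrightarrow> distinct p \<and> 2 \<le> length p \<and> length p \<le> 5 \<and> hd p = last (SK (fst ij) ! snd ij) \<and>
    last p = hd (SK (fst ij) ! Suc (snd ij)) \<and> set p \<subseteq> V \<and> set_mset (path_arcs p) \<subseteq> E \<and>
    (set p - F ij) \<inter> set (concat (SK (fst ij))) = {}" for ij p
  have finE: "finite E" using V E by (meson finite_SigmaI finite_subset)
  have finI: "finite I" by (simp add: I_def)
  have I: "i < r" "Suc j < length (SK i)" if "(i, j) \<in> I" for i j using that by (auto simp: I_def)
  have mem: "last (SK i ! j) \<in> set (SK i ! j)" "hd (SK i ! Suc j) \<in> set (SK i ! Suc j)" if "i < r" "Suc j < length (SK i)" for i j
    using sk(2)[of i "SK i ! j"] sk(2)[of i "SK i ! Suc j"] that by auto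
  have blocks: "set (SK i ! j) \<inter> set (SK i ! k) = {}" if "i < r" "j < length (SK i)" "k < length (SK i)" "j \<noteq> k" for i j k
  proof -
    have "[] \<notin> set (SK i)" using sk(2) that(1) by blast
    then have "distinct (SK i)" using sk(3)[OF that(1)] unfolding distinct_concat_iff by (simp add: removeAll_id)
    then have "SK i ! j \<noteq> SK i ! k" using that by (simp add: nth_eq_iff_index_eq)
    then show ?thesis using sk(3)[OF that(1)] that unfolding distinct_concat_iff by simp
  qed
  \<comment> \<open>A vertex lies in only one segment of a skeleton and hence is an end of at most
    two of its links, one on either side of that segment.\<close>
  have rowF: "card {ij \<in> I. x \<in> F ij} \<le> 2 * h" if x: "x \<in> V" for x
  proof -
    let ?A = "{i. i < r \<and> x \<in> set (concat (SK i))}"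
    have ex: "\<forall>i\<in>?A. \<exists>k. k < length (SK i) \<and> x \<in> set (SK i ! k)"
    proof
      fix i assume "i \<in> ?A"
      then obtain B where "B \<in> set (SK i)" "x \<in> set B" by auto
      then show "\<exists>k. k < length (SK i) \<and> x \<in> set (SK i ! k)" by (metis in_set_conv_nth)
    qed
    then obtain k where k: "\<forall>i\<in>?A. k i < length (SK i) \<and> x \<in> set (SK i ! k i)"
      by (rule bchoice[THEN exE])
    have "{ij \<in> I. x \<in> F ij} \<subseteq> (\<lambda>i. (i, k i)) ` ?A \<union> (\<lambda>i. (i, k i - 1)) ` ?A"
    proof
      fix ij assume ijI: "ij \<in> {ij \<in> I. x \<in> F ij}"
      obtain i j where eq: "ij = (i, j)" by (cases ij)
      have ij: "i < r" "Suc j < length (SK i)" using ijI I unfolding eq by auto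
      consider "x = last (SK i ! j)" | "x = hd (SK i ! Suc j)" using ijI unfolding eq by (auto simp: F_def)
      then show "ij \<in> (\<lambda>i. (i, k i)) ` ?A \<union> (\<lambda>i. (i, k i - 1)) ` ?A"
      proof cases
        case 1
        then have xin: "x \<in> set (SK i ! j)" using mem[OF ij] by simp
        then have iA: "i \<in> ?A" using ij by (auto intro!: bexI[of _ "SK i ! j"])
        then have "k i = j" using blocks[OF ij(1), of j "k i"] bspec[OF k iA] xin ij(2) by (metis Suc_lessD disjoint_iff)
        then show ?thesis using iA unfolding eq by blast
      next
        case 2
        then have xin: "x \<in> set (SK i ! Suc j)" using mem[OF ij] by simp
        then have iA: "i \<in> ?A" using ij by (auto intro!: bexI[of _ "SK i ! Suc j"])
        then have "k i = Suc j" using blocks[OF ij, of "k i"] bspec[OF k iA] xin by (metis disjoint_iff)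
        then have "(i, j) = (i, k i - 1)" by simp
        then show ?thesis using iA unfolding eq by blast
      qed
    qed
    then have "card {ij \<in> I. x \<in> F ij} \<le> card ((\<lambda>i. (i, k i)) ` ?A \<union> (\<lambda>i. (i, k i - 1)) ` ?A)"
      by (intro card_mono) auto
    also have "\<dots> \<le> card ?A + card ?A"
      by (intro order_trans[OF card_Un_le] add_mono card_image_le) auto
    finally show ?thesis using h[OF x] by linarith
  qed
  have rowG: "card {ij' \<in> I. fst ij' = fst ij} \<le> G" if "ij \<in> I" for ij
  proof -
    have "{ij' \<in> I. fst ij' = fst ij} \<subseteq> Pair (fst ij) ` {..<length (SK (fst ij))}" by (auto simp: I_def)
    then have "card {ij' \<in> I. fst ij' = fst ij} \<le> card (Pair (fst ij) ` {..<length (SK (fst ij))})"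
      by (rule card_mono[rotated]) auto
    also have "\<dots> \<le> length (SK (fst ij))" using card_image_le[of "{..<length (SK (fst ij))}"] by simp
    also have "\<dots> \<le> G" using G(1) that by (auto simp: I_def)
    finally show ?thesis .
  qed
  have step: "\<exists>p. Q ij p \<and> set_mset (path_arcs p) \<inter> U = {} \<and> (set p - F ij) \<inter> Z = {}"
    if ij: "ij \<in> I" and Z: "card Z \<le> z" "Z \<subseteq> V" and U: "finite U" "\<And>v. v \<in> V \<Longrightarrow> arc_degree U v \<le> z"
    for ij Z U
  proof -
    obtain i j where eq: "ij = (i, j)" by (cases ij)
    note ij' = I[OF ij[unfolded eq]]
    let ?x = "last (SK i ! j)" and ?y = "hd (SK i ! Suc j)" and ?Z = "Z \<union> set (concat (SK i))"
    have "set (SK i ! j) \<inter> set (SK i ! Suc j) = {}" using ij' by (intro blocks) auto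
    then have "?x \<noteq> ?y" using mem[OF ij'] by (metis disjoint_iff)
    have "card ?Z \<le> card Z + card (set (concat (SK i)))" by (rule card_Un_le)
    also have "\<dots> \<le> z + z0" using Z(1) G(2)[OF ij'(1)] card_length[of "concat (SK i)"] by linarith
    finally have cZ: "card ?Z \<le> z + z0" .
    have finZ: "finite ?Z" using Z(2) V finite_subset by blast
    have U': "arc_degree U v \<le> z + z0" if "v \<in> V" for v using U(2)[OF that] by linarith
    obtain p where "distinct p" "2 \<le> length p" "length p \<le> 5" "hd p = ?x" "last p = ?y" "set p \<subseteq> V"
      "set_mset (path_arcs p) \<subseteq> E" "set_mset (path_arcs p) \<inter> U = {}" "(set p - {?x, ?y}) \<inter> ?Z = {}"
      using link_exists[OF V E deg _ _ \<open>?x \<noteq> ?y\<close> finZ cZ U(1) U' num(5,6)] sk(4)[OF ij'] by blast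
    then show ?thesis unfolding Q_def eq F_def by (intro exI[of _ p]) auto
  qed
  have cI: "5 * card I \<le> l * zh"
  proof -
    have "card I = (\<Sum>i<r. length (SK i) - 1)" unfolding I_def by (subst card_SigmaI) auto
    also have "\<dots> \<le> (\<Sum>i<r. length (SK i))" by (rule sum_mono) simp
    finally show ?thesis using num(1) by linarith
  qed
  have "\<exists>f. (\<forall>i\<in>I. Q i (f i)) \<and>
    (\<forall>i\<in>I. \<forall>j\<in>I. i \<noteq> j \<longrightarrow> set_mset (path_arcs (f i)) \<inter> set_mset (path_arcs (f j)) = {}) \<and>
    (\<forall>i\<in>I. \<forall>j\<in>I. i \<noteq> j \<longrightarrow> fst i = fst j \<longrightarrow> (set (f i) - F i) \<inter> (set (f j) - F j) = {}) \<and>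
    (\<forall>v\<in>V. card {i \<in> I. v \<in> set (f i) - F i} \<le> l)"
  proof (rule greedy_paths[where z = z and zh = zh and h = "2 * h" and G = G])
    show "\<exists>p. Q ij p \<and> set_mset (path_arcs p) \<inter> U = {} \<and> (set p - F ij) \<inter> Z = {}"
      if "ij \<in> I" "card Z \<le> z" "Z \<subseteq> V" "finite U" "\<And>v. v \<in> V \<Longrightarrow> arc_degree U v \<le> z" for ij Z U
      by (rule step[OF that])
    show "distinct p \<and> length p \<le> 5 \<and> set p \<subseteq> V" if "Q ij p" for ij p using that by (simp add: Q_def)
  qed (fact finI V(1) rowF rowG cI num(2,3,4))+
  then obtain f where f: "\<forall>i\<in>I. Q i (f i)"
    "\<forall>i\<in>I. \<forall>j\<in>I. i \<noteq> j \<longrightarrow> set_mset (path_arcs (f i)) \<inter> set_mset (path_arcs (f j)) = {}"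
    "\<forall>i\<in>I. \<forall>j\<in>I. i \<noteq> j \<longrightarrow> fst i = fst j \<longrightarrow> (set (f i) - F i) \<inter> (set (f j) - F j) = {}"
    "\<forall>v\<in>V. card {i \<in> I. v \<in> set (f i) - F i} \<le> l" by (elim exE conjE)
  have fQ: "distinct (f (i, j))" "2 \<le> length (f (i, j))" "hd (f (i, j)) = last (SK i ! j)"
    "last (f (i, j)) = hd (SK i ! Suc j)" "set_mset (path_arcs (f (i, j))) \<subseteq> E"
    "(set (f (i, j)) - F (i, j)) \<inter> set (concat (SK i)) = {}" if "i < r" "Suc j < length (SK i)" for i j
  proof -
    have "(i, j) \<in> I" using that by (auto simp: I_def)
    then have "Q (i, j) (f (i, j))" using f(1) by blast
    then show "distinct (f (i, j))" "2 \<le> length (f (i, j))" "hd (f (i, j)) = last (SK i ! j)"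
      "last (f (i, j)) = hd (SK i ! Suc j)" "set_mset (path_arcs (f (i, j))) \<subseteq> E"
      "(set (f (i, j)) - F (i, j)) \<inter> set (concat (SK i)) = {}" by (simp_all add: Q_def)
  qed
  have inner: "set (butlast (tl (f (i, j)))) \<subseteq> set (f (i, j)) - F (i, j)" if "i < r" "Suc j < length (SK i)" for i j
  proof -
    note q = fQ[OF that]
    obtain a p where p: "f (i, j) = a # p" using q(2) by (cases "f (i, j)") auto
    have pne: "p \<noteq> []" using q(2) p by auto
    with p have "f (i, j) = a # butlast p @ [last p]" by simp
    then have "set (butlast p) \<subseteq> set (f (i, j)) - {hd (f (i, j)), last (f (i, j))}" using q(1) by auto
    then show ?thesis using q(3,4) p pne by (simp add: F_def)
  qed
  define P where "P i = weave (SK i) (\<lambda>j. f (i, j))" for i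
  define U where "U = (\<Union>ij\<in>I. set_mset (path_arcs (f ij)))"
  have Pd: "distinct (P i)" if i: "i < r" for i
  proof -
    have "distinct (P i) \<and> set (P i) \<subseteq> set (concat (SK i)) \<union> (\<Union>j\<in>{j. Suc j < length (SK i)}. set (butlast (tl (f (i, j)))))"
      unfolding P_def
    proof (rule weave_distinct)
      show "distinct (f (i, j)) \<and> set (butlast (tl (f (i, j)))) \<inter> set (concat (SK i)) = {}" if "Suc j < length (SK i)" for j
        using fQ(1,6)[OF i that] inner[OF i that] by blast
      show "set (butlast (tl (f (i, j)))) \<inter> set (butlast (tl (f (i, k)))) = {}"
        if "Suc j < length (SK i)" "Suc k < length (SK i)" "j \<noteq> k" for j k
      proof -
        have "(i, j) \<in> I" "(i, k) \<in> I" using i that by (auto simp: I_def)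
        then have "(set (f (i, j)) - F (i, j)) \<inter> (set (f (i, k)) - F (i, k)) = {}" using f(3) that(3) by simp
        then show ?thesis using inner[OF i that(1)] inner[OF i that(2)] by blast
      qed
    qed (rule sk(3)[OF i])
    then show ?thesis by blast
  qed
  have Pp: "P i \<noteq> [] \<and> hd (P i) = hd (concat (SK i)) \<and> last (P i) = last (concat (SK i)) \<and>
    path_arcs (P i) = (\<Sum>s\<leftarrow>SK i. path_arcs s) + (\<Sum>j<length (SK i) - 1. path_arcs (f (i, j)))" if i: "i < r" for i
    unfolding P_def by (rule weave_props) (use sk(1,2)[OF i] fQ[OF i] in auto)
  have fd: "distinct (f ij)" if "ij \<in> I" for ij using f(1) that by (simp add: Q_def)
  have sumU: "(\<Sum>ij\<in>I. path_arcs (f ij)) = mset_set U"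
    unfolding U_def
  proof (rule sum_path_arcs_disjoint[OF finI fd])
    show "set_mset (path_arcs (f i)) \<inter> set_mset (path_arcs (f j)) = {}" if "i \<in> I" "j \<in> I" "i \<noteq> j" for i j
      using f(2) that by blast
  qed
  have "(\<Sum>i<r. path_arcs (P i)) = (\<Sum>i<r. \<Sum>s\<leftarrow>SK i. path_arcs s) + (\<Sum>i<r. \<Sum>j<length (SK i) - 1. path_arcs (f (i, j)))"
    using Pp by (simp add: sum.distrib)
  also have "(\<Sum>i<r. \<Sum>j<length (SK i) - 1. path_arcs (f (i, j))) = (\<Sum>ij\<in>I. path_arcs (f ij))"
    unfolding I_def by (subst sum.Sigma) (auto simp: case_prod_beta)
  finally have sumP: "(\<Sum>i<r. path_arcs (P i)) = (\<Sum>i<r. \<Sum>s\<leftarrow>SK i. path_arcs s) + mset_set U" using sumU by simp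
  have UE: "U \<subseteq> E" unfolding U_def using f(1) by (intro UN_least) (simp add: Q_def)
  have degU: "arc_degree U x \<le> 2 * (l + 2 * h)" if x: "x \<in> V" for x
  proof -
    have "arc_degree U x \<le> (\<Sum>ij\<in>I. arc_degree (set_mset (path_arcs (f ij))) x)"
      unfolding U_def using finI by (intro arc_degree_UN) auto
    also have "\<dots> \<le> (\<Sum>ij\<in>I. 2 * (of_bool (x \<in> set (f ij) - F ij) + of_bool (x \<in> F ij)))"
      using fd by (intro sum_mono order_trans[OF arc_degree_path]) auto
    also have "\<dots> = 2 * (card {ij \<in> I. x \<in> set (f ij) - F ij} + card {ij \<in> I. x \<in> F ij})"
      using finI unfolding sum_distrib_left[symmetric] sum.distrib by (simp add: Int_def del: Diff_iff)
    also have "\<dots> \<le> 2 * (l + 2 * h)" using bspec[OF f(4) x] rowF[OF x] by (intro mult_le_mono2 add_mono)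
    finally show ?thesis .
  qed
  show ?thesis
    by (rule exI[of _ P], rule exI[of _ U]) (use UE Pd Pp sumP degU in simp)
qed

section \<open>Hubs, strands and tokens\<close>

lemma sum_path_arcs_unique:
  assumes "finite I" "(\<Sum>i\<in>I. path_arcs (f i)) = mset_set X"
    and "i \<in> I" "j \<in> I" "e \<in># path_arcs (f i)" "e \<in># path_arcs (f j)"
  shows "i = j"
proof (rule ccontr)
  assume "i \<noteq> j"
  have "(\<Sum>i\<in>I. path_arcs (f i)) = path_arcs (f i) + (path_arcs (f j) + (\<Sum>i\<in>I - {i} - {j}. path_arcs (f i)))"
    using assms(1,3,4) \<open>i \<noteq> j\<close> by (simp add: sum.remove[of _ i] sum.remove[of _ j])
  then have "count (mset_set X) e \<ge> count (path_arcs (f i)) e + count (path_arcs (f j)) e"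
    unfolding assms(2)[symmetric] by simp
  moreover have "count (path_arcs (f i)) e \<ge> 1" "count (path_arcs (f j)) e \<ge> 1" using assms(5,6) by auto
  moreover have "count (mset_set X) e \<le> 1" by (simp add: count_mset_set')
  ultimately show False by linarith
qed

text \<open>Each path through \<open>z\<close> has an arc at \<open>z\<close>, and distinct paths
  have no arc in common.\<close>

lemma card_paths_through:
  assumes "finite S" "(\<Sum>s\<in>S. path_arcs s) = mset_set X" "finite X" "\<And>s. s \<in> S \<Longrightarrow> 2 \<le> length s"
  shows "card {s \<in> S. z \<in> set s} \<le> arc_degree X z"
proof -
  have "\<forall>s\<in>{s \<in> S. z \<in> set s}. \<exists>e. e \<in># path_arcs s \<and> (fst e = z \<or> snd e = z)"
  proof
    fix s assume "s \<in> {s \<in> S. z \<in> set s}"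
    then have "z \<in> set s" "2 \<le> length s" using assms(4) by auto
    from path_arcs_touch[OF this] show "\<exists>e. e \<in># path_arcs s \<and> (fst e = z \<or> snd e = z)" by blast
  qed
  then obtain h where h: "\<forall>s\<in>{s \<in> S. z \<in> set s}. h s \<in># path_arcs s \<and> (fst (h s) = z \<or> snd (h s) = z)"
    by (rule bchoice[THEN exE])
  have X: "e \<in> X" if "s \<in> S" "e \<in># path_arcs s" for s e
  proof -
    have "e \<in># (\<Sum>s\<in>S. path_arcs s)" using that assms(1) by (auto simp: set_mset_sum)
    then show ?thesis using assms(2,3) by simp
  qed
  show ?thesis
    unfolding arc_degree_def
  proof (rule card_inj_on_le[of h])
    show "inj_on h {s \<in> S. z \<in> set s}"
    proof (rule inj_onI)
      fix s t assume st: "s \<in> {s \<in> S. z \<in> set s}" "t \<in> {s \<in> S. z \<in> set s}" "h s = h t"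
      have "h s \<in># path_arcs s" "h s \<in># path_arcs t" using h st by auto
      then show "s = t" using sum_path_arcs_unique[OF assms(1,2), of s t "h s"] st by simp
    qed
    show "h ` {s \<in> S. z \<in> set s} \<subseteq> {e \<in> X. fst e = z \<or> snd e = z}"
    proof
      fix e assume "e \<in> h ` {s \<in> S. z \<in> set s}"
      then obtain s where "s \<in> S" "z \<in> set s" "e = h s" by blast
      then show "e \<in> {e \<in> X. fst e = z \<or> snd e = z}" using bspec[OF h, of s] X[of s e] by simp
    qed
  qed (use assms(3) in simp)
qed

text \<open>\<open>Wp\<close> and \<open>Wm\<close> are the hubs of positive and of negative excess,
  \<open>Vc\<close> is the core. By \<open>hub_out\<close> and \<open>hub_in\<close> the arcs on the
  minority side of a hub can be matched injectively to arcs between the hub and the core; strictness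
  leaves the spare vertex that \<open>inj_avoiding\<close> needs.\<close>

locale hubs =
  fixes V :: "'a set" and E :: "('a \<times> 'a) set" and Wp Wm Vc Ec
  assumes finV: "finite V" and EV: "E \<subseteq> V \<times> V" and asym: "\<And>x y. (x, y) \<in> E \<Longrightarrow> (y, x) \<notin> E"
    and WV: "Wp \<subseteq> V" "Wm \<subseteq> V" and WW: "Wp \<inter> Wm = {}"
    and Vc: "Vc = V - (Wp \<union> Wm)" and Ec: "Ec = E \<inter> Vc \<times> Vc"
    and hub_out: "\<And>w. w \<in> Wp \<Longrightarrow> card (ins E w) < card (outs E w \<inter> Vc)"
    and hub_in: "\<And>w. w \<in> Wm \<Longrightarrow> card (outs E w) < card (ins E w \<inter> Vc)"
begin

lemma finE: "finite E" using finV EV by (meson finite_SigmaI finite_subset)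

text \<open>The other end determines an arc at \<open>x\<close>, since there are no antiparallel
  arcs. For \<open>x\<close> in the core that end is a hub.\<close>

lemma arc_degree_hub_arcs:
  assumes "x \<in> V" shows "arc_degree (E - Ec) x < card V"
    and "x \<in> Vc \<Longrightarrow> arc_degree (E - Ec) x \<le> card (Wp \<union> Wm)"
proof -
  let ?D = "{e \<in> E - Ec. fst e = x \<or> snd e = x}" and ?o = "\<lambda>e. if fst e = x then snd e else fst e"
  have irr: "(y, y) \<notin> E" for y using asym by blast
  have inj: "inj_on ?o ?D"
  proof (rule inj_onI)
    fix e e' assume e: "e \<in> ?D" "e' \<in> ?D" "?o e = ?o e'"
    show "e = e'" using e asym[of x "?o e"] by (cases e; cases e') (auto split: if_splits)
  qed
  have "?o ` ?D \<subseteq> V - {x}" using EV irr by auto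
  from card_inj_on_le[OF inj this] have "card ?D \<le> card (V - {x})" using finV by simp
  also have "\<dots> < card V" using finV assms by (rule card_Diff1_less)
  finally show "arc_degree (E - Ec) x < card V" by (simp add: arc_degree_def)
  assume x: "x \<in> Vc"
  have "?o ` ?D \<subseteq> Wp \<union> Wm" using EV x by (auto simp: Ec Vc)
  from card_inj_on_le[OF inj this] show "arc_degree (E - Ec) x \<le> card (Wp \<union> Wm)"
    using finV WV finite_subset by (fastforce simp: arc_degree_def)
qed

text \<open>The last three clauses prepare the later use. A strand from \<open>Wp\<close> to the
  core has to be a start token and one from the core to \<open>Wm\<close> an end token. Strands from
  \<open>Wp\<close> to \<open>Wm\<close> become complete paths, and being single arcs between hubs
  they are few.\<close>

definition strand :: "'a list \<Rightarrow> bool" where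
  "strand s \<longleftrightarrow> distinct s \<and> 2 \<le> length s \<and> length s \<le> 4 \<and> set s \<subseteq> V \<and> hd s \<in> Vc \<union> Wp \<and> last s \<in> Vc \<union> Wm \<and>
     set s \<inter> (Wp \<union> Wm) \<noteq> {} \<and> card (set s \<inter> (Wp \<union> Wm)) \<le> 2 \<and> card (set s \<inter> Vc) \<le> 2 \<and>
     (hd s \<in> Wp \<longrightarrow> last s \<in> Vc \<longrightarrow> set (butlast s) \<subseteq> Wp) \<and>
     (hd s \<in> Vc \<longrightarrow> last s \<in> Wm \<longrightarrow> set (tl s) \<subseteq> Wm) \<and>
     (hd s \<in> Wp \<longrightarrow> last s \<in> Wm \<longrightarrow> length s = 2)"

text \<open>Every arc entering a vertex of \<open>Wp\<close> is continued by an arc into the core, and every arc leaving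
  a vertex of \<open>Wm\<close> is preceded by an arc from the core.\<close>

lemma strands_exist:
  "\<exists>S. finite S \<and> (\<forall>s\<in>S. strand s) \<and> (\<Sum>s\<in>S. path_arcs s) = mset_set (E - Ec)"
proof -
  have irr: "(y, y) \<notin> E" for y using asym by blast
  have disj: "x \<notin> Wp" "x \<notin> Wm" if "x \<in> Vc" for x using that by (auto simp: Vc)
  have disj': "x \<notin> Wm" if "x \<in> Wp" for x using that WW by blast
  have finVc: "finite Vc" using finV by (simp add: Vc)
  have "\<forall>w\<in>Wm. \<exists>f. inj_on f (outs E w) \<and> f ` outs E w \<subseteq> ins E w \<inter> Vc"
  proof
    fix w assume w: "w \<in> Wm"
    show "\<exists>f. inj_on f (outs E w) \<and> f ` outs E w \<subseteq> ins E w \<inter> Vc"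
      using inj_avoiding[OF finite_outs[OF finE] finite_Int[OF disjI2[OF finVc]] hub_in[OF w], where forb = "\<lambda>_. undefined"]
      by (elim exE conjE) (intro exI conjI)
  qed
  then obtain \<psi> where "\<forall>w\<in>Wm. inj_on (\<psi> w) (outs E w) \<and> \<psi> w ` outs E w \<subseteq> ins E w \<inter> Vc"
    by (rule bchoice[THEN exE])
  note psi = bspec[OF this]
  have \<psi>: "inj_on (\<psi> w) (outs E w)" "\<And>v. (w, v) \<in> E \<Longrightarrow> (\<psi> w v, w) \<in> E \<and> \<psi> w v \<in> Vc" if "w \<in> Wm" for w
  proof -
    show "inj_on (\<psi> w) (outs E w)" using psi[OF that] by blast
    fix v assume "(w, v) \<in> E"
    then have "v \<in> outs E w" by (simp add: outs_def)
    then have "\<psi> w v \<in> ins E w \<inter> Vc" using psi[OF that] by blast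
    then show "(\<psi> w v, w) \<in> E \<and> \<psi> w v \<in> Vc" by (simp add: ins_def)
  qed
  \<comment> \<open>An arc from \<open>u\<close> in \<open>Wm\<close> to \<open>w\<close> in
    \<open>Wp\<close> is extended at both ends. Forbidding the value \<open>\<psi> u w\<close> keeps
    the two outer vertices of that strand distinct.\<close>
  have "\<forall>w\<in>Wp. \<exists>f. inj_on f (ins E w) \<and> f ` ins E w \<subseteq> outs E w \<inter> Vc \<and> (\<forall>u\<in>ins E w. f u \<noteq> \<psi> u w)"
  proof
    fix w assume w: "w \<in> Wp"
    show "\<exists>f. inj_on f (ins E w) \<and> f ` ins E w \<subseteq> outs E w \<inter> Vc \<and> (\<forall>u\<in>ins E w. f u \<noteq> \<psi> u w)"
      by (rule inj_avoiding[OF finite_ins[OF finE] finite_Int[OF disjI2[OF finVc]] hub_out[OF w]])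
  qed
  then obtain \<phi> where "\<forall>w\<in>Wp. inj_on (\<phi> w) (ins E w) \<and> \<phi> w ` ins E w \<subseteq> outs E w \<inter> Vc \<and> (\<forall>u\<in>ins E w. \<phi> w u \<noteq> \<psi> u w)"
    by (rule bchoice[THEN exE])
  note phi = bspec[OF this]
  have \<phi>: "inj_on (\<phi> w) (ins E w)" "\<And>u. (u, w) \<in> E \<Longrightarrow> (w, \<phi> w u) \<in> E \<and> \<phi> w u \<in> Vc \<and> \<phi> w u \<noteq> \<psi> u w" if "w \<in> Wp" for w
  proof -
    show "inj_on (\<phi> w) (ins E w)" using phi[OF that] by blast
    fix u assume "(u, w) \<in> E"
    then have "u \<in> ins E w" by (simp add: ins_def)
    then have "\<phi> w u \<in> outs E w \<inter> Vc" "\<phi> w u \<noteq> \<psi> u w" using phi[OF that] by blast+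
    then show "(w, \<phi> w u) \<in> E \<and> \<phi> w u \<in> Vc \<and> \<phi> w u \<noteq> \<psi> u w" by (simp add: outs_def)
  qed
  define g1 g2 where "g1 = (\<lambda>(u, v). (v, \<phi> v u))" and "g2 = (\<lambda>(u, v). (\<psi> u v, u))"
  define E1 E2 where "E1 = {e \<in> E. snd e \<in> Wp}" and "E2 = {e \<in> E. fst e \<in> Wm}"
  \<comment> \<open>\<open>g1\<close> and \<open>g2\<close> give the continuing and the preceding
    arcs; each arc of \<open>Pr\<close> generates one strand. The arcs of \<open>E1\<close> and
    \<open>E2\<close> all stay in \<open>Pr\<close>, because an added arc leads from
    \<open>Wp\<close> to the core or from the core to \<open>Wm\<close>.\<close>
  define Pr where "Pr = E - Ec - g1 ` E1 - g2 ` E2"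
  define \<sigma> where "\<sigma> = (\<lambda>(u, v). (if u \<in> Wm then [\<psi> u v] else []) @ [u, v] @ (if v \<in> Wp then [\<phi> v u] else []))"
  have fin: "finite Pr" "finite E1" "finite E2" using finE by (auto simp: Pr_def E1_def E2_def)
  have g1: "g1 e \<in> E - Ec" "fst (g1 e) \<in> Wp" "snd (g1 e) \<in> Vc" if "e \<in> E1" for e
    using that \<phi>(2) disj by (auto simp: E1_def g1_def Ec split: prod.splits)
  have g2: "g2 e \<in> E - Ec" "fst (g2 e) \<in> Vc" "snd (g2 e) \<in> Wm" if "e \<in> E2" for e
    using that \<psi>(2) disj by (auto simp: E2_def g2_def Ec split: prod.splits)
  have inj1: "inj_on g1 E1"
    using \<phi>(1) by (auto simp: g1_def E1_def inj_on_def ins_def)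
  have inj2: "inj_on g2 E2"
    using \<psi>(1) by (auto simp: g2_def E2_def inj_on_def outs_def)
  have E1Pr: "{e \<in> Pr. snd e \<in> Wp} = E1"
  proof
    show "E1 \<subseteq> {e \<in> Pr. snd e \<in> Wp}"
    proof
      fix e assume e: "e \<in> E1"
      then have "snd e \<in> Wp" "e \<in> E" by (auto simp: E1_def)
      moreover have "e \<notin> g1 ` E1" using g1(3) disj(1) \<open>snd e \<in> Wp\<close> by auto
      moreover have "e \<notin> g2 ` E2" using g2(3) disj' \<open>snd e \<in> Wp\<close> by auto
      moreover have "e \<notin> Ec" using disj(1) \<open>snd e \<in> Wp\<close> by (auto simp: Ec)
      ultimately show "e \<in> {e \<in> Pr. snd e \<in> Wp}" by (simp add: Pr_def)
    qed
  qed (auto simp: Pr_def E1_def)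
  have E2Pr: "{e \<in> Pr. fst e \<in> Wm} = E2"
  proof
    show "E2 \<subseteq> {e \<in> Pr. fst e \<in> Wm}"
    proof
      fix e assume e: "e \<in> E2"
      then have "fst e \<in> Wm" "e \<in> E" by (auto simp: E2_def)
      moreover have "e \<notin> g1 ` E1" using g1(2) disj' \<open>fst e \<in> Wm\<close> by auto
      moreover have "e \<notin> g2 ` E2" using g2(2) disj(2) \<open>fst e \<in> Wm\<close> by auto
      moreover have "e \<notin> Ec" using disj(2) \<open>fst e \<in> Wm\<close> by (auto simp: Ec)
      ultimately show "e \<in> {e \<in> Pr. fst e \<in> Wm}" by (simp add: Pr_def)
    qed
  qed (auto simp: Pr_def E2_def)
  have am: "path_arcs (\<sigma> e) = {#e#} + ((if snd e \<in> Wp then {#g1 e#} else {#}) + (if fst e \<in> Wm then {#g2 e#} else {#}))" for e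
    by (cases e) (auto simp: \<sigma>_def g1_def g2_def)
  have singles: "(\<Sum>e\<in>A. {#f e#}) = mset_set (f ` A)" if "finite A" "inj_on f A" for A and f :: "'a \<times> 'a \<Rightarrow> 'a \<times> 'a"
    using that by (induction A rule: finite_induct) auto
  have "(\<Sum>e\<in>Pr. path_arcs (\<sigma> e)) = (\<Sum>e\<in>Pr. {#e#}) +
      ((\<Sum>e\<in>Pr. if snd e \<in> Wp then {#g1 e#} else {#}) + (\<Sum>e\<in>Pr. if fst e \<in> Wm then {#g2 e#} else {#}))"
    unfolding am by (simp only: sum.distrib)
  also have "(\<Sum>e\<in>Pr. if snd e \<in> Wp then {#g1 e#} else {#}) = (\<Sum>e\<in>E1. {#g1 e#})"
    unfolding E1Pr[symmetric] using fin by (intro sum.inter_filter[symmetric])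
  also have "\<dots> = mset_set (g1 ` E1)" using fin inj1 by (intro singles)
  also have "(\<Sum>e\<in>Pr. if fst e \<in> Wm then {#g2 e#} else {#}) = (\<Sum>e\<in>E2. {#g2 e#})"
    unfolding E2Pr[symmetric] using fin by (intro sum.inter_filter[symmetric])
  also have "\<dots> = mset_set (g2 ` E2)" using fin inj2 by (intro singles)
  also have "(\<Sum>e\<in>Pr. {#e#}) = mset_set Pr" using singles[of Pr id] fin by simp
  also have "mset_set Pr + (mset_set (g1 ` E1) + mset_set (g2 ` E2)) = mset_set (E - Ec)"
  proof -
    have d: "g1 ` E1 \<inter> g2 ` E2 = {}"
    proof (rule ccontr)
      assume "\<not> ?thesis"
      then obtain x where x: "x \<in> g1 ` E1" "x \<in> g2 ` E2" by blast
      have "fst x \<in> Wp" using x(1) g1(2) by blast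
      moreover have "fst x \<in> Vc" using x(2) g2(2) by blast
      ultimately show False using disj(1) by simp
    qed
    have "mset_set (g1 ` E1) + mset_set (g2 ` E2) = mset_set (g1 ` E1 \<union> g2 ` E2)"
      using fin d by (intro mset_set_Union[symmetric]) auto
    moreover have "mset_set Pr + mset_set (g1 ` E1 \<union> g2 ` E2) = mset_set (Pr \<union> (g1 ` E1 \<union> g2 ` E2))"
      using fin by (intro mset_set_Union[symmetric]) (auto simp: Pr_def)
    moreover have "Pr \<union> (g1 ` E1 \<union> g2 ` E2) = E - Ec" using g1(1) g2(1) by (auto simp: Pr_def)
    ultimately show ?thesis by simp
  qed
  finally have sum: "(\<Sum>e\<in>Pr. path_arcs (\<sigma> e)) = mset_set (E - Ec)" .
  have len: "2 \<le> length (\<sigma> e)" for e by (auto simp: \<sigma>_def split: prod.splits)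
  have inj: "inj_on \<sigma> Pr"
  proof (rule inj_onI)
    fix e e' assume e: "e \<in> Pr" "e' \<in> Pr" "\<sigma> e = \<sigma> e'"
    have "path_arcs (\<sigma> e) \<noteq> {#}" using len[of e] by (simp add: path_arcs_eq_empty)
    then obtain a where "a \<in># path_arcs (\<sigma> e)" by (meson multiset_nonemptyE)
    then show "e = e'" using sum_path_arcs_unique[OF fin(1) sum e(1,2), of a] e(3) by simp
  qed
  have "strand (\<sigma> e)" if e: "e \<in> Pr" for e
  proof -
    obtain u v where uv: "e = (u, v)" by (cases e)
    have uvE: "(u, v) \<in> E" "(u, v) \<notin> Ec" using e by (auto simp: uv Pr_def)
    then have V: "u \<in> V" "v \<in> V" "u \<noteq> v" using EV irr by auto
    have W: "u \<in> Wp \<or> u \<in> Wm \<or> v \<in> Wp \<or> v \<in> Wm" using uvE V by (auto simp: Ec Vc)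
    have u: "u \<in> Vc \<or> u \<in> Wp \<or> u \<in> Wm" and v: "v \<in> Vc \<or> v \<in> Wp \<or> v \<in> Wm" using V by (auto simp: Vc)
    have VcV: "Vc \<subseteq> V" by (auto simp: Vc)
    have ps: "(\<psi> u v, u) \<in> E" "\<psi> u v \<in> Vc" "\<psi> u v \<noteq> v" "\<psi> u v \<noteq> u" if "u \<in> Wm"
      using \<psi>(2)[OF that uvE(1)] asym[OF uvE(1)] irr by auto
    have ph: "(v, \<phi> v u) \<in> E" "\<phi> v u \<in> Vc" "\<phi> v u \<noteq> v" "\<phi> v u \<noteq> u" "\<phi> v u \<noteq> \<psi> u v" if "v \<in> Wp"
      using \<phi>(2)[OF that uvE(1)] asym[OF uvE(1)] irr by auto
    have c: "card (insert a (insert b {})) \<le> 2" for a b :: 'a by (simp add: card_insert_if)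
    have sub2: "card A \<le> 2" if "A \<subseteq> {a, b}" for A and a b :: 'a
      using card_mono[OF _ that] c[of a b] by simp
    have sW: "set (\<sigma> e) \<inter> (Wp \<union> Wm) \<subseteq> {u, v}"
      using ps(2) ph(2) disj by (auto simp: uv \<sigma>_def)
    have sVc: "card (set (\<sigma> e) \<inter> Vc) \<le> 2"
    proof -
      have "set (\<sigma> e) \<inter> Vc \<subseteq> {if u \<in> Wm then \<psi> u v else u, if v \<in> Wp then \<phi> v u else v}"
        using disj by (auto simp: uv \<sigma>_def)
      then show ?thesis by (rule sub2)
    qed
    have "distinct (\<sigma> e)" using V ps ph by (auto simp: uv \<sigma>_def)
    moreover have "length (\<sigma> e) \<le> 4" by (simp add: uv \<sigma>_def)
    moreover have "set (\<sigma> e) \<subseteq> V" using V ps(2) ph(2) VcV by (auto simp: uv \<sigma>_def)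
    moreover have "hd (\<sigma> e) \<in> Vc \<union> Wp" using ps(2) u by (auto simp: uv \<sigma>_def)
    moreover have "last (\<sigma> e) \<in> Vc \<union> Wm" using ph(2) v by (auto simp: uv \<sigma>_def)
    moreover have "set (\<sigma> e) \<inter> (Wp \<union> Wm) \<noteq> {}" using W by (auto simp: uv \<sigma>_def)
    moreover have "hd (\<sigma> e) \<in> Wp \<longrightarrow> last (\<sigma> e) \<in> Vc \<longrightarrow> set (butlast (\<sigma> e)) \<subseteq> Wp"
      using ps(2) disj disj' by (auto simp: uv \<sigma>_def)
    moreover have "hd (\<sigma> e) \<in> Vc \<longrightarrow> last (\<sigma> e) \<in> Wm \<longrightarrow> set (tl (\<sigma> e)) \<subseteq> Wm"
      using ph(2) disj disj' by (auto simp: uv \<sigma>_def)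
    moreover have "hd (\<sigma> e) \<in> Wp \<longrightarrow> last (\<sigma> e) \<in> Wm \<longrightarrow> length (\<sigma> e) = 2"
      using ps(2) ph(2) disj disj' by (auto simp: uv \<sigma>_def)
    ultimately show ?thesis unfolding strand_def using len[of e] sub2[OF sW] sVc by simp
  qed
  moreover have "(\<Sum>s\<in>\<sigma> ` Pr. path_arcs s) = mset_set (E - Ec)"
    using sum sum.reindex[OF inj, of path_arcs] by simp
  ultimately show ?thesis using fin(1) by (intro exI[of _ "\<sigma> ` Pr"]) auto
qed

end

section \<open>Tokens and the plan for pairing them\<close>

definition own :: "'a set \<Rightarrow> ('a \<Rightarrow> nat) \<Rightarrow> 'a list multiset" where
  "own W g = (\<Sum>x\<in>W. replicate_mset (g x) [x])"

lemma own_add: "own W f + own W g = own W (\<lambda>x. f x + g x)"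
  unfolding own_def sum.distrib[symmetric]
  by (intro sum.cong refl) (simp add: multiset_eq_iff)

lemma own_filter:
  assumes "finite W"
  shows "size (filter_mset Q (own W g)) = (\<Sum>x\<in>W. if Q [x] then g x else 0)"
  unfolding own_def using assms
proof (induction W)
  case (insert x W)
  have "size (filter_mset Q (replicate_mset k y)) = (if Q y then k else 0)" for k and y :: "'a list"
    by (induction k) auto
  then show ?case using insert by simp
qed simp

lemma own_mem: "finite W \<Longrightarrow> A \<in># own W g \<longleftrightarrow> (\<exists>x\<in>W. 0 < g x \<and> A = [x])"
  unfolding own_def by (auto simp: set_mset_sum split: if_splits)

lemma own_arcs: "finite W \<Longrightarrow> (\<Sum>A\<in>#own W g. path_arcs A) = {#}"
proof -
  assume fin: "finite W"
  have "image_mset path_arcs (own W g) = image_mset (\<lambda>_. {#}) (own W g)"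
    by (rule image_mset_cong) (use own_mem[OF fin] in auto)
  then show ?thesis by (simp only: sum_mset.neutral_const)
qed

lemma size_own: "finite W \<Longrightarrow> size (own W g) = sum g W"
  using own_filter[of W "\<lambda>_. True" g] by simp

lemma size_filter_mset_mono:
  "(\<And>A. A \<in># M \<Longrightarrow> P A \<Longrightarrow> Q A) \<Longrightarrow> size (filter_mset P M) \<le> size (filter_mset Q M)"
  by (induction M) (auto simp: le_SucI)

lemma size_ge_1_mem: "1 \<le> size M \<Longrightarrow> \<exists>A. A \<in># M"
  by (cases M) auto

lemma set_butlast_last: "A \<noteq> [] \<Longrightarrow> set A = insert (last A) (set (butlast A))"
  by (induction A) auto

lemma set_hd_tl: "B \<noteq> [] \<Longrightarrow> set B = insert (hd B) (set (tl B))"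
  by (cases B) auto

lemma card_index_filter: "card {c. c < length xs \<and> Q (xs ! c)} = size (filter_mset Q (mset xs))"
  by (metis length_filter_conv_card mset_filter size_mset)

context hubs
begin

text \<open>Only the last vertex lies in the core, so a path of the core can be glued on without
  repeating a vertex; the condition on \<open>hd A\<close> makes the result start
  legitimately.\<close>

definition tokA :: "'a list \<Rightarrow> bool" where
  "tokA A \<longleftrightarrow> A \<noteq> [] \<and> distinct A \<and> length A \<le> 4 \<and> last A \<in> Vc \<and> set (butlast A) \<subseteq> Wp \<and> excess_at E (hd A) > 0"

definition tokB :: "'a list \<Rightarrow> bool" where
  "tokB B \<longleftrightarrow> B \<noteq> [] \<and> distinct B \<and> length B \<le> 4 \<and> hd B \<in> Vc \<and> set (tl B) \<subseteq> Wm \<and> excess_at E (last B) < 0"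

text \<open>A start token is an initial arm ending in the core, or a core vertex of positive excess; an end
  token is its dual. A plan says which start and end tokens (\<open>PL\<close>) are to be joined
  by paths, via which strands (\<open>cls\<close>), and which tokens (\<open>TA\<close>, \<open>TB\<close>) are left over.\<close>

definition plan where
  "plan PL cls TA TB SC Sg \<longleftrightarrow>
     mset_set (E - Ec) = (\<Sum>q\<in>#mset PL. path_arcs (fst q) + path_arcs (snd q)) +
       (\<Sum>i<length PL. \<Sum>s\<leftarrow>cls i. path_arcs s) + (\<Sum>A\<in>#TA. path_arcs A) + (\<Sum>B\<in>#TB. path_arcs B) +
       (\<Sum>s\<in>SC. path_arcs s) \<and>
     (\<forall>q\<in>set PL. tokA (fst q) \<and> tokB (snd q)) \<and> (\<forall>A\<in>#TA. tokA A) \<and> (\<forall>B\<in>#TB. tokB B) \<and>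
     (\<forall>i<length PL. if last (fst (PL ! i)) = hd (snd (PL ! i)) then cls i = []
        else distinct (concat (fst (PL ! i) # cls i @ [snd (PL ! i)]))) \<and>
     (\<forall>i<length PL. \<forall>s\<in>set (cls i). s \<noteq> [] \<and> length s \<le> 4 \<and> hd s \<in> Vc \<and> last s \<in> Vc) \<and>
     (\<forall>x\<in>Vc. size {#A \<in># mset (map fst PL) + TA. hd A = x#} = nat (excess_at E x)) \<and>
     (\<forall>x\<in>Vc. size {#B \<in># mset (map snd PL) + TB. last B = x#} = nat (- excess_at E x)) \<and>
     finite SC \<and> (\<forall>s\<in>SC. distinct s \<and> 2 \<le> length s \<and> hd s \<in> Wp \<and> last s \<in> Wm) \<and>
     Sg \<subseteq> Vc \<and> (\<forall>A\<in>#TA. last A \<in> Sg) \<and> (\<forall>B\<in>#TB. hd B \<in> Vc - Sg) \<and>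
     (\<forall>x\<in>Sg. \<exists>A\<in>#TA. last A = x) \<and> (\<forall>x\<in>Vc - Sg. \<exists>B\<in>#TB. hd B = x) \<and> size TA = size TB"

lemma excess_hubs: "w \<in> Wp \<Longrightarrow> excess_at E w > 0" "w \<in> Wm \<Longrightarrow> excess_at E w < 0"
proof -
  have "card (outs E w \<inter> Vc) \<le> card (outs E w)" "card (ins E w \<inter> Vc) \<le> card (ins E w)"
    using finE by (auto intro!: card_mono)
  then show "w \<in> Wp \<Longrightarrow> excess_at E w > 0" "w \<in> Wm \<Longrightarrow> excess_at E w < 0"
    using hub_out[of w] hub_in[of w] excess_at_eq[OF finE, of w] by auto
qed

text \<open>Start tokens are the strands from \<open>Wp\<close> to the core and one token
  \<open>[x]\<close> for each unit of positive excess at a core vertex \<open>x\<close>; end tokens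
  are dual. Together with the strands from hub to hub, the start tokens number exactly
  \<open>X\<close>. A supply of \<open>3 * n\<close> pairs hosts the strands running from core to
  core; the tokens left over are selected from the others with the help of
  \<open>sign_partition\<close>, and what remains is paired at will.\<close>

lemma token_plan:
  assumes n: "card V \<le> n" and om: "card (Wp \<union> Wm) \<le> om"
    and exc0: "\<forall>x\<in>Vc. excess_at E x \<noteq> 0 \<and> \<bar>excess_at E x\<bar> \<le> int tau"
    and X: "(\<Sum>v\<in>V. max (excess_at E v) 0) = int X"
    and num: "2 * om + 2 * tau \<le> n" "om * om + 6 * n \<le> X" "1 \<le> n"
  shows "\<exists>PL cls TA TB SC Sg. plan PL cls TA TB SC Sg \<and>
    (\<forall>x\<in>Vc. card {i. i < length PL \<and> x \<in> set (concat (fst (PL ! i) # cls i @ [snd (PL ! i)]))} \<le> om + tau) \<and>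
    (\<forall>x\<in>Vc. size {#A \<in># TA. last A = x#} \<le> om + tau \<and> size {#B \<in># TB. hd B = x#} \<le> om + tau) \<and>
    (\<forall>i<length PL. length (cls i) \<le> om) \<and> (\<Sum>i<length PL. length (cls i)) \<le> om * n \<and> length PL + size TA \<le> X \<and>
    X \<le> om * om + 3 * n + 2 * size TA + 2 * (om + tau) \<and>
    (Wm = {} \<longrightarrow> int X \<le> int (3 * n + size TA) + (\<Sum>w\<in>Wp. excess_at E w))"
proof -
  let ?x = "excess_at E"
  note exc = bspec[OF exc0]
  obtain S where S: "finite S" "\<And>s. s \<in> S \<Longrightarrow> strand s" "(\<Sum>s\<in>S. path_arcs s) = mset_set (E - Ec)"
    using strands_exist by blast
  have finVc: "finite Vc" and VcV: "Vc \<subseteq> V" using finV by (auto simp: Vc)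
  have disjW: "x \<notin> Wp" "x \<notin> Wm" if "x \<in> Vc" for x using that by (auto simp: Vc)
  have st: "distinct s" "2 \<le> length s" "length s \<le> 4" "set s \<subseteq> V" "hd s \<in> Vc \<union> Wp" "last s \<in> Vc \<union> Wm"
    "set s \<inter> (Wp \<union> Wm) \<noteq> {}" "card (set s \<inter> (Wp \<union> Wm)) \<le> 2" "card (set s \<inter> Vc) \<le> 2"
    "hd s \<in> Wp \<Longrightarrow> last s \<in> Vc \<Longrightarrow> set (butlast s) \<subseteq> Wp" "hd s \<in> Vc \<Longrightarrow> last s \<in> Wm \<Longrightarrow> set (tl s) \<subseteq> Wm"
    "hd s \<in> Wp \<Longrightarrow> last s \<in> Wm \<Longrightarrow> length s = 2" "s \<noteq> []" if "s \<in> S" for s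
    using S(2)[OF that] by (auto simp: strand_def)
  \<comment> \<open>\<open>SA\<close> and \<open>SB\<close> become start and end tokens,
    \<open>SP\<close> has to be threaded into paths, and \<open>SC\<close> consists of complete
    paths.\<close>
  define SA SB SP SC where "SA = {s \<in> S. hd s \<in> Wp \<and> last s \<in> Vc}" and "SB = {s \<in> S. hd s \<in> Vc \<and> last s \<in> Wm}"
    and "SP = {s \<in> S. hd s \<in> Vc \<and> last s \<in> Vc}" and "SC = {s \<in> S. hd s \<in> Wp \<and> last s \<in> Wm}"
  have fin: "finite SA" "finite SB" "finite SP" "finite SC" using S(1) by (auto simp: SA_def SB_def SP_def SC_def)
  have sub: "SA \<subseteq> S" "SB \<subseteq> S" "SP \<subseteq> S" "SC \<subseteq> S" by (auto simp: SA_def SB_def SP_def SC_def)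
  have Seq: "S = SA \<union> (SB \<union> (SP \<union> SC))" using st(5,6) by (auto simp: SA_def SB_def SP_def SC_def)
  have dis: "SA \<inter> (SB \<union> (SP \<union> SC)) = {}" "SB \<inter> (SP \<union> SC) = {}" "SP \<inter> SC = {}"
    using disjW by (auto simp: SA_def SB_def SP_def SC_def)
  have ssum: "sum f S = sum f SA + (sum f SB + (sum f SP + sum f SC))" for f :: "'a list \<Rightarrow> 'c::comm_monoid_add"
    unfolding Seq using fin dis by (simp add: sum.union_disjoint)
  define ga gb where "ga x = nat (?x x)" and "gb x = nat (- ?x x)" for x
  have gle: "ga x + gb x \<le> tau" if "x \<in> Vc" for x using exc[OF that] by (auto simp: ga_def gb_def)
  \<comment> \<open>One own token of every core vertex is withheld from the hosting pairs, so that
    every core vertex still carries a token when the signs are chosen.\<close>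
  define pa pb where "pa x = (if 0 < ga x then 1 else 0 :: nat)" and "pb x = (if 0 < gb x then 1 else 0 :: nat)" for x
  define TAf TBf where "TAf = mset_set SA + own Vc (\<lambda>x. ga x - pa x)" and "TBf = mset_set SB + own Vc (\<lambda>x. gb x - pb x)"
  define TA0 TB0 where "TA0 = mset_set SA + own Vc ga" and "TB0 = mset_set SB + own Vc gb"
  have TA0f: "TA0 = TAf + own Vc pa"
  proof -
    have "own Vc (\<lambda>x. ga x - pa x) + own Vc pa = own Vc ga"
      unfolding own_add by (rule arg_cong[of _ _ "own Vc"]) (auto simp: pa_def)
    then show ?thesis by (simp add: TA0_def TAf_def add_ac)
  qed
  have TB0f: "TB0 = TBf + own Vc pb"
  proof -
    have "own Vc (\<lambda>x. gb x - pb x) + own Vc pb = own Vc gb"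
      unfolding own_add by (rule arg_cong[of _ _ "own Vc"]) (auto simp: pb_def)
    then show ?thesis by (simp add: TB0_def TBf_def add_ac)
  qed
  have tokA: "tokA A" if A: "A \<in># TA0" for A
  proof -
    consider "A \<in> SA" | y where "y \<in> Vc" "0 < ga y" "A = [y]" using A fin finVc by (auto simp: TA0_def own_mem)
    then show ?thesis
    proof cases
      case 1
      then have "A \<in> S" "hd A \<in> Wp" "last A \<in> Vc" by (auto simp: SA_def)
      then show ?thesis using st[of A] excess_hubs(1) by (simp add: tokA_def)
    qed (simp add: tokA_def ga_def)
  qed
  have tokB: "tokB B" if B: "B \<in># TB0" for B
  proof -
    consider "B \<in> SB" | y where "y \<in> Vc" "0 < gb y" "B = [y]" using B fin finVc by (auto simp: TB0_def own_mem)
    then show ?thesis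
    proof cases
      case 1
      then have "B \<in> S" "hd B \<in> Vc" "last B \<in> Wm" by (auto simp: SB_def)
      then show ?thesis using st[of B] excess_hubs(2) by (simp add: tokB_def)
    qed (simp add: tokB_def gb_def)
  qed
  have thrA: "size {#A \<in># TA0. z \<in> set A#} = card {s \<in> SA. z \<in> set s} + (if z \<in> Vc then ga z else 0)" for z
  proof -
    have "(\<Sum>y\<in>Vc. if z \<in> set [y] then ga y else 0) = (\<Sum>y\<in>Vc. if y = z then ga y else 0)"
      by (intro sum.cong) auto
    then show ?thesis using own_filter[OF finVc, of "\<lambda>A. z \<in> set A" ga] finVc fin
      by (simp add: TA0_def sum.delta)
  qed
  have thrB: "size {#B \<in># TB0. z \<in> set B#} = card {s \<in> SB. z \<in> set s} + (if z \<in> Vc then gb z else 0)" for z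
  proof -
    have "(\<Sum>y\<in>Vc. if z \<in> set [y] then gb y else 0) = (\<Sum>y\<in>Vc. if y = z then gb y else 0)"
      by (intro sum.cong) auto
    then show ?thesis using own_filter[OF finVc, of "\<lambda>A. z \<in> set A" gb] finVc fin
      by (simp add: TB0_def sum.delta)
  qed
  have cardS: "card {s \<in> S. z \<in> set s} = card {s \<in> SA. z \<in> set s} + (card {s \<in> SB. z \<in> set s} +
    (card {s \<in> SP. z \<in> set s} + card {s \<in> SC. z \<in> set s}))" for z
  proof -
    have c: "card {s \<in> Y. z \<in> set s} = (\<Sum>s\<in>Y. of_bool (z \<in> set s))" if "finite Y" for Y
      using that by (simp add: Int_def)
    show ?thesis unfolding c[OF S(1)] c[OF fin(1)] c[OF fin(2)] c[OF fin(3)] c[OF fin(4)] by (rule ssum)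
  qed
  have finX: "finite (E - Ec)" using finE by simp
  have cS: "card {s \<in> S. z \<in> set s} \<le> arc_degree (E - Ec) z" for z
    using card_paths_through[OF S(1,3) finX] st(2) by blast
  \<comment> \<open>The load of \<open>z\<close> by tokens and passing strands. It bounds the
    conflicts of a strand at \<open>z\<close> as well as the number of planned paths visiting
    \<open>z\<close>. At a core vertex it is small, since each strand there uses up an arc between
    that vertex and a hub.\<close>
  define thr where "thr z = size {#A \<in># TA0. z \<in> set A#} + size {#B \<in># TB0. z \<in> set B#} + card {s \<in> SP. z \<in> set s}" for z
  have thrVc: "thr z \<le> om + tau" if z: "z \<in> Vc" for z
  proof -
    have "card {s \<in> S. z \<in> set s} \<le> om" using cS[of z] arc_degree_hub_arcs(2)[of z] z VcV om by (meson le_trans subsetD)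
    then show ?thesis using cardS[of z] thrA[of z] thrB[of z] gle[OF z] z unfolding thr_def by simp
  qed
  have thrW: "thr z + 1 \<le> n" if z: "z \<in> V" "z \<notin> Vc" for z
  proof -
    have "card {s \<in> S. z \<in> set s} < n" using cS[of z] arc_degree_hub_arcs(1)[OF z(1)] n by linarith
    then show ?thesis using cardS[of z] thrA[of z] thrB[of z] z(2) unfolding thr_def by simp
  qed
  have exS: "arc_excess (mset_set (E - Ec)) v = int (card {s \<in> S. hd s = v}) - int (card {s \<in> S. last s = v})" for v
  proof -
    have "arc_excess (\<Sum>s\<in>#mset_set S. path_arcs s) v =
      int (size {#s \<in># mset_set S. hd s = v#}) - int (size {#s \<in># mset_set S. last s = v#})"
      using st(13) S(1) by (intro arc_excess_paths) auto
    then show ?thesis using S(1,3) by (simp add: sum_unfold_sum_mset)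
  qed
  have finEc: "finite Ec" using finE by (simp add: Ec)
  have splitE: "mset_set E = mset_set (E - Ec) + mset_set Ec"
    using mset_set_Diff_subset[of E Ec] finE by (simp add: Ec add_ac)
  have exW: "?x w = int (card {s \<in> S. hd s = w}) - int (card {s \<in> S. last s = w})" if w: "w \<in> Wp \<union> Wm" for w
  proof -
    have "outs Ec w = {}" "ins Ec w = {}" using w by (auto simp: Ec Vc outs_def ins_def)
    then have "excess_at Ec w = 0" using excess_at_eq[OF finEc, of w] by simp
    then show ?thesis using exS[of w] by (simp only: splitE arc_excess_add)
  qed
  have cardhd: "(\<Sum>w\<in>Wp. card {s \<in> S. hd s = w}) = card SA + card SC"
  proof -
    have fW: "finite Wp" using WV finV finite_subset by blast
    have "card {s \<in> S. hd s \<in> Wp} = (\<Sum>w\<in>Wp. card {s \<in> {s \<in> S. hd s \<in> Wp}. hd s = w})"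
      using size_partition_mset[OF fW, of "mset_set {s \<in> S. hd s \<in> Wp}" hd] S(1) by simp
    also have "\<dots> = (\<Sum>w\<in>Wp. card {s \<in> S. hd s = w})"
      by (intro sum.cong refl arg_cong[of _ _ card]) auto
    also have "{s \<in> S. hd s \<in> Wp} = SA \<union> SC" using st(6) by (auto simp: SA_def SC_def)
    also have "card (SA \<union> SC) = card SA + card SC" using fin dis by (intro card_Un_disjoint) auto
    finally show ?thesis by simp
  qed
  have cardlast: "(\<Sum>w\<in>Wm. card {s \<in> S. last s = w}) = card SB + card SC"
  proof -
    have fW: "finite Wm" using WV finV finite_subset by blast
    have "card {s \<in> S. last s \<in> Wm} = (\<Sum>w\<in>Wm. card {s \<in> {s \<in> S. last s \<in> Wm}. last s = w})"
      using size_partition_mset[OF fW, of "mset_set {s \<in> S. last s \<in> Wm}" last] S(1) by simp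
    also have "\<dots> = (\<Sum>w\<in>Wm. card {s \<in> S. last s = w})"
      by (intro sum.cong refl arg_cong[of _ _ card]) auto
    also have "{s \<in> S. last s \<in> Wm} = SB \<union> SC" using st(5) by (auto simp: SB_def SC_def)
    also have "card (SB \<union> SC) = card SB + card SC" using fin dis by (intro card_Un_disjoint) auto
    finally show ?thesis by simp
  qed
  have exWp: "?x w = int (card {s \<in> S. hd s = w})" if w: "w \<in> Wp" for w
  proof -
    have "{s \<in> S. last s = w} = {}" using st(6) w WW by (auto simp: Vc)
    then have "card {s \<in> S. last s = w} = 0" by (simp only: card.empty)
    then show ?thesis using exW[of w] w by simp
  qed
  have exWm: "- ?x w = int (card {s \<in> S. last s = w})" if w: "w \<in> Wm" for w
  proof -
    have "{s \<in> S. hd s = w} = {}" using st(5) w WW by (auto simp: Vc)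
    then have "card {s \<in> S. hd s = w} = 0" by (simp only: card.empty)
    then show ?thesis using exW[of w] w by simp
  qed
  have sumV: "(\<Sum>v\<in>V. f v) = (\<Sum>v\<in>Wp. f v) + ((\<Sum>v\<in>Wm. f v) + (\<Sum>v\<in>Vc. f v))" for f :: "'a \<Rightarrow> int"
  proof -
    have "V = Wp \<union> (Wm \<union> Vc)" using WV by (auto simp: Vc)
    then have "sum f V = sum f (Wp \<union> (Wm \<union> Vc))" by simp
    also have "\<dots> = sum f Wp + sum f (Wm \<union> Vc)"
      using WV finV WW by (intro sum.union_disjoint) (auto simp: Vc intro: finite_subset)
    also have "sum f (Wm \<union> Vc) = sum f Wm + sum f Vc"
      using WV finV by (intro sum.union_disjoint) (auto simp: Vc intro: finite_subset)
    finally show ?thesis .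
  qed
  have szA: "X = size TA0 + card SC"
  proof -
    have "(\<Sum>w\<in>Wp. max (?x w) 0) = int (card SA + card SC)"
      unfolding cardhd[symmetric] of_nat_sum by (intro sum.cong) (auto simp: exWp)
    moreover have "(\<Sum>w\<in>Wm. max (?x w) 0) = 0" using excess_hubs(2) by (intro sum.neutral) force
    moreover have "(\<Sum>w\<in>Vc. max (?x w) 0) = int (sum ga Vc)" unfolding of_nat_sum by (intro sum.cong) (auto simp: ga_def)
    moreover have "size TA0 = card SA + sum ga Vc" by (simp add: TA0_def size_own[OF finVc])
    ultimately show ?thesis using X sumV[of "\<lambda>v. max (?x v) 0"] by linarith
  qed
  have szB: "X = size TB0 + card SC"
  proof -
    have "(\<Sum>w\<in>Wm. max (- ?x w) 0) = int (card SB + card SC)"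
      unfolding cardlast[symmetric] of_nat_sum by (intro sum.cong) (auto simp: exWm)
    moreover have "(\<Sum>w\<in>Wp. max (- ?x w) 0) = 0" using excess_hubs(1) by (intro sum.neutral) force
    moreover have "(\<Sum>w\<in>Vc. max (- ?x w) 0) = int (sum gb Vc)" unfolding of_nat_sum by (intro sum.cong) (auto simp: gb_def)
    moreover have "size TB0 = card SB + sum gb Vc" by (simp add: TB0_def size_own[OF finVc])
    ultimately show ?thesis using X sum_excess_neg[OF finV EV] sumV[of "\<lambda>v. max (- ?x v) 0"] by linarith
  qed
  have SCle: "card SC \<le> om * om"
  proof -
    have fW: "finite (Wp \<union> Wm)" using WV finV finite_subset by (meson finite_UnI)
    have two: "s = [hd s, last s]" if "s \<in> SC" for s
      using st(12)[of s] that by (cases s rule: remdups_adj.cases) (auto simp: SC_def)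
    have "card SC \<le> card ((Wp \<union> Wm) \<times> (Wp \<union> Wm))"
    proof (rule card_inj_on_le[of "\<lambda>s. (hd s, last s)"])
      show "inj_on (\<lambda>s. (hd s, last s)) SC" by (intro inj_onI) (metis prod.inject two)
    qed (use fW in \<open>auto simp: SC_def\<close>)
    also have "\<dots> \<le> om * om" using om by (simp add: card_cartesian_product mult_le_mono)
    finally show ?thesis .
  qed
  have N6: "6 * n \<le> size TA0" "size TB0 = size TA0" using szA szB SCle num(2) by linarith+
  have cVc: "card Vc \<le> n" using card_mono[OF finV VcV] n by linarith
  have psz: "size (own Vc pa) \<le> n" "size (own Vc pb) \<le> n"
  proof -
    have "sum pa Vc \<le> (\<Sum>x\<in>Vc. 1)" "sum pb Vc \<le> (\<Sum>x\<in>Vc. 1)" by (intro sum_mono; simp add: pa_def pb_def)+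
    then show "size (own Vc pa) \<le> n" "size (own Vc pb) \<le> n" using cVc by (simp_all add: size_own[OF finVc])
  qed
  have clsB: "size {#B \<in># TB0. hd B = y#} \<le> om + tau" for y
  proof (cases "y \<in> Vc")
    case True
    have "size {#B \<in># TB0. hd B = y#} \<le> size {#B \<in># TB0. y \<in> set B#}"
      using tokB by (intro size_filter_mset_mono) (auto simp: tokB_def)
    then show ?thesis using thrVc[OF True] unfolding thr_def by linarith
  next
    case False
    then have "{#B \<in># TB0. hd B = y#} = {#}" using tokB by (auto simp: filter_mset_eq_conv tokB_def)
    then have "size {#B \<in># TB0. hd B = y#} = 0" by (simp only: size_empty)
    then show ?thesis by linarith
  qed
  have clsA: "size {#A \<in># TA0. last A = y#} \<le> om + tau" if y: "y \<in> Vc" for y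
  proof -
    have "size {#A \<in># TA0. last A = y#} \<le> size {#A \<in># TA0. y \<in> set A#}"
      using tokA by (intro size_filter_mset_mono) (auto simp: tokA_def)
    then show ?thesis using thrVc[OF y] unfolding thr_def by linarith
  qed
  \<comment> \<open>A strand has at most two hubs, each of load at most \<open>n - 1\<close>, and at
    most two core vertices, each of load at most \<open>om + tau\<close>. So at most
    \<open>2 * (n - 1) + 2 * (om + tau)\<close> of the \<open>3 * n\<close> colours are blocked for
    it.\<close>
  define m where "m = 3 * n"
  \<comment> \<open>A pair that hosts strands must consist of disjoint tokens, hence the condition
    that their core ends differ.\<close>
  have "\<exists>PL. length PL = m \<and> mset (map fst PL) \<subseteq># TAf \<and> mset (map snd PL) \<subseteq># TBf \<and>
    (\<forall>q\<in>set PL. last (fst q) \<noteq> hd (snd q))"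
  proof (rule pair_msets[where t = "om + tau"])
    show "size {#B \<in># TBf. hd B = y#} \<le> om + tau" for y using clsB[of y] unfolding TB0f by simp
    show "m \<le> size TAf" using N6 psz unfolding TA0f m_def by simp
    show "m + (om + tau) \<le> size TBf" using N6 psz num(1) unfolding TB0f m_def by simp
  qed
  then obtain PLm where PLm: "length PLm = m" "mset (map fst PLm) \<subseteq># TAf" "mset (map snd PLm) \<subseteq># TBf"
    "\<forall>q\<in>set PLm. last (fst q) \<noteq> hd (snd q)" by (elim exE conjE)
  obtain RA RB where RA: "TAf = mset (map fst PLm) + RA" and RB: "TBf = mset (map snd PLm) + RB"
    using PLm(2,3) by (auto simp: subset_mset.le_iff_add)
  define TA1 TB1 where "TA1 = RA + own Vc pa" and "TB1 = RB + own Vc pb"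
  have TA01: "TA0 = mset (map fst PLm) + TA1" and TB01: "TB0 = mset (map snd PLm) + TB1"
    unfolding TA0f TB0f RA RB TA1_def TB1_def by (simp_all add: add_ac)
  define bad where "bad s = {c. c < m \<and> set s \<inter> (set (fst (PLm ! c)) \<union> set (snd (PLm ! c))) \<noteq> {}}" for s
  define conf where "conf s s' \<longleftrightarrow> set s \<inter> set s' \<noteq> {}" for s s' :: "'a list"
  have "\<exists>col. \<forall>s\<in>SP. col s < m \<and> col s \<notin> bad s \<and> (\<forall>s'\<in>SP. s \<noteq> s' \<longrightarrow> conf s s' \<longrightarrow> col s \<noteq> col s')"
  proof (rule greedy_colouring)
    fix s assume s: "s \<in> SP"
    then have sS: "s \<in> S" using sub by blast
    have "{s' \<in> SP. conf s s'} \<subseteq> (\<Union>z\<in>set s. {s' \<in> SP. z \<in> set s'})" by (auto simp: conf_def)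
    then have "card {s' \<in> SP. conf s s'} \<le> card (\<Union>z\<in>set s. {s' \<in> SP. z \<in> set s'})"
      using fin by (intro card_mono) auto
    also have "\<dots> \<le> (\<Sum>z\<in>set s. card {s' \<in> SP. z \<in> set s'})" by (intro card_UN_le) auto
    finally have c1: "card {s' \<in> SP. conf s s'} \<le> (\<Sum>z\<in>set s. card {s' \<in> SP. z \<in> set s'})" .
    have "bad s \<inter> {..<m} \<subseteq> (\<Union>z\<in>set s. {c. c < length PLm \<and> z \<in> set (fst (PLm ! c))} \<union> {c. c < length PLm \<and> z \<in> set (snd (PLm ! c))})"
      using PLm(1) by (auto simp: bad_def)
    then have "card (bad s \<inter> {..<m}) \<le> card (\<Union>z\<in>set s. {c. c < length PLm \<and> z \<in> set (fst (PLm ! c))} \<union> {c. c < length PLm \<and> z \<in> set (snd (PLm ! c))})"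
      by (intro card_mono) auto
    also have "\<dots> \<le> (\<Sum>z\<in>set s. card ({c. c < length PLm \<and> z \<in> set (fst (PLm ! c))} \<union> {c. c < length PLm \<and> z \<in> set (snd (PLm ! c))}))"
      by (intro card_UN_le) auto
    also have "\<dots> \<le> (\<Sum>z\<in>set s. size {#A \<in># TA0. z \<in> set A#} + size {#B \<in># TB0. z \<in> set B#})"
    proof (rule sum_mono)
      fix z
      have "card {c. c < length PLm \<and> z \<in> set (fst (PLm ! c))} = size {#A \<in># mset (map fst PLm). z \<in> set A#}"
        using card_index_filter[of "map fst PLm" "\<lambda>A. z \<in> set A"] by (simp cong: conj_cong)
      moreover have "card {c. c < length PLm \<and> z \<in> set (snd (PLm ! c))} = size {#A \<in># mset (map snd PLm). z \<in> set A#}"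
        using card_index_filter[of "map snd PLm" "\<lambda>A. z \<in> set A"] by (simp cong: conj_cong)
      ultimately show "card ({c. c < length PLm \<and> z \<in> set (fst (PLm ! c))} \<union> {c. c < length PLm \<and> z \<in> set (snd (PLm ! c))}) \<le>
        size {#A \<in># TA0. z \<in> set A#} + size {#B \<in># TB0. z \<in> set B#}"
        unfolding TA01 TB01 by (intro order_trans[OF card_Un_le]) simp
    qed
    finally have "card {s' \<in> SP. conf s s'} + card (bad s \<inter> {..<m}) \<le> (\<Sum>z\<in>set s. thr z)"
      using c1 unfolding thr_def sum.distrib by linarith
    also have "\<dots> = (\<Sum>z\<in>set s \<inter> (Wp \<union> Wm). thr z) + (\<Sum>z\<in>set s \<inter> Vc. thr z)"
    proof -
      have "set s = (set s \<inter> (Wp \<union> Wm)) \<union> (set s \<inter> Vc)" using st(4)[OF sS] by (auto simp: Vc)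
      then have "(\<Sum>z\<in>set s. thr z) = (\<Sum>z\<in>(set s \<inter> (Wp \<union> Wm)) \<union> (set s \<inter> Vc). thr z)" by simp
      also have "\<dots> = (\<Sum>z\<in>set s \<inter> (Wp \<union> Wm). thr z) + (\<Sum>z\<in>set s \<inter> Vc. thr z)"
        by (intro sum.union_disjoint) (auto simp: Vc)
      finally show ?thesis .
    qed
    also have "(\<Sum>z\<in>set s \<inter> (Wp \<union> Wm). thr z) \<le> (\<Sum>z\<in>set s \<inter> (Wp \<union> Wm). n - 1)"
    proof (rule sum_mono)
      fix z assume "z \<in> set s \<inter> (Wp \<union> Wm)"
      then have "z \<in> V" "z \<notin> Vc" using WV by (auto simp: Vc)
      from thrW[OF this] show "thr z \<le> n - 1" by simp
    qed
    also have "\<dots> \<le> 2 * (n - 1)" using st(8)[OF sS] by simp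
    also have "(\<Sum>z\<in>set s \<inter> Vc. thr z) \<le> (\<Sum>z\<in>set s \<inter> Vc. om + tau)" by (rule sum_mono) (use thrVc in auto)
    also have "\<dots> = card (set s \<inter> Vc) * (om + tau)" by simp
    also have "\<dots> \<le> 2 * (om + tau)" by (rule mult_le_mono1[OF st(9)[OF sS]])
    also have "2 * (n - 1) + 2 * (om + tau) < m" using num(1,3) unfolding m_def by simp
    finally show "card {s' \<in> SP. conf s s'} + card (bad s \<inter> {..<m}) < m" by simp
  qed (use fin in \<open>auto simp: conf_def\<close>)
  then obtain col where col: "\<forall>s\<in>SP. col s < m \<and> col s \<notin> bad s \<and> (\<forall>s'\<in>SP. s \<noteq> s' \<longrightarrow> conf s s' \<longrightarrow> col s \<noteq> col s')" ..
  define a b where "a y = size {#A \<in># TA1. last A = y#}" and "b y = size {#B \<in># TB1. hd B = y#}" for y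
  have memA1: "A \<in># TA0" if "A \<in># TA1" for A using that by (simp add: TA01)
  have memB1: "B \<in># TB0" if "B \<in># TB1" for B using that by (simp add: TB01)
  have ab1: "1 \<le> a y + b y" if y: "y \<in> Vc" for y
  proof -
    have "0 < ga y \<or> 0 < gb y" using exc[OF y] by (auto simp: ga_def gb_def)
    then show ?thesis
    proof
      assume "0 < ga y"
      then have "[y] \<in># TA1" using y finVc by (simp add: TA1_def own_mem pa_def)
      then have "[y] \<in># {#A \<in># TA1. last A = y#}" by simp
      then have "a y \<noteq> 0" unfolding a_def by (metis empty_iff set_mset_empty size_eq_0_iff_empty)
      then show ?thesis by simp
    next
      assume "0 < gb y"
      then have "[y] \<in># TB1" using y finVc by (simp add: TB1_def own_mem pb_def)
      then have "[y] \<in># {#B \<in># TB1. hd B = y#}" by simp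
      then have "b y \<noteq> 0" unfolding b_def by (metis empty_iff set_mset_empty size_eq_0_iff_empty)
      then show ?thesis by simp
    qed
  qed
  have al: "a y \<le> om + tau" if "y \<in> Vc" for y using clsA[OF that] unfolding TA01 a_def by simp
  have bl: "b y \<le> om + tau" for y using clsB[of y] unfolding TB01 b_def by simp
  have suma: "sum a Vc = size TA1"
    unfolding a_def using tokA memA1 finVc by (intro size_partition_mset[symmetric]) (auto simp: tokA_def)
  have sumb: "sum b Vc = size TB1"
    unfolding b_def using tokB memB1 finVc by (intro size_partition_mset[symmetric]) (auto simp: tokB_def)
  have szAB: "size TB1 = size TA1" "size TA0 = m + size TA1"
    using N6(2) PLm(1) unfolding TA01 TB01 by simp_all
  have sumb': "sum b Vc = size TA1" using sumb szAB(1) by simp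
  have "\<exists>S\<subseteq>Vc. (\<forall>y\<in>S. 1 \<le> a y) \<and> (\<forall>y\<in>Vc - S. 1 \<le> b y) \<and>
    size TA1 \<le> 2 * min (sum a S) (sum b (Vc - S)) + 2 * (om + tau) \<and>
    size TA1 \<le> min (sum a S) (sum b (Vc - S)) + sum a {y \<in> Vc. 0 < b y}"
    by (rule sign_partition[OF finVc ab1 al suma sumb'])
  then obtain Sg where Sg: "Sg \<subseteq> Vc" "\<forall>y\<in>Sg. 1 \<le> a y" "\<forall>y\<in>Vc - Sg. 1 \<le> b y"
    "size TA1 \<le> 2 * min (sum a Sg) (sum b (Vc - Sg)) + 2 * (om + tau)"
    "size TA1 \<le> min (sum a Sg) (sum b (Vc - Sg)) + sum a {y \<in> Vc. 0 < b y}"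
    by (elim exE conjE)
  \<comment> \<open>The same number \<open>K\<close> of start and of end tokens is left over. Since
    \<open>n \<le> K\<close>, every core vertex can be given one of the kind prescribed by its
    sign.\<close>
  define K where "K = min (sum a Sg) (sum b (Vc - Sg))"
  have "2 * (om + tau) = 2 * om + 2 * tau" by simp
  then have Kn: "n \<le> K" using Sg(4) N6(1) szAB(2) num(1) unfolding K_def[symmetric] m_def by linarith
  have selA: "\<exists>L. L \<subseteq># {#A \<in># TA1. last A \<in> Sg#} \<and> size L = K \<and> (\<forall>y\<in>Sg. \<exists>A\<in>#L. last A = y)"
  proof (rule submset_hitting)
    show "finite Sg" using Sg(1) finVc finite_subset by blast
    then have "size {#A \<in># TA1. last A \<in> Sg#} = (\<Sum>y\<in>Sg. size {#A \<in># {#A \<in># TA1. last A \<in> Sg#}. last A = y#})"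
      by (rule size_partition_mset) auto
    also have "\<dots> = sum a Sg"
      unfolding a_def filter_filter_mset by (intro sum.cong refl arg_cong[of _ _ size] filter_mset_cong) auto
    finally show "K \<le> size {#A \<in># TA1. last A \<in> Sg#}" by (simp add: K_def)
    show "card Sg \<le> K" using card_mono[OF finVc Sg(1)] cVc Kn by linarith
    show "\<exists>A\<in>#{#A \<in># TA1. last A \<in> Sg#}. last A = y" if y: "y \<in> Sg" for y
    proof -
      obtain A where "A \<in># {#A \<in># TA1. last A = y#}"
        using size_ge_1_mem[OF bspec[OF Sg(2) y, unfolded a_def]] ..
      then show ?thesis using y by auto
    qed
  qed
  then obtain TAl where TAl: "TAl \<subseteq># {#A \<in># TA1. last A \<in> Sg#}" "size TAl = K" "\<forall>y\<in>Sg. \<exists>A\<in>#TAl. last A = y"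
    by (elim exE conjE)
  have selB: "\<exists>L. L \<subseteq># {#B \<in># TB1. hd B \<in> Vc - Sg#} \<and> size L = K \<and> (\<forall>y\<in>Vc - Sg. \<exists>B\<in>#L. hd B = y)"
  proof (rule submset_hitting)
    show "finite (Vc - Sg)" using finVc by blast
    then have "size {#B \<in># TB1. hd B \<in> Vc - Sg#} = (\<Sum>y\<in>Vc - Sg. size {#B \<in># {#B \<in># TB1. hd B \<in> Vc - Sg#}. hd B = y#})"
      by (rule size_partition_mset) auto
    also have "\<dots> = sum b (Vc - Sg)"
      unfolding b_def filter_filter_mset by (intro sum.cong refl arg_cong[of _ _ size] filter_mset_cong) auto
    finally show "K \<le> size {#B \<in># TB1. hd B \<in> Vc - Sg#}" by (simp add: K_def)
    show "card (Vc - Sg) \<le> K" using card_mono[OF finVc, of "Vc - Sg"] cVc Kn by (meson Diff_subset le_trans)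
    show "\<exists>B\<in>#{#B \<in># TB1. hd B \<in> Vc - Sg#}. hd B = y" if y: "y \<in> Vc - Sg" for y
    proof -
      obtain B where "B \<in># {#B \<in># TB1. hd B = y#}"
        using size_ge_1_mem[OF bspec[OF Sg(3) y, unfolded b_def]] ..
      then show ?thesis using y by auto
    qed
  qed
  then obtain TBl where TBl: "TBl \<subseteq># {#B \<in># TB1. hd B \<in> Vc - Sg#}" "size TBl = K" "\<forall>y\<in>Vc - Sg. \<exists>B\<in>#TBl. hd B = y"
    by (elim exE conjE)
  have "TAl \<subseteq># TA1" "TBl \<subseteq># TB1"
    using TAl(1) TBl(1) multiset_filter_subset subset_mset.order_trans by blast+
  then obtain TA2 TB2 where TA2: "TA1 = TA2 + TAl" and TB2: "TB1 = TB2 + TBl"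
    by (auto simp: subset_mset.le_iff_add add_ac)
  \<comment> \<open>Tokens that neither host strands nor are left over are paired in any order. Two
    of them may meet in a core vertex, which is harmless because no strands go between them.\<close>
  obtain xs ys where xs: "mset xs = TA2" and ys: "mset ys = TB2" by (meson ex_mset)
  have lxy: "length xs = length ys"
    using szAB(1) TAl(2) TBl(2) xs ys unfolding TA2 TB2 by (metis add_right_cancel size_mset size_union)
  define PL where "PL = PLm @ zip xs ys"
  have PLf: "mset (map fst PL) + TAl = TA0" "mset (map snd PL) + TBl = TB0"
    using lxy xs ys by (simp_all add: PL_def TA01 TB01 TA2 TB2 add_ac)
  define cls where "cls i = (if i < m then (SOME zs. set zs = {s \<in> SP. col s = i} \<and> distinct zs) else [])" for i
  have clsi: "set (cls i) = {s \<in> SP. col s = i}" "distinct (cls i)" if "i < m" for i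
  proof -
    have "\<exists>zs. set zs = {s \<in> SP. col s = i} \<and> distinct zs" using fin by (intro finite_distinct_list) auto
    from someI_ex[OF this] show "set (cls i) = {s \<in> SP. col s = i}" "distinct (cls i)" using that by (auto simp: cls_def)
  qed
  have cls0: "cls i = []" if "\<not> i < m" for i using that by (simp add: cls_def)
  have clsSP: "s \<in> SP" "s \<in> S" "i < m" "col s = i" if "s \<in> set (cls i)" for s i
    using that clsi(1)[of i] cls0[of i] sub by (cases "i < m"; auto)+
  have lenPL: "m \<le> length PL" using PLm(1) by (simp add: PL_def)
  have PLtok: "tokA (fst q)" "tokB (snd q)" if "q \<in> set PL" for q
  proof -
    have "fst q \<in># mset (map fst PL)" "snd q \<in># mset (map snd PL)" using that by auto
    then have "fst q \<in># TA0" "snd q \<in># TB0" unfolding PLf[symmetric] by auto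
    then show "tokA (fst q)" "tokB (snd q)" using tokA tokB by blast+
  qed
  have clssum: "(\<Sum>i<length PL. sum_list (map f (cls i))) = sum f SP" for f :: "'a list \<Rightarrow> 'c::comm_monoid_add"
  proof -
    have "(\<Sum>i<length PL. sum_list (map f (cls i))) = (\<Sum>i<m. sum_list (map f (cls i)))"
      using lenPL cls0 by (intro sum.mono_neutral_right) auto
    also have "\<dots> = (\<Sum>i<m. \<Sum>s\<in>{s \<in> SP. col s = i}. f s)"
      using clsi by (intro sum.cong refl) (metis lessThan_iff sum_list_distinct_conv_sum_set)
    also have "\<dots> = sum f SP" using fin col by (intro sum.group) auto
    finally show ?thesis .
  qed
  have arcs: "mset_set (E - Ec) = (\<Sum>q\<in>#mset PL. path_arcs (fst q) + path_arcs (snd q)) +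
       (\<Sum>i<length PL. \<Sum>s\<leftarrow>cls i. path_arcs s) + (\<Sum>A\<in>#TAl. path_arcs A) + (\<Sum>B\<in>#TBl. path_arcs B) +
       (\<Sum>s\<in>SC. path_arcs s)"
  proof -
    have A: "(\<Sum>A\<in>#TA0. path_arcs A) = (\<Sum>s\<in>SA. path_arcs s)"
      using own_arcs[OF finVc] by (simp add: TA0_def sum_unfold_sum_mset)
    have B: "(\<Sum>A\<in>#TB0. path_arcs A) = (\<Sum>s\<in>SB. path_arcs s)"
      using own_arcs[OF finVc] by (simp add: TB0_def sum_unfold_sum_mset)
    have PLs: "(\<Sum>q\<in>#mset PL. path_arcs (fst q) + path_arcs (snd q)) =
      (\<Sum>A\<in>#mset (map fst PL). path_arcs A) + (\<Sum>B\<in>#mset (map snd PL). path_arcs B)"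
      by (simp add: sum_mset.distrib image_mset.compositionality comp_def)
    have "mset_set (E - Ec) = (\<Sum>A\<in>#TA0. path_arcs A) + ((\<Sum>A\<in>#TB0. path_arcs A) + ((\<Sum>s\<in>SP. path_arcs s) + (\<Sum>s\<in>SC. path_arcs s)))"
      unfolding S(3)[symmetric] ssum A B ..
    also have "\<dots> = (\<Sum>A\<in>#mset (map fst PL). path_arcs A) + (\<Sum>A\<in>#TAl. path_arcs A) +
      ((\<Sum>A\<in>#mset (map snd PL). path_arcs A) + (\<Sum>B\<in>#TBl. path_arcs B) + ((\<Sum>s\<in>SP. path_arcs s) + (\<Sum>s\<in>SC. path_arcs s)))"
      unfolding PLf[symmetric] image_mset_union sum_mset.union ..
    finally show ?thesis unfolding PLs clssum by (simp only: add_ac)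
  qed
  have dist: "if last (fst (PL ! i)) = hd (snd (PL ! i)) then cls i = []
        else distinct (concat (fst (PL ! i) # cls i @ [snd (PL ! i)]))" if i: "i < length PL" for i
  proof -
    have q: "PL ! i \<in> set PL" using i by simp
    note tA = PLtok(1)[OF q, unfolded tokA_def] and tB = PLtok(2)[OF q, unfolded tokB_def]
    let ?A = "fst (PL ! i)" and ?B = "snd (PL ! i)"
    have setA: "set ?A \<subseteq> insert (last ?A) Wp" using tA set_butlast_last[of ?A] by blast
    have setB: "set ?B \<subseteq> insert (hd ?B) Wm" using tB set_hd_tl[of ?B] by blast
    have AB: "set ?A \<inter> set ?B = {}" if "last ?A \<noteq> hd ?B"
    proof -
      have "insert (last ?A) Wp \<inter> insert (hd ?B) Wm = {}" using tA tB that WW disjW by auto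
      then show ?thesis using setA setB by blast
    qed
    show ?thesis
    proof (cases "i < m")
      case False
      then show ?thesis using cls0[of i] AB tA tB by auto
    next
      case True
      then have eq: "PL ! i = PLm ! i" using PLm(1) by (simp add: PL_def nth_append)
      then have ne: "last ?A \<noteq> hd ?B" using PLm(1,4) True by simp
      have "set s \<inter> set ?A = {}" "set s \<inter> set ?B = {}" if "s \<in> set (cls i)" for s
        using col clsSP[OF that] True eq by (auto simp: bad_def)
      moreover have "distinct (concat (cls i))"
      proof -
        have "set s \<inter> set s' = {}" if "s \<in> set (cls i)" "s' \<in> set (cls i)" "s \<noteq> s'" for s s'
          using col clsSP[OF that(1)] clsSP[OF that(2)] that(3) unfolding conf_def by metis
        moreover have "distinct s" if "s \<in> set (cls i)" for s using st(1) clsSP[OF that] by blast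
        moreover have "distinct (removeAll [] (cls i))" using clsi(2)[OF True] by (rule distinct_removeAll)
        ultimately show ?thesis unfolding distinct_concat_iff by blast
      qed
      ultimately show ?thesis using ne AB tA tB by auto
    qed
  qed
  have load: "card {i. i < length PL \<and> y \<in> set (concat (fst (PL ! i) # cls i @ [snd (PL ! i)]))} \<le> om + tau"
    if y: "y \<in> Vc" for y
  proof -
    let ?I1 = "{i. i < length PL \<and> y \<in> set (fst (PL ! i))}" and ?I2 = "{i. i < length PL \<and> y \<in> set (snd (PL ! i))}"
    have "{i. i < length PL \<and> y \<in> set (concat (fst (PL ! i) # cls i @ [snd (PL ! i)]))} \<subseteq>
      ?I1 \<union> (?I2 \<union> col ` {s \<in> SP. y \<in> set s})"
      using clsSP by fastforce
    then have "card {i. i < length PL \<and> y \<in> set (concat (fst (PL ! i) # cls i @ [snd (PL ! i)]))} \<le>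
      card (?I1 \<union> (?I2 \<union> col ` {s \<in> SP. y \<in> set s}))"
      using fin by (intro card_mono) auto
    also have "\<dots> \<le> card ?I1 + (card ?I2 + card {s \<in> SP. y \<in> set s})"
      using fin by (intro order_trans[OF card_Un_le] add_left_mono card_image_le) auto
    also have "card ?I1 \<le> size {#A \<in># TA0. y \<in> set A#}"
      using card_index_filter[of "map fst PL" "\<lambda>A. y \<in> set A"] unfolding PLf(1)[symmetric] by (simp cong: conj_cong)
    also have "card ?I2 \<le> size {#A \<in># TB0. y \<in> set A#}"
      using card_index_filter[of "map snd PL" "\<lambda>A. y \<in> set A"] unfolding PLf(2)[symmetric] by (simp cong: conj_cong)
    finally show ?thesis using thrVc[OF y] unfolding thr_def by simp
  qed
  have own1: "size {#A \<in># TA0. hd A = y#} = ga y" if y: "y \<in> Vc" for y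
  proof -
    have "{s \<in> SA. hd s = y} = {}" using disjW[OF y] by (auto simp: SA_def)
    then have "card {s \<in> SA. hd s = y} = 0" by (simp only: card.empty)
    moreover have "(\<Sum>z\<in>Vc. if hd [z] = y then ga z else 0) = ga y" using y finVc by (simp add: sum.delta)
    ultimately show ?thesis using own_filter[OF finVc, of "\<lambda>A. hd A = y" ga] fin by (simp add: TA0_def)
  qed
  have own2: "size {#B \<in># TB0. last B = y#} = gb y" if y: "y \<in> Vc" for y
  proof -
    have "{s \<in> SB. last s = y} = {}" using disjW[OF y] by (auto simp: SB_def)
    then have "card {s \<in> SB. last s = y} = 0" by (simp only: card.empty)
    moreover have "(\<Sum>z\<in>Vc. if last [z] = y then gb z else 0) = gb y" using y finVc by (simp add: sum.delta)
    ultimately show ?thesis using own_filter[OF finVc, of "\<lambda>A. last A = y" gb] fin by (simp add: TB0_def)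
  qed
  have memAl: "A \<in># TA1 \<and> last A \<in> Sg" if "A \<in># TAl" for A using mset_subset_eqD[OF TAl(1) that] by simp
  have memBl: "B \<in># TB1 \<and> hd B \<in> Vc - Sg" if "B \<in># TBl" for B using mset_subset_eqD[OF TBl(1) that] by simp
  have "plan PL cls TAl TBl SC Sg"
    unfolding plan_def
  proof (intro conjI)
    show "\<forall>i<length PL. \<forall>s\<in>set (cls i). s \<noteq> [] \<and> length s \<le> 4 \<and> hd s \<in> Vc \<and> last s \<in> Vc"
      using clsSP st(3,13) by (auto simp: SP_def) 
    show "\<forall>x\<in>Vc. size {#A \<in># mset (map fst PL) + TAl. hd A = x#} = nat (?x x)"
      unfolding PLf using own1 by (simp add: ga_def)
    show "\<forall>x\<in>Vc. size {#B \<in># mset (map snd PL) + TBl. last B = x#} = nat (- ?x x)"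
      unfolding PLf using own2 by (simp add: gb_def)
    show "\<forall>q\<in>set PL. tokA (fst q) \<and> tokB (snd q)" using PLtok by blast
    show "\<forall>A\<in>#TAl. tokA A" using memAl memA1 tokA by blast
    show "\<forall>B\<in>#TBl. tokB B" using memBl memB1 tokB by blast
    show "\<forall>s\<in>SC. distinct s \<and> 2 \<le> length s \<and> hd s \<in> Wp \<and> last s \<in> Wm"
      using st(1,2) sub(4) by (auto simp: SC_def)
    show "\<forall>A\<in>#TAl. last A \<in> Sg" "\<forall>B\<in>#TBl. hd B \<in> Vc - Sg" using memAl memBl by blast+
    show "size TAl = size TBl" using TAl(2) TBl(2) by simp
  qed (use arcs dist fin Sg(1) TAl(3) TBl(3) in blast)+
  moreover have "size {#A \<in># TAl. last A = y#} \<le> om + tau \<and> size {#B \<in># TBl. hd B = y#} \<le> om + tau" if "y \<in> Vc" for y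
    using al[OF that] bl[of y] unfolding a_def b_def TA2 TB2 by simp
  \<comment> \<open>Strands of one class are vertex-disjoint and each contains a hub.\<close>
  moreover have "length (cls i) \<le> om" if "i < length PL" for i
  proof (cases "i < m")
    case True
    have fW: "finite (Wp \<union> Wm)" using WV finV finite_subset by (meson finite_UnI)
    have "\<forall>s\<in>set (cls i). \<exists>w. w \<in> set s \<inter> (Wp \<union> Wm)" using st(7) clsSP by blast
    then obtain h where h: "\<forall>s\<in>set (cls i). h s \<in> set s \<inter> (Wp \<union> Wm)" by (rule bchoice[THEN exE])
    have "inj_on h (set (cls i))"
    proof (rule inj_onI, rule ccontr)
      fix s t assume s: "s \<in> set (cls i)" "t \<in> set (cls i)" "h s = h t" "s \<noteq> t"
      have "h s \<in> set s" "h s \<in> set t" using h s by auto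
      then have "conf s t" by (auto simp: conf_def)
      then show False using col clsSP[OF s(1)] clsSP[OF s(2)] s(4) by metis
    qed
    moreover have "h ` set (cls i) \<subseteq> Wp \<union> Wm" using h by blast
    ultimately have "card (set (cls i)) \<le> card (Wp \<union> Wm)" using fW by (rule card_inj_on_le)
    then show ?thesis using clsi(2)[OF True] om by (simp add: distinct_card)
  qed (simp add: cls0)
  moreover have "(\<Sum>i<length PL. length (cls i)) \<le> om * n"
  proof -
    have fW: "finite (Wp \<union> Wm)" using WV finV finite_subset by (meson finite_UnI)
    have "(\<Sum>i<length PL. length (cls i)) = card SP"
      using clssum[of "\<lambda>_. 1 :: nat"] by (simp add: sum_list_triv)
    also have "SP \<subseteq> (\<Union>w\<in>Wp \<union> Wm. {s \<in> SP. w \<in> set s})" using st(7) sub(3) by blast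
    then have "card SP \<le> card (\<Union>w\<in>Wp \<union> Wm. {s \<in> SP. w \<in> set s})" using fW fin by (intro card_mono) auto
    also have "\<dots> \<le> (\<Sum>w\<in>Wp \<union> Wm. card {s \<in> SP. w \<in> set s})" using fW by (rule card_UN_le)
    also have "\<dots> \<le> (\<Sum>w\<in>Wp \<union> Wm. n)"
    proof (rule sum_mono)
      fix w assume "w \<in> Wp \<union> Wm"
      then have "w \<in> V" "w \<notin> Vc" using WV by (auto simp: Vc)
      from thrW[OF this] show "card {s \<in> SP. w \<in> set s} \<le> n" unfolding thr_def by linarith
    qed
    also have "\<dots> \<le> om * n" using om by simp
    finally show ?thesis .
  qed
  moreover have "length PL + size TAl \<le> X"
  proof -
    have "length PL + size TAl = size (mset (map fst PL) + TAl)" by simp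
    then show ?thesis unfolding PLf using szA by linarith
  qed
  moreover have "X \<le> om * om + 3 * n + 2 * size TAl + 2 * (om + tau)"
    using szA SCle szAB(2) Sg(4) TAl(2) unfolding K_def[symmetric] m_def by linarith
  moreover have "int X \<le> int (3 * n + size TAl) + (\<Sum>w\<in>Wp. ?x w)" if Wm: "Wm = {}"
  proof -
    have SC0: "SC = {}" "SB = {}" using Wm by (auto simp: SC_def SB_def)
    \<comment> \<open>Without negative hubs all end tokens are single vertices of negative excess,
      and the start tokens ending at such a vertex are strands from \<open>Wp\<close>. So making all
      these vertices negative loses at most as many start tokens as the hubs have excess.\<close>
    have "sum a {y \<in> Vc. 0 < b y} \<le> card SA"
    proof -
      have aS: "a y \<le> card {s \<in> SA. last s = y}" if y: "y \<in> {y \<in> Vc. 0 < b y}" for y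
      proof -
        have "1 \<le> b y" using y by simp
        then obtain B where "B \<in># {#B \<in># TB1. hd B = y#}"
          unfolding b_def by (blast dest: size_ge_1_mem)
        then have B: "B \<in># TB0" "hd B = y" using memB1 by auto
        then have "0 < gb y" using SC0 finVc by (auto simp: TB0_def own_mem)
        then have "ga y = 0" by (simp add: ga_def gb_def)
        have "(\<Sum>z\<in>Vc. if last [z] = y then ga z else 0) = ga y" using y finVc by (simp add: sum.delta)
        then have "size {#A \<in># own Vc ga. last A = y#} = 0"
          using own_filter[OF finVc, of "\<lambda>A. last A = y" ga] \<open>ga y = 0\<close> by simp
        then have "size {#A \<in># TA0. last A = y#} = card {s \<in> SA. last s = y}"
          using fin by (simp add: TA0_def)
        then show ?thesis unfolding a_def TA01 by simp
      qed
      have "sum a {y \<in> Vc. 0 < b y} \<le> (\<Sum>y\<in>{y \<in> Vc. 0 < b y}. card {s \<in> SA. last s = y})" by (rule sum_mono[OF aS])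
      also have "\<dots> \<le> (\<Sum>y\<in>Vc. card {s \<in> SA. last s = y})" using finVc by (intro sum_mono2) auto
      also have "\<dots> = (\<Sum>y\<in>Vc. size {#s \<in># mset_set SA. last s = y#})" using fin(1) by simp
      also have "\<dots> = size (mset_set SA)"
        by (rule size_partition_mset[OF finVc, symmetric]) (use fin(1) in \<open>simp add: SA_def\<close>)
      also have "\<dots> = card SA" by simp
      finally show ?thesis .
    qed
    moreover have "(\<Sum>w\<in>Wp. ?x w) = int (card SA)"
      using cardhd SC0 exWp by (simp flip: of_nat_sum)
    ultimately show ?thesis using szA SC0 szAB(2) Sg(5) TAl(2) unfolding K_def[symmetric] m_def by simp
  qed
  ultimately show ?thesis using load
    by (intro exI[of _ PL] exI[of _ cls] exI[of _ TAl] exI[of _ TBl] exI[of _ SC] exI[of _ Sg] conjI) blast+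
qed

end

section \<open>Removing the hubs\<close>

lemma count_image_eq_size: "count (image_mset f M) x = size {#y \<in># M. f y = x#}"
  by (induction M) auto

text \<open>Starts and ends of a decomposition are determined by the excess alone, so they agree
  with the left-over tokens whatever the decomposition of the core is.\<close>

lemma perfect_counts:
  assumes "\<And>p. p \<in># P \<Longrightarrow> p \<noteq> []" "\<forall>p\<in>#P. \<forall>q\<in>#P. hd p \<noteq> last q"
  shows "int (count (image_mset hd P) v) = max (arc_excess (\<Sum>p\<in>#P. path_arcs p) v) 0"
    and "int (count (image_mset last P) v) = max (- arc_excess (\<Sum>p\<in>#P. path_arcs p) v) 0"
proof -
  have "size {#p \<in># P. hd p = v#} = 0 \<or> size {#p \<in># P. last p = v#} = 0"
    using assms(2) by (auto simp: filter_mset_eq_conv size_eq_0_iff_empty)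
  then show "int (count (image_mset hd P) v) = max (arc_excess (\<Sum>p\<in>#P. path_arcs p) v) 0"
    and "int (count (image_mset last P) v) = max (- arc_excess (\<Sum>p\<in>#P. path_arcs p) v) 0"
    unfolding count_image_eq_size using arc_excess_paths[OF assms(1), of P v] by linarith+
qed

lemma two_le_length: "p \<noteq> [] \<Longrightarrow> hd p \<noteq> last p \<Longrightarrow> 2 \<le> length p"
  by (cases p rule: remdups_adj.cases) auto

lemma length_concat_le: "(\<And>s. s \<in> set L \<Longrightarrow> length s \<le> k) \<Longrightarrow> length (concat L) \<le> k * length L"
proof (induction L)
  case (Cons s L)
  have "length s \<le> k" "length (concat L) \<le> k * length L" using Cons by auto
  then show ?case by simp
qed simp

context hubs
begin

text \<open>\<open>D\<close> is the core without the arcs of the links. Outside \<open>D\<close>,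
  all arcs of \<open>E\<close> belong to finished paths from positive to negative excess, or to
  left-over tokens, which wait for the paths of a decomposition of \<open>D\<close>.\<close>

lemma hub_reduction:
  assumes n: "card V \<le> n" and om: "card (Wp \<union> Wm) \<le> om"
    and exc: "\<forall>x\<in>Vc. excess_at E x \<noteq> 0 \<and> \<bar>excess_at E x\<bar> \<le> int tau"
    and deg: "\<And>x. x \<in> Vc \<Longrightarrow> 12 * n \<le> 25 * card (outs Ec x)" "\<And>x. x \<in> Vc \<Longrightarrow> 12 * n \<le> 25 * card (ins Ec x)"
    and X: "(\<Sum>v\<in>V. max (excess_at E v) 0) = int X"
    and num: "2 * om + 2 * tau \<le> n" "om * om + 6 * n \<le> X"
      "5 * (om * n + 2 * X) \<le> l * zh" "0 < l" "zh + 5 * (om + 2) \<le> z" "2 * (l + 2 * (om + tau)) \<le> z"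
      "100 * (z + 4 * (om + 2)) \<le> n" "400 \<le> n"
  shows "\<exists>D K. D \<subseteq> Ec \<and> (perfect (mset_set D) \<longrightarrow> perfect (mset_set E)) \<and>
    (\<forall>x\<in>Vc. excess_at D x \<noteq> 0 \<and> \<bar>excess_at D x\<bar> \<le> int (om + tau)) \<and>
    (\<forall>x\<in>Vc. arc_degree (Ec - D) x \<le> 2 * (l + 2 * (om + tau))) \<and>
    (\<Sum>x\<in>Vc. max (excess_at D x) 0) = int K \<and> K \<le> X \<and>
    X \<le> om * om + 3 * n + 2 * K + 2 * (om + tau) \<and>
    (Wm = {} \<longrightarrow> int X \<le> int (3 * n + K) + (\<Sum>w\<in>Wp. excess_at E w))"
proof -
  let ?x = "excess_at E"
  have "1 \<le> n" using num(8) by simp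
  from token_plan[OF n om exc X num(1,2) this]
  obtain PL cls TA TB SC Sg where pl: "plan PL cls TA TB SC Sg"
    and load: "\<forall>x\<in>Vc. card {i. i < length PL \<and> x \<in> set (concat (fst (PL ! i) # cls i @ [snd (PL ! i)]))} \<le> om + tau"
    and cnt: "\<forall>x\<in>Vc. size {#A \<in># TA. last A = x#} \<le> om + tau \<and> size {#B \<in># TB. hd B = x#} \<le> om + tau"
    and clsl: "\<forall>i<length PL. length (cls i) \<le> om" "(\<Sum>i<length PL. length (cls i)) \<le> om * n" "length PL + size TA \<le> X"
    and size: "X \<le> om * om + 3 * n + 2 * size TA + 2 * (om + tau)"
      "Wm = {} \<longrightarrow> int X \<le> int (3 * n + size TA) + (\<Sum>w\<in>Wp. excess_at E w)"
    by (elim exE conjE)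
  define r where "r = length PL"
  define A B where "A i = fst (PL ! i)" and "B i = snd (PL ! i)" for i
  note pl' = pl[unfolded plan_def, folded r_def A_def B_def]
  have p_arcs: "mset_set (E - Ec) = (\<Sum>q\<in>#mset PL. path_arcs (fst q) + path_arcs (snd q)) +
       (\<Sum>i<r. \<Sum>s\<leftarrow>cls i. path_arcs s) + (\<Sum>A\<in>#TA. path_arcs A) + (\<Sum>B\<in>#TB. path_arcs B) +
       (\<Sum>s\<in>SC. path_arcs s)" using pl' by (elim conjE)
  have tok1: "\<forall>q\<in>set PL. tokA (fst q) \<and> tokB (snd q)" using pl' by (elim conjE)
  have tok2: "\<forall>A\<in>#TA. tokA A" using pl' by (elim conjE)
  have tok3: "\<forall>B\<in>#TB. tokB B" using pl' by (elim conjE)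
  note p_tok = tok1 tok2 tok3
  have p_dist: "\<forall>i<r. if last (A i) = hd (B i) then cls i = [] else distinct (concat (A i # cls i @ [B i]))" using pl' by (elim conjE)
  have p_cls: "\<forall>i<r. \<forall>s\<in>set (cls i). s \<noteq> [] \<and> length s \<le> 4 \<and> hd s \<in> Vc \<and> last s \<in> Vc" using pl' by (elim conjE)
  have p_A: "\<forall>x\<in>Vc. size {#A \<in># mset (map fst PL) + TA. hd A = x#} = nat (?x x)" using pl' by (elim conjE)
  have p_B: "\<forall>x\<in>Vc. size {#B \<in># mset (map snd PL) + TB. last B = x#} = nat (- ?x x)" using pl' by (elim conjE)
  have sc1: "finite SC" using pl' by (elim conjE)
  have sc2: "\<forall>s\<in>SC. distinct s \<and> 2 \<le> length s \<and> hd s \<in> Wp \<and> last s \<in> Wm" using pl' by (elim conjE)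
  note p_SC = sc1 sc2
  have sg1: "Sg \<subseteq> Vc" using pl' by (elim conjE)
  have sg2: "\<forall>A\<in>#TA. last A \<in> Sg" using pl' by (elim conjE)
  have sg3: "\<forall>B\<in>#TB. hd B \<in> Vc - Sg" using pl' by (elim conjE)
  have sg4: "\<forall>x\<in>Sg. \<exists>A\<in>#TA. last A = x" using pl' by (elim conjE)
  have sg5: "\<forall>x\<in>Vc - Sg. \<exists>B\<in>#TB. hd B = x" using pl' by (elim conjE)
  note p_Sg = sg1 sg2 sg3 sg4 sg5
  have finVc: "finite Vc" and VcV: "Vc \<subseteq> V" using finV by (auto simp: Vc)
  have disjW: "x \<notin> Wp" "x \<notin> Wm" if "x \<in> Vc" for x using that by (auto simp: Vc)
  have EcV: "Ec \<subseteq> Vc \<times> Vc" and EcE: "Ec \<subseteq> E" by (auto simp: Ec)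
  have finEc: "finite Ec" using finE EcE finite_subset by blast
  have asymc: "(y, x) \<notin> Ec" if "(x, y) \<in> Ec" for x y using asym EcE that by blast
  have tA: "A i \<noteq> []" "distinct (A i)" "length (A i) \<le> 4" "last (A i) \<in> Vc" "set (butlast (A i)) \<subseteq> Wp" "?x (hd (A i)) > 0"
    and tB: "B i \<noteq> []" "distinct (B i)" "length (B i) \<le> 4" "hd (B i) \<in> Vc" "set (tl (B i)) \<subseteq> Wm" "?x (last (B i)) < 0"
    if i: "i < r" for i
  proof -
    have "PL ! i \<in> set PL" using i by (simp add: r_def)
    then have "tokA (A i)" "tokB (B i)" using p_tok(1) unfolding A_def B_def by blast+
    then show "A i \<noteq> []" "distinct (A i)" "length (A i) \<le> 4" "last (A i) \<in> Vc" "set (butlast (A i)) \<subseteq> Wp" "?x (hd (A i)) > 0"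
      "B i \<noteq> []" "distinct (B i)" "length (B i) \<le> 4" "hd (B i) \<in> Vc" "set (tl (B i)) \<subseteq> Wm" "?x (last (B i)) < 0"
      unfolding tokA_def tokB_def by blast+
  qed
  have setA: "set (A i) \<subseteq> insert (last (A i)) Wp" if "i < r" for i
    using set_butlast_last[OF tA(1)[OF that]] tA(5)[OF that] by blast
  \<comment> \<open>Two tokens sharing their core vertex are merged into a single segment and need
    no link; otherwise the tokens and the strands between them are separate segments.\<close>
  define SK where "SK i = (if last (A i) = hd (B i) then [A i @ tl (B i)] else A i # cls i @ [B i])" for i
  have SKarcs: "(\<Sum>s\<leftarrow>SK i. path_arcs s) = path_arcs (A i) + path_arcs (B i) + (\<Sum>s\<leftarrow>cls i. path_arcs s)" if i: "i < r" for i
  proof (cases "last (A i) = hd (B i)")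
    case True
    then have "cls i = []" using p_dist i by auto
    then show ?thesis using True path_arcs_glue'[OF tA(1)[OF i] tB(1)[OF i] True] by (simp add: SK_def)
  qed (simp add: SK_def add_ac)
  have SKset: "set (concat (SK i)) \<subseteq> set (concat (A i # cls i @ [B i]))" for i
    by (cases "B i") (auto simp: SK_def)
  have SKhd: "hd (concat (SK i)) = hd (A i)" if i: "i < r" for i
    using tA(1)[OF i] by (simp add: SK_def)
  have SKlast: "last (concat (SK i)) = last (B i)" if i: "i < r" for i
  proof (cases "last (A i) = hd (B i)")
    case True
    then show ?thesis using tB(1)[OF i] tA(1)[OF i] by (cases "B i") (auto simp: SK_def)
  next
    case False
    then show ?thesis using tB(1)[OF i] by (simp add: SK_def)
  qed
  have SKdist: "distinct (concat (SK i))" if i: "i < r" for i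
  proof (cases "last (A i) = hd (B i)")
    case True
    have "set (A i) \<inter> set (tl (B i)) = {}" using setA[OF i] tA(4)[OF i] tB(5)[OF i] disjW WW by blast
    then show ?thesis using True tA(2)[OF i] tB(2)[OF i] by (simp add: SK_def distinct_tl)
  next
    case False
    have "distinct (concat (A i # cls i @ [B i]))" using p_dist[rule_format, OF i] unfolding if_not_P[OF False] .
    then show ?thesis using False by (simp add: SK_def)
  qed
  have SKne: "s \<noteq> [] \<and> (last (A i) \<noteq> hd (B i) \<longrightarrow> length s \<le> 4)" if "i < r" "s \<in> set (SK i)" for i s
    using that p_cls tA(1,3)[OF that(1)] tB(1,3)[OF that(1)] by (auto simp: SK_def split: if_splits)
  have SKlink: "last (SK i ! j) \<in> Vc \<and> hd (SK i ! Suc j) \<in> Vc" if i: "i < r" and j: "Suc j < length (SK i)" for i j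
  proof -
    have ne: "last (A i) \<noteq> hd (B i)" using j by (auto simp: SK_def split: if_splits)
    then have eq: "SK i = A i # cls i @ [B i]" by (simp add: SK_def)
    have "SK i ! j = butlast (SK i) ! j" using j by (simp add: nth_butlast)
    moreover have "butlast (SK i) = A i # cls i" by (simp add: eq)
    moreover have "j < length (A i # cls i)" using j by (simp add: eq)
    ultimately have 1: "SK i ! j \<in> set (A i # cls i)" by (metis nth_mem)
    have "SK i ! Suc j = (cls i @ [B i]) ! j" by (simp add: eq)
    then have 2: "SK i ! Suc j \<in> set (cls i @ [B i])" using j by (metis Suc_less_eq eq length_Cons nth_mem)
    show ?thesis using 1 2 tA(4)[OF i] tB(4)[OF i] p_cls i by auto
  qed
  have SKlen: "length (SK i) \<le> om + 2" "length (SK i) \<le> length (cls i) + 2" if "i < r" for i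
    using clsl(1) that by (auto simp: SK_def r_def)
  have SKlen2: "length (concat (SK i)) \<le> 4 * (om + 2)" if i: "i < r" for i
  proof (cases "last (A i) = hd (B i)")
    case True
    then show ?thesis using tA(3)[OF i] tB(3)[OF i] by (simp add: SK_def)
  next
    case False
    then have "length (concat (SK i)) \<le> 4 * length (SK i)" using SKne[OF i] by (intro length_concat_le) blast
    then show ?thesis using SKlen(1)[OF i] by (meson le_trans mult_le_mono2)
  qed
  have "\<exists>P U. U \<subseteq> Ec \<and> (\<forall>i<r. distinct (P i) \<and> P i \<noteq> [] \<and> hd (P i) = hd (concat (SK i)) \<and> last (P i) = last (concat (SK i))) \<and>
    (\<Sum>i<r. path_arcs (P i)) = (\<Sum>i<r. \<Sum>s\<leftarrow>SK i. path_arcs s) + mset_set U \<and>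
    (\<forall>x\<in>Vc. arc_degree U x \<le> 2 * (l + 2 * (om + tau)))"
  proof (rule link_skeletons[where n = n and z = z and zh = zh and ?z0.0 = "4 * (om + 2)" and G = "om + 2"])
    show "card Vc \<le> n" using card_mono[OF finV VcV] n by linarith
    show "SK i \<noteq> []" if "i < r" for i by (simp add: SK_def)
    show "card {i. i < r \<and> x \<in> set (concat (SK i))} \<le> om + tau" if x: "x \<in> Vc" for x
    proof -
      have "card {i. i < r \<and> x \<in> set (concat (SK i))} \<le> card {i. i < r \<and> x \<in> set (concat (A i # cls i @ [B i]))}"
        using SKset by (intro card_mono) auto
      then show ?thesis using bspec[OF load x] unfolding r_def A_def B_def by linarith
    qed
    have "(\<Sum>i<r. length (SK i)) \<le> (\<Sum>i<r. length (cls i) + 2)" using SKlen(2) by (intro sum_mono) auto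
    also have "\<dots> = (\<Sum>i<r. length (cls i)) + 2 * r" unfolding sum.distrib by simp
    also have "\<dots> \<le> om * n + 2 * X" using clsl(2,3) unfolding r_def by linarith
    finally have "5 * (\<Sum>i<r. length (SK i)) \<le> 5 * (om * n + 2 * X)" by (rule mult_le_mono2)
    then show "5 * (\<Sum>i<r. length (SK i)) \<le> l * zh" using num(3) by (rule le_trans)
  qed (fact finVc EcV asymc deg SKdist SKlink SKlen SKlen2 num(4-8) | use SKne in blast)+
  then obtain P U where PU: "U \<subseteq> Ec" "\<forall>i<r. distinct (P i) \<and> P i \<noteq> [] \<and> hd (P i) = hd (concat (SK i)) \<and> last (P i) = last (concat (SK i))"
    "(\<Sum>i<r. path_arcs (P i)) = (\<Sum>i<r. \<Sum>s\<leftarrow>SK i. path_arcs s) + mset_set U"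
    "\<forall>x\<in>Vc. arc_degree U x \<le> 2 * (l + 2 * (om + tau))" by (elim exE conjE)
  have Pi: "distinct (P i)" "P i \<noteq> []" "hd (P i) = hd (A i)" "last (P i) = last (B i)" if "i < r" for i
    using PU(2) SKhd[OF that] SKlast[OF that] that by auto
  define D where "D = Ec - U"
  define PM where "PM = mset (map P [0..<r])"
  have PMarcs: "(\<Sum>p\<in>#PM. path_arcs p) = (\<Sum>i<r. path_arcs (P i))"
    by (simp add: PM_def sum_unfold_sum_mset image_mset.compositionality comp_def atLeast0LessThan)
  have PLarcs: "(\<Sum>q\<in>#mset PL. path_arcs (fst q) + path_arcs (snd q)) = (\<Sum>i<r. path_arcs (A i) + path_arcs (B i))"
  proof -
    let ?f = "\<lambda>q. path_arcs (fst q) + path_arcs (snd q)"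
    have "(\<Sum>q\<in>#mset PL. ?f q) = sum_list (map ?f PL)"
      unfolding mset_map[symmetric] by (rule sum_mset_sum_list)
    also have "\<dots> = (\<Sum>i<r. map ?f PL ! i)" by (simp add: sum_list_sum_nth atLeast0LessThan r_def)
    also have "\<dots> = (\<Sum>i<r. path_arcs (A i) + path_arcs (B i))"
      by (intro sum.cong) (simp_all add: r_def A_def B_def)
    finally show ?thesis .
  qed
  have ident: "mset_set E = (\<Sum>p\<in>#PM. path_arcs p) + (\<Sum>A\<in>#TA. path_arcs A) + (\<Sum>B\<in>#TB. path_arcs B) +
    (\<Sum>s\<in>SC. path_arcs s) + mset_set D"
  proof -
    have 1: "mset_set E = mset_set (E - Ec) + mset_set Ec"
      using mset_set_Diff_subset[OF finE EcE] by (simp add: add_ac)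
    have 2: "mset_set Ec = mset_set U + mset_set D"
      unfolding D_def by (rule mset_set_Diff_subset[OF finEc PU(1)])
    have 3: "(\<Sum>i<r. \<Sum>s\<leftarrow>SK i. path_arcs s) = (\<Sum>i<r. path_arcs (A i) + path_arcs (B i)) + (\<Sum>i<r. \<Sum>s\<leftarrow>cls i. path_arcs s)"
      using SKarcs by (simp add: sum.distrib)
    show ?thesis unfolding 1 2 p_arcs PMarcs PU(3) 3 PLarcs by (simp only: add_ac)
  qed
  have hdPM: "image_mset hd PM = image_mset hd (mset (map fst PL))"
  proof -
    have "map hd (map P [0..<r]) = map hd (map fst PL)"
      by (rule nth_equalityI) (auto simp: r_def[symmetric] Pi(3) A_def)
    then show ?thesis unfolding PM_def mset_map[symmetric] by (simp only:)
  qed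
  have lastPM: "image_mset last PM = image_mset last (mset (map snd PL))"
  proof -
    have "map last (map P [0..<r]) = map last (map snd PL)"
      by (rule nth_equalityI) (auto simp: r_def[symmetric] Pi(4) B_def)
    then show ?thesis unfolding PM_def mset_map[symmetric] by (simp only:)
  qed
  have PMmem: "\<exists>i<r. p = P i" if "p \<in># PM" for p using that by (auto simp: PM_def)
  have PMne: "p \<noteq> []" if "p \<in># PM" for p
  proof -
    from PMmem[OF that] obtain i where "i < r" "p = P i" by (elim exE conjE)
    then show ?thesis using Pi(2) by simp
  qed
  have TAne: "A \<noteq> []" if "A \<in># TA" for A using p_tok(2) that by (auto simp: tokA_def)
  have TBne: "B \<noteq> []" if "B \<in># TB" for B using p_tok(3) that by (auto simp: tokB_def)
  let ?cA = "\<lambda>x. size {#A \<in># TA. last A = x#}" and ?cB = "\<lambda>x. size {#B \<in># TB. hd B = x#}"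
  \<comment> \<open>Tokens beginning or ending at \<open>x\<close> as legitimate ends of paths match
    the excess of \<open>x\<close> in \<open>E\<close> exactly and cancel it; only the inner ends of
    left-over tokens remain.\<close>
  have exD: "excess_at D x = int (?cA x) - int (?cB x)" if x: "x \<in> Vc" for x
  proof -
    have e1: "arc_excess (\<Sum>p\<in>#PM. path_arcs p) x = int (size {#p \<in># PM. hd p = x#}) - int (size {#p \<in># PM. last p = x#})"
      by (rule arc_excess_paths[OF PMne])
    have e2: "arc_excess (\<Sum>p\<in>#TA. path_arcs p) x = int (size {#p \<in># TA. hd p = x#}) - int (?cA x)"
      by (rule arc_excess_paths[OF TAne])
    have e3: "arc_excess (\<Sum>p\<in>#TB. path_arcs p) x = int (?cB x) - int (size {#p \<in># TB. last p = x#})"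
      by (rule arc_excess_paths[OF TBne])
    have e4: "arc_excess (\<Sum>s\<in>SC. path_arcs s) x = 0"
    proof -
      have "arc_excess (path_arcs s) x = 0" if "s \<in> SC" for s
      proof -
        have s: "2 \<le> length s" "hd s \<in> Wp" "last s \<in> Wm" using bspec[OF p_SC(2) that] by simp_all
        then have "s \<noteq> []" "hd s \<noteq> x" "last s \<noteq> x" using disjW[OF x] by auto
        then show ?thesis by (simp add: arc_excess_path)
      qed
      moreover have "arc_excess (\<Sum>s\<in>S'. path_arcs s) x = (\<Sum>s\<in>S'. arc_excess (path_arcs s) x)" if "finite S'" for S'
        using that by (induction S') auto
      ultimately show ?thesis using p_SC(1) by simp
    qed
    have h: "size {#p \<in># PM. hd p = x#} = size {#A \<in># mset (map fst PL). hd A = x#}"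
      unfolding count_image_eq_size[symmetric] hdPM ..
    have la: "size {#p \<in># PM. last p = x#} = size {#B \<in># mset (map snd PL). last B = x#}"
      unfolding count_image_eq_size[symmetric] lastPM ..
    have "size {#A \<in># mset (map fst PL). hd A = x#} + size {#A \<in># TA. hd A = x#} = nat (?x x)"
      using bspec[OF p_A x] by (simp only: filter_union_mset size_union)
    moreover have "size {#B \<in># mset (map snd PL). last B = x#} + size {#B \<in># TB. last B = x#} = nat (- ?x x)"
      using bspec[OF p_B x] by (simp only: filter_union_mset size_union)
    moreover have "?x x = arc_excess (\<Sum>p\<in>#PM. path_arcs p) x + arc_excess (\<Sum>p\<in>#TA. path_arcs p) x +
      arc_excess (\<Sum>p\<in>#TB. path_arcs p) x + arc_excess (\<Sum>s\<in>SC. path_arcs s) x + excess_at D x"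
      by (simp only: ident arc_excess_add)
    ultimately show ?thesis unfolding e1 e2 e3 e4 h la by linarith
  qed
  have cA0: "?cA x = 0" if "x \<notin> Sg" for x
  proof -
    have "{#A \<in># TA. last A = x#} = {#}" using p_Sg(2) that by (auto simp: filter_mset_eq_conv)
    then show ?thesis by (simp only: size_empty)
  qed
  have cB0: "?cB x = 0" if "x \<notin> Vc - Sg" for x
  proof -
    have "{#B \<in># TB. hd B = x#} = {#}" using p_Sg(3) that by (auto simp: filter_mset_eq_conv)
    then show ?thesis by (simp only: size_empty)
  qed
  have cA1: "?cA x \<noteq> 0" if x: "x \<in> Sg" for x
  proof -
    obtain A where "A \<in># TA" "last A = x" using bspec[OF p_Sg(4) x] ..
    then have "A \<in># {#A \<in># TA. last A = x#}" by simp
    then show ?thesis by (metis empty_iff set_mset_empty size_eq_0_iff_empty)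
  qed
  have cB1: "?cB x \<noteq> 0" if x: "x \<in> Vc - Sg" for x
  proof -
    obtain B where "B \<in># TB" "hd B = x" using bspec[OF p_Sg(5) x] ..
    then have "B \<in># {#B \<in># TB. hd B = x#}" by simp
    then show ?thesis by (metis empty_iff set_mset_empty size_eq_0_iff_empty)
  qed
  \<comment> \<open>No core vertex has left-over tokens of both kinds, so each kind is counted by
    one sign of the excess.\<close>
  have maxD: "max (excess_at D x) 0 = int (?cA x)" "max (- excess_at D x) 0 = int (?cB x)" if x: "x \<in> Vc" for x
    using exD[OF x] cA0[of x] cB0[of x] x by (cases "x \<in> Sg"; simp)+
  have D1: "excess_at D x \<noteq> 0 \<and> \<bar>excess_at D x\<bar> \<le> int (om + tau)" if x: "x \<in> Vc" for x
    using exD[OF x] cA0[of x] cB0[of x] cA1[of x] cB1[of x] bspec[OF cnt x] x by (cases "x \<in> Sg") auto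
  have D2: "(\<Sum>x\<in>Vc. max (excess_at D x) 0) = int (size TA)"
  proof -
    have "size TA = (\<Sum>x\<in>Vc. ?cA x)" using p_Sg(1,2) by (intro size_partition_mset[OF finVc]) auto
    then show ?thesis using maxD(1) by simp
  qed
  have D3: "arc_degree (Ec - D) x \<le> 2 * (l + 2 * (om + tau))" if x: "x \<in> Vc" for x
  proof -
    have "Ec - D = U" using PU(1) by (auto simp: D_def)
    then show ?thesis using PU(4) x by simp
  qed
  have "perfect (mset_set E)" if "perfect (mset_set D)"
  proof -
    obtain P0 where P0: "\<forall>p\<in>#P0. distinct p \<and> 2 \<le> length p" "\<forall>p\<in>#P0. \<forall>q\<in>#P0. hd p \<noteq> last q"
      "(\<Sum>p\<in>#P0. path_arcs p) = mset_set D" using \<open>perfect (mset_set D)\<close> unfolding perfect_def by (elim exE conjE)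
    have P0ne: "p \<noteq> []" if "p \<in># P0" for p using P0(1) that by force
    have finD: "finite D" using finEc by (simp add: D_def)
    have P0V: "set p \<subseteq> Vc" if p: "p \<in># P0" for p
    proof
      fix x assume x: "x \<in> set p"
      have "2 \<le> length p" using P0(1) p by blast
      from path_arcs_touch[OF x this] obtain e where e: "e \<in># path_arcs p" "fst e = x \<or> snd e = x" by blast
      have "e \<in># (\<Sum>p\<in>#P0. path_arcs p)" using e(1) p by auto
      then have "e \<in> D" unfolding P0(3) using finD by simp
      then have "e \<in> Vc \<times> Vc" using EcV by (auto simp: D_def)
      then show "x \<in> Vc" using e(2) by auto
    qed
    have cP0: "int (count (image_mset hd P0) x) = max (excess_at D x) 0" "int (count (image_mset last P0) x) = max (- excess_at D x) 0" for x
      using perfect_counts(1)[OF P0ne P0(2), of x] perfect_counts(2)[OF P0ne P0(2), of x] unfolding P0(3) by simp_all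
    have ends: "hd p \<in> Vc" "last p \<in> Vc" if "p \<in># P0" for p
      using P0V[OF that] P0ne[OF that] by auto
    have m1: "image_mset last TA = image_mset hd P0"
    proof (rule multiset_eqI)
      fix x show "count (image_mset last TA) x = count (image_mset hd P0) x"
      proof (cases "x \<in> Vc")
        case True
        then show ?thesis using cP0(1)[of x] maxD(1)[OF True] by (simp add: count_image_eq_size)
      next
        case False
        then have "x \<notin># image_mset last TA" "x \<notin># image_mset hd P0" using p_Sg(1,2) ends(1) by auto
        then show ?thesis by (simp only: not_in_iff)
      qed
    qed
    have m2: "image_mset last P0 = image_mset hd TB"
    proof (rule multiset_eqI)
      fix x show "count (image_mset last P0) x = count (image_mset hd TB) x"
      proof (cases "x \<in> Vc")
        case True
        then show ?thesis using cP0(2)[of x] maxD(2)[OF True] by (simp add: count_image_eq_size)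
      next
        case False
        then have "x \<notin># image_mset last P0" "x \<notin># image_mset hd TB" using p_Sg(3) ends(2) by auto
        then show ?thesis by (simp only: not_in_iff)
      qed
    qed
    \<comment> \<open>Every path of the decomposition of \<open>D\<close> receives a start token
      ending at its first vertex and, by \<open>M2\<close> below, an end token beginning at its last
      vertex. The equations \<open>m1\<close> and \<open>m2\<close> leave no token and no path
      unmatched.\<close>
    obtain M1 where M1: "image_mset fst M1 = TA" "image_mset snd M1 = P0" "\<forall>q\<in>#M1. last (fst q) = hd (snd q)"
      using match_msets[OF m1] by (elim exE conjE)
    have m3: "image_mset (\<lambda>q. last (snd q)) M1 = image_mset hd TB"
      using m2 unfolding M1(2)[symmetric] by (simp add: image_mset.compositionality comp_def)
    obtain M2 where M2: "image_mset fst M2 = M1" "image_mset snd M2 = TB" "\<forall>q\<in>#M2. last (snd (fst q)) = hd (snd q)"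
      using match_msets[OF m3] by (elim exE conjE)
    define nw where "nw q = butlast (fst (fst q)) @ snd (fst q) @ tl (snd q)" for q :: "('a list \<times> 'a list) \<times> 'a list"
    have nw: "distinct (nw q)" "2 \<le> length (nw q)" "?x (hd (nw q)) > 0" "?x (last (nw q)) < 0"
      "path_arcs (nw q) = path_arcs (fst (fst q)) + path_arcs (snd (fst q)) + path_arcs (snd q)" if q: "q \<in># M2" for q
    proof -
      obtain A p B where eq: "q = ((A, p), B)" by (cases q; cases "fst q") auto
      have q1: "(A, p) \<in># M1" using q unfolding M2(1)[symmetric] eq by force
      have "A \<in># TA" using q1 unfolding M1(1)[symmetric] by force
      then have A: "A \<noteq> []" "distinct A" "last A \<in> Vc" "set (butlast A) \<subseteq> Wp" "?x (hd A) > 0"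
        using p_tok(2) by (auto simp: tokA_def)
      have "B \<in># TB" using q unfolding M2(2)[symmetric] eq by force
      then have B: "B \<noteq> []" "distinct B" "hd B \<in> Vc" "set (tl B) \<subseteq> Wm" "?x (last B) < 0"
        using p_tok(3) by (auto simp: tokB_def)
      have "p \<in># P0" using q1 unfolding M1(2)[symmetric] by force
      then have p: "p \<noteq> []" "distinct p" "2 \<le> length p" "set p \<subseteq> Vc"
        using bspec[OF P0(1), of p] P0ne[of p] P0V[of p] by simp_all
      have l1: "last A = hd p" using bspec[OF M1(3) q1] by simp
      have l2: "last p = hd B" using bspec[OF M2(3) q] unfolding eq by simp
      have nweq: "nw q = butlast A @ p @ tl B" by (simp add: nw_def eq)
      have "set (butlast A) \<inter> set p = {}" "set p \<inter> set (tl B) = {}" "set (butlast A) \<inter> set (tl B) = {}"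
        using A(4) B(4) p(4) disjW WW by blast+
      then show "distinct (nw q)" using A(2) B(2) p(2) by (auto simp: nweq distinct_butlast distinct_tl)
      show "2 \<le> length (nw q)" using p(3) by (simp add: nweq)
      have "hd (nw q) = hd A"
      proof (cases "butlast A = []")
        case True
        then have "A = [last A]" using A(1) by (metis append_Nil append_butlast_last_id)
        then have "hd A = hd p" using l1 by (metis list.sel(1))
        then show ?thesis using True p(1) by (simp add: nweq)
      next
        case False
        then show ?thesis using A(1) by (cases A) (auto simp: nweq split: if_splits)
      qed
      then show "?x (hd (nw q)) > 0" using A(5) by simp
      have "last (nw q) = last B"
      proof (cases "tl B = []")
        case True
        then have "B = [hd B]" using B(1) by (metis list.collapse)
        then have "last B = last p" using l2 by (metis last.simps)
        then show ?thesis using True p(1) by (simp add: nweq)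
      next
        case False
        then show ?thesis using B(1) by (cases B) (auto simp: nweq)
      qed
      then show "?x (last (nw q)) < 0" using B(5) by simp
      have "path_arcs (butlast A @ p) = path_arcs A + path_arcs p" by (rule path_arcs_glue[OF A(1) p(1) l1])
      moreover have "path_arcs ((butlast A @ p) @ tl B) = path_arcs (butlast A @ p) + path_arcs B"
        using p(1) B(1) l2 by (intro path_arcs_glue') auto
      ultimately show "path_arcs (nw q) = path_arcs (fst (fst q)) + path_arcs (snd (fst q)) + path_arcs (snd q)"
        by (simp add: nweq[unfolded eq] eq)
    qed
    define Q where "Q = PM + image_mset nw M2 + mset_set SC"
    have "(\<Sum>p\<in>#image_mset nw M2. path_arcs p) = (\<Sum>q\<in>#M2. path_arcs (fst (fst q)) + path_arcs (snd (fst q)) + path_arcs (snd q))"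
      using nw(5) by (simp add: image_mset.compositionality comp_def cong: image_mset_cong)
    also have "\<dots> = (\<Sum>A\<in>#TA. path_arcs A) + mset_set D + (\<Sum>B\<in>#TB. path_arcs B)"
      unfolding P0(3)[symmetric] M1(1,2)[symmetric] M2(1,2)[symmetric]
      by (simp add: sum_mset.distrib image_mset.compositionality comp_def)
    finally have "(\<Sum>p\<in>#Q. path_arcs p) = mset_set E"
      unfolding Q_def ident by (simp add: sum_unfold_sum_mset add_ac)
    moreover have Qm: "distinct p \<and> 2 \<le> length p \<and> ?x (hd p) > 0 \<and> ?x (last p) < 0" if p: "p \<in># Q" for p
    proof -
      consider "p \<in># PM" | q where "q \<in># M2" "p = nw q" | "p \<in> SC" using p p_SC(1) unfolding Q_def by auto
      then show ?thesis
      proof cases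
        case 1
        from PMmem[OF this] obtain i where i: "i < r" "p = P i" by (elim exE conjE)
        have e: "?x (hd p) > 0" "?x (last p) < 0" using Pi[OF i(1)] tA(6)[OF i(1)] tB(6)[OF i(1)] i(2) by auto
        then have "hd p \<noteq> last p" by auto
        then have "2 \<le> length p" using Pi(2)[OF i(1)] i(2) by (intro two_le_length) auto
        then show ?thesis using e Pi(1)[OF i(1)] i(2) by simp
      next
        case 2
        then show ?thesis using nw(1-4)[of q] by simp
      next
        case 3
        then show ?thesis using p_SC(2) excess_hubs by auto
      qed
    qed
    moreover have "hd p \<noteq> last q" if "p \<in># Q" "q \<in># Q" for p q using Qm[OF that(1)] Qm[OF that(2)] by auto
    ultimately show ?thesis unfolding perfect_def by (intro exI[of _ Q] conjI ballI) simp_all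
  qed
  then show ?thesis
    using D1 D2 D3 size by (intro exI[of _ D] exI[of _ "size TA"] conjI) (auto simp: D_def clsl(3)[THEN add_leD2])
qed

end

section \<open>Numerical parameters and parity\<close>

lemma half_le_div:
  fixes x :: real
  assumes "2 * x \<le> real a / real b" "1 \<le> x"
  shows "x \<le> real (a div b)"
proof -
  have "real a / real b < real (a div b) + 1"
    by (metis floor_divide_of_nat_eq of_int_of_nat_eq real_of_int_floor_add_one_gt)
  then show ?thesis using assms by linarith
qed

text \<open>\<open>s\<close> comes from the excess bound, and \<open>k\<close>, \<open>L\<close>,
  \<open>w\<close> are the largest integers that the upper bounds in
  \<open>dense_perfect_nat\<close> allow; rounding costs at most a factor 2 by
  \<open>half_le_div\<close>. In units of \<open>n\<close>, the last three are at least
  \<open>c\<close>, \<open>c ^ 2 / 2 ^ 10\<close> and \<open>c ^ 4 / 2 ^ 21\<close>.\<close>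

lemma dense_perfect:
  fixes \<beta> :: real
  assumes T: "tourn V E" and n: "card V = n" and b: "0 < \<beta>" "\<beta> \<le> 1" and big: "2 ^ 260 \<le> \<beta> ^ 36 * real n"
    and ex: "real_of_int (\<Sum>v\<in>V. max (excess_at E v) 0) \<ge> \<beta>\<^sup>2 * (real n)\<^sup>2"
  shows "perfect (mset_set E)"
proof -
  let ?N = "real n"
  have Npos: "0 < ?N" using big by (cases "n = 0") auto
  have pow: "2 ^ 260 \<le> \<beta> ^ j * ?N" if "j \<le> 36" for j
  proof -
    have "\<beta> ^ 36 \<le> \<beta> ^ j" using that b by (intro power_decreasing) auto
    then have "\<beta> ^ 36 * ?N \<le> \<beta> ^ j * ?N" using Npos by (intro mult_right_mono) auto
    then show ?thesis using big by linarith
  qed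
  have num: "(1000000000 :: real) \<le> 2 ^ 260" by simp
  have p2: "1000000000 \<le> \<beta> ^ 2 * ?N" using order_trans[OF num pow[of 2]] by simp
  define s where "s = nat \<lfloor>\<beta> ^ 2 * ?N / 80\<rfloor>"
  define k where "k = s * s div (100 * n)"
  define L where "L = k * k div (512 * n)"
  define w where "w = k * k * L div (1024 * n * n)"
  \<comment> \<open>Before rounding, \<open>k\<close> is at least
    \<open>\<beta> ^ 4 * n / 2560000\<close>, where \<open>2560000 = 100 * 160 ^ 2\<close>; the
    denominator \<open>2 ^ 23\<close> absorbs this constant and the factor 2 for rounding.\<close>
  define c where "c = \<beta> ^ 4 / 2 ^ 23"
  have cpos: "0 < c" using b by (simp add: c_def)
  have c4: "c ^ 4 = \<beta> ^ 16 / 2 ^ 92" "c ^ 2 = \<beta> ^ 8 / 2 ^ 46" "c ^ 5 = \<beta> ^ 20 / 2 ^ 115" "c ^ 9 = \<beta> ^ 36 / 2 ^ 207"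
    unfolding c_def power_divide by (simp_all flip: power_mult)
  have s1: "real s \<le> \<beta> ^ 2 * ?N / 80" "\<beta> ^ 2 * ?N / 160 \<le> real s"
    using p2 unfolding s_def by linarith+
  have s100: "100 \<le> s" using s1(2) p2 by linarith
  have "c * ?N \<le> real k"
    unfolding k_def
  proof (rule half_le_div)
    have "(\<beta> ^ 2 * ?N / 160) * (\<beta> ^ 2 * ?N / 160) \<le> real s * real s"
      using s1(2) b Npos by (intro mult_mono) auto
    then have "((\<beta> ^ 2 * ?N / 160) * (\<beta> ^ 2 * ?N / 160)) / (100 * ?N) \<le> (real s * real s) / (100 * ?N)"
      by (rule divide_right_mono) (use Npos in simp)
    moreover have "(real s * real s) / (100 * ?N) =  real (s * s) / real (100 * n)" by simp
    moreover have "((\<beta> ^ 2 * ?N / 160) * (\<beta> ^ 2 * ?N / 160)) / (100 * ?N) = \<beta> ^ 4 * ?N / 2560000"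
      using Npos by (simp add: field_simps power_numeral_reduce)
    moreover have "2 * (c * ?N) \<le> \<beta> ^ 4 * ?N / 2560000"
      using Npos b unfolding c_def by (simp add: field_simps)
    ultimately show "2 * (c * ?N) \<le> real (s * s) / real (100 * n)" by linarith
    show "1 \<le> c * ?N" using pow[of 4] unfolding c_def by simp
  qed
  note k1 = this
  have "c ^ 2 / 2 ^ 10 * ?N \<le> real L"
    unfolding L_def
  proof (rule half_le_div)
    have "(c * ?N) * (c * ?N) \<le> real k * real k" using k1 cpos Npos by (intro mult_mono) auto
    then have "((c * ?N) * (c * ?N)) / (512 * ?N) \<le> (real k * real k) / (512 * ?N)"
      by (rule divide_right_mono) (use Npos in simp)
    moreover have "(real k * real k) / (512 * ?N) =  real (k * k) / real (512 * n)" by simp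
    moreover have "((c * ?N) * (c * ?N)) / (512 * ?N) = 2 * (c ^ 2 / 2 ^ 10 * ?N)"
      using Npos by (simp add: field_simps power2_eq_square)
    ultimately show "2 * (c ^ 2 / 2 ^ 10 * ?N) \<le> real (k * k) / real (512 * n)" by linarith
    show "1 \<le> c ^ 2 / 2 ^ 10 * ?N" using pow[of 8] unfolding c4 by simp
  qed
  note L1 = this
  have "c ^ 4 / 2 ^ 21 * ?N \<le> real w"
    unfolding w_def
  proof (rule half_le_div)
    have "(c * ?N) * (c * ?N) * (c ^ 2 / 2 ^ 10 * ?N) \<le> real k * real k * real L"
      using k1 L1 cpos Npos by (intro mult_mono) auto
    then have "((c * ?N) * (c * ?N) * (c ^ 2 / 2 ^ 10 * ?N)) / (1024 * ?N * ?N) \<le> (real k * real k * real L) / (1024 * ?N * ?N)"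
      by (rule divide_right_mono) (use Npos in simp)
    moreover have "(real k * real k * real L) / (1024 * ?N * ?N) =  real (k * k * L) / real (1024 * n * n)" by simp
    moreover have "((c * ?N) * (c * ?N) * (c ^ 2 / 2 ^ 10 * ?N)) / (1024 * ?N * ?N) = 2 * (c ^ 4 / 2 ^ 21 * ?N)"
      using Npos by (simp add: field_simps power_numeral_reduce)
    ultimately show "2 * (c ^ 4 / 2 ^ 21 * ?N) \<le> real (k * k * L) / real (1024 * n * n)" by linarith
    show "1 \<le> c ^ 4 / 2 ^ 21 * ?N" using pow[of 16] unfolding c4 by simp
  qed
  note w1 = this
  have Vne: "V \<noteq> {}" using Npos n by auto
  have npos: "0 < n" using Npos by simp
  show ?thesis
  proof (rule dense_perfect_nat[OF T n Vne])
    have "real (80 * s * n) \<le> \<beta>\<^sup>2 * (real n)\<^sup>2"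
      using mult_right_mono[OF s1(1), of ?N] Npos by (simp add: power2_eq_square mult_ac)
    then show "(\<Sum>v\<in>V. max (excess_at E v) 0) \<ge> int (80 * s * n)"
      using ex by linarith
    show "100 \<le> s" by (rule s100)
    show "100 * n * k \<le> s * s" unfolding k_def by (rule times_div_less_eq_dividend)
    show "512 * n * L \<le> k * k" unfolding L_def by (rule times_div_less_eq_dividend)
    show w2: "1024 * n * n * w \<le> k * k * L" unfolding w_def by (rule times_div_less_eq_dividend)
    have "c ^ 2 / 2 ^ 10 * ?N > 0" "c ^ 4 / 2 ^ 21 * ?N > 0" using cpos Npos by simp_all
    then have "0 < real L" "0 < real w" using L1 w1 by linarith+
    then show Lpos: "0 < L" and wpos: "0 < w" by simp_all
    \<comment> \<open>The most demanding requirement on \<open>n\<close>: it follows from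
      \<open>c ^ 9 * n / 2 ^ 42 > 4\<close>, and \<open>c ^ 9 = \<beta> ^ 36 / 2 ^ 207\<close>. This
      is the origin of the exponent 36 and, with some room, of \<open>2 ^ 260\<close>.\<close>
    show "4 * n * n < w * (w * k)"
    proof -
      have "(c ^ 4 / 2 ^ 21 * ?N) * ((c ^ 4 / 2 ^ 21 * ?N) * (c * ?N)) \<le> real w * (real w * real k)"
        using w1 k1 cpos Npos by (intro mult_mono) auto
      moreover have "(c ^ 4 / 2 ^ 21 * ?N) * ((c ^ 4 / 2 ^ 21 * ?N) * (c * ?N)) = (c ^ 9 * ?N / 2 ^ 42) * (?N * ?N)"
        by (simp add: field_simps power_numeral_reduce)
      moreover have "5 \<le> c ^ 9 * ?N / 2 ^ 42" using big unfolding c4 by simp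
      then have "5 * (?N * ?N) \<le> (c ^ 9 * ?N / 2 ^ 42) * (?N * ?N)" using Npos by (intro mult_right_mono) auto
      moreover have "0 < ?N * ?N" using Npos by simp
      ultimately have "4 * (?N * ?N) < real w * (real w * real k)" by linarith
      then have "real (4 * n * n) < real (w * (w * k))" by simp
      then show ?thesis by (simp only: of_nat_less_iff)
    qed
    show "16 * w * w + 56 * n \<le> w * k"
    proof -
      have "(c ^ 4 / 2 ^ 21 * ?N) * (c * ?N) \<le> real w * real k"
        using w1 k1 cpos Npos by (intro mult_mono) auto
      moreover have "(c ^ 4 / 2 ^ 21 * ?N) * (c * ?N) = (c ^ 5 * ?N / 2 ^ 21) * ?N"
        by (simp add: field_simps power_numeral_reduce)
      moreover have "112 \<le> c ^ 5 * ?N / 2 ^ 21" using pow[of 20] unfolding c4 by simp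
      then have "112 * ?N \<le> (c ^ 5 * ?N / 2 ^ 21) * ?N" using Npos by (intro mult_right_mono) auto
      ultimately have "112 * ?N \<le> real w * real k" by linarith
      then have "real (112 * n) \<le> real (w * k)" by simp
      then have 1: "112 * n \<le> w * k" by (simp only: of_nat_le_iff)
      have "\<beta> ^ 2 \<le> 1" using b by (intro power_le_one) auto
      then have "\<beta> ^ 2 * ?N \<le> 1 * ?N" using Npos by (intro mult_right_mono) auto
      then have "real s \<le> ?N" using s1(1) by linarith
      then have sn: "s \<le> n" by simp
      have kn: "k \<le> n"
      proof -
        have "k \<le> n * n div (100 * n)" unfolding k_def using sn by (intro div_le_mono mult_le_mono)
        also have "\<dots> \<le> n * n div n" using npos by (intro div_le_mono2) auto
        finally show ?thesis using npos by simp
      qed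
      have Ln: "L \<le> n"
      proof -
        have "L \<le> n * n div (512 * n)" unfolding L_def using kn by (intro div_le_mono mult_le_mono)
        also have "\<dots> \<le> n * n div n" using npos by (intro div_le_mono2) auto
        finally show ?thesis using npos by simp
      qed
      have "k * k * L \<le> k * n * n" using kn Ln by (intro mult_le_mono) auto
      then have "1024 * n * n * w \<le> k * n * n" using w2 by linarith
      then have "n * n * (1024 * w) \<le> n * n * k" by (simp only: mult_ac)
      then have "1024 * w \<le> k" using npos by simp
      then have "w * (1024 * w) \<le> w * k" by simp
      then show ?thesis using 1 by linarith
    qed
  qed
qed

lemma card_remove_arcs:
  assumes "finite E" "D \<subseteq> E"
  shows "card (outs E x) \<le> card (outs D x) + arc_degree (E - D) x"
    and "card (ins E x) \<le> card (ins D x) + arc_degree (E - D) x"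
    and "card (outs E x) + card (ins E x) \<le> card (outs D x) + card (ins D x) + 2 * arc_degree (E - D) x"
proof -
  have finD: "finite D" using assms finite_subset by blast
  have "outs E x = outs D x \<union> outs (E - D) x" "ins E x = ins D x \<union> ins (E - D) x"
    using assms(2) by (auto simp: outs_def ins_def)
  then have "card (outs E x) \<le> card (outs D x) + card (outs (E - D) x)"
    "card (ins E x) \<le> card (ins D x) + card (ins (E - D) x)" by (metis card_Un_le)+
  moreover have "finite (E - D)" using assms(1) by simp
  ultimately show 1: "card (outs E x) \<le> card (outs D x) + arc_degree (E - D) x"
    and 2: "card (ins E x) \<le> card (ins D x) + arc_degree (E - D) x"
    using card_outs_le[of "E - D" x] card_ins_le[of "E - D" x] by linarith+
  then show "card (outs E x) + card (ins E x) \<le> card (outs D x) + card (ins D x) + 2 * arc_degree (E - D) x"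
    by linarith
qed

lemma card_restrict:
  assumes "finite E" "E \<subseteq> V \<times> V" "finite W" "x \<in> V - W"
  shows "card (outs E x) \<le> card (outs (E \<inter> (V - W) \<times> (V - W)) x) + card W"
    and "card (ins E x) \<le> card (ins (E \<inter> (V - W) \<times> (V - W)) x) + card W"
proof -
  let ?E = "E \<inter> (V - W) \<times> (V - W)"
  have "outs E x \<subseteq> outs ?E x \<union> W" "ins E x \<subseteq> ins ?E x \<union> W"
    using assms(2,4) by (auto simp: outs_def ins_def)
  then have "card (outs E x) \<le> card (outs ?E x \<union> W)" "card (ins E x) \<le> card (ins ?E x \<union> W)"
    using assms(1,3) by (auto intro!: card_mono)
  then show "card (outs E x) \<le> card (outs ?E x) + card W" "card (ins E x) \<le> card (ins ?E x) + card W"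
    by (meson card_Un_le le_trans)+
qed

text \<open>The estimates separate scales: the number \<open>om\<close> of hubs is far below both
  \<open>\<beta> * n\<close> and the hub threshold \<open>t = \<alpha> * n\<close>, which in turn is
  far below \<open>\<epsilon> * n\<close>.\<close>

lemma reduction:
  fixes C \<epsilon> \<alpha> \<beta> :: real
  assumes T: "tourn V E" and n: "card V = n" "even n" and C: "C > 32"
    and eps: "0 < \<epsilon>" "\<epsilon> \<le> 1" and al: "0 < \<alpha>" "\<alpha> \<le> \<epsilon> / 1000000" and be: "0 < \<beta>" "\<beta> \<le> \<alpha>\<^sup>2 / 1000000"
    and big: "2 ^ 260 \<le> \<beta> ^ 36 * real n"
    and ex: "real_of_int (\<Sum>v\<in>V. max (excess_at E v) 0) \<ge> C * real n"
    and np: "\<not> perfect (mset_set E)"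
  shows "\<exists>V' D. V' \<subseteq> V \<and> D \<subseteq> E \<inter> V' \<times> V' \<and> \<not> perfect (mset_set D) \<and>
    real (card V') \<ge> (1 - \<beta>) * real n \<and> even (card V') \<and>
    (\<forall>v\<in>V'. real (card (outs D v) + card (ins D v)) \<ge> (1 - \<epsilon>) * real (card V')) \<and>
    (\<forall>v\<in>V'. 1 \<le> \<bar>excess_at D v\<bar> \<and> real_of_int \<bar>excess_at D v\<bar> \<le> 3 * \<alpha> * real (card V')) \<and>
    real_of_int (\<Sum>v\<in>V'. max (excess_at D v) 0) \<ge> (C / 4 - 5) * real n"
proof -
  let ?N = "real n" and ?x = "excess_at E"
  note TD = tournD[OF T]
  have finE: "finite E" using TD(1,2) by (meson finite_SigmaI finite_subset)
  have Npos: "0 < ?N" using big by (cases "n = 0") auto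
  have al1: "\<alpha> \<le> 1 / 1000000" using al eps by simp
  have be1: "\<beta> \<le> \<alpha> / 1000000000000"
  proof -
    have "\<alpha> * \<alpha> \<le> \<alpha> * (1 / 1000000)" using al al1 by (intro mult_left_mono) auto
    then show ?thesis using be(2) by (simp add: power2_eq_square)
  qed
  have be2: "\<beta> \<le> 1" using be1 al1 by simp
  have bN: "1000000000 \<le> \<beta> * ?N"
  proof -
    have "(1000000000 :: real) \<le> 2 ^ 260" by simp
    moreover
    have "\<beta> ^ 36 \<le> \<beta> ^ 1" using be(1) be2 by (intro power_decreasing) auto
    then have "\<beta> ^ 36 * ?N \<le> \<beta> * ?N" using Npos by (intro mult_right_mono) auto
    ultimately show ?thesis using big by linarith
  qed
  define t where "t = \<alpha> * ?N"
  have bt: "\<beta> * ?N \<le> t / 1000000000000" using mult_right_mono[OF be1, of ?N] Npos by (simp add: t_def)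
  have tN: "t \<le> \<epsilon> * ?N / 1000000" using mult_right_mono[OF al(2), of ?N] Npos by (simp add: t_def)
  have eN: "\<epsilon> * ?N \<le> ?N" using mult_right_mono[OF eps(2), of ?N] Npos by simp
  have t260: "1000000000 \<le> t" using bN bt by linarith
  have nonneg: "0 \<le> (\<Sum>v\<in>V. max (?x v) 0)" by (rule sum_nonneg) simp
  define X where "X = nat (\<Sum>v\<in>V. max (?x v) 0)"
  have X: "(\<Sum>v\<in>V. max (?x v) 0) = int X" using nonneg by (simp add: X_def)
  have XC: "C * ?N \<le> real X" using ex X by simp
  have X32: "32 * ?N \<le> real X" 
  proof -
    have "32 * ?N \<le> C * ?N" using C Npos by (intro mult_right_mono) auto
    then show ?thesis using XC by linarith
  qed
  have Xsmall: "real X < \<beta>\<^sup>2 * ?N\<^sup>2"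
  proof (rule ccontr)
    assume "\<not> ?thesis"
    then have "perfect (mset_set E)" using dense_perfect[OF T n(1) be(1) be2 big] X by simp
    then show False using np by blast
  qed
  define Wp Wm where "Wp = {v \<in> V. real_of_int (?x v) > t}" and "Wm = {v \<in> V. real_of_int (- ?x v) > t}"
  define Vc where "Vc = V - (Wp \<union> Wm)"
  define Ec where "Ec = E \<inter> Vc \<times> Vc"
  define om where "om = card (Wp \<union> Wm)"
  have finW: "finite (Wp \<union> Wm)" using TD(1) by (auto simp: Wp_def Wm_def)
  have WW: "Wp \<inter> Wm = {}" using t260 by (auto simp: Wp_def Wm_def)
  \<comment> \<open>Every hub has excess above \<open>t\<close> in absolute value, and the absolute
    values sum to twice the total excess.\<close>
  have omX: "real om * t \<le> 2 * real X"
  proof -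
    have "real om * t = (\<Sum>v\<in>Wp \<union> Wm. t)" by (simp add: om_def)
    also have "\<dots> \<le> (\<Sum>v\<in>Wp \<union> Wm. real_of_int (max (?x v) 0 + max (- ?x v) 0))"
      by (rule sum_mono) (auto simp: Wp_def Wm_def)
    also have "\<dots> \<le> (\<Sum>v\<in>V. real_of_int (max (?x v) 0 + max (- ?x v) 0))"
      using TD(1) by (intro sum_mono2) (auto simp: Wp_def Wm_def)
    also have "\<dots> = real_of_int ((\<Sum>v\<in>V. max (?x v) 0) + (\<Sum>v\<in>V. max (- ?x v) 0))"
      by (simp add: sum.distrib)
    also have "\<dots> = 2 * real X" using sum_excess_neg[OF TD(1,2)] X by simp
    finally show ?thesis .
  qed
  have omt: "real om \<le> t / 1000000" and omb: "real om \<le> \<beta> * ?N / 1000000"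
  proof -
    have "real om * t \<le> 2 * (\<beta>\<^sup>2 * ?N\<^sup>2)" using omX Xsmall by linarith
    also have "\<beta>\<^sup>2 * ?N\<^sup>2 = (\<beta> * ?N) * (\<beta> * ?N)" by (simp add: power2_eq_square)
    also have "2 * ((\<beta> * ?N) * (\<beta> * ?N)) \<le> 2 * ((\<beta> * ?N) * (t / 1000000000000))"
      using bt bN by (intro mult_left_mono) auto
    finally have "real om * t \<le> (2 * (\<beta> * ?N) / 1000000000000) * t" by (simp add: field_simps)
    then have "real om \<le> 2 * (\<beta> * ?N) / 1000000000000" using t260 by (simp add: mult_le_cancel_right)
    then show "real om \<le> \<beta> * ?N / 1000000" "real om \<le> t / 1000000" using bN bt t260 by linarith+
  qed
  define l where "l = nat \<lfloor>t\<rfloor>"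
  have l: "real l \<le> t" "t \<le> real l + 1" using t260 unfolding l_def by linarith+
  \<comment> \<open>\<open>z\<close> bounds what a link may have to avoid; together with the
    vertices of a skeleton it stays within one percent of \<open>n\<close>. \<open>zh\<close> is the
    share of overloaded vertices in it.\<close>
  define zh z where "zh = n div 1000" and "z = n div 200"
  have zz: "real zh \<le> ?N / 1000" "?N / 1000 \<le> real zh + 1" "real z \<le> ?N / 200" "?N / 200 \<le> real z + 1"
    unfolding zh_def z_def by linarith+
  have tN6: "t \<le> ?N / 1000000" using tN eN by linarith
  have om2: "real (om * om) \<le> real X / 100000"
  proof -
    have "real om * real om \<le> real om * (t / 1000000)" using omt by (intro mult_left_mono) auto
    also have "\<dots> = real om * t / 1000000" by simp
    finally show ?thesis using omX by simp
  qed
  \<comment> \<open>The general form serves both rounds: \<open>om\<close> hubs with total excess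
    \<open>X\<close>, and a single hub with total excess \<open>K0\<close>.\<close>
  have big5: "5 * (m * n + 2 * Y) \<le> l * zh" if m: "m \<le> om + 1" and Y: "Y \<le> X" for m Y
  proof -
    have "real m \<le> t / 100000" using m omt t260 by linarith
    then have 1: "real m * ?N \<le> (t / 100000) * ?N" using Npos by (intro mult_right_mono) auto
    have "\<beta>\<^sup>2 * ?N\<^sup>2 = (\<beta> * ?N) * (\<beta> * ?N)" by (simp add: power2_eq_square)
    also have "\<dots> \<le> (t / 1000000000000) * ?N"
      using bt bN be2 Npos by (intro mult_mono) (auto simp: mult_le_cancel_right2)
    finally have 2: "real X \<le> (t / 1000000000000) * ?N" using Xsmall by linarith
    have "(t / 2) * (?N / 2000) \<le> real l * real zh"
      using l zz t260 tN6 Npos by (intro mult_mono) linarith+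
    moreover have "(t / 2) * (?N / 2000) = (t * ?N) / 4000" "(t / 100000) * ?N = (t * ?N) / 100000"
      "(t / 1000000000000) * ?N = (t * ?N) / 1000000000000" by simp_all
    moreover have "0 \<le> t * ?N" using t260 Npos by simp
    moreover have "real Y \<le> real X" using Y by simp
    ultimately have "5 * (real m * ?N + 2 * real Y) \<le> real l * real zh" using 1 2 by argo
    then have "real (5 * (m * n + 2 * Y)) \<le> real (l * zh)" by simp
    then show ?thesis by (simp only: of_nat_le_iff)
  qed
  have h: "hubs V E Wp Wm Vc Ec"
  proof
    show "(y, x) \<notin> E" if "(x, y) \<in> E" for x y by (rule tourn_asym[OF T that])
    have fW: "finite Wp" "finite Wm" using finW by auto
    show "card (ins E w) < card (outs E w \<inter> Vc)" if w: "w \<in> Wp" for w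
    proof -
      have "outs E w \<subseteq> (outs E w \<inter> Vc) \<union> (Wp \<union> Wm)" using TD(2) by (auto simp: outs_def Vc_def)
      then have "card (outs E w) \<le> card ((outs E w \<inter> Vc) \<union> (Wp \<union> Wm))"
        using finE finW by (intro card_mono) auto
      also have "\<dots> \<le> card (outs E w \<inter> Vc) + om" unfolding om_def by (rule card_Un_le)
      finally show ?thesis using w excess_at_eq[OF finE, of w] omt t260 by (auto simp: Wp_def)
    qed
    show "card (outs E w) < card (ins E w \<inter> Vc)" if w: "w \<in> Wm" for w
    proof -
      have "ins E w \<subseteq> (ins E w \<inter> Vc) \<union> (Wp \<union> Wm)" using TD(2) by (auto simp: ins_def Vc_def)
      then have "card (ins E w) \<le> card ((ins E w \<inter> Vc) \<union> (Wp \<union> Wm))"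
        using finE finW by (intro card_mono) auto
      also have "\<dots> \<le> card (ins E w \<inter> Vc) + om" unfolding om_def by (rule card_Un_le)
      finally show ?thesis using w excess_at_eq[OF finE, of w] omt t260 by (auto simp: Wm_def)
    qed
  qed (use TD WW in \<open>auto simp: Wp_def Wm_def Vc_def Ec_def\<close>)
  have degE: "card (outs E x) + card (ins E x) + 1 = n" if "x \<in> V" for x using tourn_degrees[OF T that] n by simp
  \<comment> \<open>All degrees equal \<open>n - 1\<close>, which is odd, so in- and out-degree
    differ.\<close>
  have exc: "?x x \<noteq> 0 \<and> \<bar>?x x\<bar> \<le> int l" if x: "x \<in> Vc" for x
  proof -
    have "x \<in> V" using x by (simp add: Vc_def)
    from degE[OF this] have "?x x \<noteq> 0" using excess_at_eq[OF finE, of x] n(2) by auto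
    moreover have "real_of_int \<bar>?x x\<bar> \<le> t" using x by (auto simp: Vc_def Wp_def Wm_def)
    then have "\<bar>?x x\<bar> \<le> \<lfloor>t\<rfloor>" by (simp add: le_floor_iff)
    ultimately show ?thesis using t260 by (simp add: l_def)
  qed
  have degEc: "49 * n \<le> 100 * card (outs Ec x)" "49 * n \<le> 100 * card (ins Ec x)" "n \<le> card (outs Ec x) + card (ins Ec x) + 2 * om + 1"
    if x: "x \<in> Vc" for x
  proof -
    have xV: "x \<in> V" "x \<in> V - (Wp \<union> Wm)" using x by (auto simp: Vc_def)
    have "real_of_int \<bar>?x x\<bar> \<le> t" using x by (auto simp: Vc_def Wp_def Wm_def)
    moreover have "card (outs E x) \<le> card (outs Ec x) + om" "card (ins E x) \<le> card (ins Ec x) + om"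
      using card_restrict[OF finE TD(2) finW xV(2)] unfolding om_def Ec_def Vc_def by blast+
    moreover have "real_of_int (?x x) = real (card (outs E x)) - real (card (ins E x))" using excess_at_eq[OF finE, of x] by simp
    moreover have "real (card (outs E x)) + real (card (ins E x)) + 1 = ?N" using degE[OF xV(1)] by (metis of_nat_1 of_nat_add)
    ultimately have "49 * ?N \<le> 100 * real (card (outs Ec x))" "49 * ?N \<le> 100 * real (card (ins Ec x))"
      "?N \<le> real (card (outs Ec x)) + real (card (ins Ec x)) + 2 * real om + 1"
      using omt tN6 t260 by linarith+
    then show "49 * n \<le> 100 * card (outs Ec x)" "49 * n \<le> 100 * card (ins Ec x)" "n \<le> card (outs Ec x) + card (ins Ec x) + 2 * om + 1"
      by linarith+
  qed
  have numz: "zh + 5 * (om + 2) \<le> z" "100 * (z + 4 * (om + 2)) \<le> n" "400 \<le> n" "2 * om + 2 * l \<le> n"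
    "om * om + 6 * n \<le> X" "2 * (l + 2 * (om + l)) \<le> z" "zh + 5 * (1 + 2) \<le> z" "100 * (z + 4 * (1 + 2)) \<le> n"
    "2 * 1 + 2 * (om + l) \<le> n" "2 * (l + 2 * (1 + (om + l))) \<le> z"
  proof -
    have "real (zh + 5 * (om + 2)) \<le> real (z)" "real (100 * (z + 4 * (om + 2))) \<le> real (n)" "real (400) \<le> real (n)" "real (2 * om + 2 * l) \<le> real (n)" "real (om * om + 6 * n) \<le> real (X)" "real (2 * (l + 2 * (om + l))) \<le> real (z)" "real (zh + 5 * (1 + 2)) \<le> real (z)" "real (100 * (z + 4 * (1 + 2))) \<le> real (n)" "real (2 * 1 + 2 * (om + l)) \<le> real (n)" "real (2 * (l + 2 * (1 + (om + l)))) \<le> real (z)"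
      using zz omt tN6 t260 l om2 X32 Npos
      unfolding of_nat_add of_nat_mult of_nat_numeral of_nat_1 distrib_left by linarith+
    then show "zh + 5 * (om + 2) \<le> z" "100 * (z + 4 * (om + 2)) \<le> n" "400 \<le> n" "2 * om + 2 * l \<le> n" "om * om + 6 * n \<le> X" "2 * (l + 2 * (om + l)) \<le> z" "zh + 5 * (1 + 2) \<le> z" "100 * (z + 4 * (1 + 2)) \<le> n" "2 * 1 + 2 * (om + l) \<le> n" "2 * (l + 2 * (1 + (om + l))) \<le> z"
      by (simp_all only: of_nat_le_iff)
  qed
  have "\<exists>D K. D \<subseteq> Ec \<and> (perfect (mset_set D) \<longrightarrow> perfect (mset_set E)) \<and>
    (\<forall>x\<in>Vc. excess_at D x \<noteq> 0 \<and> \<bar>excess_at D x\<bar> \<le> int (om + l)) \<and>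
    (\<forall>x\<in>Vc. arc_degree (Ec - D) x \<le> 2 * (l + 2 * (om + l))) \<and>
    (\<Sum>x\<in>Vc. max (excess_at D x) 0) = int K \<and> K \<le> X \<and>
    X \<le> om * om + 3 * n + 2 * K + 2 * (om + l) \<and>
    (Wm = {} \<longrightarrow> int X \<le> int (3 * n + K) + (\<Sum>w\<in>Wp. excess_at E w))"
  proof (rule hubs.hub_reduction[OF h, where l = l and zh = zh and z = z])
    show "card V \<le> n" "card (Wp \<union> Wm) \<le> om" using n by (auto simp: om_def)
    show "\<forall>x\<in>Vc. ?x x \<noteq> 0 \<and> \<bar>?x x\<bar> \<le> int l" using exc by blast
    show "12 * n \<le> 25 * card (outs Ec x)" "12 * n \<le> 25 * card (ins Ec x)" if "x \<in> Vc" for x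
      using degEc[OF that] by linarith+
    show "(\<Sum>v\<in>V. max (?x v) 0) = int X" by (rule X)
    show "5 * (om * n + 2 * X) \<le> l * zh" by (rule big5) auto
    show "0 < l" using l t260 by linarith
  qed (fact numz)+
  then obtain D0 K0 where D0: "D0 \<subseteq> Ec" "perfect (mset_set D0) \<longrightarrow> perfect (mset_set E)"
    "\<forall>x\<in>Vc. excess_at D0 x \<noteq> 0 \<and> \<bar>excess_at D0 x\<bar> \<le> int (om + l)"
    "\<forall>x\<in>Vc. arc_degree (Ec - D0) x \<le> 2 * (l + 2 * (om + l))"
    "(\<Sum>x\<in>Vc. max (excess_at D0 x) 0) = int K0" "K0 \<le> X" "X \<le> om * om + 3 * n + 2 * K0 + 2 * (om + l)"
    by (elim exE conjE)
  have finEc: "finite Ec" using finE by (simp add: Ec_def)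
  have finD0: "finite D0" using D0(1) finEc finite_subset by blast
  have finVc: "finite Vc" using TD(1) by (simp add: Vc_def)
  have np0: "\<not> perfect (mset_set D0)" using D0(2) np by blast
  define CN where "CN = C * ?N"
  have C32: "32 * ?N \<le> CN" using C Npos by (simp add: CN_def)
  \<comment> \<open>About half of \<open>X\<close> survives, less a linear term; the quadratic term
    \<open>om * om\<close> is negligible against \<open>X\<close>.\<close>
  have K0: "CN / 2 - 2 * ?N \<le> real K0 + CN / 100000"
  proof -
    have "real X \<le> real (om * om + 3 * n + 2 * K0 + 2 * (om + l))"
      using D0(7) by (simp only: of_nat_le_iff)
    then have "real X \<le> real (om * om) + 3 * ?N + 2 * real K0 + 2 * (real om + real l)" by simp
    moreover have "real X * (1 - 1 / 100000) = real X - real X / 100000" by (simp add: algebra_simps)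
    ultimately have "real X * (1 - 1 / 100000) \<le> 3 * ?N + 2 * real K0 + 2 * (real om + real l)" using om2 by linarith
    moreover have "CN * (1 - 1 / 100000) \<le> real X * (1 - 1 / 100000)" using XC unfolding CN_def by (intro mult_right_mono) auto
    moreover have "CN * (1 - 1 / 100000) = CN - CN / 100000" by (simp add: algebra_simps)
    ultimately have "CN - CN / 100000 \<le> 3 * ?N + 2 * real K0 + 2 * (real om + real l)" by linarith
    moreover have "real om + real l \<le> ?N / 2" using omt l tN6 t260 by linarith
    moreover have "0 \<le> CN / 100000" using C32 Npos by simp
    moreover have "2 * (real om + real l) = 2 * real om + 2 * real l" by simp
    ultimately have "CN - CN / 100000 \<le> 4 * ?N + 2 * real K0" "0 \<le> CN / 100000" by argo+
    then show ?thesis by (simp add: field_simps)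
  qed
  \<comment> \<open>Here \<open>C > 32\<close> enters: \<open>CN / 2 - 2 * n\<close> exceeds
    \<open>CN / 4\<close> by several \<open>n\<close>, and \<open>K0\<close> is large enough for a
    second round.\<close>
  have K0big: "13 * ?N \<le> real K0" "CN / 4 + ?N \<le> real K0" using K0 C32 Npos by (simp_all add: field_simps)
  have cVc: "card Vc + om = n"
    unfolding Vc_def om_def using card_Diff_subset[OF finW, of V] card_mono[OF TD(1), of "Wp \<union> Wm"] n(1)
    by (auto simp: Wp_def Wm_def)
  \<comment> \<open>Bounds on the number of link arcs removed at a vertex in the first and in the
    second round.\<close>
  define r r1 where "r = 2 * (l + 2 * (om + l))" and "r1 = 2 * (l + 2 * (1 + (om + l)))"
  have rr: "real r \<le> 7 * t" "real r1 \<le> 7 * t" using l omt t260 unfolding r_def r1_def by simp_all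
  \<comment> \<open>Common end of both parities. The allowances for one further vertex and for the
    link arcs of a second round are included, so the even case satisfies them with room.\<close>
  have finish: ?thesis
    if D: "V' \<subseteq> V" "D \<subseteq> E \<inter> V' \<times> V'" "\<not> perfect (mset_set D)" "even (card V')"
      and cV: "n \<le> card V' + om + 1" "card V' \<le> n"
      and dg: "\<And>v. v \<in> V' \<Longrightarrow> n \<le> card (outs D v) + card (ins D v) + 2 * om + 3 + 2 * r + 2 * r1"
      and xs: "\<And>v. v \<in> V' \<Longrightarrow> excess_at D v \<noteq> 0 \<and> \<bar>excess_at D v\<bar> \<le> int (1 + (om + l))"
      and K: "(\<Sum>v\<in>V'. max (excess_at D v) 0) = int K" "(C / 4 - 5) * ?N \<le> real K" for V' D K
  proof (rule exI[of _ V'], rule exI[of _ D], intro conjI ballI)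
    have cV': "?N \<le> real (card V') + real om + 1" "real (card V') \<le> ?N" using cV by linarith+
    have "(1 - \<beta>) * ?N = ?N - \<beta> * ?N" by (simp add: algebra_simps)
    then show "(1 - \<beta>) * ?N \<le> real (card V')" using cV' omb bN by linarith
    fix v assume v: "v \<in> V'"
    have "(1 - \<epsilon>) * real (card V') \<le> (1 - \<epsilon>) * ?N" using cV' eps by (intro mult_left_mono) auto
    also have "\<dots> = ?N - \<epsilon> * ?N" by (simp add: algebra_simps)
    also have "\<dots> \<le> real (card (outs D v) + card (ins D v))"
    proof -
      have "?N \<le> real (card (outs D v) + card (ins D v)) + 2 * real om + 3 + 2 * real r + 2 * real r1"
        using dg[OF v] by linarith
      then show ?thesis using omt rr tN t260 by linarith
    qed
    finally show "(1 - \<epsilon>) * real (card V') \<le> real (card (outs D v) + card (ins D v))" .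
    show "1 \<le> \<bar>excess_at D v\<bar>" using xs[OF v] by linarith
    have "\<alpha> * (9 / 10 * ?N) \<le> \<alpha> * real (card V')" using cV' omt tN6 t260 al by (intro mult_left_mono) linarith+
    moreover have "\<alpha> * (9 / 10 * ?N) = 9 / 10 * t" by (simp add: t_def)
    moreover have "real_of_int \<bar>excess_at D v\<bar> \<le> 1 + (real om + real l)" using xs[OF v] by linarith
    ultimately show "real_of_int \<bar>excess_at D v\<bar> \<le> 3 * \<alpha> * real (card V')" using l omt t260 by linarith
  qed (use D K in simp_all)
  show ?thesis
  proof (cases "even (card Vc)")
    case True
    show ?thesis
    proof (rule finish[of Vc D0 K0])
      show "Vc \<subseteq> V" by (auto simp: Vc_def)
      show "D0 \<subseteq> E \<inter> Vc \<times> Vc" using D0(1) by (simp add: Ec_def)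
      show "n \<le> card (outs D0 v) + card (ins D0 v) + 2 * om + 3 + 2 * r + 2 * r1" if v: "v \<in> Vc" for v
        using card_remove_arcs(3)[OF finEc D0(1), of v] bspec[OF D0(4) v] degEc(3)[OF v] unfolding r_def[symmetric] by linarith
      show "excess_at D0 v \<noteq> 0 \<and> \<bar>excess_at D0 v\<bar> \<le> int (1 + (om + l))" if v: "v \<in> Vc" for v
        using bspec[OF D0(3) v] by auto
      show "(C / 4 - 5) * ?N \<le> real K0" using K0big(2) Npos by (simp add: CN_def algebra_simps)
    qed (use True cVc np0 D0(5) in simp_all)
  next
    case odd: False
    have "\<exists>u\<in>Vc. excess_at D0 u > 0"
    proof (rule ccontr)
      assume "\<not> ?thesis"
      then have "(\<Sum>x\<in>Vc. max (excess_at D0 x) 0) = 0" by (intro sum.neutral) (auto simp: not_less)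
      then show False using D0(5) K0big(1) Npos by simp
    qed
    \<comment> \<open>A vertex of positive excess satisfies \<open>hub_out\<close> on its own, as
      all its out-neighbours lie in the new core. With no negative hub, the last clause of
      \<open>hub_reduction\<close> applies and the excess is not halved again.\<close>
    then obtain u where u: "u \<in> Vc" "excess_at D0 u > 0" by blast
    define V1 where "V1 = Vc - {u}"
    define E1 where "E1 = D0 \<inter> V1 \<times> V1"
    have D0Vc: "D0 \<subseteq> Vc \<times> Vc" and D0E: "D0 \<subseteq> E" using D0(1) by (auto simp: Ec_def)
    have irr: "(y, y) \<notin> D0" for y using D0E TD(3) by blast
    have h1: "hubs Vc D0 {u} {} V1 E1"
    proof
      show "(y, x) \<notin> D0" if "(x, y) \<in> D0" for x y using tourn_asym[OF T] D0E that by blast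
      show "card (ins D0 w) < card (outs D0 w \<inter> V1)" if w: "w \<in> {u}" for w
      proof -
        have "outs D0 u \<inter> V1 = outs D0 u" using D0Vc irr by (auto simp: outs_def V1_def)
        then show ?thesis using w u(2) excess_at_eq[OF finD0, of u] by simp
      qed
    qed (use finVc D0Vc u in \<open>auto simp: V1_def E1_def\<close>)
    have E1eq: "E1 = D0 \<inter> (Vc - {u}) \<times> (Vc - {u})" by (simp add: E1_def V1_def)
    have dgD0: "card (outs Ec x) \<le> card (outs E1 x) + r + 1" "card (ins Ec x) \<le> card (ins E1 x) + r + 1"
      "card (outs Ec x) + card (ins Ec x) \<le> card (outs E1 x) + card (ins E1 x) + 2 * r + 2" if x: "x \<in> V1" for x
    proof -
      have xV: "x \<in> Vc" "x \<in> Vc - {u}" using x by (auto simp: V1_def)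
      have a: "arc_degree (Ec - D0) x \<le> r" using bspec[OF D0(4) xV(1)] unfolding r_def .
      have b: "card (outs D0 x) \<le> card (outs E1 x) + 1" "card (ins D0 x) \<le> card (ins E1 x) + 1"
        using card_restrict[OF finD0 D0Vc _ xV(2)] unfolding E1eq by simp_all
      show "card (outs Ec x) \<le> card (outs E1 x) + r + 1" "card (ins Ec x) \<le> card (ins E1 x) + r + 1"
        "card (outs Ec x) + card (ins Ec x) \<le> card (outs E1 x) + card (ins E1 x) + 2 * r + 2"
        using card_remove_arcs[OF finEc D0(1), of x] a b by linarith+
    qed
    have "\<exists>D K. D \<subseteq> E1 \<and> (perfect (mset_set D) \<longrightarrow> perfect (mset_set D0)) \<and>
      (\<forall>x\<in>V1. excess_at D x \<noteq> 0 \<and> \<bar>excess_at D x\<bar> \<le> int (1 + (om + l))) \<and>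
      (\<forall>x\<in>V1. arc_degree (E1 - D) x \<le> 2 * (l + 2 * (1 + (om + l)))) \<and>
      (\<Sum>x\<in>V1. max (excess_at D x) 0) = int K \<and> K \<le> K0 \<and>
      K0 \<le> 1 * 1 + 3 * n + 2 * K + 2 * (1 + (om + l)) \<and>
      ({} = ({} :: 'a set) \<longrightarrow> int K0 \<le> int (3 * n + K) + (\<Sum>w\<in>{u}. excess_at D0 w))"
    proof (rule hubs.hub_reduction[OF h1, where l = l and zh = zh and z = z])
      show "card Vc \<le> n" "card ({u} \<union> {}) \<le> 1" using cVc by simp_all
      show "\<forall>x\<in>V1. excess_at D0 x \<noteq> 0 \<and> \<bar>excess_at D0 x\<bar> \<le> int (om + l)" using D0(3) by (auto simp: V1_def)
      have "real (100 * r + 100) \<le> ?N" using rr tN6 t260 by simp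
      then have r100: "100 * r + 100 \<le> n" by (simp only: of_nat_le_iff)
      then show "12 * n \<le> 25 * card (outs E1 x)" "12 * n \<le> 25 * card (ins E1 x)" if x: "x \<in> V1" for x
      proof -
        have xV: "x \<in> Vc" using x by (auto simp: V1_def)
        show "12 * n \<le> 25 * card (outs E1 x)" "12 * n \<le> 25 * card (ins E1 x)"
          using degEc(1,2)[OF xV] dgD0(1,2)[OF x] r100 by linarith+
      qed
      show "(\<Sum>v\<in>Vc. max (excess_at D0 v) 0) = int K0" by (rule D0(5))
      show "5 * (1 * n + 2 * K0) \<le> l * zh" by (rule big5) (use D0(6) in auto)
      show "0 < l" using l t260 by linarith
      show "1 * 1 + 6 * n \<le> K0" using K0big(1) numz(3) by linarith
    qed (fact numz)+
    then obtain D1 K1 where D1: "D1 \<subseteq> E1" "perfect (mset_set D1) \<longrightarrow> perfect (mset_set D0)"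
      "\<forall>x\<in>V1. excess_at D1 x \<noteq> 0 \<and> \<bar>excess_at D1 x\<bar> \<le> int (1 + (om + l))"
      "\<forall>x\<in>V1. arc_degree (E1 - D1) x \<le> 2 * (l + 2 * (1 + (om + l)))"
      "(\<Sum>x\<in>V1. max (excess_at D1 x) 0) = int K1"
      "{} = ({} :: 'a set) \<longrightarrow> int K0 \<le> int (3 * n + K1) + (\<Sum>w\<in>{u}. excess_at D0 w)"
      by (elim exE conjE)
    have finE1: "finite E1" using finD0 by (simp add: E1_def)
    have cV1: "card V1 + om + 1 = n" using cVc card_Suc_Diff1[OF finVc u(1)] unfolding V1_def by linarith
    show ?thesis
    proof (rule finish[of V1 D1 K1])
      show "V1 \<subseteq> V" by (auto simp: V1_def Vc_def)
      show "D1 \<subseteq> E \<inter> V1 \<times> V1" using D1(1) D0E by (auto simp: E1_def)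
      show "\<not> perfect (mset_set D1)" using D1(2) np0 by blast
      show "even (card V1)" using odd card_Suc_Diff1[OF finVc u(1)] unfolding V1_def by (metis even_Suc)
      show "n \<le> card (outs D1 v) + card (ins D1 v) + 2 * om + 3 + 2 * r + 2 * r1" if v: "v \<in> V1" for v
      proof -
        have "v \<in> Vc" using v by (simp add: V1_def)
        then show ?thesis
          using card_remove_arcs(3)[OF finE1 D1(1), of v] bspec[OF D1(4) v] degEc(3)[of v] dgD0(3)[OF v]
          unfolding r1_def[symmetric] by linarith
      qed
      show "excess_at D1 v \<noteq> 0 \<and> \<bar>excess_at D1 v\<bar> \<le> int (1 + (om + l))" if "v \<in> V1" for v
        using D1(3) that by blast
      \<comment> \<open>The second round costs at most \<open>3 * n\<close> and the excess of
        \<open>u\<close>, which is at most \<open>om + l\<close>.\<close>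
      have "real K0 \<le> 3 * ?N + real K1 + (real om + real l)"
      proof -
        have "int K0 \<le> int (3 * n + K1) + excess_at D0 u" using D1(6) by simp
        moreover have "excess_at D0 u \<le> int (om + l)" using bspec[OF D0(3) u(1)] by linarith
        ultimately have "K0 \<le> 3 * n + K1 + (om + l)" by linarith
        then show ?thesis by linarith
      qed
      then have "CN / 4 - 5 * ?N \<le> real K1"
        using K0big(2) omt l tN6 t260 Npos by linarith
      then show "(C / 4 - 5) * ?N \<le> real K1" by (simp add: CN_def algebra_simps)
    qed (use cV1 D1(5) in simp_all)
  qed
qed

section \<open>Translation to digraphs\<close>

context digraph
begin

lemma inj_arc_to_ends: "inj_on (arc_to_ends G) (arcs G)"
  using no_multi_arcs by (auto simp: inj_on_def)

lemma out_degree_outs: "out_degree G v = card (outs (arcs_ends G) v)"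
  unfolding out_degree_def
proof (rule bij_betw_same_card[of "head G"])
  show "bij_betw (head G) (out_arcs G v) (outs (arcs_ends G) v)"
    using no_multi_arcs by (force simp: bij_betw_def inj_on_def out_arcs_def outs_def arcs_ends_def arc_to_ends_def)
qed

lemma in_degree_ins: "in_degree G v = card (ins (arcs_ends G) v)"
  unfolding in_degree_def
proof (rule bij_betw_same_card[of "tail G"])
  show "bij_betw (tail G) (in_arcs G v) (ins (arcs_ends G) v)"
    using no_multi_arcs by (force simp: bij_betw_def inj_on_def in_arcs_def ins_def arcs_ends_def arc_to_ends_def)
qed

lemma excess_eq: "excess G v = excess_at (arcs_ends G) v"
proof -
  have "finite (arcs_ends G)" by (simp add: arcs_ends_def)
  then show ?thesis by (simp add: excess_def out_degree_outs in_degree_ins excess_at_eq)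
qed

lemma total_excess_eq: "total_excess G = (\<Sum>v\<in>verts G. max (excess_at (arcs_ends G) v) 0)"
  by (simp add: total_excess_def excess_eq)

lemma perfect_iff: "has_perfect_decomposition G \<longleftrightarrow> perfect (mset_set (arcs_ends G))"
  using perfect_if_has_perfect_decomposition has_perfect_decomposition_if_perfect
    inj_arc_to_ends total_excess_eq by auto

text \<open>\<open>H\<close> keeps the arcs of \<open>G\<close> themselves instead of using pairs as
  arcs, so that it is a genuine subgraph of \<open>G\<close>.\<close>

lemma restricted_digraph:
  fixes V' :: "'a set" and D :: "('a \<times> 'a) set"
  defines "H \<equiv> \<lparr>verts = V', arcs = {a \<in> arcs G. arc_to_ends G a \<in> D}, tail = tail G, head = head G\<rparr>"
  assumes "V' \<subseteq> verts G" "D \<subseteq> arcs_ends G \<inter> V' \<times> V'"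
  shows "subgraph H G" "digraph H" "arcs_ends H = D" "verts H = V'"
proof -
  have ate: "arc_to_ends H = arc_to_ends G" by (simp add: H_def arc_to_ends_def fun_eq_iff)
  have wf: "wf_digraph H"
    using assms(3) by unfold_locales (auto simp: H_def arc_to_ends_def)
  show "verts H = V'" by (simp add: H_def)
  show "subgraph H G"
    unfolding subgraph_def compatible_def using assms(2) wf wf_digraph_axioms by (auto simp: H_def)
  show "digraph H"
  proof (intro digraph.intro fin_digraph.intro fin_digraph_axioms.intro loopfree_digraph.intro
      loopfree_digraph_axioms.intro nomulti_digraph.intro nomulti_digraph_axioms.intro wf)
    show "finite (verts H)" using finite_subset[OF assms(2)] by (simp add: H_def)
    show "finite (arcs H)" by (simp add: H_def)
    show "tail H e \<noteq> head H e" if "e \<in> arcs H" for e using that no_loops by (auto simp: H_def)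
    show "e1 = e2" if "e1 \<in> arcs H" "e2 \<in> arcs H" "arc_to_ends H e1 = arc_to_ends H e2" for e1 e2
      using that no_multi_arcs unfolding ate by (auto simp: H_def)
  qed
  show "arcs_ends H = D"
    unfolding arcs_ends_def ate using assms(3) by (force simp: H_def arcs_ends_def)
qed

end

lemma tournament_tourn: "tournament T \<Longrightarrow> tourn (verts T) (arcs_ends T)"
proof -
  assume T: "tournament T"
  then interpret digraph T by (simp add: tournament_def)
  have "arcs_ends T \<subseteq> verts T \<times> verts T" by (auto simp: arcs_ends_def arc_to_ends_def)
  moreover have "(x, x) \<notin> arcs_ends T" for x
    using no_loops by (auto simp: arcs_ends_def arc_to_ends_def)
  ultimately show ?thesis using T finite_verts unfolding tourn_def tournament_def by blast
qed

theorem theorem6p1: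
  "\<exists>f\<^sub>1 f\<^sub>2 f\<^sub>3. hierarchy_fun f\<^sub>1 \<and> hierarchy_fun f\<^sub>2 \<and> hierarchy_fun f\<^sub>3 \<and>
    (\<forall>(C::real) (\<epsilon>::real) (\<alpha>::real) (\<beta>::real) (n::nat) (T :: ('a, 'b) pre_digraph).
      C > 32 \<and> 0 < \<epsilon> \<and> \<epsilon> \<le> 1 \<and> 0 < \<alpha> \<and> \<alpha> \<le> f\<^sub>1 \<epsilon> \<and> 0 < \<beta> \<and> \<beta> \<le> f\<^sub>2 \<alpha> \<and>
      0 < n \<and> 1 / real n \<le> f\<^sub>3 \<beta> \<and> even n \<and>
      tournament T \<and> card (verts T) = n \<and>
      real_of_int (total_excess T) \<ge> C * real n \<and>
      \<not> has_perfect_decomposition T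
      \<longrightarrow>
      (\<exists>D. subgraph D T \<and>
        \<not> has_perfect_decomposition D \<and>
        real (card (verts D)) \<ge> (1 - \<beta>) * real n \<and> even (card (verts D)) \<and>
        (\<forall>v \<in> verts D. real (degree D v) \<ge> (1 - \<epsilon>) * real (card (verts D))) \<and>
        (\<forall>v \<in> verts D. 1 \<le> \<bar>excess D v\<bar> \<and>
          real_of_int \<bar>excess D v\<bar> \<le> 3 * \<alpha> * real (card (verts D))) \<and>
        real_of_int (total_excess D) \<ge> (C / 4 - 5) * real n))"
proof (rule exI[of _ "\<lambda>x. x / 1000000"], rule exI[of _ "\<lambda>x. x\<^sup>2 / 1000000"],
    rule exI[of _ "\<lambda>x. x ^ 36 / 2 ^ 260"], intro conjI allI impI)
  show "hierarchy_fun (\<lambda>x. x / 1000000)" "hierarchy_fun (\<lambda>x. x\<^sup>2 / 1000000)" "hierarchy_fun (\<lambda>x. x ^ 36 / 2 ^ 260)"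
  proof -
    show "hierarchy_fun (\<lambda>x. x / 1000000)"
      by (auto simp: hierarchy_fun_def mono_on_def)
    have "x\<^sup>2 \<le> 1" "x ^ 36 \<le> 1" if "0 < x" "x \<le> 1" for x :: real
      using that by (simp_all add: power_le_one)
    then have le: "x\<^sup>2 \<le> 1000000" "x ^ 36 \<le> 2 ^ 260" if "0 < x" "x \<le> 1" for x :: real
      using that by fastforce+
    show "hierarchy_fun (\<lambda>x. x\<^sup>2 / 1000000)"
      unfolding hierarchy_fun_def using le(1) by (auto simp: mono_on_def intro: power_mono)
    show "hierarchy_fun (\<lambda>x. x ^ 36 / 2 ^ 260)"
      unfolding hierarchy_fun_def using le(2)
      by (auto simp: mono_on_def intro!: divide_right_mono power_mono)
  qed
next
  fix C \<epsilon> \<alpha> \<beta> :: real and n :: nat and T :: "('a, 'b) pre_digraph"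
  assume a: "C > 32 \<and> 0 < \<epsilon> \<and> \<epsilon> \<le> 1 \<and> 0 < \<alpha> \<and> \<alpha> \<le> \<epsilon> / 1000000 \<and> 0 < \<beta> \<and> \<beta> \<le> \<alpha>\<^sup>2 / 1000000 \<and>
      0 < n \<and> 1 / real n \<le> \<beta> ^ 36 / 2 ^ 260 \<and> even n \<and>
      tournament T \<and> card (verts T) = n \<and>
      real_of_int (total_excess T) \<ge> C * real n \<and>
      \<not> has_perfect_decomposition T"
  then interpret T: digraph T by (simp add: tournament_def)
  \<comment> \<open>The third hierarchy function is chosen so that its condition is exactly the
    largeness of \<open>n\<close> demanded by \<open>dense_perfect\<close>.\<close>
  have "1 / real n * (2 ^ 260 * real n) \<le> \<beta> ^ 36 / 2 ^ 260 * (2 ^ 260 * real n)"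
    using a by (intro mult_right_mono) auto
  then have big: "2 ^ 260 \<le> \<beta> ^ 36 * real n" using a by simp
  have "\<exists>V' D. V' \<subseteq> verts T \<and> D \<subseteq> arcs_ends T \<inter> V' \<times> V' \<and> \<not> perfect (mset_set D) \<and>
    real (card V') \<ge> (1 - \<beta>) * real n \<and> even (card V') \<and>
    (\<forall>v\<in>V'. real (card (outs D v) + card (ins D v)) \<ge> (1 - \<epsilon>) * real (card V')) \<and>
    (\<forall>v\<in>V'. 1 \<le> \<bar>excess_at D v\<bar> \<and> real_of_int \<bar>excess_at D v\<bar> \<le> 3 * \<alpha> * real (card V')) \<and>
    real_of_int (\<Sum>v\<in>V'. max (excess_at D v) 0) \<ge> (C / 4 - 5) * real n"
    by (rule reduction[OF tournament_tourn, where \<beta> = \<beta>])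
      (use a big T.perfect_iff T.total_excess_eq in simp_all)
  then obtain V' D where D: "V' \<subseteq> verts T" "D \<subseteq> arcs_ends T \<inter> V' \<times> V'" "\<not> perfect (mset_set D)"
    "real (card V') \<ge> (1 - \<beta>) * real n" "even (card V')"
    "\<forall>v\<in>V'. real (card (outs D v) + card (ins D v)) \<ge> (1 - \<epsilon>) * real (card V')"
    "\<forall>v\<in>V'. 1 \<le> \<bar>excess_at D v\<bar> \<and> real_of_int \<bar>excess_at D v\<bar> \<le> 3 * \<alpha> * real (card V')"
    "real_of_int (\<Sum>v\<in>V'. max (excess_at D v) 0) \<ge> (C / 4 - 5) * real n" by (elim exE conjE)
  define H where "H = \<lparr>verts = V', arcs = {a \<in> arcs T. arc_to_ends T a \<in> D}, tail = tail T, head = head T\<rparr>"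
  note rd = T.restricted_digraph[OF D(1,2), folded H_def]
  interpret H: digraph H by (rule rd(2))
  show "\<exists>D. subgraph D T \<and>
        \<not> has_perfect_decomposition D \<and>
        real (card (verts D)) \<ge> (1 - \<beta>) * real n \<and> even (card (verts D)) \<and>
        (\<forall>v \<in> verts D. real (degree D v) \<ge> (1 - \<epsilon>) * real (card (verts D))) \<and>
        (\<forall>v \<in> verts D. 1 \<le> \<bar>excess D v\<bar> \<and>
          real_of_int \<bar>excess D v\<bar> \<le> 3 * \<alpha> * real (card (verts D))) \<and>
        real_of_int (total_excess D) \<ge> (C / 4 - 5) * real n"
    unfolding degree_def
    by (rule exI[of _ H], unfold H.perfect_iff H.excess_eq H.total_excess_eq H.out_degree_outs H.in_degree_ins rd(3,4))
      (use rd(1) D in blast)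
qed

end
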